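(* Let a system with finite-dimensional Hilbert space, Hamiltonian $H$ and state $\rho$ have period $\tau>0$. Then its coherence cost with respect to TI operations equals $$C_c^{\rm TI}(\rho)=\frac{F_H(\rho)}{F_{\rm c\text{-}bit}}=\Big(\frac{\tau}{2\pi}\Big)^2F_H(\rho).$$ Equivalently: for every $R>(\tau/2\pi)^2F_H(\rho)$ there are TI operations $\mathcal E_n$ with $\|\mathcal E_n(\Phi_{\rm c\text{-}bit}^{\otimes\lceil Rn\rceil})-\rho^{\otimes n}\|_1\to0$, and for every $R<(\tau/2\pi)^2F_H(\rho)$ no such sequence exists.
   Context: $\hbar=1$. The period of $\rho$ under $H$ is $\tau=\inf\{t>0:e^{-iHt}\rho e^{iHt}=\rho\}$. QFI: for $\rho=\sum_j p_j|\psi_j\rangle\langle\psi_j|$, $F_H(\rho)=2\sum_{j,k:\,p_j+p_k>0}\frac{(p_j-p_k)^2}{p_j+p_k}|\langle\psi_j|H|\psi_k\rangle|^2$. A c-bit with period $\tau$ is a qubit with Hamiltonian $H_{\rm c\text{-}bit}=\pi\sigma_z/\tau$ in state $|\Phi\rangle_{\rm c\text{-}bit}=(|0\rangle+|1\rangle)/\sqrt2$; its QFI is $F_{\rm c\text{-}bit}=4\pi^2/\tau^2$. $n$ copies of a system with Hamiltonian $H$ means state $\rho^{\otimes n}$ with Hamiltonian $\sum_i I^{\otimes(i-1)}\otimes H\otimes I^{\otimes(n-i)}$. A TI operation from input Hamiltonian $H_{\rm in}$ to output Hamiltonian $H_{\rm out}$ is a CPTP map $\mathcal E$ with $e^{-iH_{\rm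 out}t}\mathcal E(\sigma)e^{iH_{\rm out}t}=\mathcal E(e^{-iH_{\rm in}t}\sigma e^{iH_{\rm in}t})$ for all $\sigma,t$. The coherence cost is $C_c^{\rm TI}(\rho)=\inf\{R:\exists$ TI operations $\mathcal E_n$ from $\lceil Rn\rceil$ c-bits to $n$ copies with $\|\mathcal E_n(\Phi_{\rm c\text{-}bit}^{\otimes\lceil Rn\rceil})-\rho^{\otimes n}\|_1\to0\}$. *)

theory Defs
  imports Complex_Main "Jordan_Normal_Form.Matrix"
begin

definition adj :: "complex mat \<Rightarrow> complex mat" where
  "adj A = mat (dim_col A) (dim_row A) (\<lambda>(i,j). cnj (A $$ (j,i)))"

definition hermitian :: "nat \<Rightarrow> complex mat \<Rightarrow> bool" where
  "hermitian d A \<longleftrightarrow> A \<in> carrier_mat d d \<and> adj A = A"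

definition psd :: "nat \<Rightarrow> complex mat \<Rightarrow> bool" where
  "psd d A \<longleftrightarrow> hermitian d A \<and>
     (\<forall>v \<in> carrier_vec d. 0 \<le> Re (\<Sum>i<d. cnj (v $ i) * (A *\<^sub>v v) $ i))"

definition mtrace :: "complex mat \<Rightarrow> complex" where
  "mtrace A = (\<Sum>i<dim_row A. A $$ (i,i))"

definition density :: "nat \<Rightarrow> complex mat \<Rightarrow> bool" where
  "density d \<rho> \<longleftrightarrow> psd d \<rho> \<and> mtrace \<rho> = 1"

definition unitary :: "nat \<Rightarrow> complex mat \<Rightarrow> bool" where
  "unitary d U \<longleftrightarrow> U \<in> carrier_mat d d \<and> adj U * U = 1\<^sub>m d"

definition mexp :: "complex mat \<Rightarrow> complex mat" where
  "mexp A = mat (dim_row A) (dim_col A)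
     (\<lambda>(i,j). \<Sum>k. (A ^\<^sub>m k) $$ (i,j) / of_nat (fact k))"

definition evol :: "complex mat \<Rightarrow> real \<Rightarrow> complex mat \<Rightarrow> complex mat" where
  "evol H t \<sigma> = (let U = mexp ((- \<i> * complex_of_real t) \<cdot>\<^sub>m H) in U * \<sigma> * adj U)"

definition period :: "complex mat \<Rightarrow> complex mat \<Rightarrow> real" where
  "period H \<rho> = Inf {t. t > 0 \<and> evol H t \<rho> = \<rho>}"

definition kron :: "complex mat \<Rightarrow> complex mat \<Rightarrow> complex mat" where
  "kron A B = mat (dim_row A * dim_row B) (dim_col A * dim_col B)
     (\<lambda>(i,j). A $$ (i div dim_row B, j div dim_col B) * B $$ (i mod dim_row B, j mod dim_col B))"

fun tpow :: "complex mat \<Rightarrow> nat \<Rightarrow> complex mat" where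
  "tpow A 0 = 1\<^sub>m 1"
| "tpow A (Suc n) = kron (tpow A n) A"

text \<open>Hamiltonian of n copies: sum_i I^{(i-1)} (x) H (x) I^{(n-i)}, for H of dimension d.\<close>
fun ham_copies :: "nat \<Rightarrow> complex mat \<Rightarrow> nat \<Rightarrow> complex mat" where
  "ham_copies d H 0 = 0\<^sub>m 1 1"
| "ham_copies d H (Suc n) = kron (ham_copies d H n) (1\<^sub>m d) + kron (1\<^sub>m (d ^ n)) H"

definition rdiag :: "nat \<Rightarrow> (nat \<Rightarrow> real) \<Rightarrow> complex mat" where
  "rdiag d p = mat d d (\<lambda>(i,j). if i = j then complex_of_real (p i) else 0)"

text \<open>Orthonormal eigendecomposition rho = sum_j p_j |psi_j><psi_j|, psi_j = j-th column of U.\<close>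
definition spectral_decomp :: "nat \<Rightarrow> complex mat \<Rightarrow> complex mat \<Rightarrow> (nat \<Rightarrow> real) \<Rightarrow> bool" where
  "spectral_decomp d \<rho> U p \<longleftrightarrow> unitary d U \<and> \<rho> = U * rdiag d p * adj U"

definition qfi_of_decomp :: "nat \<Rightarrow> complex mat \<Rightarrow> complex mat \<Rightarrow> (nat \<Rightarrow> real) \<Rightarrow> real" where
  "qfi_of_decomp d H U p = 2 * (\<Sum>j<d. \<Sum>k<d.
      if p j + p k > 0 then (p j - p k)^2 / (p j + p k) * (cmod ((adj U * H * U) $$ (j,k)))^2 else 0)"

definition qfi :: "nat \<Rightarrow> complex mat \<Rightarrow> complex mat \<Rightarrow> real" where
  "qfi d H \<rho> = (let X = (SOME X. spectral_decomp d \<rho> (fst X) (snd X)) in qfi_of_decomp d H (fst X) (snd X))"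

definition psqrt :: "nat \<Rightarrow> complex mat \<Rightarrow> complex mat" where
  "psqrt d A = (SOME B. psd d B \<and> B * B = A)"

definition trace_norm :: "complex mat \<Rightarrow> real" where
  "trace_norm A = Re (mtrace (psqrt (dim_col A) (adj A * A)))"

definition msum :: "nat \<Rightarrow> complex mat list \<Rightarrow> complex mat" where
  "msum d Ms = foldr (+) Ms (0\<^sub>m d d)"

definition cptp :: "nat \<Rightarrow> nat \<Rightarrow> (complex mat \<Rightarrow> complex mat) \<Rightarrow> bool" where
  "cptp din dout E \<longleftrightarrow> (\<exists>Ks. set Ks \<subseteq> carrier_mat dout din
      \<and> msum din (map (\<lambda>K. adj K * K) Ks) = 1\<^sub>m din
      \<and> (\<forall>\<sigma> \<in> carrier_mat din din. E \<sigma> = msum dout (map (\<lambda>K. K * \<sigma> * adj K) Ks)))"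

definition ti_op :: "nat \<Rightarrow> complex mat \<Rightarrow> nat \<Rightarrow> complex mat \<Rightarrow> (complex mat \<Rightarrow> complex mat) \<Rightarrow> bool" where
  "ti_op din Hin dout Hout E \<longleftrightarrow> cptp din dout E \<and>
     (\<forall>\<sigma> \<in> carrier_mat din din. \<forall>t. evol Hout t (E \<sigma>) = E (evol Hin t \<sigma>))"

definition cbit_ham :: "real \<Rightarrow> complex mat" where
  "cbit_ham \<tau> = mat 2 2 (\<lambda>(i,j). if i = j then (if i = 0 then complex_of_real (pi / \<tau>) else complex_of_real (- pi / \<tau>)) else 0)"

definition cbit_state :: "complex mat" where
  "cbit_state = mat 2 2 (\<lambda>(i,j). 1 / 2)"

definition achievable :: "nat \<Rightarrow> complex mat \<Rightarrow> complex mat \<Rightarrow> real \<Rightarrow> real \<Rightarrow> bool" where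
  "achievable d H \<rho> \<tau> R \<longleftrightarrow> (let m = (\<lambda>n::nat. nat \<lceil>R * real n\<rceil>) in
     \<exists>E :: nat \<Rightarrow> complex mat \<Rightarrow> complex mat.
       (\<forall>n. ti_op (2 ^ m n) (ham_copies 2 (cbit_ham \<tau>) (m n)) (d ^ n) (ham_copies d H n) (E n))
       \<and> (\<lambda>n. trace_norm (E n (tpow cbit_state (m n)) - tpow \<rho> n)) \<longlonglongrightarrow> 0)"

definition coherence_cost :: "nat \<Rightarrow> complex mat \<Rightarrow> complex mat \<Rightarrow> real \<Rightarrow> real" where
  "coherence_cost d H \<rho> \<tau> = Inf {R. achievable d H \<rho> \<tau> R}"

end

theory Submission
  imports Defs "Jordan_Normal_Form.Spectral_Radius" "HOL-Real_Asymp.Real_Asymp"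
    "HOL-Computational_Algebra.Polynomial"
begin

text \<open>
  Converse: measure every copy in the eigenbasis of the symmetric logarithmic derivative and compare
  the outcome distributions at times \<open>0\<close> and \<open>1 / sqrt n\<close>. Their Bhattacharyya coefficient tends to
  \<open>exp (- F / 8)\<close>, it is continuous in the trace norm, and by covariance and the Cauchy-Schwarz inequality
  it is at least the overlap \<open>cos (pi / (\<tau> * sqrt n)) ^ m\<close> of the c-bits with their own time evolution.

  Achievability: \<open>\<rho>\<close> is a mixture of pure states supported on energies of a lattice of spacing
  \<open>2 * pi / \<tau>\<close> with average energy variance \<open>F / 4\<close> (the convex roof formula). For a typical product of these
  states, the energy distribution, convolved with a suitable distribution \<open>r\<close>, is close in the \<open>l1\<close> norm
  to the binomial distribution of the c-bits; this is a Lindeberg replacement argument in which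
  distributions are polynomials and two of them with equal first two moments differ by a
  multiple of \<open>(x - 1) ^ 3\<close>. A covariant channel undoing the convolution with \<open>r\<close> then prepares the
  product state.\<close>

section \<open>Matrices\<close>

text \<open>At time \<open>1 / sqrt n\<close> both overlaps in the converse have limits strictly
  between 0 and 1: the quadratic term of the single-copy coefficient survives the n-th power and can
  be compared with that of the c-bits.

  In the other direction each Kraus operator shifts all energies by one fixed amount, so energy
  distributions must agree level by level, in l1; weak convergence as in the central limit theorem
  is not enough. The smoothing comes from a surplus of order n of unmatched coin flips, which exists
  because the rate strictly exceeds the bound: every replacement then costs O(n^(-3/2)), and there
  are O(n) of them. Equal moments require an integral mean and a variance in multiples of 1/2. The
  noise that enforces this wastes a bounded number of flips per replacement, so long blocks of
  copies are replaced at once. Noise and surplus flips together form \<open>r\<close>.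

  The energies of \<rho> may lie on several lattices. Invariance under evolution for time \<tau>
  forbids coherence between them, so each pure state of the mixture can be confined to one
  lattice.\<close>

lemma mult_entry:
  assumes "A \<in> carrier_mat n m" "B \<in> carrier_mat m k" "i < n" "j < k"
  shows "(A * B) $$ (i,j) = (\<Sum>l<m. A $$ (i,l) * B $$ (l,j))"
  using assms by (auto simp: scalar_prod_def lessThan_atLeast0 intro!: sum.cong)

lemma mult_carrier_sq [simp]:
  "A \<in> carrier_mat d d \<Longrightarrow> B \<in> carrier_mat d d \<Longrightarrow> A * B \<in> carrier_mat d d"
  by (rule mult_carrier_mat)

lemma adj_carrier [simp]: "A \<in> carrier_mat n m \<Longrightarrow> adj A \<in> carrier_mat m n"
  by (auto simp: adj_def)

lemma dim_adj [simp]: "dim_row (adj A) = dim_col A" "dim_col (adj A) = dim_row A"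
  by (auto simp: adj_def)

lemma adj_entry:
  "A \<in> carrier_mat n m \<Longrightarrow> i < m \<Longrightarrow> j < n \<Longrightarrow> adj A $$ (i,j) = cnj (A $$ (j,i))"
  by (auto simp: adj_def)

lemma adj_adj [simp]: "adj (adj A) = A"
  by (intro eq_matI) (auto simp: adj_def)

lemma adj_mult:
  assumes "A \<in> carrier_mat n m" "B \<in> carrier_mat m k"
  shows "adj (A * B) = adj B * adj A"
proof (rule eq_matI)
  fix i j assume "i < dim_row (adj B * adj A)" "j < dim_col (adj B * adj A)"
  hence ij: "i < k" "j < n" using assms by auto
  have "adj (A * B) $$ (i,j) = cnj (\<Sum>l<m. A $$ (j,l) * B $$ (l,i))"
    using ij assms by (subst adj_entry[of _ n k]) (auto simp: mult_entry simp del: index_mult_mat)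
  also have "\<dots> = (\<Sum>l<m. adj B $$ (i,l) * adj A $$ (l,j))"
    using ij assms by (auto simp: adj_entry[of _ m k] adj_entry[of _ n m] intro!: sum.cong)
  also have "\<dots> = (adj B * adj A) $$ (i,j)"
    using ij assms by (intro mult_entry[symmetric, of _ k m _ n]) auto
  finally show "adj (A * B) $$ (i,j) = (adj B * adj A) $$ (i,j)" .
qed (use assms in auto)

lemma conj_entry:
  assumes "X \<in> carrier_mat n k" "A \<in> carrier_mat n n" "i < k" "j < k"
  shows "(adj X * A * X) $$ (i,j) = (\<Sum>a<n. \<Sum>b<n. cnj (X $$ (a,i)) * A $$ (a,b) * X $$ (b,j))"
proof -
  have "(adj X * A * X) $$ (i,j) = (\<Sum>b<n. (\<Sum>a<n. cnj (X $$ (a,i)) * A $$ (a,b)) * X $$ (b,j))"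
    using assms mult_carrier_mat[OF adj_carrier[OF assms(1)] assms(2)]
    by (subst mult_entry[of _ k n _ k])
       (auto simp: mult_entry[of _ k n _ n] adj_entry[of _ n k] simp del: index_mult_mat intro!: sum.cong)
  also have "\<dots> = (\<Sum>a<n. \<Sum>b<n. cnj (X $$ (a,i)) * A $$ (a,b) * X $$ (b,j))"
    by (subst sum.swap) (simp add: sum_distrib_right)
  finally show ?thesis .
qed

text \<open>The definition only provides a left inverse; for square matrices it is
  two-sided.\<close>

lemma unitaryD:
  assumes "unitary d U"
  shows "U \<in> carrier_mat d d" "adj U * U = 1\<^sub>m d" "U * adj U = 1\<^sub>m d"
proof -
  show U: "U \<in> carrier_mat d d" "adj U * U = 1\<^sub>m d" using assms by (auto simp: unitary_def)
  show "U * adj U = 1\<^sub>m d"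
    using mat_mult_left_right_inverse[OF adj_carrier[OF U(1)] U(1) U(2)] .
qed

lemma unitary_adj: "unitary d U \<Longrightarrow> unitary d (adj U)"
  unfolding unitary_def[of d "adj U"] using unitaryD[of d U] by simp

lemma assoc4:
  assumes "A \<in> carrier_mat a b" "B \<in> carrier_mat b c" "C \<in> carrier_mat c d" "D \<in> carrier_mat d e"
  shows "(A * B) * (C * D) = A * (B * C) * (D::complex mat)"
proof -
  have "(A * B) * (C * D) = A * (B * (C * D))"
    using assms by (intro assoc_mult_mat[of _ a b _ c _ e]) auto
  also have "B * (C * D) = (B * C) * D"
    using assms by (intro assoc_mult_mat[symmetric, of _ b c _ d _ e]) auto
  also have "A * \<dots> = A * (B * C) * D"
    using assms by (intro assoc_mult_mat[symmetric, of _ a b _ d _ e]) auto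
  finally show ?thesis .
qed

lemma unitary_mult:
  assumes U: "unitary d U" and V: "unitary d V"
  shows "unitary d (U * V)"
proof -
  note u = unitaryD[OF U] and v = unitaryD[OF V]
  have "adj (U * V) * (U * V) = (adj V * adj U) * (U * V)"
    using u v by (simp add: adj_mult[of _ d d _ d])
  also have "\<dots> = adj V * (adj U * U) * V"
    using u v by (intro assoc4[of _ d d _ d _ d _ d]) auto
  also have "\<dots> = 1\<^sub>m d" using u v by (simp add: right_mult_one_mat[of _ d d])
  finally show ?thesis using u v by (auto simp: unitary_def)
qed

lemma unitary_sum:
  assumes "unitary d U"
  shows "i < d \<Longrightarrow> j < d \<Longrightarrow> (\<Sum>l<d. cnj (U $$ (l,i)) * U $$ (l,j)) = (if i = j then 1 else 0)"
    and "i < d \<Longrightarrow> j < d \<Longrightarrow> (\<Sum>l<d. U $$ (i,l) * cnj (U $$ (j,l))) = (if i = j then 1 else 0)"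
proof -
  note u = unitaryD[OF assms]
  { assume ij: "i < d" "j < d"
    have "(adj U * U) $$ (i,j) = (\<Sum>l<d. cnj (U $$ (l,i)) * U $$ (l,j))"
      using ij u by (subst mult_entry[of _ d d _ d]) (auto simp: adj_entry[of _ d d])
    thus "(\<Sum>l<d. cnj (U $$ (l,i)) * U $$ (l,j)) = (if i = j then 1 else 0)" using u ij by simp
    have "(U * adj U) $$ (i,j) = (\<Sum>l<d. U $$ (i,l) * cnj (U $$ (j,l)))"
      using ij u by (subst mult_entry[of _ d d _ d]) (auto simp: adj_entry[of _ d d])
    thus "(\<Sum>l<d. U $$ (i,l) * cnj (U $$ (j,l))) = (if i = j then 1 else 0)" using u ij by simp }
qed

lemma unitaryI:
  assumes "U \<in> carrier_mat d d"
    and "\<And>i j. i < d \<Longrightarrow> j < d \<Longrightarrow> (\<Sum>l<d. cnj (U $$ (l,i)) * U $$ (l,j)) = (if i = j then 1 else 0)"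
  shows "unitary d U"
  unfolding unitary_def
proof
  show "adj U * U = 1\<^sub>m d"
  proof (rule eq_matI)
    fix i j assume "i < dim_row (1\<^sub>m d :: complex mat)" "j < dim_col (1\<^sub>m d :: complex mat)"
    hence ij: "i < d" "j < d" by auto
    have "(adj U * U) $$ (i,j) = (\<Sum>l<d. cnj (U $$ (l,i)) * U $$ (l,j))"
      using ij assms(1) by (subst mult_entry[of _ d d _ d]) (auto simp: adj_entry[of _ d d])
    thus "(adj U * U) $$ (i,j) = 1\<^sub>m d $$ (i,j)" using assms(2)[OF ij] ij by simp
  qed (use assms in auto)
qed (fact assms)

lemma conj_conj:
  assumes "unitary d U" "A \<in> carrier_mat d d"
  shows "U * (adj U * A * U) * adj U = A" "adj U * (U * A * adj U) * U = A"
proof -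
  note u = unitaryD[OF assms(1)]
  note [simp] = left_mult_one_mat[of _ d d] right_mult_one_mat[of _ d d] u assms(2)
  show "U * (adj U * A * U) * adj U = A"
  proof -
    have "U * (adj U * A * U) * adj U = (U * (adj U * A)) * (U * adj U)"
      by (subst assoc4[of _ d d _ d _ d _ d]) auto
    also have "\<dots> = (U * adj U) * A"
      by (subst assoc_mult_mat[of U d d "adj U" d A d]) auto
    finally show ?thesis by simp
  qed
  show "adj U * (U * A * adj U) * U = A"
  proof -
    have "adj U * (U * A * adj U) * U = (adj U * (U * A)) * (adj U * U)"
      by (subst assoc4[of _ d d _ d _ d _ d]) auto
    also have "\<dots> = (adj U * U) * A"
      by (subst assoc_mult_mat[of "adj U" d d U d A d]) auto
    finally show ?thesis by simp
  qed
qed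

section \<open>Functions of diagonalized matrices and time evolution\<close>

text \<open>A complex counterpart of \<open>rdiag\<close>, because the eigenvalues of propagators
  are phases.\<close>

definition cdiag :: "nat \<Rightarrow> (nat \<Rightarrow> complex) \<Rightarrow> complex mat" where
  "cdiag d f = mat d d (\<lambda>(i,j). if i = j then f i else 0)"

lemma cdiag_carrier [simp]: "cdiag d f \<in> carrier_mat d d"
  and dim_cdiag [simp]: "dim_row (cdiag d f) = d" "dim_col (cdiag d f) = d"
  and cdiag_entry: "i < d \<Longrightarrow> j < d \<Longrightarrow> cdiag d f $$ (i,j) = (if i = j then f i else 0)"
  by (auto simp: cdiag_def)

lemma rdiag_cdiag: "rdiag d p = cdiag d (\<lambda>i. complex_of_real (p i))"
  by (auto simp: rdiag_def cdiag_def intro!: eq_matI)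

lemma adj_cdiag: "adj (cdiag d f) = cdiag d (\<lambda>i. cnj (f i))"
  by (auto simp: adj_def cdiag_def intro!: eq_matI)

lemma cdiag_mult: "cdiag d f * cdiag d g = cdiag d (\<lambda>i. f i * g i)"
proof (rule eq_matI)
  fix i j assume "i < dim_row (cdiag d (\<lambda>i. f i * g i))" "j < dim_col (cdiag d (\<lambda>i. f i * g i))"
  hence ij: "i < d" "j < d" by auto
  have "(cdiag d f * cdiag d g) $$ (i,j) = (\<Sum>l<d. cdiag d f $$ (i,l) * cdiag d g $$ (l,j))"
    using ij by (intro mult_entry[of _ d d _ d]) auto
  also have "\<dots> = (\<Sum>l<d. if i = l then (if l = j then f i * g l else 0) else 0)"
    using ij by (intro sum.cong) (auto simp: cdiag_entry)
  finally show "(cdiag d f * cdiag d g) $$ (i,j) = cdiag d (\<lambda>i. f i * g i) $$ (i,j)"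
    using ij by (simp add: cdiag_entry)
qed auto

lemma cdiag_conj_entry:
  assumes "W \<in> carrier_mat n d" "i < n" "j < n"
  shows "(W * cdiag d f * adj W) $$ (i,j) = (\<Sum>l<d. W $$ (i,l) * f l * cnj (W $$ (j,l)))"
proof -
  have *: "(W * cdiag d f) $$ (i,l) = W $$ (i,l) * f l" if "l < d" for l
  proof -
    have "(W * cdiag d f) $$ (i,l) = (\<Sum>m<d. W $$ (i,m) * cdiag d f $$ (m,l))"
      using that assms by (intro mult_entry[of _ n d _ d]) auto
    also have "\<dots> = (\<Sum>m<d. if m = l then W $$ (i,m) * f l else 0)"
      using that assms by (intro sum.cong) (auto simp: cdiag_entry)
    finally show ?thesis using that by simp
  qed
  show ?thesis
    using assms by (subst mult_entry[of _ n d _ n]) (auto simp: * adj_entry[of _ n d] simp del: index_mult_mat)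
qed

lemma cdiag_conj_mult:
  assumes "unitary d W"
  shows "(W * cdiag d f * adj W) * (W * cdiag d g * adj W) = W * cdiag d (\<lambda>i. f i * g i) * adj W"
proof -
  note w = unitaryD[OF assms]
  have "(W * cdiag d f * adj W) * (W * cdiag d g * adj W)
      = (W * cdiag d f * adj W) * (W * (cdiag d g * adj W))"
    using w by (subst assoc_mult_mat[of W d d "cdiag d g" d "adj W" d]) auto
  also have "\<dots> = W * cdiag d f * (adj W * W) * (cdiag d g * adj W)"
    using w by (intro assoc4[of _ d d _ d _ d _ d]) auto
  also have "\<dots> = W * (cdiag d f * cdiag d g) * adj W"
    using w by (simp add: right_mult_one_mat[of _ d d]) (intro assoc4[of _ d d _ d _ d _ d], auto)
  finally show ?thesis by (simp add: cdiag_mult)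
qed

lemma cdiag_conj_pow:
  assumes "unitary d W"
  shows "(W * cdiag d f * adj W) ^\<^sub>m k = W * cdiag d (\<lambda>i. f i ^ k) * adj W"
proof (induction k)
  case 0
  note w = unitaryD[OF assms]
  have "cdiag d (\<lambda>i. 1) = 1\<^sub>m d" by (auto simp: cdiag_def intro!: eq_matI)
  thus ?case using w by (simp add: right_mult_one_mat[of _ d d])
next
  case (Suc k)
  show ?case by (simp add: Suc cdiag_conj_mult[OF assms] mult.commute)
qed

text \<open>Each entry of a power is a finite combination of powers of the eigenvalues, so the
  entrywise series behind \<open>mexp\<close> is a finite sum of scalar exponential series.\<close>

lemma mexp_cdiag_conj:
  assumes "unitary d W"
  shows "mexp (W * cdiag d f * adj W) = W * cdiag d (\<lambda>i. exp (f i)) * adj W" (is "mexp ?A = ?B")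
proof (rule eq_matI)
  note w = unitaryD[OF assms]
  fix i j assume "i < dim_row ?B" "j < dim_col ?B"
  hence ij: "i < d" "j < d" using w by auto
  have s: "(\<lambda>k. f l ^ k / of_nat (fact k)) sums exp (f l)" for l
    using exp_converges[of "f l"] by (simp add: scaleR_conv_of_real field_simps)
  have "(\<lambda>k. \<Sum>l<d. W $$ (i,l) * (f l ^ k / of_nat (fact k)) * cnj (W $$ (j,l)))
      sums (\<Sum>l<d. W $$ (i,l) * exp (f l) * cnj (W $$ (j,l)))"
    by (intro sums_sum sums_mult sums_mult2 s)
  moreover have "(\<Sum>l<d. W $$ (i,l) * (f l ^ k / of_nat (fact k)) * cnj (W $$ (j,l)))
      = (?A ^\<^sub>m k) $$ (i,j) / of_nat (fact k)" for k
    unfolding cdiag_conj_pow[OF assms] using w ij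
    by (simp add: cdiag_conj_entry sum_divide_distrib del: index_mult_mat)
  ultimately have "(\<Sum>k. (?A ^\<^sub>m k) $$ (i,j) / of_nat (fact k)) = ?B $$ (i,j)"
    using w ij by (simp add: cdiag_conj_entry sums_iff del: index_mult_mat)
  thus "mexp ?A $$ (i,j) = ?B $$ (i,j)" using w ij by (simp add: mexp_def)
qed (use assms in \<open>auto simp: mexp_def\<close>)

lemma smult_cdiag_conj:
  assumes "unitary d W"
  shows "c \<cdot>\<^sub>m (W * cdiag d f * adj W) = W * cdiag d (\<lambda>i. c * f i) * adj W"
proof (rule eq_matI)
  note w = unitaryD[OF assms]
  fix i j assume "i < dim_row (W * cdiag d (\<lambda>i. c * f i) * adj W)" "j < dim_col (W * cdiag d (\<lambda>i. c * f i) * adj W)"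
  hence ij: "i < d" "j < d" using w by auto
  thus "(c \<cdot>\<^sub>m (W * cdiag d f * adj W)) $$ (i,j) = (W * cdiag d (\<lambda>i. c * f i) * adj W) $$ (i,j)"
    using w by (subst index_smult_mat)
      (auto simp: cdiag_conj_entry[of _ d d] sum_distrib_left mult_ac simp del: index_mult_mat(1))
qed (use unitaryD[OF assms] in auto)

lemma cdiag_conj_unitary:
  assumes "unitary d W" "\<And>i. i < d \<Longrightarrow> cmod (f i) = 1"
  shows "unitary d (W * cdiag d f * adj W)"
proof -
  have "unitary d (cdiag d f)"
  proof -
    have "adj (cdiag d f) * cdiag d f = cdiag d (\<lambda>i. cnj (f i) * f i)"
      by (simp add: adj_cdiag cdiag_mult)
    also have "\<dots> = 1\<^sub>m d"
      using assms(2) by (intro eq_matI) (auto simp: cdiag_entry mult.commute complex_norm_square[symmetric])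
    finally show ?thesis by (simp add: unitary_def)
  qed
  thus ?thesis using assms by (intro unitary_mult unitary_adj)
qed

lemma evol_propagator:
  assumes "unitary d W" "H = W * rdiag d E * adj W"
  shows "mexp ((- \<i> * complex_of_real t) \<cdot>\<^sub>m H) = W * cdiag d (\<lambda>i. cis (- E i * t)) * adj W"
  using assms by (simp add: rdiag_cdiag smult_cdiag_conj mexp_cdiag_conj cis_conv_exp mult_ac)

lemma evol_alt:
  fixes t :: real
  assumes "unitary d W" "H = W * rdiag d E * adj W"
  defines "V \<equiv> W * cdiag d (\<lambda>i. cis (- E i * t)) * adj W"
  shows "evol H t \<sigma> = V * \<sigma> * adj V" "unitary d V"
  unfolding V_def evol_def evol_propagator[OF assms(1,2)] Let_def
  by (auto intro!: cdiag_conj_unitary assms(1))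

lemma evol_carrier:
  assumes "unitary d W" "H = W * rdiag d E * adj W" "\<sigma> \<in> carrier_mat d d"
  shows "evol H t \<sigma> \<in> carrier_mat d d"
  unfolding evol_alt(1)[OF assms(1,2)]
  by (intro mult_carrier_mat[of _ d d _ d] adj_carrier unitaryD(1)[OF evol_alt(2)[OF assms(1,2)]] assms(3))

text \<open>In the energy basis, evolution multiplies each matrix element by a phase at its Bohr
  frequency. Invariance, covariance and periodicity are later read off from these phases.\<close>

lemma evol_entry:
  assumes W: "unitary d W" and H: "H = W * rdiag d E * adj W" and s: "\<sigma> \<in> carrier_mat d d"
    and ij: "i < d" "j < d"
  shows "(adj W * evol H t \<sigma> * W) $$ (i,j) = cis (- (E i - E j) * t) * (adj W * \<sigma> * W) $$ (i,j)"
proof -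
  note w = unitaryD[OF W]
  define D where "D = cdiag d (\<lambda>i. cis (- E i * t))"
  have D [simp]: "D \<in> carrier_mat d d" by (simp add: D_def)
  define V where "V = W * D * adj W"
  have cW: "adj W \<in> carrier_mat d d" and cD: "adj D \<in> carrier_mat d d" using w by auto
  have V: "V \<in> carrier_mat d d" and cV: "adj V \<in> carrier_mat d d"
    using w by (auto simp: V_def intro!: mult_carrier_mat[of _ d d _ d])
  have 1: "adj W * V = D * adj W"
  proof -
    have "adj W * V = adj W * (W * (D * adj W))"
      unfolding V_def by (subst assoc_mult_mat[OF w(1) D cW]) simp
    also have "\<dots> = (adj W * W) * (D * adj W)"
      by (rule assoc_mult_mat[symmetric, OF cW w(1) mult_carrier_mat[OF D cW]])
    finally show ?thesis using w left_mult_one_mat[OF mult_carrier_mat[OF D cW]] by simp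
  qed
  have 2: "adj V * W = W * adj D"
  proof -
    have "adj V * W = adj (adj W * V)" by (simp add: adj_mult[OF cW V])
    also have "\<dots> = W * adj D" by (simp add: 1 adj_mult[OF D cW])
    finally show ?thesis .
  qed
  have "adj W * evol H t \<sigma> * W = adj W * (V * \<sigma> * adj V) * W"
    using evol_alt(1)[OF W H, of t \<sigma>] by (simp add: D_def V_def)
  also have "\<dots> = (adj W * (V * \<sigma>)) * (adj V * W)"
    by (rule assoc4[symmetric, OF cW mult_carrier_mat[OF V s] cV w(1)])
  also have "adj W * (V * \<sigma>) = D * adj W * \<sigma>"
    by (subst assoc_mult_mat[symmetric, OF cW V s]) (simp add: 1)
  also have "D * adj W * \<sigma> = D * (adj W * \<sigma>)"
    by (rule assoc_mult_mat[OF D cW s])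
  also have "D * (adj W * \<sigma>) * (adj V * W) = D * (adj W * \<sigma> * W) * adj D"
    unfolding 2 by (rule assoc4[OF D mult_carrier_mat[OF cW s] w(1) cD])
  finally have eq: "adj W * evol H t \<sigma> * W = D * (adj W * \<sigma> * W) * adj D" .
  define S where "S = adj W * \<sigma> * W"
  have S: "S \<in> carrier_mat d d" using w s by (auto simp: S_def)
  have "(D * S * adj D) $$ (i,j) = (adj (adj D) * S * adj D) $$ (i,j)" by simp
  also have "\<dots> = (\<Sum>a<d. \<Sum>b<d. cnj (adj D $$ (a,i)) * S $$ (a,b) * adj D $$ (b,j))"
    using S ij by (intro conj_entry[of _ d d]) auto
  also have "\<dots> = (\<Sum>a<d. \<Sum>b<d. if a = i then (if b = j then D $$ (i,i) * S $$ (i,j) * cnj (D $$ (j,j)) else 0) else 0)"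
    using ij by (intro sum.cong refl) (auto simp: adj_entry[of _ d d] D_def cdiag_entry)
  also have "\<dots> = D $$ (i,i) * S $$ (i,j) * cnj (D $$ (j,j))"
  proof -
    have "(\<Sum>a<d. \<Sum>b<d. if a = i then (if b = j then c else 0) else 0) = c" for c :: complex
      using ij by (subst sum.swap) simp
    thus ?thesis .
  qed
  also have "\<dots> = cis (- (E i - E j) * t) * S $$ (i,j)"
  proof -
    have "cis (- E i * t) * cnj (cis (- E j * t)) = cis (- (E i - E j) * t)"
      by (simp add: cis_cnj cis_mult algebra_simps)
    thus ?thesis using ij by (simp add: D_def cdiag_entry mult_ac)
  qed
  finally show ?thesis unfolding eq S_def .
qed

lemma cmod_sq: "(complex_of_real (cmod z))\<^sup>2 = z * cnj z"
  by (metis complex_norm_square of_real_power)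

section \<open>Hermitian matrices and the spectral theorem\<close>

lemma hermitian_carrier: "hermitian d A \<Longrightarrow> A \<in> carrier_mat d d"
  by (simp add: hermitian_def)

lemma hermitian_entry:
  assumes "hermitian d A" "i < d" "j < d"
  shows "A $$ (j,i) = cnj (A $$ (i,j))"
  using assms adj_entry[of A d d j i] by (simp add: hermitian_def)

lemma hermitianI:
  assumes "A \<in> carrier_mat d d" "\<And>i j. i < d \<Longrightarrow> j < d \<Longrightarrow> A $$ (j,i) = cnj (A $$ (i,j))"
  shows "hermitian d A"
  unfolding hermitian_def
proof
  show "adj A = A"
  proof (rule eq_matI)
    fix i j assume "i < dim_row A" "j < dim_col A"
    hence "i < d" "j < d" using assms(1) by auto
    thus "adj A $$ (i,j) = A $$ (i,j)"
      using assms(2)[of j i] adj_entry[OF assms(1), of i j] by simp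
  qed (use assms in auto)
qed (fact assms)

lemma hermitian_conj:
  assumes "hermitian d A" "X \<in> carrier_mat d k"
  shows "hermitian k (adj X * A * X)"
proof -
  have A: "A \<in> carrier_mat d d" "adj A = A" using assms by (auto simp: hermitian_def)
  have aX: "adj X \<in> carrier_mat k d" using assms by simp
  have c: "adj X * A * X \<in> carrier_mat k k"
    by (rule mult_carrier_mat[OF mult_carrier_mat[OF aX A(1)] assms(2)])
  have "adj (adj X * A * X) = adj X * (A * X)"
    using assms(2) A by (simp add: adj_mult[OF mult_carrier_mat[OF aX A(1)] assms(2)] adj_mult[OF aX A(1)])
  also have "\<dots> = adj X * A * X" by (rule assoc_mult_mat[symmetric, OF aX A(1) assms(2)])
  finally show ?thesis using c by (simp add: hermitian_def)
qed

text \<open>A Householder reflection.\<close>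

lemma unitary_first_column:
  fixes v :: "nat \<Rightarrow> complex"
  assumes "d > 0" "(\<Sum>i<d. (cmod (v i))\<^sup>2) = 1"
  shows "\<exists>U c. unitary d U \<and> (\<forall>i<d. U $$ (i,0) = c * v i)"
proof -
  \<comment> \<open>The phase of \<open>v 0\<close>. Adding it in coordinate 0 prevents
    cancellation: \<open>w\<close> has squared norm \<open>2 * S\<close> with \<open>S\<close> at
    least 1, so a \<open>v\<close> parallel to the first basis vector needs no separate
    treatment.\<close>
  define s where "s = (if v 0 = 0 then 1 else v 0 / cmod (v 0))"
  define S where "S = complex_of_real (1 + cmod (v 0))"
  define w where "w = (\<lambda>i. v i + (if i = 0 then s else 0))"
  define U where "U = mat d d (\<lambda>(i,j). (if i = j then 1 else 0) - w i * cnj (w j) / S)"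
  have Uc: "U \<in> carrier_mat d d" by (simp add: U_def)
  have "1 + cmod (v 0) > 0" using norm_ge_zero[of "v 0"] by linarith
  hence S0: "S \<noteq> 0" unfolding S_def by (metis of_real_eq_0_iff less_irrefl)
  have "cmod s = 1" by (simp add: s_def norm_divide)
  hence ss: "s * cnj s = 1" by (simp flip: cmod_sq)
  have sv: "cnj s * v 0 = cmod (v 0)"
    using cmod_sq[of "v 0"] by (auto simp: s_def power2_eq_square field_simps)
  have w0: "w 0 = s * S"
  proof -
    have "s * (cnj s * v 0) = v 0" using ss by (simp add: mult.assoc[symmetric])
    thus ?thesis by (simp add: w_def S_def sv algebra_simps)
  qed
  have ws: "(\<Sum>l<d. cnj (w l) * w l) = 2 * S"
  proof -
    have "(\<Sum>l<d. cnj (w l) * w l) = (\<Sum>l<d. cnj (v l) * v l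
        + (if l = 0 then cnj (v 0) * s + cnj s * v 0 + cnj s * s else 0))"
      by (intro sum.cong) (auto simp: w_def algebra_simps)
    also have "\<dots> = (\<Sum>l<d. cnj (v l) * v l) + (cnj (v 0) * s + cnj s * v 0 + cnj s * s)"
      using assms(1) by (simp add: sum.distrib)
    also have "(\<Sum>l<d. cnj (v l) * v l) = complex_of_real (\<Sum>i<d. (cmod (v i))\<^sup>2)"
      by (simp add: cmod_sq mult.commute)
    also have "cnj (v 0) * s = cnj (cnj s * v 0)" by simp
    finally show ?thesis using ss by (simp add: assms(2) sv S_def mult.commute)
  qed
  have "unitary d U"
  proof (rule unitaryI[OF Uc])
    fix i j assume ij: "i < d" "j < d"
    have cS: "cnj S = S" by (simp add: S_def)
    have "(\<Sum>l<d. cnj (U $$ (l,i)) * U $$ (l,j)) =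
       (\<Sum>l<d. (if l = i then if i = j then 1 else 0 else 0) - (if l = i then w i * cnj (w j) / S else 0)
         - (if l = j then cnj (w j) * w i / S else 0) + (w i * cnj (w j) / S\<^sup>2) * (cnj (w l) * w l))"
      using ij by (intro sum.cong refl)
        (auto simp: U_def cS algebra_simps power2_eq_square)
    also have "\<dots> = (if i = j then 1 else 0) - w i * cnj (w j) / S - cnj (w j) * w i / S
         + (w i * cnj (w j) / S\<^sup>2) * (2 * S)"
      unfolding sum.distrib sum_subtractf sum_distrib_left[symmetric] ws using ij by simp
    also have "\<dots> = (if i = j then 1 else 0)" using S0 by (simp add: field_simps power2_eq_square)
    finally show "(\<Sum>l<d. cnj (U $$ (l,i)) * U $$ (l,j)) = (if i = j then 1 else 0)" .
  qed
  moreover have "\<forall>i<d. U $$ (i,0) = (- cnj s) * v i"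
  proof (intro allI impI)
    fix i assume i: "i < d"
    have "cnj S = S" by (simp add: S_def)
    hence "U $$ (i,0) = (if i = 0 then 1 else 0) - w i * cnj s"
      using i S0 by (simp add: U_def w0)
    also have "\<dots> = (- cnj s) * v i" using ss by (simp add: w_def algebra_simps)
    finally show "U $$ (i,0) = (- cnj s) * v i" .
  qed
  ultimately show ?thesis by blast
qed

lemma eigenvector_exists:
  fixes A :: "complex mat"
  assumes "A \<in> carrier_mat d d" "d > 0"
  shows "\<exists>k v. (\<Sum>i<d. (cmod (v i))\<^sup>2) = 1 \<and> (\<forall>i<d. (\<Sum>j<d. A $$ (i,j) * v j) = k * v i)"
proof -
  from spectrum_non_empty[OF assms(1)] assms(2) obtain k where "eigenvalue A k"
    by (auto simp: spectrum_def)
  then obtain u where u: "u \<in> carrier_vec d" "u \<noteq> 0\<^sub>v d" "A *\<^sub>v u = k \<cdot>\<^sub>v u"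
    using assms by (auto simp: eigenvalue_def eigenvector_def)
  define N where "N = (\<Sum>i<d. (cmod (u $ i))\<^sup>2)"
  have "N \<noteq> 0"
  proof
    assume "N = 0"
    hence "\<forall>i<d. u $ i = 0" unfolding N_def by (subst (asm) sum_nonneg_eq_0_iff) auto
    hence "u = 0\<^sub>v d" using u(1) by (intro eq_vecI) auto
    thus False using u(2) by simp
  qed
  moreover have "N \<ge> 0" by (auto simp: N_def intro!: sum_nonneg)
  ultimately have N: "N > 0" by simp
  define v where "v = (\<lambda>i. u $ i / complex_of_real (sqrt N))"
  have "(\<Sum>i<d. (cmod (v i))\<^sup>2) = 1"
    using N by (simp add: v_def norm_divide power_divide sum_divide_distrib[symmetric] N_def[symmetric])
  moreover have "(\<Sum>j<d. A $$ (i,j) * v j) = k * v i" if "i < d" for i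
  proof -
    have "(A *\<^sub>v u) $ i = (\<Sum>j<d. A $$ (i,j) * u $ j)"
      using that assms u(1) by (auto simp: scalar_prod_def lessThan_atLeast0 intro!: sum.cong)
    thus ?thesis using u that by (simp add: v_def sum_divide_distrib[symmetric])
  qed
  ultimately show ?thesis by blast
qed

text \<open>Deflation: in an orthonormal basis that starts with an eigenvector, the first column
  vanishes off the diagonal. Hermiticity carries this over to the first row, and the remaining block
  is Hermitian of smaller size.\<close>

lemma hermitian_diagonalize:
  "hermitian d A \<Longrightarrow> \<exists>V. unitary d V \<and> (\<forall>i<d. \<forall>j<d. i \<noteq> j \<longrightarrow> (adj V * A * V) $$ (i,j) = 0)"
proof (induction d arbitrary: A)
  case 0
  have "unitary 0 (1\<^sub>m 0)" by (rule unitaryI) auto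
  thus ?case by auto
next
  case (Suc n)
  have A: "A \<in> carrier_mat (Suc n) (Suc n)" using Suc.prems by (rule hermitian_carrier)
  from eigenvector_exists[OF A] obtain k v
    where v: "(\<Sum>i<Suc n. (cmod (v i))\<^sup>2) = 1"
      "\<And>i. i < Suc n \<Longrightarrow> (\<Sum>j<Suc n. A $$ (i,j) * v j) = k * v i" by auto
  from unitary_first_column[OF _ v(1)] obtain U c
    where U: "unitary (Suc n) U" and Uc: "\<And>i. i < Suc n \<Longrightarrow> U $$ (i,0) = c * v i" by auto
  note u = unitaryD[OF U]
  define B where "B = adj U * A * U"
  have B: "hermitian (Suc n) B" unfolding B_def by (rule hermitian_conj[OF Suc.prems u(1)])
  have B0: "B $$ (i,0) = 0" if i: "0 < i" "i < Suc n" for i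
  proof -
    have "B $$ (i,0) = (\<Sum>a<Suc n. \<Sum>b<Suc n. cnj (U $$ (a,i)) * A $$ (a,b) * U $$ (b,0))"
      unfolding B_def using i by (intro conj_entry[OF u(1) A]) auto
    also have "\<dots> = (\<Sum>a<Suc n. cnj (U $$ (a,i)) * c * (\<Sum>b<Suc n. A $$ (a,b) * v b))"
      unfolding sum_distrib_left by (intro sum.cong refl) (auto simp: Uc)
    also have "\<dots> = (\<Sum>a<Suc n. k * (cnj (U $$ (a,i)) * U $$ (a,0)))"
      by (intro sum.cong refl) (auto simp: Uc v(2) simp del: sum.lessThan_Suc)
    also have "\<dots> = 0"
      unfolding sum_distrib_left[symmetric] using unitary_sum(1)[OF U, of i 0] i by simp
    finally show ?thesis .
  qed
  have B0': "B $$ (0,i) = 0" if i: "0 < i" "i < Suc n" for i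
    using hermitian_entry[OF B, of i 0] B0[OF i] i by simp
  define A' where "A' = mat n n (\<lambda>(i,j). B $$ (Suc i, Suc j))"
  have A': "hermitian n A'"
  proof (rule hermitianI)
    fix i j assume "i < n" "j < n"
    thus "A' $$ (j, i) = cnj (A' $$ (i, j))"
      unfolding A'_def using hermitian_entry[OF B, of "Suc i" "Suc j"] by simp
  qed (simp add: A'_def)
  from Suc.IH[OF A'] obtain V' where V': "unitary n V'"
    and D: "\<And>i j. i < n \<Longrightarrow> j < n \<Longrightarrow> i \<noteq> j \<Longrightarrow> (adj V' * A' * V') $$ (i,j) = 0" by blast
  define V where "V = mat (Suc n) (Suc n) (\<lambda>(i,j). if i = 0 \<and> j = 0 then 1 else if i = 0 \<or> j = 0 then 0
     else V' $$ (i - 1, j - 1))"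
  have Vc: "V \<in> carrier_mat (Suc n) (Suc n)" by (simp add: V_def)
  have Ve: "V $$ (0,0) = 1" "\<And>i. i < n \<Longrightarrow> V $$ (Suc i,0) = 0" "\<And>i. i < n \<Longrightarrow> V $$ (0,Suc i) = 0"
    "\<And>i j. i < n \<Longrightarrow> j < n \<Longrightarrow> V $$ (Suc i,Suc j) = V' $$ (i,j)"
    by (auto simp: V_def)
  have V: "unitary (Suc n) V"
  proof (rule unitaryI[OF Vc])
    fix i j assume ij: "i < Suc n" "j < Suc n"
    show "(\<Sum>l<Suc n. cnj (V $$ (l,i)) * V $$ (l,j)) = (if i = j then 1 else 0)"
      unfolding sum.lessThan_Suc_shift
      using ij unitary_sum(1)[OF V', of "i-1" "j-1"]
      by (cases i; cases j) (simp_all add: Ve)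
  qed
  have diag: "(adj V * B * V) $$ (i,j) = 0" if ij: "i < Suc n" "j < Suc n" "i \<noteq> j" for i j
  proof -
    have "(adj V * B * V) $$ (i,j)
        = (\<Sum>a<Suc n. \<Sum>b<Suc n. cnj (V $$ (a,i)) * B $$ (a,b) * V $$ (b,j))"
      using ij by (intro conj_entry[OF Vc hermitian_carrier[OF B]]) auto
    also have "\<dots> = 0"
    proof (cases "i = 0 \<or> j = 0")
      case True
      thus ?thesis using ij unfolding sum.lessThan_Suc_shift
        by (cases i; cases j) (auto simp: Ve B0 B0' intro!: sum.neutral)
    next
      case False
      then obtain i' j' where [simp]: "i = Suc i'" "j = Suc j'" by (meson not0_implies_Suc)
      have "(\<Sum>a<Suc n. \<Sum>b<Suc n. cnj (V $$ (a,i)) * B $$ (a,b) * V $$ (b,j))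
         = (\<Sum>a<n. \<Sum>b<n. cnj (V' $$ (a,i')) * A' $$ (a,b) * V' $$ (b,j'))"
        using ij unfolding sum.lessThan_Suc_shift
        by (auto simp: Ve B0 B0' A'_def intro!: sum.cong)
      also have "\<dots> = (adj V' * A' * V') $$ (i',j')"
        using ij by (intro conj_entry[symmetric, OF unitaryD(1)[OF V']]) (auto simp: A'_def)
      finally show ?thesis using D[of i' j'] ij by simp
    qed
    finally show ?thesis .
  qed
  have "adj (U * V) * A * (U * V) = adj V * B * V"
  proof -
    have "adj (U * V) * A * (U * V) = (adj V * adj U) * A * (U * V)"
      using u Vc by (simp add: adj_mult[of _ "Suc n" "Suc n" _ "Suc n"])
    also have "\<dots> = adj V * (adj U * A) * (U * V)"
      by (subst assoc_mult_mat[of _ "Suc n" "Suc n" _ "Suc n" _ "Suc n"]) (use u Vc A in auto)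
    also have "\<dots> = adj V * (adj U * A * U) * V"
      by (rule assoc4[of _ "Suc n" "Suc n" _ "Suc n" _ "Suc n" _ "Suc n"]) (use u Vc A in auto)
    finally show ?thesis by (simp add: B_def)
  qed
  thus ?case using diag unitary_mult[OF U V] by metis
qed

theorem hermitian_spectral:
  assumes "hermitian d A"
  shows "\<exists>V a. unitary d V \<and> A = V * rdiag d a * adj V"
proof -
  from hermitian_diagonalize[OF assms] obtain V where V: "unitary d V"
    and D: "\<And>i j. i < d \<Longrightarrow> j < d \<Longrightarrow> i \<noteq> j \<Longrightarrow> (adj V * A * V) $$ (i,j) = 0" by blast
  have h: "hermitian d (adj V * A * V)" by (rule hermitian_conj[OF assms unitaryD(1)[OF V]])
  have "adj V * A * V = rdiag d (\<lambda>i. Re ((adj V * A * V) $$ (i,i)))" (is "?D = ?R")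
  proof (rule eq_matI)
    fix i j assume "i < dim_row ?R" "j < dim_col ?R"
    hence ij: "i < d" "j < d" by (auto simp: rdiag_def)
    show "?D $$ (i,j) = ?R $$ (i,j)"
      using ij D[of i j] hermitian_entry[OF h ij(1) ij(1)]
      by (auto simp: rdiag_def complex_eq_iff simp del: index_mult_mat)
  qed (use unitaryD[OF V] in \<open>auto simp: rdiag_def\<close>)
  thus ?thesis using conj_conj(1)[OF V hermitian_carrier[OF assms]] V by metis
qed

section \<open>Positive matrices, square roots and the trace norm\<close>

lemma psd_diag_nonneg:
  assumes "psd d A" "X \<in> carrier_mat d k" "i < k"
  shows "0 \<le> Re ((adj X * A * X) $$ (i,i))"
proof -
  have A: "A \<in> carrier_mat d d" using assms by (auto simp: psd_def hermitian_def)
  have "(adj X * A * X) $$ (i,i) = (\<Sum>a<d. cnj (col X i $ a) * (A *\<^sub>v col X i) $ a)"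
    using A assms by (subst conj_entry[OF assms(2) A assms(3,3)])
      (auto simp: scalar_prod_def lessThan_atLeast0 sum_distrib_left mult_ac intro!: sum.cong)
  moreover have "0 \<le> Re (\<Sum>a<d. cnj (col X i $ a) * (A *\<^sub>v col X i) $ a)"
  proof -
    have "col X i \<in> carrier_vec d" using assms by auto
    thus ?thesis using assms(1) unfolding psd_def by blast
  qed
  ultimately show ?thesis by simp
qed

lemma diag_of_conj:
  assumes V: "unitary d V" and A: "A = V * rdiag d a * adj V" and "i < d" "j < d"
  shows "(adj V * A * V) $$ (i,j) = (if i = j then complex_of_real (a i) else 0)"
proof -
  have "adj V * A * V = rdiag d a"
    unfolding A by (rule conj_conj(2)[OF V]) (simp add: rdiag_def)
  thus ?thesis using assms by (simp add: rdiag_cdiag cdiag_entry)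
qed

lemma psd_eigen_nonneg:
  assumes "psd d A" "unitary d V" "A = V * rdiag d a * adj V" "i < d"
  shows "a i \<ge> 0"
  using psd_diag_nonneg[OF assms(1) unitaryD(1)[OF assms(2)] assms(4)] diag_of_conj[OF assms(2,3,4,4)]
  by simp

text \<open>In the eigenbasis the quadratic form is the sum of the eigenvalues weighted with squared
  moduli of coefficients.\<close>

lemma psdI:
  assumes V: "unitary d V" and A: "A = V * rdiag d a * adj V" and nn: "\<And>i. i < d \<Longrightarrow> a i \<ge> 0"
  shows "psd d A"
  unfolding psd_def
proof (intro conjI ballI)
  note v = unitaryD[OF V]
  have rc: "rdiag d a \<in> carrier_mat d d" by (simp add: rdiag_def)
  have "hermitian d (rdiag d a)" by (rule hermitianI) (auto simp: rdiag_def)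
  from hermitian_conj[OF this adj_carrier[OF v(1)]] show "hermitian d A" by (simp add: A)
  fix x :: "complex vec" assume x: "x \<in> carrier_vec d"
  have "(A *\<^sub>v x) $ i = (\<Sum>j<d. A $$ (i,j) * x $ j)" if "i < d" for i
    using that x v A by (auto simp: scalar_prod_def lessThan_atLeast0 intro!: sum.cong)
  hence "(\<Sum>i<d. cnj (x $ i) * (A *\<^sub>v x) $ i)
    = (\<Sum>i<d. \<Sum>j<d. \<Sum>l<d. cnj (x $ i) * (V $$ (i,l) * a l * cnj (V $$ (j,l))) * x $ j)"
    unfolding A rdiag_cdiag using v
    by (simp add: cdiag_conj_entry[of _ d d] sum_distrib_left sum_distrib_right mult_ac del: index_mult_mat)
  also have "\<dots> = (\<Sum>l<d. a l * (cnj (\<Sum>i<d. x $ i * cnj (V $$ (i,l))) * (\<Sum>j<d. x $ j * cnj (V $$ (j,l)))))"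
    (is "(\<Sum>i<d. \<Sum>j<d. \<Sum>l<d. ?F i j l) = _")
  proof -
    have "(\<Sum>i<d. \<Sum>j<d. \<Sum>l<d. ?F i j l) = (\<Sum>i<d. \<Sum>l<d. \<Sum>j<d. ?F i j l)"
      by (intro sum.cong refl sum.swap)
    also have "\<dots> = (\<Sum>l<d. \<Sum>i<d. \<Sum>j<d. ?F i j l)" by (rule sum.swap)
    also have "\<dots> = (\<Sum>l<d. a l * (cnj (\<Sum>i<d. x $ i * cnj (V $$ (i,l))) * (\<Sum>j<d. x $ j * cnj (V $$ (j,l)))))"
      by (simp only: cnj_sum sum_product, simp only: sum_distrib_left, intro sum.cong refl) (simp add: mult_ac)
    finally show ?thesis .
  qed
  also have "\<dots> = complex_of_real (\<Sum>l<d. a l * (cmod (\<Sum>i<d. x $ i * cnj (V $$ (i,l))))\<^sup>2)"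
    by (simp add: cmod_sq mult.commute)
  finally show "0 \<le> Re (\<Sum>i<d. cnj (x $ i) * (A *\<^sub>v x) $ i)"
    using nn by (auto intro!: sum_nonneg)
qed

text \<open>Needed because \<open>psqrt\<close> is a choice. In eigenbases of the two roots the
  overlap matrix \<open>X\<close> intertwines their squares: an entry of \<open>X\<close> is nonzero
  only where the squared eigenvalues agree, hence, by nonnegativity, only where the eigenvalues
  agree. So \<open>X\<close> intertwines the roots themselves.\<close>

lemma psd_sqrt_unique:
  assumes B: "psd d B" and C: "psd d C" and eq: "B * B = C * C"
  shows "B = C"
proof -
  from B C have "hermitian d B" "hermitian d C" by (auto simp: psd_def)
  then obtain W b V c where W: "unitary d W" and Bd: "B = W * rdiag d b * adj W"
    and V: "unitary d V" and Cd: "C = V * rdiag d c * adj V"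
    using hermitian_spectral by metis
  note w = unitaryD[OF W] and v = unitaryD[OF V]
  have b: "\<And>i. i < d \<Longrightarrow> b i \<ge> 0" using psd_eigen_nonneg[OF B W Bd] .
  have c: "\<And>i. i < d \<Longrightarrow> c i \<ge> 0" using psd_eigen_nonneg[OF C V Cd] .
  have cw: "adj W \<in> carrier_mat d d" and cv: "adj V \<in> carrier_mat d d" using w v by auto
  define X where "X = adj W * V"
  have X: "X \<in> carrier_mat d d" using w v by (simp add: X_def)
  have BB: "B * B = W * cdiag d (\<lambda>i. of_real (b i) * of_real (b i)) * adj W"
    unfolding Bd rdiag_cdiag by (rule cdiag_conj_mult[OF W])
  have CC: "C * C = V * cdiag d (\<lambda>i. of_real (c i) * of_real (c i)) * adj V"
    unfolding Cd rdiag_cdiag by (rule cdiag_conj_mult[OF V])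
  have lft: "adj W * (W * D * adj W) * V = D * X" if D: "D \<in> carrier_mat d d" for D
  proof -
    have "adj W * (W * D * adj W) * V = adj W * (W * D * adj W * V)"
      by (rule assoc_mult_mat) (use w v D in auto)
    also have "W * D * adj W * V = W * (D * (adj W * V))"
      using w v D by (simp add: assoc_mult_mat[of _ d d _ d _ d])
    also have "adj W * \<dots> = adj W * W * (D * (adj W * V))"
      by (rule assoc_mult_mat[symmetric]) (use w v D in auto)
    finally show ?thesis using w v D by (simp add: X_def left_mult_one_mat[of _ d d])
  qed
  have rgt: "adj W * (V * D * adj V) * V = X * D" if D: "D \<in> carrier_mat d d" for D
  proof -
    have "adj W * (V * D * adj V) * V = adj W * (V * D * adj V * V)"
      by (rule assoc_mult_mat) (use w v D in auto)
    also have "V * D * adj V * V = V * D * (adj V * V)"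
      by (rule assoc_mult_mat) (use w v D in auto)
    also have "\<dots> = V * D" using v D by (simp add: right_mult_one_mat[of _ d d])
    also have "adj W * (V * D) = adj W * V * D"
      by (rule assoc_mult_mat[symmetric]) (use w v D in auto)
    finally show ?thesis by (simp add: X_def)
  qed
  have ent1: "(cdiag d f * X) $$ (i,j) = f i * X $$ (i,j)" if "i < d" "j < d" for f i j
  proof -
    have "(cdiag d f * X) $$ (i,j) = (\<Sum>l<d. cdiag d f $$ (i,l) * X $$ (l,j))"
      using that X by (intro mult_entry[of _ d d _ d]) auto
    also have "\<dots> = (\<Sum>l<d. if l = i then f i * X $$ (i,j) else 0)"
      using that by (intro sum.cong refl) (simp add: cdiag_entry)
    finally have "(cdiag d f * X) $$ (i,j) = (\<Sum>l<d. if l = i then f i * X $$ (i,j) else 0)" .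
    thus ?thesis using that by simp
  qed
  have ent2: "(X * cdiag d f) $$ (i,j) = X $$ (i,j) * f j" if "i < d" "j < d" for f i j
  proof -
    have "(X * cdiag d f) $$ (i,j) = (\<Sum>l<d. X $$ (i,l) * cdiag d f $$ (l,j))"
      using that X by (intro mult_entry[of _ d d _ d]) auto
    also have "\<dots> = (\<Sum>l<d. if l = j then X $$ (i,j) * f j else 0)"
      using that by (intro sum.cong refl) (simp add: cdiag_entry)
    finally have "(X * cdiag d f) $$ (i,j) = (\<Sum>l<d. if l = j then X $$ (i,j) * f j else 0)" .
    thus ?thesis using that by simp
  qed
  have sq: "cdiag d (\<lambda>i. of_real (b i) * of_real (b i)) * X = X * cdiag d (\<lambda>i. of_real (c i) * of_real (c i))"
    using lft[of "cdiag d (\<lambda>i. of_real (b i) * of_real (b i))"] rgt[of "cdiag d (\<lambda>i. of_real (c i) * of_real (c i))"]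
      BB CC eq by simp
  have "rdiag d b * X = X * rdiag d c"
  proof (rule eq_matI)
    fix i j assume "i < dim_row (X * rdiag d c)" "j < dim_col (X * rdiag d c)"
    hence ij: "i < d" "j < d" using X by (auto simp: rdiag_def)
    have "(of_real (b i) * of_real (b i)) * X $$ (i,j) = X $$ (i,j) * (of_real (c j) * of_real (c j))"
      using ent1[OF ij] ent2[OF ij] sq by metis
    hence "X $$ (i,j) = 0 \<or> complex_of_real ((b i)\<^sup>2) = complex_of_real ((c j)\<^sup>2)"
      by (auto simp: power2_eq_square)
    hence "X $$ (i,j) = 0 \<or> b i = c j" using b[OF ij(1)] c[OF ij(2)]
      unfolding of_real_eq_iff by (auto simp: power2_eq_iff_nonneg)
    thus "(rdiag d b * X) $$ (i,j) = (X * rdiag d c) $$ (i,j)"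
      unfolding rdiag_cdiag ent1[OF ij] ent2[OF ij] by auto
  qed (use X in \<open>auto simp: rdiag_def\<close>)
  hence "W * (adj W * B * V) * adj V = W * (adj W * C * V) * adj V"
    unfolding Bd Cd rdiag_cdiag by (simp add: lft rgt)
  moreover have "W * (adj W * Y * V) * adj V = Y" if Y: "Y \<in> carrier_mat d d" for Y
  proof -
    have "W * (adj W * Y * V) * adj V = W * (adj W * Y) * (V * adj V)"
      by (rule assoc4[symmetric, OF w(1) mult_carrier_mat[OF cw Y] v(1) cv])
    also have "\<dots> = W * (adj W * Y)" unfolding v(3)
      by (rule right_mult_one_mat[of _ d d]) (use w Y in auto)
    also have "\<dots> = (W * adj W) * Y" by (rule assoc_mult_mat[symmetric, OF w(1) cw Y])
    finally show ?thesis using w Y by (simp add: left_mult_one_mat[of _ d d])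
  qed
  moreover have "B \<in> carrier_mat d d" "C \<in> carrier_mat d d"
    using B C by (auto simp: psd_def hermitian_def)
  ultimately show ?thesis by metis
qed

lemma mtrace_conj:
  assumes "unitary d V"
  shows "mtrace (V * cdiag d f * adj V) = (\<Sum>i<d. f i)"
proof -
  note v = unitaryD[OF assms]
  have "mtrace (V * cdiag d f * adj V) = (\<Sum>i<d. \<Sum>l<d. V $$ (i,l) * f l * cnj (V $$ (i,l)))"
    using v by (simp add: mtrace_def cdiag_conj_entry[of _ d d] del: index_mult_mat(1))
  also have "\<dots> = (\<Sum>l<d. f l * (\<Sum>i<d. cnj (V $$ (i,l)) * V $$ (i,l)))"
    unfolding sum_distrib_left by (subst sum.swap) (simp add: mult_ac)
  also have "\<dots> = (\<Sum>l<d. f l)" by (intro sum.cong refl) (simp add: unitary_sum(1)[OF assms])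
  finally show ?thesis .
qed

text \<open>The matrix with the absolute eigenvalues is positive and squares to
  \<open>adj A * A\<close>, so by uniqueness it is the root chosen by \<open>psqrt\<close>.\<close>

lemma trace_norm_diag:
  assumes V: "unitary d V" and A: "A = V * rdiag d a * adj V"
  shows "trace_norm A = (\<Sum>i<d. \<bar>a i\<bar>)"
proof -
  note v = unitaryD[OF V]
  define P where "P = V * rdiag d (\<lambda>i. \<bar>a i\<bar>) * adj V"
  have P: "psd d P" by (rule psdI[OF V P_def]) simp
  have hA: "adj A = A"
  proof -
    have "hermitian d (rdiag d a)" by (rule hermitianI) (auto simp: rdiag_def)
    from hermitian_conj[OF this adj_carrier[OF v(1)]] show "adj A = A" by (simp add: A hermitian_def)
  qed
  have "P * P = A * A"
    unfolding P_def A rdiag_cdiag cdiag_conj_mult[OF V]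
    by (simp flip: of_real_mult)
  hence eq: "P * P = adj A * A" by (simp add: hA)
  have "psqrt d (adj A * A) = P"
    unfolding psqrt_def
    by (rule some_equality) (use P eq in \<open>auto intro: psd_sqrt_unique\<close>)
  moreover have "dim_col A = d" using v by (simp add: A)
  ultimately have "trace_norm A = Re (mtrace P)" by (simp add: trace_norm_def)
  thus ?thesis unfolding P_def rdiag_cdiag mtrace_conj[OF V] by simp
qed

lemma diag_conj_entry_cdiag:
  assumes W: "unitary d W" and V: "unitary d V" and i: "i < d"
  shows "(adj W * (V * cdiag d f * adj V) * W) $$ (i,i) = (\<Sum>l<d. f l * (cmod ((adj W * V) $$ (i,l)))\<^sup>2)"
proof -
  note w = unitaryD[OF W] and v = unitaryD[OF V]
  have X: "adj W * V \<in> carrier_mat d d" using w v by simp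
  have cw: "adj W \<in> carrier_mat d d" and cv: "adj V \<in> carrier_mat d d" using w v by auto
  have "adj W * (V * cdiag d f * adj V) * W = (adj W * V) * cdiag d f * (adj V * W)"
    using w v by (simp add: assoc_mult_mat[of _ d d _ d _ d])
  also have "adj V * W = adj (adj W * V)" by (simp add: adj_mult[OF cw v(1)])
  finally show ?thesis
    using i X by (simp add: cdiag_conj_entry[OF X] cmod_sq mult_ac del: index_mult_mat)
qed

lemma unitary_row_sum:
  assumes "unitary d W" "i < d"
  shows "(\<Sum>l<d. (cmod (W $$ (i,l)))\<^sup>2) = 1" "(\<Sum>l<d. (cmod (W $$ (l,i)))\<^sup>2) = 1"
proof -
  have "complex_of_real (\<Sum>l<d. (cmod (W $$ (i,l)))\<^sup>2) = 1"
    using unitary_sum(2)[OF assms(1) assms(2) assms(2)] by (simp add: cmod_sq)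
  thus "(\<Sum>l<d. (cmod (W $$ (i,l)))\<^sup>2) = 1" by (metis of_real_eq_1_iff)
  have "complex_of_real (\<Sum>l<d. (cmod (W $$ (l,i)))\<^sup>2) = 1"
    using unitary_sum(1)[OF assms(1) assms(2) assms(2)] by (simp add: cmod_sq mult.commute)
  thus "(\<Sum>l<d. (cmod (W $$ (l,i)))\<^sup>2) = 1" by (metis of_real_eq_1_iff)
qed

text \<open>The diagonal in any orthonormal basis averages the eigenvalues with the doubly
  stochastic matrix of squared overlaps. Physically, no measurement separates two states by more
  than the trace norm of their difference.\<close>

theorem trace_norm_ge:
  assumes A: "hermitian d A" and W: "unitary d W"
  shows "(\<Sum>i<d. cmod ((adj W * A * W) $$ (i,i))) \<le> trace_norm A"
proof -
  from hermitian_spectral[OF A] obtain V a where V: "unitary d V" and Ad: "A = V * rdiag d a * adj V"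
    by blast
  have X: "unitary d (adj W * V)" by (intro unitary_mult unitary_adj W V)
  have "(\<Sum>i<d. cmod ((adj W * A * W) $$ (i,i)))
      \<le> (\<Sum>i<d. \<Sum>l<d. \<bar>a l\<bar> * (cmod ((adj W * V) $$ (i,l)))\<^sup>2)"
    unfolding Ad rdiag_cdiag
    by (intro sum_mono) (auto simp: diag_conj_entry_cdiag[OF W V] norm_mult norm_power simp del: index_mult_mat intro!: sum_norm_le)
  also have "\<dots> = (\<Sum>l<d. \<bar>a l\<bar> * (\<Sum>i<d. (cmod ((adj W * V) $$ (i,l)))\<^sup>2))"
    unfolding sum_distrib_left by (rule sum.swap)
  also have "\<dots> = trace_norm A"
    unfolding trace_norm_diag[OF V Ad] by (intro sum.cong refl) (simp add: unitary_row_sum[OF X] del: index_mult_mat)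
  finally show ?thesis .
qed

text \<open>The eigenbasis gives equality, so an upper bound on the trace norm follows from a bound
  on the diagonal in an arbitrary basis.\<close>

theorem trace_norm_attained:
  assumes A: "hermitian d A"
  shows "\<exists>W. unitary d W \<and> trace_norm A = (\<Sum>i<d. cmod ((adj W * A * W) $$ (i,i)))"
proof -
  from hermitian_spectral[OF A] obtain V a where V: "unitary d V" and Ad: "A = V * rdiag d a * adj V"
    by blast
  have "(\<Sum>i<d. cmod ((adj V * A * V) $$ (i,i))) = (\<Sum>i<d. \<bar>a i\<bar>)"
    by (intro sum.cong refl) (simp add: diag_of_conj[OF V Ad] del: index_mult_mat)
  thus ?thesis using V trace_norm_diag[OF V Ad] by metis
qed

section \<open>Tensor powers\<close>

text \<open>Indices of a tensor power are read in base \<open>d\<close>, one digit per factor;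
  \<open>kron\<close> puts the newest factor into digit 0.\<close>

definition dig :: "nat \<Rightarrow> nat \<Rightarrow> nat \<Rightarrow> nat" where
  "dig d l i = (i div d ^ l) mod d"

lemma dig_0 [simp]: "dig d 0 i = i mod d"
  by (simp add: dig_def)

lemma dig_Suc: "dig d (Suc l) i = dig d l (i div d)"
  by (simp add: dig_def div_mult2_eq)

lemma dig_less: "d > 0 \<Longrightarrow> dig d l i < d"
  by (simp add: dig_def)

lemma div_less_pow: "i < d ^ Suc n \<Longrightarrow> i div d < (d::nat) ^ n"
  by (simp add: less_mult_imp_div_less mult.commute)

lemma dig_less_pow: "i < d ^ n \<Longrightarrow> l < n \<Longrightarrow> dig d l i < d"
  by (cases "d = 0") (auto simp: power_0_left intro: dig_less split: if_splits)

lemma dig_inj: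
  assumes "i < d ^ n" "j < d ^ n" "\<And>l. l < n \<Longrightarrow> dig d l i = dig d l j"
  shows "i = j"
  using assms
proof (induction n arbitrary: i j)
  case (Suc n)
  have "i div d = j div d"
    by (rule Suc.IH) (use Suc.prems(1,2) Suc.prems(3)[of "Suc _"] in \<open>auto simp: dig_Suc div_less_pow simp del: power_Suc\<close>)
  moreover have "i mod d = j mod d" using Suc.prems(3)[of 0] by simp
  ultimately show ?case by (metis div_mult_mod_eq)
qed simp

lemma sum_pow_Suc:
  fixes g :: "nat \<Rightarrow> 'a::comm_monoid_add"
  shows "(\<Sum>i<d ^ Suc n. g i) = (\<Sum>i<d ^ n. \<Sum>a<d. g (i * d + a))"
proof -
  have "(\<Sum>i<d ^ Suc n. g i) = (\<Sum>i<d ^ n. sum g {i * d..<i * d + d})"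
    by (simp add: sum.nat_group mult.commute)
  also have "\<dots> = (\<Sum>i<d ^ n. \<Sum>a<d. g (i * d + a))"
  proof (rule sum.cong[OF refl])
    fix i
    have "sum g {i * d..<i * d + d} = sum g {0 + i * d..<d + i * d}" by (simp add: add.commute)
    also have "\<dots> = (\<Sum>a<d. g (i * d + a))"
      unfolding sum.shift_bounds_nat_ivl by (simp add: lessThan_atLeast0 add.commute)
    finally show "sum g {i * d..<i * d + d} = (\<Sum>a<d. g (i * d + a))" .
  qed
  finally show ?thesis .
qed

text \<open>Stated over commutative semirings because it serves for real and complex numbers and
  also for polynomials, where it says that the generating polynomials of independent summands
  multiply.\<close>

lemma sum_prod_dig:
  fixes f :: "nat \<Rightarrow> nat \<Rightarrow> 'a::comm_semiring_1"
  shows "(\<Sum>i<d ^ n. \<Prod>l<n. f l (dig d l i)) = (\<Prod>l<n. \<Sum>a<d. f l a)"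
proof (induction n arbitrary: f)
  case (Suc n)
  have "(\<Sum>i<d ^ Suc n. \<Prod>l<Suc n. f l (dig d l i))
      = (\<Sum>i<d ^ n. \<Sum>a<d. f 0 a * (\<Prod>l<n. f (Suc l) (dig d l i)))"
    unfolding sum_pow_Suc prod.lessThan_Suc_shift
    by (intro sum.cong refl) (auto simp: dig_Suc)
  also have "\<dots> = (\<Sum>a<d. f 0 a) * (\<Sum>i<d ^ n. \<Prod>l<n. f (Suc l) (dig d l i))"
    by (simp add: sum_distrib_left sum_distrib_right)
  also have "\<dots> = (\<Prod>l<Suc n. \<Sum>a<d. f l a)"
    using Suc[of "\<lambda>l. f (Suc l)"] by (simp add: prod.lessThan_Suc_shift del: prod.lessThan_Suc)
  finally show ?case .
qed simp

lemma kron_carrier [simp]: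
  "A \<in> carrier_mat a b \<Longrightarrow> B \<in> carrier_mat c d \<Longrightarrow> kron A B \<in> carrier_mat (a * c) (b * d)"
  by (auto simp: kron_def)

lemma tpow_carrier [simp]: "A \<in> carrier_mat d d \<Longrightarrow> tpow A n \<in> carrier_mat (d ^ n) (d ^ n)"
proof (induction n)
  case (Suc n)
  thus ?case using kron_carrier[OF Suc.IH Suc.prems] by (simp add: mult.commute)
qed simp

lemma kron_entry:
  assumes "A \<in> carrier_mat (d ^ n) (d ^ n)" "B \<in> carrier_mat d d" "i < d ^ Suc n" "j < d ^ Suc n"
  shows "kron A B $$ (i,j) = A $$ (i div d, j div d) * B $$ (i mod d, j mod d)"
  using assms by (auto simp: kron_def mult.commute)

lemma tpow_entry:
  assumes "A \<in> carrier_mat d d" "i < d ^ n" "j < d ^ n"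
  shows "tpow A n $$ (i,j) = (\<Prod>l<n. A $$ (dig d l i, dig d l j))"
  using assms(2,3)
proof (induction n arbitrary: i j)
  case (Suc n)
  have "tpow A (Suc n) $$ (i,j) = tpow A n $$ (i div d, j div d) * A $$ (i mod d, j mod d)"
    unfolding tpow.simps by (rule kron_entry) (use assms Suc.prems in auto)
  also have "\<dots> = (\<Prod>l<Suc n. A $$ (dig d l i, dig d l j))"
    unfolding prod.lessThan_Suc_shift using Suc.IH Suc.prems
    by (simp add: div_less_pow dig_Suc mult.commute del: power_Suc)
  finally show ?case .
qed simp

lemma tpow_mult:
  assumes A: "A \<in> carrier_mat d d" and B: "B \<in> carrier_mat d d"
  shows "tpow A n * tpow B n = tpow (A * B) n"
proof -
  have AB: "A * B \<in> carrier_mat d d" using A B by simp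
  show ?thesis
  proof (rule eq_matI)
    fix i j assume "i < dim_row (tpow (A * B) n)" "j < dim_col (tpow (A * B) n)"
    hence ij: "i < d ^ n" "j < d ^ n" using tpow_carrier[OF AB, of n] by auto
    have "(tpow A n * tpow B n) $$ (i,j)
        = (\<Sum>k<d ^ n. \<Prod>l<n. A $$ (dig d l i, dig d l k) * B $$ (dig d l k, dig d l j))"
      using ij by (subst mult_entry[OF tpow_carrier[OF A] tpow_carrier[OF B]])
        (auto simp: tpow_entry[OF A] tpow_entry[OF B] prod.distrib)
    also have "\<dots> = (\<Prod>l<n. \<Sum>k<d. A $$ (dig d l i, k) * B $$ (k, dig d l j))"
      by (rule sum_prod_dig)
    also have "\<dots> = (\<Prod>l<n. (A * B) $$ (dig d l i, dig d l j))"
      by (intro prod.cong refl mult_entry[symmetric, OF A B]) (use ij dig_less_pow in auto)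
    also have "\<dots> = tpow (A * B) n $$ (i,j)" by (rule tpow_entry[symmetric, OF AB ij])
    finally show "(tpow A n * tpow B n) $$ (i,j) = tpow (A * B) n $$ (i,j)" .
  qed (simp_all only: index_mult_mat(2,3) carrier_matD[OF tpow_carrier[OF A]]
       carrier_matD[OF tpow_carrier[OF B]] carrier_matD[OF tpow_carrier[OF AB]])
qed

lemma tpow_eqI:
  assumes A: "A \<in> carrier_mat d d" and B: "B \<in> carrier_mat (d ^ n) (d ^ n)"
    and "\<And>i j. i < d ^ n \<Longrightarrow> j < d ^ n \<Longrightarrow> B $$ (i,j) = (\<Prod>l<n. A $$ (dig d l i, dig d l j))"
  shows "B = tpow A n"
  by (rule eq_matI) (use assms carrier_matD[OF tpow_carrier[OF A, of n]] tpow_entry[OF A] in auto)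


lemma tpow_one: "tpow (1\<^sub>m d) n = 1\<^sub>m (d ^ n)"
proof (rule tpow_eqI[symmetric])
  fix i j assume ij: "i < d ^ n" "j < d ^ n"
  show "1\<^sub>m (d ^ n) $$ (i,j) = (\<Prod>l<n. (1\<^sub>m d :: complex mat) $$ (dig d l i, dig d l j))"
  proof (cases "i = j")
    case True
    thus ?thesis using ij dig_less_pow[OF ij(1)] by simp
  next
    case False
    then obtain l where "l < n" "dig d l i \<noteq> dig d l j" using dig_inj ij by blast
    thus ?thesis using ij dig_less_pow[OF ij(1)] dig_less_pow[OF ij(2)] False by (auto intro!: bexI[of _ l])
  qed
qed auto

lemma adj_tpow:
  assumes A: "A \<in> carrier_mat d d"
  shows "adj (tpow A n) = tpow (adj A) n"
  using A by (intro tpow_eqI) (auto simp: adj_entry[OF tpow_carrier[OF A]] tpow_entry[OF A] adj_entry[OF A] dig_less_pow)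

lemma tpow_unitary:
  assumes "unitary d U"
  shows "unitary (d ^ n) (tpow U n)"
  using unitaryD[OF assms] unfolding unitary_def
  by (simp add: adj_tpow[of U d] tpow_mult[of _ d] tpow_one)

lemma tpow_conj:
  assumes "W \<in> carrier_mat d d" "A \<in> carrier_mat d d"
  shows "adj (tpow W n) * tpow A n * tpow W n = tpow (adj W * A * W) n"
  using assms by (simp add: adj_tpow[of W d] tpow_mult[of _ d])

section \<open>Hamiltonian and evolution of several copies\<close>

definition esum :: "nat \<Rightarrow> nat \<Rightarrow> (nat \<Rightarrow> real) \<Rightarrow> nat \<Rightarrow> real" where
  "esum d n E i = (\<Sum>l<n. E (dig d l i))"

lemma esum_Suc: "esum d (Suc n) E i = esum d n E (i div d) + E (i mod d)"
  unfolding esum_def sum.lessThan_Suc_shift by (simp add: dig_Suc add.commute)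

lemma ham_copies_carrier:
  "H \<in> carrier_mat d d \<Longrightarrow> ham_copies d H n \<in> carrier_mat (d ^ n) (d ^ n)"
proof (induction n)
  case (Suc n)
  have "kron (1\<^sub>m (d ^ n)) H \<in> carrier_mat (d ^ n * d) (d ^ n * d)"
    using Suc.prems by (intro kron_carrier) auto
  thus ?case using kron_carrier[OF Suc.IH[OF Suc.prems] one_carrier_mat[of d]]
    by (simp add: mult.commute)
qed simp

lemma ham_copies_diag:
  assumes W: "unitary d W" and H: "H = W * rdiag d E * adj W"
  shows "ham_copies d H n = tpow W n * rdiag (d ^ n) (esum d n E) * adj (tpow W n)"
proof (induction n)
  case 0
  have [simp]: "esum d 0 E = (\<lambda>_. 0)" by (auto simp: esum_def)
  have "1\<^sub>m 1 * rdiag 1 (\<lambda>_. 0) * adj (1\<^sub>m 1) = 0\<^sub>m 1 1"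
    by (rule eq_matI) (auto simp: rdiag_def adj_def scalar_prod_def)
  thus ?case by simp
next
  case (Suc n)
  note w = unitaryD[OF W]
  let ?Wn = "tpow W n"
  have Hc: "H \<in> carrier_mat d d" using w by (simp add: H rdiag_cdiag)
  have Wn: "unitary (d ^ n) ?Wn" by (rule tpow_unitary[OF W])
  note wn = unitaryD[OF Wn]
  have Wsc: "tpow W (Suc n) \<in> carrier_mat (d ^ Suc n) (d ^ Suc n)" using w by (intro tpow_carrier)
  show ?case
  proof (rule eq_matI)
    fix i j
    assume "i < dim_row (tpow W (Suc n) * rdiag (d ^ Suc n) (esum d (Suc n) E) * adj (tpow W (Suc n)))"
      "j < dim_col (tpow W (Suc n) * rdiag (d ^ Suc n) (esum d (Suc n) E) * adj (tpow W (Suc n)))"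
    hence ij: "i < d ^ Suc n" "j < d ^ Suc n" using Wsc by auto
    hence d: "d > 0" by (cases "d = 0") auto
    define i1 i2 j1 j2 where "i1 = i div d" and "i2 = i mod d" and "j1 = j div d" and "j2 = j mod d"
    have lt: "i1 < d ^ n" "j1 < d ^ n" "i2 < d" "j2 < d"
      using ij d div_less_pow by (auto simp: i1_def j1_def i2_def j2_def simp del: power_Suc)
    have "kron (ham_copies d H n) (1\<^sub>m d) $$ (i,j) = ham_copies d H n $$ (i1,j1) * (if i2 = j2 then 1 else 0)"
      unfolding i1_def i2_def j1_def j2_def
      using d by (subst kron_entry[OF ham_copies_carrier[OF Hc] one_carrier_mat ij]) auto
    moreover have "kron (1\<^sub>m (d ^ n)) H $$ (i,j) = (if i1 = j1 then 1 else 0) * H $$ (i2,j2)"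
      using lt unfolding i1_def i2_def j1_def j2_def
      by (subst kron_entry[OF one_carrier_mat Hc ij]) auto
    moreover have "ham_copies d H (Suc n) $$ (i,j)
       = kron (ham_copies d H n) (1\<^sub>m d) $$ (i,j) + kron (1\<^sub>m (d ^ n)) H $$ (i,j)"
      using ij kron_carrier[OF one_carrier_mat Hc, of "d ^ n"] by (simp add: mult.commute)
    moreover have hn: "ham_copies d H n $$ (i1,j1) = (\<Sum>l<d ^ n. ?Wn $$ (i1,l) * esum d n E l * cnj (?Wn $$ (j1,l)))"
      by (simp only: Suc rdiag_cdiag cdiag_conj_entry[OF wn(1) lt(1,2)])
    moreover have hH: "H $$ (i2,j2) = (\<Sum>a<d. W $$ (i2,a) * E a * cnj (W $$ (j2,a)))"
      by (simp only: H rdiag_cdiag cdiag_conj_entry[OF w(1) lt(3,4)])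
    ultimately have "ham_copies d H (Suc n) $$ (i,j)
       = ham_copies d H n $$ (i1,j1) * (if i2 = j2 then 1 else 0) + (if i1 = j1 then 1 else 0) * H $$ (i2,j2)"
      by simp
    \<comment> \<open>Both Kronecker deltas are expanded into resolutions of the identity by
      unitarity, so that the two summands merge into one double sum over product
      eigenvectors.\<close>
    also have "\<dots> = (\<Sum>l<d ^ n. ?Wn $$ (i1,l) * esum d n E l * cnj (?Wn $$ (j1,l))) * (\<Sum>a<d. W $$ (i2,a) * cnj (W $$ (j2,a)))
       + (\<Sum>l<d ^ n. ?Wn $$ (i1,l) * cnj (?Wn $$ (j1,l))) * (\<Sum>a<d. W $$ (i2,a) * E a * cnj (W $$ (j2,a)))"
      unfolding hn hH unitary_sum(2)[OF Wn lt(1,2)] unitary_sum(2)[OF W lt(3,4)] by simp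
    also have "\<dots> = (\<Sum>l<d ^ n. \<Sum>a<d. (?Wn $$ (i1,l) * W $$ (i2,a)) * (esum d n E l + E a)
         * cnj (?Wn $$ (j1,l) * W $$ (j2,a)))"
      unfolding sum_product sum.distrib[symmetric] by (intro sum.cong refl) (simp add: algebra_simps)
    also have "\<dots> = (\<Sum>l<d ^ Suc n. tpow W (Suc n) $$ (i,l) * esum d (Suc n) E l * cnj (tpow W (Suc n) $$ (j,l)))"
      unfolding sum_pow_Suc
    proof (intro sum.cong refl)
      fix l a assume la: "l \<in> {..<d ^ n}" "a \<in> {..<d}"
      have lt': "l * d + a < d ^ Suc n"
      proof -
        have "l * d + a < Suc l * d" using la by simp
        also have "\<dots> \<le> d ^ n * d" using la by (intro mult_right_mono) auto
        finally show ?thesis by (simp add: mult.commute)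
      qed
      show "(?Wn $$ (i1,l) * W $$ (i2,a)) * (esum d n E l + E a) * cnj (?Wn $$ (j1,l) * W $$ (j2,a))
        = tpow W (Suc n) $$ (i,l * d + a) * esum d (Suc n) E (l * d + a) * cnj (tpow W (Suc n) $$ (j,l * d + a))"
        using kron_entry[OF wn(1) w(1) ij(1) lt'] kron_entry[OF wn(1) w(1) ij(2) lt'] la
        by (simp add: esum_Suc i1_def i2_def j1_def j2_def)
    qed
    also have "\<dots> = (tpow W (Suc n) * rdiag (d ^ Suc n) (esum d (Suc n) E) * adj (tpow W (Suc n))) $$ (i,j)"
      unfolding rdiag_cdiag by (rule cdiag_conj_entry[symmetric, OF Wsc ij])
    finally show "ham_copies d H (Suc n) $$ (i,j)
      = (tpow W (Suc n) * rdiag (d ^ Suc n) (esum d (Suc n) E) * adj (tpow W (Suc n))) $$ (i,j)" .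
  qed (use ham_copies_carrier[OF Hc, of "Suc n"] Wsc in auto)
qed

text \<open>Allows identities between operators to be checked on matrix elements in the energy
  basis.\<close>

lemma conj_inject:
  assumes "unitary d W" "A \<in> carrier_mat d d" "B \<in> carrier_mat d d" "adj W * A * W = adj W * B * W"
  shows "A = B"
  using conj_conj(1)[OF assms(1,2)] conj_conj(1)[OF assms(1,3)] assms(4) by metis

lemma cis_sum: "finite S \<Longrightarrow> cis (\<Sum>x\<in>S. f x) = (\<Prod>x\<in>S. cis (f x))"
  by (induction S rule: finite_induct) (auto simp flip: cis_mult)

text \<open>The phase of a total energy is the product of the phases of the single energies, so
  copies without interaction evolve independently.\<close>

lemma evol_tpow:
  assumes W: "unitary d W" and H: "H = W * rdiag d E * adj W" and r: "\<rho> \<in> carrier_mat d d"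
  shows "evol (ham_copies d H n) t (tpow \<rho> n) = tpow (evol H t \<rho>) n"
proof (rule conj_inject)
  let ?Wn = "tpow W n"
  note w = unitaryD[OF W]
  show Wn: "unitary (d ^ n) ?Wn" by (rule tpow_unitary[OF W])
  note Hn = ham_copies_diag[OF W H, of n]
  have e: "evol H t \<rho> \<in> carrier_mat d d" by (rule evol_carrier[OF W H r])
  show c: "evol (ham_copies d H n) t (tpow \<rho> n) \<in> carrier_mat (d ^ n) (d ^ n)"
    by (rule evol_carrier[OF Wn Hn]) (use r in simp)
  show "tpow (evol H t \<rho>) n \<in> carrier_mat (d ^ n) (d ^ n)" using e by simp
  have s: "adj W * \<rho> * W \<in> carrier_mat d d" "adj W * evol H t \<rho> * W \<in> carrier_mat d d"
    using w r e by auto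
  have "adj ?Wn * evol (ham_copies d H n) t (tpow \<rho> n) * ?Wn = tpow (adj W * evol H t \<rho> * W) n"
  proof (rule tpow_eqI[OF s(2)])
    fix i j assume ij: "i < d ^ n" "j < d ^ n"
    have "(adj ?Wn * evol (ham_copies d H n) t (tpow \<rho> n) * ?Wn) $$ (i,j)
       = cis (- (esum d n E i - esum d n E j) * t) * tpow (adj W * \<rho> * W) n $$ (i,j)"
      using r by (subst evol_entry[OF Wn Hn _ ij]) (simp_all add: tpow_conj[OF w(1) r])
    also have "cis (- (esum d n E i - esum d n E j) * t)
        = (\<Prod>l<n. cis (- (E (dig d l i) - E (dig d l j)) * t))"
      by (subst cis_sum[symmetric]) (auto simp: esum_def sum_subtractf[symmetric] sum_negf[symmetric] sum_distrib_right)
    also have "\<dots> * tpow (adj W * \<rho> * W) n $$ (i,j)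
        = (\<Prod>l<n. (adj W * evol H t \<rho> * W) $$ (dig d l i, dig d l j))"
      unfolding tpow_entry[OF s(1) ij] prod.distrib[symmetric]
      by (intro prod.cong refl evol_entry[symmetric, OF W H r]) (use ij dig_less_pow in auto)
    finally show "(adj ?Wn * evol (ham_copies d H n) t (tpow \<rho> n) * ?Wn) $$ (i,j)
        = (\<Prod>l<n. (adj W * evol H t \<rho> * W) $$ (dig d l i, dig d l j))" .
  qed (use c unitaryD[OF Wn] in simp)
  thus "adj ?Wn * evol (ham_copies d H n) t (tpow \<rho> n) * ?Wn = adj ?Wn * tpow (evol H t \<rho>) n * ?Wn"
    by (simp add: tpow_conj[OF w(1) e])
qed

section \<open>The c-bits in the energy basis\<close>

definition cbit_energy :: "real \<Rightarrow> nat \<Rightarrow> real" where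
  "cbit_energy \<tau> i = (if i = 0 then pi / \<tau> else - pi / \<tau>)"

lemma cbit_ham_diag: "cbit_ham \<tau> = 1\<^sub>m 2 * rdiag 2 (cbit_energy \<tau>) * adj (1\<^sub>m 2)"
proof -
  have "adj (1\<^sub>m 2) = (1\<^sub>m 2 :: complex mat)" by (rule eq_matI) (auto simp: adj_def)
  moreover have "cbit_ham \<tau> = rdiag 2 (cbit_energy \<tau>)"
    by (rule eq_matI) (auto simp: cbit_ham_def rdiag_def cbit_energy_def)
  moreover have "rdiag 2 (cbit_energy \<tau>) \<in> carrier_mat 2 2" by (simp add: rdiag_def)
  ultimately show ?thesis by simp
qed

lemma unitary_one: "unitary d (1\<^sub>m d)"
  by (rule unitaryI) (auto intro!: sum.neutral simp: if_distrib cong: if_cong)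

lemma cbits_diag:
  "ham_copies 2 (cbit_ham \<tau>) m = 1\<^sub>m (2 ^ m) * rdiag (2 ^ m) (esum 2 m (cbit_energy \<tau>)) * adj (1\<^sub>m (2 ^ m))"
  using ham_copies_diag[OF unitary_one cbit_ham_diag, of \<tau> m] by (simp add: tpow_one)

lemma cbits_state_entry:
  assumes "i < 2 ^ m" "j < 2 ^ m"
  shows "tpow cbit_state m $$ (i,j) = (1/2) ^ m"
  using assms dig_less_pow[OF assms(1)] dig_less_pow[OF assms(2)]
  by (subst tpow_entry[of _ 2]) (auto simp: cbit_state_def)

section \<open>Channels and the converse bound\<close>

text \<open>By Lagrange's identity the defect in the squared inequality is half a double sum of
  squares.\<close>

lemma Cauchy_Schwarz_sum:
  fixes a b :: "'i \<Rightarrow> real"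
  shows "(\<Sum>i\<in>I. a i * b i) \<le> sqrt (\<Sum>i\<in>I. (a i)\<^sup>2) * sqrt (\<Sum>i\<in>I. (b i)\<^sup>2)"
proof -
  have "0 \<le> (\<Sum>i\<in>I. \<Sum>j\<in>I. (a i * b j - a j * b i)\<^sup>2)" by (intro sum_nonneg) auto
  also have "\<dots> = (\<Sum>i\<in>I. \<Sum>j\<in>I. (a i)\<^sup>2 * (b j)\<^sup>2) + (\<Sum>i\<in>I. \<Sum>j\<in>I. (b i)\<^sup>2 * (a j)\<^sup>2)
      - 2 * (\<Sum>i\<in>I. \<Sum>j\<in>I. (a i * b i) * (a j * b j))"
    unfolding sum_distrib_left sum.distrib[symmetric] sum_subtractf[symmetric]
    by (intro sum.cong refl) (simp add: power2_eq_square algebra_simps)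
  also have "\<dots> = 2 * ((\<Sum>i\<in>I. (a i)\<^sup>2) * (\<Sum>i\<in>I. (b i)\<^sup>2) - (\<Sum>i\<in>I. a i * b i)\<^sup>2)"
    unfolding sum_product[symmetric] by (simp add: power2_eq_square algebra_simps)
  finally have "(\<Sum>i\<in>I. a i * b i)\<^sup>2 \<le> (\<Sum>i\<in>I. (a i)\<^sup>2) * (\<Sum>i\<in>I. (b i)\<^sup>2)" by simp
  thus ?thesis unfolding real_sqrt_mult[symmetric] by (rule real_le_rsqrt)
qed

lemma sqrt_diff_sq_le:
  fixes a b :: real
  assumes "a \<ge> 0" "b \<ge> 0"
  shows "(sqrt a - sqrt b)\<^sup>2 \<le> \<bar>a - b\<bar>"
proof -
  have "(sqrt a - sqrt b)\<^sup>2 \<le> \<bar>sqrt a - sqrt b\<bar> * \<bar>sqrt a + sqrt b\<bar>"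
    unfolding power2_abs[of "sqrt a - sqrt b", symmetric] unfolding power2_eq_square
    using assms by (intro mult_left_mono) (auto simp: abs_le_iff)
  also have "\<dots> = \<bar>(sqrt a - sqrt b) * (sqrt a + sqrt b)\<bar>" by (rule abs_mult[symmetric])
  also have "(sqrt a - sqrt b) * (sqrt a + sqrt b) = a - b" using assms by (simp add: algebra_simps)
  finally show ?thesis .
qed

text \<open>\<open>P\<close> is exchanged for \<open>p\<close>, then \<open>Q\<close> for
  \<open>q\<close>. Each exchange is bounded by the Cauchy-Schwarz inequality against a normalized
  factor, and the squared difference of two square roots is at most the absolute difference of the
  radicands.\<close>

lemma bhattacharyya_continuous:
  fixes P Q p q :: "'i \<Rightarrow> real"
  assumes nn: "\<And>i. i \<in> I \<Longrightarrow> P i \<ge> 0" "\<And>i. i \<in> I \<Longrightarrow> Q i \<ge> 0" "\<And>i. i \<in> I \<Longrightarrow> p i \<ge> 0" "\<And>i. i \<in> I \<Longrightarrow> q i \<ge> 0"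
    and s: "sum Q I = 1" "sum p I = 1"
  shows "(\<Sum>i\<in>I. sqrt (P i) * sqrt (Q i)) \<le> (\<Sum>i\<in>I. sqrt (p i) * sqrt (q i))
     + sqrt (\<Sum>i\<in>I. \<bar>P i - p i\<bar>) + sqrt (\<Sum>i\<in>I. \<bar>Q i - q i\<bar>)"
proof -
  have "(\<Sum>i\<in>I. sqrt (P i) * sqrt (Q i)) = (\<Sum>i\<in>I. sqrt (p i) * sqrt (q i))
     + (\<Sum>i\<in>I. (sqrt (P i) - sqrt (p i)) * sqrt (Q i)) + (\<Sum>i\<in>I. sqrt (p i) * (sqrt (Q i) - sqrt (q i)))"
    unfolding sum.distrib[symmetric] by (intro sum.cong refl) (simp add: algebra_simps)
  moreover have "(\<Sum>i\<in>I. (sqrt (P i) - sqrt (p i)) * sqrt (Q i)) \<le> sqrt (\<Sum>i\<in>I. \<bar>P i - p i\<bar>)"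
  proof -
    have "(\<Sum>i\<in>I. (sqrt (Q i))\<^sup>2) = 1" using nn s by simp
    hence "(\<Sum>i\<in>I. (sqrt (P i) - sqrt (p i)) * sqrt (Q i)) \<le> sqrt (\<Sum>i\<in>I. (sqrt (P i) - sqrt (p i))\<^sup>2)"
      using Cauchy_Schwarz_sum[of "\<lambda>i. sqrt (P i) - sqrt (p i)" "\<lambda>i. sqrt (Q i)" I] by simp
    also have "\<dots> \<le> sqrt (\<Sum>i\<in>I. \<bar>P i - p i\<bar>)"
      by (intro real_sqrt_le_mono sum_mono sqrt_diff_sq_le nn)
    finally show ?thesis .
  qed
  moreover have "(\<Sum>i\<in>I. sqrt (p i) * (sqrt (Q i) - sqrt (q i))) \<le> sqrt (\<Sum>i\<in>I. \<bar>Q i - q i\<bar>)"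
  proof -
    have "(\<Sum>i\<in>I. (sqrt (p i))\<^sup>2) = 1" using nn s by simp
    hence "(\<Sum>i\<in>I. sqrt (p i) * (sqrt (Q i) - sqrt (q i))) \<le> sqrt (\<Sum>i\<in>I. (sqrt (Q i) - sqrt (q i))\<^sup>2)"
      using Cauchy_Schwarz_sum[of "\<lambda>i. sqrt (p i)" "\<lambda>i. sqrt (Q i) - sqrt (q i)" I] by simp
    also have "\<dots> \<le> sqrt (\<Sum>i\<in>I. \<bar>Q i - q i\<bar>)"
      by (intro real_sqrt_le_mono sum_mono sqrt_diff_sq_le nn)
    finally show ?thesis .
  qed
  ultimately show ?thesis by simp
qed

section \<open>Kraus representations and the overlap bound\<close>

lemma msum_carrier [simp]: "(\<And>M. M \<in> set Ms \<Longrightarrow> M \<in> carrier_mat d d) \<Longrightarrow> msum d Ms \<in> carrier_mat d d"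
  unfolding msum_def by (induction Ms) auto

lemma msum_entry:
  assumes "\<And>M. M \<in> set Ms \<Longrightarrow> M \<in> carrier_mat d d" "i < d" "j < d"
  shows "msum d Ms $$ (i,j) = (\<Sum>M\<leftarrow>Ms. M $$ (i,j))"
  using assms(1)
proof (induction Ms)
  case (Cons M Ms)
  have "msum d Ms \<in> carrier_mat d d" by (rule msum_carrier) (use Cons.prems in simp)
  thus ?case using Cons assms(2,3) by (auto simp: msum_def)
qed (use assms in \<open>simp add: msum_def\<close>)

lemma kraus_entry:
  assumes K: "K \<in> carrier_mat n m" and s: "\<sigma> \<in> carrier_mat m m" and ij: "i < n" "j < n"
  shows "(K * \<sigma> * adj K) $$ (i,j) = (\<Sum>a<m. \<Sum>b<m. K $$ (i,a) * \<sigma> $$ (a,b) * cnj (K $$ (j,b)))"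
  using conj_entry[OF adj_carrier[OF K] s ij] adj_entry[OF K] ij by simp

lemma kraus_gram_entry:
  assumes K: "K \<in> carrier_mat n m" and ab: "a < m" "b < m"
  shows "(adj K * K) $$ (a,b) = (\<Sum>x<n. cnj (K $$ (x,a)) * K $$ (x,b))"
  using ab adj_entry[OF K] by (subst mult_entry[OF adj_carrier[OF K] K]) auto

text \<open>The entrywise form of a channel, indexed by numbers instead of a list, so that sums over
  Kraus operators, rows and columns can be interchanged.\<close>

definition kraus_rep ::
  "nat \<Rightarrow> nat \<Rightarrow> nat \<Rightarrow> (nat \<Rightarrow> complex mat) \<Rightarrow> (complex mat \<Rightarrow> complex mat) \<Rightarrow> bool" where
  "kraus_rep din dout N K E \<longleftrightarrow> (\<forall>k<N. K k \<in> carrier_mat dout din)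
     \<and> (\<forall>a<din. \<forall>b<din. (\<Sum>k<N. \<Sum>x<dout. cnj (K k $$ (x,a)) * K k $$ (x,b)) = (if a = b then 1 else 0))
     \<and> (\<forall>\<sigma>\<in>carrier_mat din din. E \<sigma> \<in> carrier_mat dout dout \<and> (\<forall>i<dout. \<forall>j<dout.
          E \<sigma> $$ (i,j) = (\<Sum>k<N. \<Sum>a<din. \<Sum>b<din. K k $$ (i,a) * \<sigma> $$ (a,b) * cnj (K k $$ (j,b)))))"

lemma cptp_kraus_rep:
  assumes "cptp din dout E"
  shows "\<exists>N K. kraus_rep din dout N K E"
proof -
  from assms obtain Ks where Ks: "set Ks \<subseteq> carrier_mat dout din"
    and tp: "msum din (map (\<lambda>K. adj K * K) Ks) = 1\<^sub>m din"
    and E: "\<And>\<sigma>. \<sigma> \<in> carrier_mat din din \<Longrightarrow> E \<sigma> = msum dout (map (\<lambda>K. K * \<sigma> * adj K) Ks)"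
    unfolding cptp_def by blast
  have Kc: "Ks ! k \<in> carrier_mat dout din" if "k < length Ks" for k using Ks that nth_mem by blast
  have c1: "adj K * K \<in> carrier_mat din din" if "K \<in> set Ks" for K
  proof -
    have "K \<in> carrier_mat dout din" using Ks that by auto
    thus ?thesis by (intro mult_carrier_mat[of _ din dout]) auto
  qed
  have c2: "K * \<sigma> * adj K \<in> carrier_mat dout dout" if "K \<in> set Ks" "\<sigma> \<in> carrier_mat din din" for K \<sigma>
  proof -
    have "K \<in> carrier_mat dout din" using Ks that by auto
    thus ?thesis using that(2) by (intro mult_carrier_mat[of _ dout din]) auto
  qed
  have "kraus_rep din dout (length Ks) (\<lambda>k. Ks ! k) E"
    unfolding kraus_rep_def
  proof (intro conjI allI impI ballI)
    fix a b assume ab: "a < din" "b < din"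
    have "1\<^sub>m din $$ (a,b) = (\<Sum>K\<leftarrow>Ks. (adj K * K) $$ (a,b))"
      unfolding tp[symmetric] using ab c1 by (subst msum_entry) (auto simp: o_def)
    also have "\<dots> = (\<Sum>k<length Ks. (adj (Ks ! k) * (Ks ! k)) $$ (a,b))"
      by (simp add: sum_list_sum_nth lessThan_atLeast0)
    also have "\<dots> = (\<Sum>k<length Ks. \<Sum>x<dout. cnj ((Ks ! k) $$ (x,a)) * (Ks ! k) $$ (x,b))"
      by (intro sum.cong refl kraus_gram_entry) (use Kc ab in auto)
    finally show "(\<Sum>k<length Ks. \<Sum>x<dout. cnj ((Ks ! k) $$ (x,a)) * (Ks ! k) $$ (x,b)) = (if a = b then 1 else 0)"
      using ab by simp
  next
    fix \<sigma> :: "complex mat" assume s: "\<sigma> \<in> carrier_mat din din"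
    show "E \<sigma> \<in> carrier_mat dout dout" unfolding E[OF s] using c2 s by (intro msum_carrier) auto
    fix i j assume ij: "i < dout" "j < dout"
    have "E \<sigma> $$ (i,j) = (\<Sum>K\<leftarrow>Ks. (K * \<sigma> * adj K) $$ (i,j))"
      unfolding E[OF s] using ij c2 s by (subst msum_entry) (auto simp: o_def)
    also have "\<dots> = (\<Sum>k<length Ks. (Ks ! k * \<sigma> * adj (Ks ! k)) $$ (i,j))"
      by (simp add: sum_list_sum_nth lessThan_atLeast0)
    also have "\<dots> = (\<Sum>k<length Ks. \<Sum>a<din. \<Sum>b<din. (Ks ! k) $$ (i,a) * \<sigma> $$ (a,b) * cnj ((Ks ! k) $$ (j,b)))"
      by (intro sum.cong refl kraus_entry) (use Kc ij s in auto)
    finally show "E \<sigma> $$ (i,j) = (\<Sum>k<length Ks. \<Sum>a<din. \<Sum>b<din. (Ks ! k) $$ (i,a) * \<sigma> $$ (a,b) * cnj ((Ks ! k) $$ (j,b)))" .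
  qed (use Kc in auto)
  thus ?thesis by blast
qed

definition outer :: "nat \<Rightarrow> (nat \<Rightarrow> complex) \<Rightarrow> complex mat" where
  "outer d v = mat d d (\<lambda>(i,j). v i * cnj (v j))"

lemma outer_carrier [simp]: "outer d v \<in> carrier_mat d d"
  by (simp add: outer_def)

lemma dim_outer [simp]: "dim_row (outer d v) = d" "dim_col (outer d v) = d"
  by (simp_all add: outer_def)

lemma outer_entry: "i < d \<Longrightarrow> j < d \<Longrightarrow> outer d v $$ (i,j) = v i * cnj (v j)"
  by (simp add: outer_def)

text \<open>The amplitudes \<open>A v k x\<close> of outcome \<open>x\<close> in the branch of Kraus
  operator \<open>k\<close> depend isometrically on \<open>v\<close>. The inner product of two
  inputs is thus a sum over \<open>x\<close> and \<open>k\<close>, and the Cauchy-Schwarz inequality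
  in \<open>k\<close> alone turns its modulus into a Bhattacharyya coefficient: a channel followed
  by a measurement cannot make pure inputs easier to distinguish.\<close>

lemma cptp_overlap:
  assumes E: "cptp din dout E" and X: "unitary dout X"
  defines "P \<equiv> \<lambda>v x. Re ((adj X * E (outer din v) * X) $$ (x,x))"
  shows "\<And>v x. x < dout \<Longrightarrow> 0 \<le> P v x"
    and "\<And>v. (\<Sum>x<dout. P v x) = (\<Sum>a<din. (cmod (v a))\<^sup>2)"
    and "\<And>v w. cmod (\<Sum>a<din. cnj (v a) * w a) \<le> (\<Sum>x<dout. sqrt (P v x) * sqrt (P w x))"
proof -
  obtain N K where "kraus_rep din dout N K E" using cptp_kraus_rep[OF E] by blast
  hence K: "\<And>k. k < N \<Longrightarrow> K k \<in> carrier_mat dout din"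
    and tp: "\<And>a b. a < din \<Longrightarrow> b < din \<Longrightarrow>
       (\<Sum>k<N. \<Sum>x<dout. cnj (K k $$ (x,a)) * K k $$ (x,b)) = (if a = b then 1 else 0)"
    and Ec: "\<And>\<sigma>. \<sigma> \<in> carrier_mat din din \<Longrightarrow> E \<sigma> \<in> carrier_mat dout dout"
    and Ee: "\<And>\<sigma> i j. \<sigma> \<in> carrier_mat din din \<Longrightarrow> i < dout \<Longrightarrow> j < dout \<Longrightarrow>
       E \<sigma> $$ (i,j) = (\<Sum>k<N. \<Sum>a<din. \<Sum>b<din. K k $$ (i,a) * \<sigma> $$ (a,b) * cnj (K k $$ (j,b)))"
    by (auto simp: kraus_rep_def)
  define B where "B = (\<lambda>v k i. \<Sum>a<din. K k $$ (i,a) * v a)"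
  define A where "A = (\<lambda>v k x. \<Sum>i<dout. cnj (X $$ (i,x)) * B v k i)"
  have Eo: "E (outer din v) $$ (i,j) = (\<Sum>k<N. B v k i * cnj (B v k j))" if "i < dout" "j < dout" for v i j
    using that by (simp add: Ee B_def outer_entry sum_product mult_ac cnj_sum)
  have diag: "(adj X * E (outer din v) * X) $$ (x,x) = (\<Sum>k<N. A v k x * cnj (A v k x))" if "x < dout" for v x
  proof -
    have "(adj X * E (outer din v) * X) $$ (x,x)
      = (\<Sum>i<dout. \<Sum>j<dout. \<Sum>k<N. cnj (X $$ (i,x)) * (B v k i * cnj (B v k j)) * X $$ (j,x))"
      using that by (subst conj_entry[OF unitaryD(1)[OF X] Ec]) (auto simp: Eo sum_distrib_left sum_distrib_right)
    also have "\<dots> = (\<Sum>i<dout. \<Sum>k<N. \<Sum>j<dout. cnj (X $$ (i,x)) * (B v k i * cnj (B v k j)) * X $$ (j,x))"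
      by (intro sum.cong refl sum.swap)
    also have "\<dots> = (\<Sum>k<N. \<Sum>i<dout. \<Sum>j<dout. cnj (X $$ (i,x)) * (B v k i * cnj (B v k j)) * X $$ (j,x))"
      by (rule sum.swap)
    also have "\<dots> = (\<Sum>k<N. A v k x * cnj (A v k x))"
      by (simp add: A_def sum_product mult_ac cnj_sum)
    finally show ?thesis .
  qed
  have P: "P v x = (\<Sum>k<N. (cmod (A v k x))\<^sup>2)" if "x < dout" for v x
    unfolding P_def diag[OF that] by (simp flip: cmod_sq)
  show nn: "0 \<le> P v x" if "x < dout" for v x
    unfolding P[OF that] by (intro sum_nonneg) auto
  have inner: "(\<Sum>x<dout. \<Sum>k<N. cnj (A v k x) * A w k x) = (\<Sum>a<din. cnj (v a) * w a)" for v w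
  proof -
    have "(\<Sum>x<dout. cnj (A v k x) * A w k x) = (\<Sum>i<dout. cnj (B v k i) * B w k i)" for k
    proof -
      have "(\<Sum>x<dout. cnj (A v k x) * A w k x)
        = (\<Sum>x<dout. \<Sum>i<dout. \<Sum>j<dout. (X $$ (i,x) * cnj (X $$ (j,x))) * (cnj (B v k i) * B w k j))"
        unfolding A_def cnj_sum sum_product by (intro sum.cong refl) simp
      also have "\<dots> = (\<Sum>i<dout. \<Sum>x<dout. \<Sum>j<dout. (X $$ (i,x) * cnj (X $$ (j,x))) * (cnj (B v k i) * B w k j))"
        by (rule sum.swap)
      also have "\<dots> = (\<Sum>i<dout. \<Sum>j<dout. \<Sum>x<dout. (X $$ (i,x) * cnj (X $$ (j,x))) * (cnj (B v k i) * B w k j))"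
        by (intro sum.cong refl sum.swap)
      also have "\<dots> = (\<Sum>i<dout. \<Sum>j<dout. if i = j then cnj (B v k i) * B w k j else 0)"
        unfolding sum_distrib_right[symmetric] by (intro sum.cong refl) (simp add: unitary_sum(2)[OF X])
      finally show ?thesis by simp
    qed
    hence "(\<Sum>x<dout. \<Sum>k<N. cnj (A v k x) * A w k x) = (\<Sum>k<N. \<Sum>i<dout. cnj (B v k i) * B w k i)"
      by (subst sum.swap) simp
    also have "\<dots> = (\<Sum>k<N. \<Sum>i<dout. \<Sum>a<din. \<Sum>b<din. (cnj (K k $$ (i,a)) * K k $$ (i,b)) * (cnj (v a) * w b))"
      unfolding B_def cnj_sum sum_product by (intro sum.cong refl) simp
    also have "\<dots> = (\<Sum>k<N. \<Sum>a<din. \<Sum>i<dout. \<Sum>b<din. (cnj (K k $$ (i,a)) * K k $$ (i,b)) * (cnj (v a) * w b))"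
      by (intro sum.cong refl sum.swap)
    also have "\<dots> = (\<Sum>k<N. \<Sum>a<din. \<Sum>b<din. \<Sum>i<dout. (cnj (K k $$ (i,a)) * K k $$ (i,b)) * (cnj (v a) * w b))"
      by (intro sum.cong refl sum.swap)
    also have "\<dots> = (\<Sum>a<din. \<Sum>k<N. \<Sum>b<din. \<Sum>i<dout. (cnj (K k $$ (i,a)) * K k $$ (i,b)) * (cnj (v a) * w b))"
      by (rule sum.swap)
    also have "\<dots> = (\<Sum>a<din. \<Sum>b<din. \<Sum>k<N. \<Sum>i<dout. (cnj (K k $$ (i,a)) * K k $$ (i,b)) * (cnj (v a) * w b))"
      by (intro sum.cong refl sum.swap)
    also have "\<dots> = (\<Sum>a<din. \<Sum>b<din. if a = b then cnj (v a) * w b else 0)"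
      unfolding sum_distrib_right[symmetric] by (intro sum.cong refl) (simp add: tp)
    finally show ?thesis by simp
  qed
  show "(\<Sum>x<dout. P v x) = (\<Sum>a<din. (cmod (v a))\<^sup>2)" for v
  proof -
    have "complex_of_real (\<Sum>x<dout. P v x) = (\<Sum>x<dout. \<Sum>k<N. cnj (A v k x) * A v k x)"
      by (simp add: P cmod_sq mult.commute)
    also have "\<dots> = complex_of_real (\<Sum>a<din. (cmod (v a))\<^sup>2)"
      unfolding inner by (simp add: cmod_sq mult.commute)
    finally show ?thesis by (simp only: of_real_eq_iff)
  qed
  show "cmod (\<Sum>a<din. cnj (v a) * w a) \<le> (\<Sum>x<dout. sqrt (P v x) * sqrt (P w x))" for v w
  proof -
    have "cmod (\<Sum>a<din. cnj (v a) * w a) \<le> (\<Sum>x<dout. \<Sum>k<N. cmod (A v k x) * cmod (A w k x))"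
      unfolding inner[symmetric] by (intro sum_norm_le) (simp add: norm_mult)
    also have "\<dots> \<le> (\<Sum>x<dout. sqrt (P v x) * sqrt (P w x))"
      by (intro sum_mono) (simp add: P Cauchy_Schwarz_sum)
    finally show ?thesis .
  qed
qed

text \<open>Brings channel outputs into the scope of the trace norm bounds, which concern Hermitian
  matrices.\<close>

lemma cptp_hermitian:
  assumes E: "cptp din dout E" and s: "hermitian din \<sigma>"
  shows "hermitian dout (E \<sigma>)"
proof -
  obtain N K where "kraus_rep din dout N K E" using cptp_kraus_rep[OF E] by blast
  hence "\<And>k. k < N \<Longrightarrow> K k \<in> carrier_mat dout din"
    and "\<And>a b. a < din \<Longrightarrow> b < din \<Longrightarrow>
       (\<Sum>k<N. \<Sum>x<dout. cnj (K k $$ (x,a)) * K k $$ (x,b)) = (if a = b then 1 else 0)"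
    and Ec: "\<And>\<sigma>. \<sigma> \<in> carrier_mat din din \<Longrightarrow> E \<sigma> \<in> carrier_mat dout dout"
    and Ee: "\<And>\<sigma> i j. \<sigma> \<in> carrier_mat din din \<Longrightarrow> i < dout \<Longrightarrow> j < dout \<Longrightarrow>
       E \<sigma> $$ (i,j) = (\<Sum>k<N. \<Sum>a<din. \<Sum>b<din. K k $$ (i,a) * \<sigma> $$ (a,b) * cnj (K k $$ (j,b)))"
    by (auto simp: kraus_rep_def)
  note sc = hermitian_carrier[OF s]
  show ?thesis
  proof (rule hermitianI[OF Ec[OF sc]])
    fix i j assume ij: "i < dout" "j < dout"
    have "E \<sigma> $$ (j,i) = (\<Sum>k<N. \<Sum>b<din. \<Sum>a<din. K k $$ (j,a) * \<sigma> $$ (a,b) * cnj (K k $$ (i,b)))"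
      unfolding Ee[OF sc ij(2,1)] by (intro sum.cong refl sum.swap)
    also have "\<dots> = cnj (E \<sigma> $$ (i,j))"
      unfolding Ee[OF sc ij] cnj_sum
    proof (intro sum.cong refl)
      fix k a b assume "b \<in> {..<din}" "a \<in> {..<din}"
      hence "\<sigma> $$ (a,b) = cnj (\<sigma> $$ (b,a))" by (intro hermitian_entry[OF s]) auto
      thus "K k $$ (j,a) * \<sigma> $$ (a,b) * cnj (K k $$ (i,b)) = cnj (K k $$ (i,b) * \<sigma> $$ (b,a) * cnj (K k $$ (j,a)))"
        by simp
    qed
    finally show "E \<sigma> $$ (j,i) = cnj (E \<sigma> $$ (i,j))" .
  qed
qed

definition cbits_amp :: "real \<Rightarrow> nat \<Rightarrow> real \<Rightarrow> nat \<Rightarrow> complex" where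
  "cbits_amp \<tau> m t a = complex_of_real (1 / sqrt (2 ^ m)) * cis (- esum 2 m (cbit_energy \<tau>) a * t)"

text \<open>The overlap with the evolved state is a product over the bits, and each bit contributes
  the average of two opposite phases, a cosine.\<close>

lemma cbits_evol_outer:
  shows "tpow cbit_state m = outer (2 ^ m) (cbits_amp \<tau> m 0)"
    and "evol (ham_copies 2 (cbit_ham \<tau>) m) t (tpow cbit_state m) = outer (2 ^ m) (cbits_amp \<tau> m t)"
    and "(\<Sum>a<2 ^ m. (cmod (cbits_amp \<tau> m t a))\<^sup>2) = 1"
    and "cmod (\<Sum>a<2 ^ m. cnj (cbits_amp \<tau> m 0 a) * cbits_amp \<tau> m t a) = \<bar>cos (pi * t / \<tau>)\<bar> ^ m"
proof -
  have c: "tpow cbit_state m \<in> carrier_mat (2 ^ m) (2 ^ m)" by (intro tpow_carrier) (simp add: cbit_state_def)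
  have sq: "complex_of_real (1 / sqrt (2 ^ m)) * complex_of_real (1 / sqrt (2 ^ m)) = (1/2) ^ m"
    by (simp add: power_divide flip: of_real_mult)
  show 1: "tpow cbit_state m = outer (2 ^ m) (cbits_amp \<tau> m 0)"
  proof (rule eq_matI)
    fix i j assume "i < dim_row (outer (2 ^ m) (cbits_amp \<tau> m 0))" "j < dim_col (outer (2 ^ m) (cbits_amp \<tau> m 0))"
    hence ij: "i < 2 ^ m" "j < 2 ^ m" by auto
    show "tpow cbit_state m $$ (i,j) = outer (2 ^ m) (cbits_amp \<tau> m 0) $$ (i,j)"
      unfolding outer_entry[OF ij] cbits_state_entry[OF ij] sq[symmetric] by (simp add: cbits_amp_def)
  qed (use c in auto)
  note U1 = unitary_one[of "2 ^ m"]
  have "adj (1\<^sub>m (2 ^ m)) = (1\<^sub>m (2 ^ m) :: complex mat)" by (rule eq_matI) (auto simp: adj_def)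
  hence one: "adj (1\<^sub>m (2 ^ m)) * A * 1\<^sub>m (2 ^ m) = A" if "A \<in> carrier_mat (2 ^ m) (2 ^ m)" for A :: "complex mat"
    using that by simp
  have ec: "evol (ham_copies 2 (cbit_ham \<tau>) m) t (tpow cbit_state m) \<in> carrier_mat (2 ^ m) (2 ^ m)"
    by (rule evol_carrier[OF U1 cbits_diag c])
  show "evol (ham_copies 2 (cbit_ham \<tau>) m) t (tpow cbit_state m) = outer (2 ^ m) (cbits_amp \<tau> m t)"
  proof (rule eq_matI)
    fix i j assume "i < dim_row (outer (2 ^ m) (cbits_amp \<tau> m t))" "j < dim_col (outer (2 ^ m) (cbits_amp \<tau> m t))"
    hence ij: "i < 2 ^ m" "j < 2 ^ m" by (auto simp: outer_def)
    have "evol (ham_copies 2 (cbit_ham \<tau>) m) t (tpow cbit_state m) $$ (i,j)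
      = cis (- (esum 2 m (cbit_energy \<tau>) i - esum 2 m (cbit_energy \<tau>) j) * t) * (1/2) ^ m"
      using evol_entry[OF U1 cbits_diag c ij, of \<tau> t] unfolding one[OF ec] one[OF c]
      by (simp add: cbits_state_entry[OF ij])
    also have "cis (- (esum 2 m (cbit_energy \<tau>) i - esum 2 m (cbit_energy \<tau>) j) * t)
       = cis (- esum 2 m (cbit_energy \<tau>) i * t) * cnj (cis (- esum 2 m (cbit_energy \<tau>) j * t))"
      by (simp add: cis_cnj cis_mult algebra_simps)
    finally show "evol (ham_copies 2 (cbit_ham \<tau>) m) t (tpow cbit_state m) $$ (i,j) = outer (2 ^ m) (cbits_amp \<tau> m t) $$ (i,j)"
      unfolding outer_entry[OF ij] sq[symmetric] by (simp add: cbits_amp_def mult_ac)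
  qed (use ec in \<open>auto simp: outer_def\<close>)
  show "(\<Sum>a<2 ^ m. (cmod (cbits_amp \<tau> m t a))\<^sup>2) = 1"
    by (simp add: cbits_amp_def norm_mult norm_divide power_divide)
  have "(\<Sum>a<2 ^ m. cnj (cbits_amp \<tau> m 0 a) * cbits_amp \<tau> m t a) = (\<Sum>a<2 ^ m. \<Prod>l<m. (1/2) * cis (- cbit_energy \<tau> (dig 2 l a) * t))"
  proof (intro sum.cong refl)
    fix a
    have "cnj (cbits_amp \<tau> m 0 a) * cbits_amp \<tau> m t a = (complex_of_real (1 / sqrt (2 ^ m)) * complex_of_real (1 / sqrt (2 ^ m)))
       * cis (\<Sum>l<m. - cbit_energy \<tau> (dig 2 l a) * t)"
      by (simp add: cbits_amp_def esum_def sum_negf sum_distrib_right)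
    thus "cnj (cbits_amp \<tau> m 0 a) * cbits_amp \<tau> m t a = (\<Prod>l<m. (1/2) * cis (- cbit_energy \<tau> (dig 2 l a) * t))"
      unfolding sq cis_sum[OF finite_lessThan] prod.distrib by simp
  qed
  also have "\<dots> = (\<Prod>l<m. \<Sum>x<2. (1/2) * cis (- cbit_energy \<tau> x * t))"
    by (rule sum_prod_dig)
  also have "(\<Sum>x<2. (1/2) * cis (- cbit_energy \<tau> x * t)) = complex_of_real (cos (pi * t / \<tau>))"
    by (simp add: numeral_2_eq_2 cbit_energy_def complex_eq_iff)
  finally have "(\<Sum>a<2 ^ m. cnj (cbits_amp \<tau> m 0 a) * cbits_amp \<tau> m t a) = complex_of_real (cos (pi * t / \<tau>)) ^ m"
    by simp
  thus "cmod (\<Sum>a<2 ^ m. cnj (cbits_amp \<tau> m 0 a) * cbits_amp \<tau> m t a) = \<bar>cos (pi * t / \<tau>)\<bar> ^ m"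
    by (simp add: norm_power)
qed

lemma parseval:
  assumes V: "unitary d V"
  shows "(\<Sum>x<d. (cmod (\<Sum>k<d. V $$ (k,x) * c k))\<^sup>2) = (\<Sum>k<d. (cmod (c k))\<^sup>2)"
proof -
  have "complex_of_real (\<Sum>x<d. (cmod (\<Sum>k<d. V $$ (k,x) * c k))\<^sup>2)
    = (\<Sum>x<d. \<Sum>k<d. \<Sum>j<d. (V $$ (k,x) * cnj (V $$ (j,x))) * (c k * cnj (c j)))"
    unfolding of_real_sum of_real_power cmod_sq cnj_sum sum_product
    by (intro sum.cong refl) (simp add: mult_ac)
  also have "\<dots> = (\<Sum>k<d. \<Sum>x<d. \<Sum>j<d. (V $$ (k,x) * cnj (V $$ (j,x))) * (c k * cnj (c j)))"
    by (rule sum.swap)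
  also have "\<dots> = (\<Sum>k<d. \<Sum>j<d. \<Sum>x<d. (V $$ (k,x) * cnj (V $$ (j,x))) * (c k * cnj (c j)))"
    by (intro sum.cong refl sum.swap)
  also have "\<dots> = (\<Sum>k<d. \<Sum>j<d. if k = j then c k * cnj (c j) else 0)"
    unfolding sum_distrib_right[symmetric] by (intro sum.cong refl) (simp add: unitary_sum(2)[OF V])
  also have "\<dots> = complex_of_real (\<Sum>k<d. (cmod (c k))\<^sup>2)"
    unfolding of_real_sum of_real_power cmod_sq by simp
  finally show ?thesis by (simp only: of_real_eq_iff)
qed

lemma conj_conj_mult:
  assumes "X \<in> carrier_mat d d" "Y \<in> carrier_mat d d" "A \<in> carrier_mat d d"
  shows "adj X * (Y * A * adj Y) * X = adj (adj Y * X) * A * (adj Y * X)"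
proof -
  have c: "adj X \<in> carrier_mat d d" "adj Y \<in> carrier_mat d d" using assms by auto
  have "adj (adj Y * X) * A * (adj Y * X) = (adj X * Y) * A * (adj Y * X)"
    using adj_mult[OF c(2) assms(1)] by simp
  also have "\<dots> = adj X * (Y * A) * (adj Y * X)"
    using assms c by (simp add: assoc_mult_mat[of _ d d _ d _ d])
  also have "\<dots> = adj X * (Y * A * adj Y) * X"
    using assms c by (intro assoc4[of _ d d _ d _ d _ d]) auto
  finally show ?thesis ..
qed

lemma conj_change_basis:
  assumes W: "unitary d W" and "X \<in> carrier_mat d d" "A \<in> carrier_mat d d"
  shows "adj X * A * X = adj (adj W * X) * (adj W * A * W) * (adj W * X)"
proof -
  have "adj W * A * W \<in> carrier_mat d d" using unitaryD[OF W] assms(3) by auto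
  thus ?thesis
    using conj_conj_mult[OF assms(2) unitaryD(1)[OF W], of "adj W * A * W"] conj_conj(1)[OF W assms(3)] by simp
qed

text \<open>Heisenberg picture: the evolution is moved onto the measurement basis. As
  \<open>V\<close> does not depend on the state, positivity, normalization and trace norm bounds at
  time 0 carry over to all times.\<close>

lemma conj_evol:
  assumes W: "unitary d W" and H: "H = W * rdiag d E * adj W"
  shows "\<exists>V. unitary d V \<and> (\<forall>X\<in>carrier_mat d d. \<forall>\<sigma>\<in>carrier_mat d d.
     adj X * evol H t \<sigma> * X = adj (V * X) * \<sigma> * (V * X))"
proof -
  define V where "V = W * cdiag d (\<lambda>i. cis (- E i * t)) * adj W"
  have V: "unitary d V" "\<And>\<sigma>. evol H t \<sigma> = V * \<sigma> * adj V"
    using evol_alt[OF W H] by (auto simp: V_def)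
  show ?thesis
    using unitary_adj[OF V(1)] conj_conj_mult[OF _ unitaryD(1)[OF V(1)]] unfolding V(2) by metis
qed

lemma trace_conj:
  assumes "unitary d X" "A \<in> carrier_mat d d"
  shows "(\<Sum>x<d. (adj X * A * X) $$ (x,x)) = mtrace A"
proof -
  have "(\<Sum>x<d. (adj X * A * X) $$ (x,x)) = (\<Sum>x<d. \<Sum>a<d. \<Sum>b<d. (X $$ (b,x) * cnj (X $$ (a,x))) * A $$ (a,b))"
    by (intro sum.cong refl) (simp add: conj_entry[OF unitaryD(1)[OF assms(1)] assms(2)] mult_ac)
  also have "\<dots> = (\<Sum>a<d. \<Sum>x<d. \<Sum>b<d. (X $$ (b,x) * cnj (X $$ (a,x))) * A $$ (a,b))"
    by (rule sum.swap)
  also have "\<dots> = (\<Sum>a<d. \<Sum>b<d. \<Sum>x<d. (X $$ (b,x) * cnj (X $$ (a,x))) * A $$ (a,b))"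
    by (intro sum.cong refl sum.swap)
  also have "\<dots> = (\<Sum>a<d. \<Sum>b<d. if b = a then A $$ (a,b) else 0)"
    unfolding sum_distrib_right[symmetric] by (intro sum.cong refl) (simp add: unitary_sum(2)[OF assms(1)])
  also have "\<dots> = mtrace A" using assms(2) by (simp add: mtrace_def)
  finally show ?thesis .
qed

section \<open>The symmetric logarithmic derivative and its measurement\<close>

text \<open>With \<open>A\<close> the Hamiltonian in the eigenbasis of \<rho>, this is the solution
  L of (\<rho> L + L \<rho>) / 2 = - i (A \<rho> - \<rho> A). Where \<open>p j\<close> and
  \<open>p k\<close> both vanish, division by zero makes the entry 0.\<close>

definition sld :: "nat \<Rightarrow> complex mat \<Rightarrow> (nat \<Rightarrow> real) \<Rightarrow> complex mat" where
  "sld d A p = mat d d (\<lambda>(j,k). 2 * \<i> * (complex_of_real ((p j - p k) / (p j + p k))) * A $$ (j,k))"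

lemma sld_hermitian:
  assumes "hermitian d A"
  shows "hermitian d (sld d A p)"
proof (rule hermitianI)
  fix i j assume ij: "i < d" "j < d"
  have q: "(p j - p i) / (p j + p i) = - ((p i - p j) / (p i + p j))"
    by (metis add.commute minus_diff_eq minus_divide_left)
  have "sld d A p $$ (j,i) = 2 * \<i> * complex_of_real (- ((p i - p j) / (p i + p j))) * cnj (A $$ (i,j))"
    unfolding q[symmetric] hermitian_entry[OF assms ij, symmetric] using ij by (simp add: sld_def)
  also have "\<dots> = cnj (sld d A p $$ (i,j))" using ij by (simp add: sld_def)
  finally show "sld d A p $$ (j,i) = cnj (sld d A p $$ (i,j))" .
qed (simp add: sld_def)

text \<open>The left side is the trace of \<rho> L^2. The squared moduli are symmetric in the two
  indices, so \<open>p j\<close> may be replaced by the mean of \<open>p j\<close> and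
  \<open>p k\<close>; the 4 from squaring the entry then leaves a factor 2.\<close>

lemma sld_fisher_information:
  assumes A: "hermitian d A" and p: "\<And>j. j < d \<Longrightarrow> p j \<ge> 0"
  shows "(\<Sum>j<d. \<Sum>k<d. p j * (cmod (sld d A p $$ (j,k)))\<^sup>2)
    = 2 * (\<Sum>j<d. \<Sum>k<d. if p j + p k > 0 then (p j - p k)\<^sup>2 / (p j + p k) * (cmod (A $$ (j,k)))\<^sup>2 else 0)"
proof -
  let ?L = "\<lambda>j k. (cmod (sld d A p $$ (j,k)))\<^sup>2"
  have sym: "?L j k = ?L k j" if "j < d" "k < d" for j k
    using hermitian_entry[OF sld_hermitian[OF A] that, of p] by simp
  have "(\<Sum>j<d. \<Sum>k<d. p j * ?L j k) = (\<Sum>j<d. \<Sum>k<d. p k * ?L k j)" by (rule sum.swap)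
  also have "\<dots> = (\<Sum>j<d. \<Sum>k<d. p k * ?L j k)"
    by (intro sum.cong refl) (metis sym lessThan_iff)
  finally have "2 * (\<Sum>j<d. \<Sum>k<d. p j * ?L j k) = (\<Sum>j<d. \<Sum>k<d. (p j + p k) * ?L j k)"
    unfolding distrib_right sum.distrib by linarith
  also have "\<dots> = (\<Sum>j<d. \<Sum>k<d. 4 * (if p j + p k > 0 then (p j - p k)\<^sup>2 / (p j + p k) * (cmod (A $$ (j,k)))\<^sup>2 else 0))"
  proof (intro sum.cong refl)
    fix j k assume jk: "j \<in> {..<d}" "k \<in> {..<d}"
    have L: "?L j k = 4 * ((p j - p k) / (p j + p k))\<^sup>2 * (cmod (A $$ (j,k)))\<^sup>2"
      using jk by (simp add: sld_def norm_mult power_mult_distrib norm_divide flip: of_real_add of_real_diff)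
        (simp add: power_divide power_mult_distrib)
    show "(p j + p k) * ?L j k = 4 * (if p j + p k > 0 then (p j - p k)\<^sup>2 / (p j + p k) * (cmod (A $$ (j,k)))\<^sup>2 else 0)"
    proof (cases "p j + p k > 0")
      case True
      have "s * (4 * (t / s)\<^sup>2 * c) = 4 * (t\<^sup>2 / s * c)" if "s > 0" for s t c :: real
        using that by (simp add: power2_eq_square field_simps)
      thus ?thesis unfolding L using True by simp
    next
      case False
      hence "p j + p k = 0" using jk p[of j] p[of k] by simp
      thus ?thesis by simp
    qed
  qed
  finally show ?thesis by (simp add: sum_distrib_left[symmetric])
qed

text \<open>First order change of the outcome probabilities in the eigenbasis of the symmetric
  logarithmic derivative.\<close>

lemma sld_derivative:
  fixes G V :: "nat \<Rightarrow> nat \<Rightarrow> complex" and p E l :: "nat \<Rightarrow> real"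
  assumes A: "hermitian d A" and p: "\<And>j. j < d \<Longrightarrow> p j \<ge> 0"
    and AG: "\<And>j k. j < d \<Longrightarrow> k < d \<Longrightarrow> A $$ (j,k) = (\<Sum>a<d. cnj (G a j) * E a * G a k)"
    and Y: "\<And>a. a < d \<Longrightarrow> Y a = (\<Sum>k<d. G a k * V k x)"
    and GY: "\<And>j. j < d \<Longrightarrow> (\<Sum>b<d. cnj (G b j) * Y b) = V j x"
    and LV: "\<And>k. k < d \<Longrightarrow> (\<Sum>j<d. sld d A p $$ (k,j) * V j x) = l x * V k x"
  shows "(\<Sum>a<d. \<Sum>b<d. cnj (Y a) * (- \<i> * (E a - E b) * (\<Sum>j<d. G a j * p j * cnj (G b j))) * Y b)
    = complex_of_real (l x * (\<Sum>j<d. p j * (cmod (V j x))\<^sup>2))"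
proof -
  let ?L = "\<lambda>k j. sld d A p $$ (k,j)"
  \<comment> \<open>\<open>G\<close> maps the eigenbasis of \<rho> to the energy basis, the columns
    of \<open>V\<close> are eigenvectors of the logarithmic derivative, and \<open>Y\<close> is
    column \<open>x\<close> in the energy basis. \<open>S\<close> is the expectation of A \<rho> in
    that column; the derivative is - i S plus its complex conjugate.\<close>
  define S where "S = (\<Sum>k<d. \<Sum>j<d. cnj (V k x) * A $$ (k,j) * p j * V j x)"
  have cS: "cnj S = (\<Sum>k<d. \<Sum>j<d. cnj (V k x) * A $$ (k,j) * p k * V j x)"
  proof -
    have "cnj S = (\<Sum>k<d. \<Sum>j<d. cnj (V j x) * A $$ (j,k) * p j * V k x)"
      unfolding S_def cnj_sum
    proof (intro sum.cong refl)
      fix k j assume "k \<in> {..<d}" "j \<in> {..<d}"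
      hence "A $$ (j,k) = cnj (A $$ (k,j))" by (intro hermitian_entry[OF A]) auto
      thus "cnj (cnj (V k x) * A $$ (k,j) * p j * V j x) = cnj (V j x) * A $$ (j,k) * p j * V k x"
        by (simp add: mult_ac)
    qed
    also have "\<dots> = (\<Sum>k<d. \<Sum>j<d. cnj (V k x) * A $$ (k,j) * p k * V j x)" by (rule sum.swap)
    finally show ?thesis .
  qed
  have T: "(\<Sum>a<d. cnj (Y a) * E a * G a j) = (\<Sum>k<d. cnj (V k x) * A $$ (k,j))" if j: "j < d" for j
  proof -
    have "(\<Sum>a<d. cnj (Y a) * E a * G a j) = (\<Sum>a<d. \<Sum>k<d. cnj (V k x) * (cnj (G a k) * E a * G a j))"
      by (intro sum.cong refl) (simp add: Y cnj_sum sum_distrib_left sum_distrib_right mult_ac)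
    also have "\<dots> = (\<Sum>k<d. \<Sum>a<d. cnj (V k x) * (cnj (G a k) * E a * G a j))" by (rule sum.swap)
    also have "\<dots> = (\<Sum>k<d. cnj (V k x) * A $$ (k,j))"
      using j by (intro sum.cong refl) (simp add: AG sum_distrib_left)
    finally show ?thesis .
  qed
  define B where "B = (\<Sum>a<d. \<Sum>b<d. cnj (Y a) * (E a * (\<Sum>j<d. G a j * p j * cnj (G b j))) * Y b)"
  have BS: "B = S"
  proof -
    have "B = (\<Sum>a<d. \<Sum>b<d. \<Sum>j<d. (cnj (Y a) * E a * G a j) * p j * (cnj (G b j) * Y b))"
      unfolding B_def by (intro sum.cong refl) (simp add: sum_distrib_left sum_distrib_right mult_ac)
    also have "\<dots> = (\<Sum>a<d. \<Sum>j<d. \<Sum>b<d. (cnj (Y a) * E a * G a j) * p j * (cnj (G b j) * Y b))"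
      by (intro sum.cong refl sum.swap)
    also have "\<dots> = (\<Sum>j<d. \<Sum>a<d. \<Sum>b<d. (cnj (Y a) * E a * G a j) * p j * (cnj (G b j) * Y b))"
      by (rule sum.swap)
    also have "\<dots> = (\<Sum>j<d. (\<Sum>a<d. cnj (Y a) * E a * G a j) * p j * (\<Sum>b<d. cnj (G b j) * Y b))"
      by (intro sum.cong refl) (simp add: sum_distrib_left sum_distrib_right mult_ac)
    also have "\<dots> = (\<Sum>j<d. \<Sum>k<d. cnj (V k x) * A $$ (k,j) * p j * V j x)"
      by (intro sum.cong refl) (simp add: T GY sum_distrib_right)
    also have "\<dots> = S" unfolding S_def by (rule sum.swap)
    finally show ?thesis .
  qed
  have B': "cnj B = (\<Sum>a<d. \<Sum>b<d. cnj (Y a) * (E b * (\<Sum>j<d. G a j * p j * cnj (G b j))) * Y b)"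
    unfolding B_def cnj_sum
    by (subst sum.swap) (intro sum.cong refl, simp add: cnj_sum mult_ac)
  have "(\<Sum>a<d. \<Sum>b<d. cnj (Y a) * (- \<i> * (E a - E b) * (\<Sum>j<d. G a j * p j * cnj (G b j))) * Y b)
    = - \<i> * B + \<i> * cnj B"
  proof -
    have "(\<Sum>a<d. \<Sum>b<d. cnj (Y a) * (- \<i> * (E a - E b) * C a b) * Y b)
      = - \<i> * (\<Sum>a<d. \<Sum>b<d. cnj (Y a) * (E a * C a b) * Y b)
        + \<i> * (\<Sum>a<d. \<Sum>b<d. cnj (Y a) * (E b * C a b) * Y b)" for C :: "nat \<Rightarrow> nat \<Rightarrow> complex"
      unfolding sum_distrib_left sum.distrib[symmetric]
      by (intro sum.cong refl) (simp add: algebra_simps)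
    thus ?thesis unfolding B' unfolding B_def by simp
  qed
  also have "\<dots> = (\<Sum>k<d. \<Sum>j<d. cnj (V k x) * (\<i> * (p k - p j) * A $$ (k,j)) * V j x)"
    unfolding BS cS unfolding S_def sum_distrib_left sum.distrib[symmetric]
    by (intro sum.cong refl) (simp add: algebra_simps)
  \<comment> \<open>The defining equation of the logarithmic derivative. It persists where
    \<open>p k + p j = 0\<close>, since both eigenvalues vanish there.\<close>
  also have "\<dots> = (\<Sum>k<d. \<Sum>j<d. cnj (V k x) * (?L k j * ((p k + p j) / 2)) * V j x)"
  proof (intro sum.cong refl)
    fix k j assume kj: "k \<in> {..<d}" "j \<in> {..<d}"
    define q where "q = (p k - p j) / (p k + p j)"
    have "q * (p k + p j) = p k - p j"
      using kj p[of k] p[of j] by (cases "p k + p j = 0") (auto simp: q_def)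
    hence q: "complex_of_real q * complex_of_real (p k + p j) = complex_of_real (p k - p j)"
      by (metis of_real_mult)
    have L: "?L k j = 2 * \<i> * complex_of_real q * A $$ (k,j)" using kj by (simp add: sld_def q_def)
    have "\<i> * (p k - p j) * A $$ (k,j) = \<i> * (complex_of_real q * complex_of_real (p k + p j)) * A $$ (k,j)"
      unfolding q by simp
    also have "\<dots> = ?L k j * ((p k + p j) / 2)" unfolding L by simp
    finally have "\<i> * (p k - p j) * A $$ (k,j) = ?L k j * ((p k + p j) / 2)" .
    thus "cnj (V k x) * (\<i> * (p k - p j) * A $$ (k,j)) * V j x = cnj (V k x) * (?L k j * ((p k + p j) / 2)) * V j x"
      by (simp only:)
  qed
  also have "\<dots> = (\<Sum>k<d. \<Sum>j<d. cnj (V k x) * (p k / 2) * (?L k j * V j x))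
      + (\<Sum>k<d. \<Sum>j<d. (p j / 2) * V j x * (cnj (V k x) * ?L k j))"
    unfolding sum.distrib[symmetric] by (intro sum.cong refl) (simp add: algebra_simps add_divide_distrib)
  also have "(\<Sum>k<d. \<Sum>j<d. (p j / 2) * V j x * (cnj (V k x) * ?L k j))
      = (\<Sum>j<d. (p j / 2) * V j x * (\<Sum>k<d. cnj (V k x) * ?L k j))"
    by (subst sum.swap) (simp add: sum_distrib_left)
  also have "\<dots> = (\<Sum>j<d. (p j / 2) * V j x * cnj (l x * V j x))"
  proof (intro sum.cong refl)
    fix j assume j: "j \<in> {..<d}"
    have "(\<Sum>k<d. cnj (V k x) * ?L k j) = cnj (\<Sum>k<d. ?L j k * V k x)"
      unfolding cnj_sum using j
    proof (intro sum.cong refl)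
      fix k assume "k \<in> {..<d}"
      hence "?L k j = cnj (?L j k)" using j by (intro hermitian_entry[OF sld_hermitian[OF A]]) auto
      thus "cnj (V k x) * ?L k j = cnj (?L j k * V k x)" by (simp add: mult.commute)
    qed
    also have "(\<Sum>k<d. ?L j k * V k x) = l x * V j x" using LV j by simp
    finally show "(p j / 2) * V j x * (\<Sum>k<d. cnj (V k x) * ?L k j) = (p j / 2) * V j x * cnj (l x * V j x)"
      by (simp only:)
  qed
  also have "(\<Sum>k<d. \<Sum>j<d. cnj (V k x) * (p k / 2) * (?L k j * V j x))
      = (\<Sum>k<d. cnj (V k x) * (p k / 2) * (l x * V k x))"
    unfolding sum_distrib_left[symmetric] by (intro sum.cong refl) (simp add: LV)
  also have "(\<Sum>k<d. cnj (V k x) * (p k / 2) * (l x * V k x)) + (\<Sum>j<d. (p j / 2) * V j x * cnj (l x * V j x))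
    = complex_of_real (l x * (\<Sum>j<d. p j * (cmod (V j x))\<^sup>2))"
    unfolding sum.distrib[symmetric] of_real_mult of_real_sum sum_distrib_left of_real_power cmod_sq
    by (intro sum.cong refl) (simp add: algebra_simps)
  finally show ?thesis .
qed

text \<open>Twice the defect of a Bhattacharyya coefficient is the sum of squared differences of
  root probabilities. In the eigenbasis of the logarithmic derivative, \<open>P s x\<close> has
  derivative \<open>l x * \<pi> x\<close> at 0, so the square of the derivative of its root is (l
  x)^2 \<pi> x / 4. These sum to F / 4, and halving gives F / 8.\<close>

lemma sld_measurement:
  assumes H: "hermitian d H" and \<rho>: "density d \<rho>" and sd: "spectral_decomp d \<rho> U p"
  shows "\<exists>X g. unitary d X
    \<and> (\<forall>s. (\<Sum>x<d. sqrt (Re ((adj X * \<rho> * X) $$ (x,x))) * sqrt (Re ((adj X * evol H s \<rho> * X) $$ (x,x)))) \<le> 1 - g s)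
    \<and> ((\<lambda>s. g s / s\<^sup>2) \<longlongrightarrow> qfi_of_decomp d H U p / 8) (at 0)"
proof -
  from hermitian_spectral[OF H] obtain W E where W: "unitary d W" and Hd: "H = W * rdiag d E * adj W"
    by blast
  have U: "unitary d U" and \<rho>d: "\<rho> = U * rdiag d p * adj U" using sd by (auto simp: spectral_decomp_def)
  have rpsd: "psd d \<rho>" using \<rho> by (simp add: density_def)
  have rc: "\<rho> \<in> carrier_mat d d" using rpsd by (simp add: psd_def hermitian_def)
  have p: "\<And>j. j < d \<Longrightarrow> p j \<ge> 0" using psd_eigen_nonneg[OF rpsd U \<rho>d] .
  note w = unitaryD[OF W] and u = unitaryD[OF U]
  have cW: "adj W \<in> carrier_mat d d" and cU: "adj U \<in> carrier_mat d d" using w u by auto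
  define A where "A = adj U * H * U"
  have A: "hermitian d A" unfolding A_def by (rule hermitian_conj[OF H u(1)])
  from hermitian_spectral[OF sld_hermitian[OF A]] obtain V l where V: "unitary d V"
    and Ld: "sld d A p = V * rdiag d l * adj V" by blast
  note v = unitaryD[OF V]
  \<comment> \<open>The eigenvectors of the logarithmic derivative, transported from the eigenbasis
    of \<rho> to the original basis.\<close>
  define X where "X = U * V"
  have X: "unitary d X" unfolding X_def by (rule unitary_mult[OF U V])
  note x = unitaryD[OF X]
  define G where "G = adj W * U"
  have G: "unitary d G" unfolding G_def by (intro unitary_mult unitary_adj W U)
  note g = unitaryD[OF G]
  define Y where "Y = adj W * X"
  have Y: "unitary d Y" unfolding Y_def by (intro unitary_mult unitary_adj W X)
  have YGV: "Y = G * V" unfolding Y_def X_def G_def by (rule assoc_mult_mat[symmetric, OF cW u(1) v(1)])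
  define R where "R = adj W * \<rho> * W"
  have R: "R = G * rdiag d p * adj G"
  proof -
    have "G * rdiag d p * adj G = (adj W * U) * rdiag d p * (adj U * W)"
      unfolding G_def by (simp add: adj_mult[OF cW u(1)])
    also have "\<dots> = adj W * (U * rdiag d p) * (adj U * W)"
      by (subst assoc_mult_mat[OF cW u(1)]) (auto simp: rdiag_def)
    also have "\<dots> = adj W * (U * rdiag d p * adj U) * W"
      by (rule assoc4[of _ d d _ d _ d _ d]) (use w u in \<open>auto simp: rdiag_cdiag\<close>)
    finally show ?thesis by (simp add: R_def \<rho>d)
  qed
  have Re: "R $$ (a,b) = (\<Sum>j<d. G $$ (a,j) * p j * cnj (G $$ (b,j)))" if "a < d" "b < d" for a b
    unfolding R rdiag_cdiag by (rule cdiag_conj_entry[OF g(1) that])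
  have AG: "A $$ (j,k) = (\<Sum>a<d. cnj (G $$ (a,j)) * E a * G $$ (a,k))" if jk: "j < d" "k < d" for j k
  proof -
    have cE: "rdiag d E \<in> carrier_mat d d" by (simp add: rdiag_cdiag)
    have "A = adj G * rdiag d E * G" unfolding A_def Hd G_def by (rule conj_conj_mult[OF u(1) w(1) cE])
    hence "A $$ (j,k) = (adj G * cdiag d (\<lambda>i. E i) * adj (adj G)) $$ (j,k)" by (simp add: rdiag_cdiag)
    also have "\<dots> = (\<Sum>a<d. adj G $$ (j,a) * E a * cnj (adj G $$ (k,a)))"
      by (rule cdiag_conj_entry) (use g jk in auto)
    also have "\<dots> = (\<Sum>a<d. cnj (G $$ (a,j)) * E a * G $$ (a,k))"
      using jk by (intro sum.cong refl) (simp add: adj_entry[OF g(1)])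
    finally show ?thesis .
  qed
  have LV: "(\<Sum>j<d. sld d A p $$ (k,j) * V $$ (j,x)) = l x * V $$ (k,x)" if kx: "k < d" "x < d" for k x
  proof -
    have "sld d A p * V = V * rdiag d l"
    proof -
      have "V * rdiag d l \<in> carrier_mat d d" using v by (simp add: rdiag_cdiag)
      thus ?thesis unfolding Ld using v
        by (subst assoc_mult_mat[of _ d d _ d _ d]) (auto simp: right_mult_one_mat[of _ d d])
    qed
    hence "(\<Sum>j<d. sld d A p $$ (k,j) * V $$ (j,x)) = (V * rdiag d l) $$ (k,x)"
      using mult_entry[OF _ v(1) kx, of "sld d A p"] hermitian_carrier[OF sld_hermitian[OF A]] by simp
    also have "\<dots> = (\<Sum>j<d. V $$ (k,j) * rdiag d l $$ (j,x))"
      using kx v by (intro mult_entry) (auto simp: rdiag_cdiag)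
    also have "\<dots> = (\<Sum>j<d. if j = x then V $$ (k,x) * l x else 0)"
      using kx by (intro sum.cong refl) (auto simp: rdiag_cdiag cdiag_entry)
    finally show ?thesis using kx by (simp add: mult.commute)
  qed
  define \<pi> where "\<pi> = (\<lambda>x. \<Sum>j<d. p j * (cmod (V $$ (j,x)))\<^sup>2)"
  define P where "P = (\<lambda>s x. Re ((adj X * evol H s \<rho> * X) $$ (x,x)))"
  have ec: "evol H s \<rho> \<in> carrier_mat d d" for s by (rule evol_carrier[OF W Hd rc])
  have Psum: "P s x = (\<Sum>a<d. \<Sum>b<d. Re (cis (- (E a - E b) * s) * (cnj (Y $$ (a,x)) * R $$ (a,b) * Y $$ (b,x))))"
    if x: "x < d" for s x
  proof -
    have c: "adj W * evol H s \<rho> * W \<in> carrier_mat d d" using w ec by auto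
    have "adj X * evol H s \<rho> * X = adj Y * (adj W * evol H s \<rho> * W) * Y"
      unfolding Y_def by (rule conj_change_basis[OF W unitaryD(1)[OF X] ec])
    hence "(adj X * evol H s \<rho> * X) $$ (x,x)
      = (\<Sum>a<d. \<Sum>b<d. cnj (Y $$ (a,x)) * (cis (- (E a - E b) * s) * R $$ (a,b)) * Y $$ (b,x))"
      using conj_entry[OF unitaryD(1)[OF Y] c x x] evol_entry[OF W Hd rc] by (simp add: R_def)
    thus ?thesis unfolding P_def by (simp add: mult_ac)
  qed
  have X\<rho>: "P 0 x = Re ((adj X * \<rho> * X) $$ (x,x))" if x: "x < d" for x
  proof -
    have c: "adj W * \<rho> * W \<in> carrier_mat d d" using w rc by auto
    have "adj X * \<rho> * X = adj Y * R * Y"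
      unfolding Y_def R_def by (rule conj_change_basis[OF W unitaryD(1)[OF X] rc])
    hence "(adj X * \<rho> * X) $$ (x,x) = (\<Sum>a<d. \<Sum>b<d. cnj (Y $$ (a,x)) * R $$ (a,b) * Y $$ (b,x))"
      using conj_entry[OF unitaryD(1)[OF Y] _ x x, of R] c by (simp add: R_def)
    thus ?thesis unfolding Psum[OF x] by simp
  qed
  have P0: "P 0 x = \<pi> x" if x: "x < d" for x
  proof -
    have rp: "rdiag d p \<in> carrier_mat d d" by (simp add: rdiag_cdiag)
    have "adj X * \<rho> * X = adj V * rdiag d p * adj (adj V)"
    proof -
      have "adj U * X = V" unfolding X_def
        using assoc_mult_mat[OF cU u(1) v(1)] u v by simp
      thus ?thesis using conj_conj_mult[OF unitaryD(1)[OF X] u(1) rp] by (simp add: \<rho>d)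
    qed
    hence "(adj X * \<rho> * X) $$ (x,x) = (\<Sum>j<d. adj V $$ (x,j) * p j * cnj (adj V $$ (x,j)))"
      using cdiag_conj_entry[OF adj_carrier[OF v(1)] x x] by (simp add: rdiag_cdiag)
    also have "\<dots> = complex_of_real (\<pi> x)"
      unfolding \<pi>_def of_real_sum of_real_mult of_real_power cmod_sq
      using x by (intro sum.cong refl) (simp add: adj_entry[OF v(1)] mult_ac)
    finally show ?thesis unfolding X\<rho>[OF x] by simp
  qed
  have Pnn: "P s x \<ge> 0" and P1: "(\<Sum>x<d. P s x) = 1" if "x < d" for s x
  proof -
    from conj_evol[OF W Hd, of s] obtain V' where V': "unitary d V'"
      and e: "\<And>X \<sigma>. X \<in> carrier_mat d d \<Longrightarrow> \<sigma> \<in> carrier_mat d d \<Longrightarrow> adj X * evol H s \<sigma> * X = adj (V' * X) * \<sigma> * (V' * X)"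
      by blast
    have VX: "unitary d (V' * X)" by (intro unitary_mult V' X)
    show "P s x \<ge> 0" unfolding P_def e[OF unitaryD(1)[OF X] rc]
      by (rule psd_diag_nonneg[OF rpsd unitaryD(1)[OF VX] that])
    have "(\<Sum>x<d. P s x) = Re (\<Sum>x<d. (adj (V' * X) * \<rho> * (V' * X)) $$ (x,x))"
      unfolding P_def e[OF unitaryD(1)[OF X] rc] by simp
    thus "(\<Sum>x<d. P s x) = 1" unfolding trace_conj[OF VX rc] using \<rho> by (simp add: density_def)
  qed
  have dP: "((\<lambda>s. P s x) has_real_derivative l x * \<pi> x) (at 0)" if x: "x < d" for x
  proof -
    define c where "c = (\<lambda>a b. cnj (Y $$ (a,x)) * R $$ (a,b) * Y $$ (b,x))"
    have d1: "((\<lambda>s. Re (cis (- (E a - E b) * s) * c a b)) has_real_derivative Re (- \<i> * (E a - E b) * c a b)) (at 0)" for a b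
    proof -
      have "(\<lambda>s. Re (cis (- (E a - E b) * s) * c a b))
         = (\<lambda>s. cos (- (E a - E b) * s) * Re (c a b) - sin (- (E a - E b) * s) * Im (c a b))"
        by (auto simp: cis.simps)
      moreover have "((\<lambda>s. cos (- (E a - E b) * s) * Re (c a b) - sin (- (E a - E b) * s) * Im (c a b))
         has_real_derivative (E a - E b) * Im (c a b)) (at 0)"
        by (auto intro!: derivative_eq_intros simp: algebra_simps)
      ultimately show ?thesis by simp
    qed
    have "((\<lambda>s. P s x) has_real_derivative (\<Sum>a<d. \<Sum>b<d. Re (- \<i> * (E a - E b) * c a b))) (at 0)"
    proof -
      have Pc: "P s x = (\<Sum>a<d. \<Sum>b<d. Re (cis (- (E a - E b) * s) * c a b))" for s
        unfolding Psum[OF x] c_def ..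
      show ?thesis unfolding Pc by (intro DERIV_sum d1)
    qed
    also have "(\<Sum>a<d. \<Sum>b<d. Re (- \<i> * (E a - E b) * c a b))
       = Re (\<Sum>a<d. \<Sum>b<d. cnj (Y $$ (a,x)) * (- \<i> * (E a - E b) * (\<Sum>j<d. G $$ (a,j) * p j * cnj (G $$ (b,j)))) * Y $$ (b,x))"
      unfolding Re_sum c_def by (intro sum.cong refl arg_cong[of _ _ Re]) (simp add: Re mult_ac)
    also have "\<dots> = l x * \<pi> x"
    proof (subst sld_derivative[OF A p, where G = "\<lambda>a j. G $$ (a,j)" and V = "\<lambda>j x. V $$ (j,x)" and l = l and x = x])
      show "(\<Sum>b<d. cnj (G $$ (b,j)) * Y $$ (b,x)) = V $$ (j,x)" if j: "j < d" for j
      proof -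
        have "adj G * Y = V" unfolding YGV
          using assoc_mult_mat[OF adj_carrier[OF g(1)] g(1) v(1)] g v by simp
        thus ?thesis using mult_entry[OF adj_carrier[OF g(1)] unitaryD(1)[OF Y] j x] j
          by (simp add: adj_entry[OF g(1)])
      qed
      show "Y $$ (a,x) = (\<Sum>k<d. G $$ (a,k) * V $$ (k,x))" if "a < d" for a
        unfolding YGV by (rule mult_entry[OF g(1) v(1) that x])
    qed (use AG LV x in \<open>auto simp: \<pi>_def\<close>)
    finally show ?thesis .
  qed
  \<comment> \<open>Outcomes of probability 0 at time 0 are dropped, since a square root need not be
    differentiable there. This can only lower \<open>gg\<close>, which is why the coefficient is
    bounded from above and not expanded.\<close>
  define S where "S = {x. x < d \<and> \<pi> x > 0}"
  define gg where "gg = (\<lambda>s. (\<Sum>x\<in>S. (sqrt (P s x) - sqrt (\<pi> x))\<^sup>2) / 2)"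
  have fS: "S \<subseteq> {..<d}" "finite S" by (auto simp: S_def)
  have bc: "(\<Sum>x<d. sqrt (P 0 x) * sqrt (P s x)) \<le> 1 - gg s" for s
  proof -
    have "(\<Sum>x\<in>S. (sqrt (P s x) - sqrt (\<pi> x))\<^sup>2) \<le> (\<Sum>x<d. (sqrt (P s x) - sqrt (P 0 x))\<^sup>2)"
    proof -
      have "(\<Sum>x\<in>S. (sqrt (P s x) - sqrt (\<pi> x))\<^sup>2) = (\<Sum>x\<in>S. (sqrt (P s x) - sqrt (P 0 x))\<^sup>2)"
        using fS by (intro sum.cong) (auto simp: P0 subset_iff)
      also have "\<dots> \<le> (\<Sum>x<d. (sqrt (P s x) - sqrt (P 0 x))\<^sup>2)"
        using fS by (intro sum_mono2) auto
      finally show ?thesis .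
    qed
    also have "\<dots> = (\<Sum>x<d. P s x + P 0 x - 2 * (sqrt (P 0 x) * sqrt (P s x)))"
      by (intro sum.cong refl) (simp add: power2_diff Pnn)
    also have "\<dots> = (\<Sum>x<d. P s x) + (\<Sum>x<d. P 0 x) - 2 * (\<Sum>x<d. sqrt (P 0 x) * sqrt (P s x))"
      by (simp add: sum.distrib sum_subtractf sum_distrib_left)
    also have "\<dots> \<le> 2 - 2 * (\<Sum>x<d. sqrt (P 0 x) * sqrt (P s x))"
      using P1[of 0] by (cases "d = 0") auto
    finally show ?thesis by (simp add: gg_def)
  qed
  have lim: "((\<lambda>s. gg s / s\<^sup>2) \<longlongrightarrow> (\<Sum>x\<in>S. (l x * \<pi> x * (inverse (sqrt (\<pi> x)) / 2))\<^sup>2) / 2) (at 0)"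
  proof -
    have "((\<lambda>s. ((sqrt (P s x) - sqrt (\<pi> x)) / s)\<^sup>2) \<longlongrightarrow> (l x * \<pi> x * (inverse (sqrt (\<pi> x)) / 2))\<^sup>2) (at 0)"
      if "x \<in> S" for x
    proof -
      have x: "x < d" "\<pi> x > 0" using that by (auto simp: S_def)
      have "((\<lambda>s. sqrt (P s x)) has_real_derivative (inverse (sqrt (\<pi> x)) / 2) * (l x * \<pi> x)) (at 0)"
        by (rule DERIV_chain2[of sqrt _ "\<lambda>s. P s x"]) (use dP[OF x(1)] DERIV_real_sqrt[of "P 0 x"] P0[OF x(1)] x in auto)
      hence "((\<lambda>s. (sqrt (P s x) - sqrt (\<pi> x)) / s) \<longlongrightarrow> (inverse (sqrt (\<pi> x)) / 2) * (l x * \<pi> x)) (at 0)"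
        by (simp add: DERIV_def P0[OF x(1)])
      from tendsto_power[OF this, of 2] show ?thesis by (simp add: mult.commute)
    qed
    hence "((\<lambda>s. (\<Sum>x\<in>S. ((sqrt (P s x) - sqrt (\<pi> x)) / s)\<^sup>2) / 2) \<longlongrightarrow> (\<Sum>x\<in>S. (l x * \<pi> x * (inverse (sqrt (\<pi> x)) / 2))\<^sup>2) / 2) (at 0)"
      by (intro tendsto_divide tendsto_sum tendsto_const) auto
    thus ?thesis by (simp add: gg_def power_divide sum_divide_distrib mult.commute)
  qed
  have "(\<Sum>x\<in>S. (l x * \<pi> x * (inverse (sqrt (\<pi> x)) / 2))\<^sup>2) = (\<Sum>x\<in>S. (l x)\<^sup>2 * \<pi> x / 4)"
  proof (intro sum.cong refl)
    fix x assume "x \<in> S"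
    hence "\<pi> x > 0" by (simp add: S_def)
    thus "(l x * \<pi> x * (inverse (sqrt (\<pi> x)) / 2))\<^sup>2 = (l x)\<^sup>2 * \<pi> x / 4"
      by (simp add: power_mult_distrib power_divide power_inverse field_simps power2_eq_square)
  qed
  also have "\<dots> = (\<Sum>x<d. (l x)\<^sup>2 * \<pi> x / 4)"
  proof (rule sum.mono_neutral_left)
    show "\<forall>i\<in>{..<d} - S. (l i)\<^sup>2 * \<pi> i / 4 = 0"
    proof
      fix i assume "i \<in> {..<d} - S"
      moreover have "\<pi> i \<ge> 0" if "i < d" using Pnn[OF that, of 0] P0[OF that] by simp
      ultimately show "(l i)\<^sup>2 * \<pi> i / 4 = 0" by (fastforce simp: S_def)
    qed
  qed (use fS in auto)
  also have "\<dots> = (\<Sum>x<d. \<Sum>j<d. p j * (cmod (\<Sum>k<d. V $$ (k,x) * sld d A p $$ (j,k)))\<^sup>2) / 4"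
    unfolding \<pi>_def sum_divide_distrib sum_distrib_left
  proof (intro sum.cong refl)
    fix x j assume xj: "x \<in> {..<d}" "j \<in> {..<d}"
    have "(\<Sum>k<d. V $$ (k,x) * sld d A p $$ (j,k)) = l x * V $$ (j,x)"
      using LV[of j x] xj by (simp add: mult.commute)
    thus "(l x)\<^sup>2 * (p j * (cmod (V $$ (j,x)))\<^sup>2) / 4 = p j * (cmod (\<Sum>k<d. V $$ (k,x) * sld d A p $$ (j,k)))\<^sup>2 / 4"
      by (simp add: norm_mult power_mult_distrib)
  qed
  also have "(\<Sum>x<d. \<Sum>j<d. p j * (cmod (\<Sum>k<d. V $$ (k,x) * sld d A p $$ (j,k)))\<^sup>2)
      = (\<Sum>j<d. \<Sum>k<d. p j * (cmod (sld d A p $$ (j,k)))\<^sup>2)"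
    by (subst sum.swap) (simp add: parseval[OF V] flip: sum_distrib_left)
  also have "\<dots> = qfi_of_decomp d H U p"
    unfolding qfi_of_decomp_def A_def[symmetric] by (rule sld_fisher_information[OF A p])
  finally have F: "(\<Sum>x\<in>S. (l x * \<pi> x * (inverse (sqrt (\<pi> x)) / 2))\<^sup>2) = qfi_of_decomp d H U p / 4" .
  have "((\<lambda>s. gg s / s\<^sup>2) \<longlongrightarrow> qfi_of_decomp d H U p / 8) (at 0)" using lim unfolding F by simp
  moreover have "\<forall>s. (\<Sum>x<d. sqrt (Re ((adj X * \<rho> * X) $$ (x,x))) * sqrt (Re ((adj X * evol H s \<rho> * X) $$ (x,x)))) \<le> 1 - gg s"
  proof
    fix s
    have "(\<Sum>x<d. sqrt (Re ((adj X * \<rho> * X) $$ (x,x))) * sqrt (Re ((adj X * evol H s \<rho> * X) $$ (x,x)))) = (\<Sum>x<d. sqrt (P 0 x) * sqrt (P s x))"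
      by (intro sum.cong refl) (simp add: X\<rho> del: index_mult_mat, simp add: P_def)
    thus "(\<Sum>x<d. sqrt (Re ((adj X * \<rho> * X) $$ (x,x))) * sqrt (Re ((adj X * evol H s \<rho> * X) $$ (x,x)))) \<le> 1 - gg s"
      using bc by simp
  qed
  ultimately show ?thesis using X by blast
qed

section \<open>Asymptotic lower bound on the rate\<close>

lemma minus_conj_entry:
  assumes X: "X \<in> carrier_mat d d" and A: "A \<in> carrier_mat d d" and B: "B \<in> carrier_mat d d"
    and "i < d" "j < d"
  shows "(adj X * (A - B) * X) $$ (i,j) = (adj X * A * X) $$ (i,j) - (adj X * B * X) $$ (i,j)"
proof -
  have "A - B \<in> carrier_mat d d" using A B by (intro minus_carrier_mat)
  thus ?thesis
    using assms by (simp add: conj_entry[OF X] sum_subtractf[symmetric] right_diff_distrib left_diff_distrib del: index_mult_mat)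
qed

lemma hermitian_minus:
  assumes "hermitian d A" "hermitian d B"
  shows "hermitian d (A - B)"
proof (rule hermitianI)
  note c = hermitian_carrier[OF assms(1)] hermitian_carrier[OF assms(2)]
  show "A - B \<in> carrier_mat d d" using c by (intro minus_carrier_mat)
  fix i j assume ij: "i < d" "j < d"
  have "A $$ (j,i) = cnj (A $$ (i,j))" "B $$ (j,i) = cnj (B $$ (i,j))"
    using hermitian_entry[OF assms(1) ij] hermitian_entry[OF assms(2) ij] by auto
  thus "(A - B) $$ (j,i) = cnj ((A - B) $$ (i,j))" using c ij by simp
qed

lemma hermitian_tpow:
  assumes "hermitian d A"
  shows "hermitian (d ^ n) (tpow A n)"
proof -
  have "A \<in> carrier_mat d d" "adj A = A" using assms by (auto simp: hermitian_def)
  thus ?thesis by (simp add: hermitian_def adj_tpow[of A d])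
qed

lemma one_minus_le_cos: "1 - x\<^sup>2 / 2 \<le> cos (x::real)"
proof -
  have "(sin (x/2))\<^sup>2 \<le> (x/2)\<^sup>2"
    by (metis abs_ge_zero abs_sin_x_le_abs_x power2_abs power_mono)
  moreover have "cos x = 1 - 2 * (sin (x/2))\<^sup>2"
    using cos_double_sin[of "x/2"] by simp
  ultimately show ?thesis by (simp add: power2_eq_square)
qed

text \<open>The real exponent \<open>r * real n + 1\<close> absorbs the ceiling in the number of
  c-bits.\<close>

lemma cbit_overlap_limit:
  fixes a r :: real
  assumes "a > 0" "r > 0"
  shows "(\<lambda>n::nat. (1 - a / real n) powr (r * real n + 1)) \<longlonglongrightarrow> exp (- (a * r))"
  using assms by real_asymp

text \<open>On time scale 1 / sqrt n, the overlap of n copies with their time evolution tends to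
  exp (- F / 8), while that of the c-bits tends to a Gaussian in their period.\<close>

lemma sqrt_prod: "sqrt (\<Prod>x\<in>S. f x) = (\<Prod>x\<in>S. sqrt (f x))"
  by (induction S rule: infinite_finite_induct) (auto simp: real_sqrt_mult)

text \<open>A negative rate means no c-bits at all, because \<open>nat\<close> truncates; hence the
  maximum with 0. Working with an arbitrary larger \<open>r\<close> guarantees a positive rate in
  the limit.\<close>

theorem achievable_imp_qfi_le:
  assumes H: "hermitian d H" and \<rho>: "density d \<rho>" and sd: "spectral_decomp d \<rho> U p"
    and \<tau>: "\<tau> > 0" and ach: "achievable d H \<rho> \<tau> R"
  shows "(\<tau> / (2 * pi))\<^sup>2 * qfi_of_decomp d H U p \<le> max R 0"
proof (rule dense_ge)
  fix r assume r: "max R 0 < r"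
  define F where "F = qfi_of_decomp d H U p"
  define m where "m = (\<lambda>n::nat. nat \<lceil>R * real n\<rceil>)"
  from ach obtain E where ti: "\<And>n. ti_op (2 ^ m n) (ham_copies 2 (cbit_ham \<tau>) (m n)) (d ^ n) (ham_copies d H n) (E n)"
    and lim: "(\<lambda>n. trace_norm (E n (tpow cbit_state (m n)) - tpow \<rho> n)) \<longlonglongrightarrow> 0"
    unfolding achievable_def Let_def m_def by blast
  from sld_measurement[OF H \<rho> sd] obtain X g where X: "unitary d X"
    and bc: "\<And>s. (\<Sum>x<d. sqrt (Re ((adj X * \<rho> * X) $$ (x,x))) * sqrt (Re ((adj X * evol H s \<rho> * X) $$ (x,x)))) \<le> 1 - g s"
    and glim: "((\<lambda>s. g s / s\<^sup>2) \<longlongrightarrow> F / 8) (at 0)"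
    unfolding F_def by blast
  from hermitian_spectral[OF H] obtain W e where W: "unitary d W" and Hd: "H = W * rdiag d e * adj W"
    by blast
  have rpsd: "psd d \<rho>" using \<rho> by (simp add: density_def)
  have rh: "hermitian d \<rho>" using rpsd by (simp add: psd_def)
  note rc = hermitian_carrier[OF rh]
  have ec: "evol H s \<rho> \<in> carrier_mat d d" for s by (rule evol_carrier[OF W Hd rc])
  note xc = unitaryD(1)[OF X]
  define q where "q = (\<lambda>s x. Re ((adj X * evol H s \<rho> * X) $$ (x,x)))"
  define q0 where "q0 = (\<lambda>x. Re ((adj X * \<rho> * X) $$ (x,x)))"
  have q0: "q0 x \<ge> 0" if "x < d" for x
    unfolding q0_def by (rule psd_diag_nonneg[OF rpsd xc that])
  have q: "q s x \<ge> 0" if x: "x < d" for s x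
  proof -
    from conj_evol[OF W Hd, of s] obtain V' where V': "unitary d V'"
      and e: "\<And>X \<sigma>. X \<in> carrier_mat d d \<Longrightarrow> \<sigma> \<in> carrier_mat d d \<Longrightarrow> adj X * evol H s \<sigma> * X = adj (V' * X) * \<sigma> * (V' * X)"
      by blast
    show ?thesis unfolding q_def e[OF xc rc]
      by (rule psd_diag_nonneg[OF rpsd unitaryD(1)[OF unitary_mult[OF V' X]] x])
  qed
  have q01: "(\<Sum>x<d. q0 x) = 1"
    unfolding q0_def Re_sum[symmetric] trace_conj[OF X rc] using \<rho> by (simp add: density_def)
  have q0_im: "(adj X * \<rho> * X) $$ (x,x) = complex_of_real (q0 x)" if "x < d" for x
    using hermitian_entry[OF hermitian_conj[OF rh xc] that that] by (simp add: complex_eq_iff q0_def del: index_mult_mat)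
  have q_im: "(adj X * evol H s \<rho> * X) $$ (x,x) = complex_of_real (q s x)" if x: "x < d" for s x
  proof -
    from conj_evol[OF W Hd, of s] obtain V' where V': "unitary d V'"
      and e: "\<And>X \<sigma>. X \<in> carrier_mat d d \<Longrightarrow> \<sigma> \<in> carrier_mat d d \<Longrightarrow> adj X * evol H s \<sigma> * X = adj (V' * X) * \<sigma> * (V' * X)"
      by blast
    have "hermitian d (adj X * evol H s \<rho> * X)"
      unfolding e[OF xc rc] by (rule hermitian_conj[OF rh unitaryD(1)[OF unitary_mult[OF V' X]]])
    from hermitian_entry[OF this x x] show ?thesis by (simp add: complex_eq_iff q_def del: index_mult_mat)
  qed
  define \<epsilon> where "\<epsilon> = (\<lambda>n. trace_norm (E n (tpow cbit_state (m n)) - tpow \<rho> n))"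
  \<comment> \<open>At a fixed time \<open>s\<close>, the c-bit overlap is a lower bound on the
    Bhattacharyya coefficient of the measured outputs. For the target the product measurement makes
    the coefficient an n-th power, and passing from outputs to target costs one square root of the
    error for each of the two distributions.\<close>
  have key: "\<bar>cos (pi * s / \<tau>)\<bar> ^ m n \<le> (1 - g s) ^ n + 2 * sqrt (\<epsilon> n)" for n s
  proof -
    let ?Xn = "tpow X n" and ?Hn = "ham_copies d H n" and ?Hc = "ham_copies 2 (cbit_ham \<tau>) (m n)"
    let ?D = "d ^ n" and ?\<Phi> = "tpow cbit_state (m n)"
    have cp: "cptp (2 ^ m n) ?D (E n)" using ti by (simp add: ti_op_def)
    have Xn: "unitary ?D ?Xn" by (rule tpow_unitary[OF X])
    have Wn: "unitary ?D (tpow W n)" by (rule tpow_unitary[OF W])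
    note Hn = ham_copies_diag[OF W Hd, of n]
    have \<Phi>h: "hermitian (2 ^ m n) ?\<Phi>"
      by (rule hermitian_tpow) (rule hermitianI, auto simp: cbit_state_def)
    note \<Phi>c = hermitian_carrier[OF \<Phi>h]
    have \<sigma>h: "hermitian ?D (E n ?\<Phi>)" by (rule cptp_hermitian[OF cp \<Phi>h])
    have \<rho>n: "hermitian ?D (tpow \<rho> n)" by (rule hermitian_tpow[OF rh])
    note \<sigma>c = hermitian_carrier[OF \<sigma>h] and \<rho>nc = hermitian_carrier[OF \<rho>n]
    have dh: "hermitian ?D (E n ?\<Phi> - tpow \<rho> n)" by (rule hermitian_minus[OF \<sigma>h \<rho>n])
    have ev: "evol ?Hn s (E n ?\<Phi>) = E n (evol ?Hc s ?\<Phi>)"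
      using ti[of n] \<Phi>c by (simp add: ti_op_def)
    define P where "P = (\<lambda>v x. Re ((adj ?Xn * E n (outer (2 ^ m n) v) * ?Xn) $$ (x,x)))"
    let ?u = "cbits_amp \<tau> (m n) 0" and ?v = "cbits_amp \<tau> (m n) s"
    have P0: "P ?u x = Re ((adj ?Xn * E n ?\<Phi> * ?Xn) $$ (x,x))" for x
      unfolding P_def cbits_evol_outer(1)[of "m n" \<tau>] ..
    have Ps: "P ?v x = Re ((adj ?Xn * evol ?Hn s (E n ?\<Phi>) * ?Xn) $$ (x,x))" for x
      unfolding P_def ev cbits_evol_outer(2) ..
    have dgl: "dig d l x < d" if "x < ?D" "l < n" for x l using that by (rule dig_less_pow)
    have p0: "(adj ?Xn * tpow \<rho> n * ?Xn) $$ (x,x) = complex_of_real (\<Prod>l<n. q0 (dig d l x))" if "x < ?D" for x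
      unfolding tpow_conj[OF xc rc]
      using that dgl[OF that] xc rc by (subst tpow_entry[of _ d]) (auto simp: q0_im simp del: index_mult_mat)
    have ps: "(adj ?Xn * evol ?Hn s (tpow \<rho> n) * ?Xn) $$ (x,x) = complex_of_real (\<Prod>l<n. q s (dig d l x))" if "x < ?D" for x
      unfolding evol_tpow[OF W Hd rc] tpow_conj[OF xc ec]
      using that dgl[OF that] xc ec by (subst tpow_entry[of _ d]) (auto simp: q_im simp del: index_mult_mat)
    let ?pa = "\<lambda>x. \<Prod>l<n. q0 (dig d l x)" and ?pb = "\<lambda>x. \<Prod>l<n. q s (dig d l x)"
    have e0: "(\<Sum>x<?D. \<bar>P ?u x - ?pa x\<bar>) \<le> \<epsilon> n"
    proof -
      have "(\<Sum>x<?D. \<bar>P ?u x - ?pa x\<bar>) \<le> (\<Sum>x<?D. cmod ((adj ?Xn * (E n ?\<Phi> - tpow \<rho> n) * ?Xn) $$ (x,x)))"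
      proof (intro sum_mono)
        fix x assume "x \<in> {..<?D}"
        hence "P ?u x - ?pa x = Re ((adj ?Xn * (E n ?\<Phi> - tpow \<rho> n) * ?Xn) $$ (x,x))"
          using minus_conj_entry[OF unitaryD(1)[OF Xn] \<sigma>c \<rho>nc, of x x] p0[of x] by (simp add: P0 del: index_mult_mat of_real_prod)
        thus "\<bar>P ?u x - ?pa x\<bar> \<le> cmod ((adj ?Xn * (E n ?\<Phi> - tpow \<rho> n) * ?Xn) $$ (x,x))"
          using abs_Re_le_cmod by simp
      qed
      also have "\<dots> \<le> \<epsilon> n" unfolding \<epsilon>_def by (rule trace_norm_ge[OF dh Xn])
      finally show ?thesis .
    qed
    \<comment> \<open>By covariance the evolved input yields the evolved output. With the evolution
      moved onto the basis, the error at time 0 also controls the evolved pair.\<close>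
    have es: "(\<Sum>x<?D. \<bar>P ?v x - ?pb x\<bar>) \<le> \<epsilon> n"
    proof -
      from conj_evol[OF Wn Hn, of s] obtain V where V: "unitary ?D V"
        and e: "\<And>X \<sigma>. X \<in> carrier_mat ?D ?D \<Longrightarrow> \<sigma> \<in> carrier_mat ?D ?D \<Longrightarrow> adj X * evol ?Hn s \<sigma> * X = adj (V * X) * \<sigma> * (V * X)"
        by blast
      have Y: "unitary ?D (V * ?Xn)" by (rule unitary_mult[OF V Xn])
      let ?Y = "V * ?Xn"
      have "(\<Sum>x<?D. \<bar>P ?v x - ?pb x\<bar>) \<le> (\<Sum>x<?D. cmod ((adj ?Y * (E n ?\<Phi> - tpow \<rho> n) * ?Y) $$ (x,x)))"
      proof (intro sum_mono)
        fix x assume "x \<in> {..<?D}"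
        hence "P ?v x - ?pb x = Re ((adj ?Y * (E n ?\<Phi> - tpow \<rho> n) * ?Y) $$ (x,x))"
          using minus_conj_entry[OF unitaryD(1)[OF Y] \<sigma>c \<rho>nc, of x x] ps[of x]
          unfolding e[OF unitaryD(1)[OF Xn] \<rho>nc] Ps e[OF unitaryD(1)[OF Xn] \<sigma>c] by (simp del: index_mult_mat of_real_prod)
        thus "\<bar>P ?v x - ?pb x\<bar> \<le> cmod ((adj ?Y * (E n ?\<Phi> - tpow \<rho> n) * ?Y) $$ (x,x))"
          using abs_Re_le_cmod by simp
      qed
      also have "\<dots> \<le> \<epsilon> n" unfolding \<epsilon>_def by (rule trace_norm_ge[OF dh Y])
      finally show ?thesis .
    qed
    have "\<bar>cos (pi * s / \<tau>)\<bar> ^ m n \<le> (\<Sum>x<?D. sqrt (P ?u x) * sqrt (P ?v x))"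
      using cptp_overlap(3)[OF cp Xn, of ?u ?v] unfolding cbits_evol_outer(4) P_def .
    also have "\<dots> \<le> (\<Sum>x<?D. sqrt (?pa x) * sqrt (?pb x)) + sqrt (\<Sum>x<?D. \<bar>P ?u x - ?pa x\<bar>) + sqrt (\<Sum>x<?D. \<bar>P ?v x - ?pb x\<bar>)"
    proof (rule bhattacharyya_continuous)
      show "sum (P ?v) {..<?D} = 1"
        using cptp_overlap(2)[OF cp Xn, of ?v] cbits_evol_outer(3)[where \<tau> = \<tau> and m = "m n" and t = s] by (simp add: P_def)
      show "sum ?pa {..<?D} = 1" by (simp add: sum_prod_dig[where f = "\<lambda>_. q0"] q01)
    qed (use cptp_overlap(1)[OF cp Xn] dgl q q0 in \<open>auto simp: P_def intro!: prod_nonneg\<close>)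
    also have "(\<Sum>x<?D. sqrt (?pa x) * sqrt (?pb x)) = (\<Sum>x<?D. \<Prod>l<n. sqrt (q0 (dig d l x)) * sqrt (q s (dig d l x)))"
      by (simp add: prod.distrib sqrt_prod)
    also have "\<dots> = (\<Sum>x<d. sqrt (q0 x) * sqrt (q s x)) ^ n"
      by (subst sum_prod_dig[where f = "\<lambda>_ x. sqrt (q0 x) * sqrt (q s x)"]) simp
    also have "\<dots> \<le> (1 - g s) ^ n"
      using bc[of s] q q0 by (intro power_mono sum_nonneg mult_nonneg_nonneg) (auto simp: q_def q0_def)
    finally show ?thesis using real_sqrt_le_mono[OF e0] real_sqrt_le_mono[OF es] by linarith
  qed
  have g1: "g s \<le> 1" for s
  proof -
    have "0 \<le> (\<Sum>x<d. sqrt (q0 x) * sqrt (q s x))" using q q0 by (intro sum_nonneg mult_nonneg_nonneg) auto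
    thus ?thesis using bc[of s] by (simp add: q_def q0_def)
  qed
  \<comment> \<open>The quadratic coefficient of \<open>cos (pi * s / \<tau>)\<close>: at
    \<open>s = 1 / sqrt n\<close> a single c-bit has overlap at least
    \<open>1 - a / n\<close>.\<close>
  define a where "a = pi\<^sup>2 / (2 * \<tau>\<^sup>2)"
  have a: "a > 0" using \<tau> by (simp add: a_def)
  have rpos: "r > 0" using r by simp
  have "filterlim (\<lambda>n. 1 / sqrt (real n)) (at 0) sequentially" by real_asymp
  from filterlim_compose[OF glim this]
  have gl: "(\<lambda>n. g (1 / sqrt (real n)) / (1 / sqrt (real n))\<^sup>2) \<longlonglongrightarrow> F / 8" .
  have el: "\<epsilon> \<longlonglongrightarrow> 0" using lim by (simp add: \<epsilon>_def)
  have up: "(\<lambda>n. exp (- (g (1 / sqrt (real n)) / (1 / sqrt (real n))\<^sup>2)) + 2 * sqrt (\<epsilon> n)) \<longlonglongrightarrow> exp (- (F / 8)) + 2 * sqrt 0"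
    by (intro tendsto_add tendsto_exp tendsto_minus gl tendsto_mult tendsto_const tendsto_real_sqrt el)
  have "\<forall>\<^sub>F n in sequentially. (1 - a / real n) powr (r * real n + 1) \<le> exp (- (g (1 / sqrt (real n)) / (1 / sqrt (real n))\<^sup>2)) + 2 * sqrt (\<epsilon> n)"
    using eventually_gt_at_top[of "nat \<lceil>a\<rceil>"]
  proof eventually_elim
    case (elim n)
    hence n: "real n > a" "n > 0" using a by linarith+
    let ?s = "1 / sqrt (real n)"
    have x: "0 < 1 - a / real n" "1 - a / real n \<le> 1" using n a by (auto simp: field_simps)
    have c: "1 - a / real n \<le> \<bar>cos (pi * ?s / \<tau>)\<bar>"
      using one_minus_le_cos[of "pi * ?s / \<tau>"] n by (simp add: a_def power_mult_distrib power_divide mult_ac)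
    have "real (m n) \<le> r * real n + 1"
    proof -
      have "real (m n) \<le> max (R * real n) 0 + 1"
        unfolding m_def using of_nat_ceiling[of "R * real n"] by linarith
      also have "max (R * real n) 0 = max R 0 * real n" 
        using max_mult_distrib_right[of R 0 "real n"] by simp
      also have "\<dots> \<le> r * real n" using r by (intro mult_right_mono) auto
      finally show ?thesis by simp
    qed
    hence "(1 - a / real n) powr (r * real n + 1) \<le> (1 - a / real n) powr real (m n)"
      using x by (intro powr_mono') auto
    also have "\<dots> = (1 - a / real n) ^ m n" using x by (simp add: powr_realpow)
    also have "\<dots> \<le> \<bar>cos (pi * ?s / \<tau>)\<bar> ^ m n" using c x by (intro power_mono) auto
    also have "\<dots> \<le> (1 - g ?s) ^ n + 2 * sqrt (\<epsilon> n)" by (rule key)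
    also have "(1 - g ?s) ^ n \<le> exp (- g ?s) ^ n"
      using g1[of ?s] exp_ge_add_one_self[of "- g ?s"] by (intro power_mono) auto
    also have "\<dots> = exp (- (g ?s / ?s\<^sup>2))"
      using n by (simp add: exp_of_nat_mult[symmetric] power_divide mult.commute)
    finally show ?case by simp
  qed
  hence "exp (- (a * r)) \<le> exp (- (F / 8)) + 2 * sqrt 0"
    by (intro tendsto_le[OF _ up cbit_overlap_limit[OF a rpos]]) auto
  hence "F / 8 \<le> a * r" by simp
  hence "(\<tau>\<^sup>2 / (2 * pi)\<^sup>2) * F \<le> (\<tau>\<^sup>2 / (2 * pi)\<^sup>2) * (8 * (a * r))" by (intro mult_left_mono) auto
  also have "\<dots> = r" using \<tau> by (simp add: a_def field_simps power2_eq_square)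
  finally show "(\<tau> / (2 * pi))\<^sup>2 * qfi_of_decomp d H U p \<le> r" by (simp add: F_def power_divide)
qed

section \<open>Probability polynomials\<close>

text \<open>On a difference of two generating polynomials this is twice the total variation
  distance; products of such polynomials are convolutions.\<close>

definition norm1 :: "real poly \<Rightarrow> real" where
  "norm1 p = (\<Sum>i\<le>degree p. \<bar>coeff p i\<bar>)"

lemma norm1_altdef:
  assumes "degree p \<le> n"
  shows "norm1 p = (\<Sum>i\<le>n. \<bar>coeff p i\<bar>)"
  unfolding norm1_def using assms by (intro sum.mono_neutral_left) (auto simp: coeff_eq_0)

lemma norm1_nonneg [simp]: "norm1 p \<ge> 0"
  by (auto simp: norm1_def intro!: sum_nonneg)

lemma norm1_pCons: "norm1 (pCons a p) = \<bar>a\<bar> + norm1 p"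
proof -
  have "norm1 (pCons a p) = (\<Sum>i\<le>Suc (degree p). \<bar>coeff (pCons a p) i\<bar>)"
    by (rule norm1_altdef) (rule degree_pCons_le)
  also have "\<dots> = \<bar>a\<bar> + norm1 p" unfolding sum.atMost_Suc_shift by (simp add: norm1_def)
  finally show ?thesis .
qed

lemma norm1_0 [simp]: "norm1 0 = 0"
  by (simp add: norm1_def)

lemma norm1_add: "norm1 (p + q) \<le> norm1 p + norm1 q"
proof -
  let ?n = "max (degree p) (degree q)"
  have "norm1 (p + q) = (\<Sum>i\<le>?n. \<bar>coeff (p + q) i\<bar>)" by (rule norm1_altdef) (rule degree_add_le_max)
  also have "\<dots> \<le> (\<Sum>i\<le>?n. \<bar>coeff p i\<bar> + \<bar>coeff q i\<bar>)" by (intro sum_mono) simp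
  also have "\<dots> = norm1 p + norm1 q" by (simp add: sum.distrib norm1_altdef[of p ?n] norm1_altdef[of q ?n])
  finally show ?thesis .
qed

lemma norm1_smult: "norm1 (smult c p) = \<bar>c\<bar> * norm1 p"
  using norm1_altdef[OF degree_smult_le, of c p]
  by (simp add: norm1_def abs_mult sum_distrib_left)

lemma norm1_mult: "norm1 (p * q) \<le> norm1 p * norm1 q"
proof (induction p)
  case (pCons a p)
  have "norm1 (pCons a p * q) \<le> norm1 (smult a q) + norm1 (pCons 0 (p * q))"
    unfolding mult_pCons_left by (rule norm1_add)
  also have "\<dots> \<le> \<bar>a\<bar> * norm1 q + norm1 p * norm1 q" using pCons by (simp add: norm1_smult norm1_pCons)
  finally show ?case by (simp add: norm1_pCons algebra_simps)
qed simp

definition prob_poly :: "real poly \<Rightarrow> bool" where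
  "prob_poly p \<longleftrightarrow> (\<forall>i. coeff p i \<ge> 0) \<and> poly p 1 = 1"

lemma prob_poly_mult:
  assumes "prob_poly p" "prob_poly q"
  shows "prob_poly (p * q)"
  using assms by (auto simp: prob_poly_def coeff_mult intro!: sum_nonneg)

lemma prob_poly_1 [simp]: "prob_poly 1"
  by (simp add: prob_poly_def)

lemma prob_poly_power: "prob_poly p \<Longrightarrow> prob_poly (p ^ n)"
  by (induction n) (auto intro: prob_poly_mult)

lemma prob_poly_monom [simp]: "prob_poly (monom 1 n)"
  by (simp add: prob_poly_def poly_monom)

lemma prob_poly_prod_list: "(\<And>p. p \<in> set ps \<Longrightarrow> prob_poly p) \<Longrightarrow> prob_poly (prod_list ps)"
  by (induction ps) (auto intro: prob_poly_mult)

lemma norm1_prob_poly: "prob_poly p \<Longrightarrow> norm1 p = 1"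
  by (simp add: prob_poly_def norm1_def poly_altdef)

text \<open>A common independent summand cannot increase the l1 distance. This discards the factors
  that a replacement leaves untouched.\<close>

lemma norm1_mult_prob_le: "prob_poly q \<Longrightarrow> norm1 (p * q) \<le> norm1 p"
  using norm1_mult[of p q] by (simp add: norm1_prob_poly)

section \<open>Mean and variance of generating polynomials\<close>

definition mean :: "real poly \<Rightarrow> real" where
  "mean p = poly (pderiv p) 1"

text \<open>The second derivative at 1 is the second factorial moment; adding the mean yields the
  second moment.\<close>

definition variance :: "real poly \<Rightarrow> real" where
  "variance p = poly (pderiv (pderiv p)) 1 + mean p - (mean p)\<^sup>2"

lemma mean_mult: "poly p 1 = 1 \<Longrightarrow> poly q 1 = 1 \<Longrightarrow> mean (p * q) = mean p + mean q"
  by (simp add: mean_def pderiv_mult)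

lemma variance_mult:
  assumes "poly p 1 = 1" "poly q 1 = 1"
  shows "variance (p * q) = variance p + variance q"
  using assms by (simp add: variance_def mean_mult pderiv_mult pderiv_add mean_def power2_eq_square algebra_simps)

lemma moments_1 [simp]: "mean 1 = 0" "variance 1 = 0"
  by (simp_all add: mean_def variance_def pderiv_1)

lemma moments_power:
  assumes "poly p 1 = 1"
  shows "mean (p ^ n) = n * mean p" "variance (p ^ n) = n * variance p"
  by (induction n) (use assms in \<open>auto simp: mean_mult variance_mult algebra_simps\<close>)

lemma moments_monom: "mean (monom 1 n) = n" "variance (monom 1 n) = 0"
proof -
  show m: "mean (monom 1 n) = n" by (simp add: mean_def pderiv_monom poly_monom)
  show "variance (monom 1 n) = 0"
    unfolding variance_def m
    by (cases n) (simp_all add: pderiv_monom poly_monom power2_eq_square algebra_simps)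
qed

lemma poly_moment_sums:
  assumes "degree p \<le> n"
  shows "poly p 1 = (\<Sum>i\<le>n. coeff p i)"
    and "mean p = (\<Sum>i\<le>n. real i * coeff p i)"
    and "poly (pderiv (pderiv p)) 1 + mean p = (\<Sum>i\<le>n. (real i)\<^sup>2 * coeff p i)"
proof -
  show "poly p 1 = (\<Sum>i\<le>n. coeff p i)"
    unfolding poly_altdef using assms by (simp, intro sum.mono_neutral_left) (auto simp: coeff_eq_0)
  have p: "p = (\<Sum>i\<le>n. monom (coeff p i) i)"
    using assms poly_as_sum_of_monoms'[of p n] by simp
  have d: "pderiv (\<Sum>i\<in>A. q i) = (\<Sum>i\<in>A. pderiv (q i))" for A :: "nat set" and q :: "nat \<Rightarrow> real poly"
    by (induction A rule: infinite_finite_induct) (auto simp: pderiv_add)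
  have 1: "pderiv p = (\<Sum>i\<le>n. monom (real i * coeff p i) (i - 1))"
    by (subst p) (simp add: d pderiv_monom)
  show m: "mean p = (\<Sum>i\<le>n. real i * coeff p i)"
    unfolding mean_def 1 by (simp add: poly_sum poly_monom)
  have "poly (pderiv (pderiv p)) 1 = (\<Sum>i\<le>n. real (i - 1) * (real i * coeff p i))"
    unfolding 1 by (simp add: d pderiv_monom poly_sum poly_monom)
  moreover have "real (i - 1) * (real i * c) + real i * c = (real i)\<^sup>2 * c" for i c
    by (cases i) (auto simp: power2_eq_square algebra_simps)
  ultimately show "poly (pderiv (pderiv p)) 1 + mean p = (\<Sum>i\<le>n. (real i)\<^sup>2 * coeff p i)"
    by (simp add: m sum.distrib[symmetric])
qed

lemma variance_eq_sum:
  assumes "prob_poly p" "degree p \<le> n"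
  shows "variance p = (\<Sum>i\<le>n. (real i - mean p)\<^sup>2 * coeff p i)"
proof -
  have "(\<Sum>i\<le>n. (real i - mean p)\<^sup>2 * coeff p i) = (\<Sum>i\<le>n. (real i)\<^sup>2 * coeff p i)
     - 2 * mean p * (\<Sum>i\<le>n. real i * coeff p i) + (mean p)\<^sup>2 * (\<Sum>i\<le>n. coeff p i)"
    unfolding sum_distrib_left sum.distrib[symmetric] sum_subtractf[symmetric]
    by (intro sum.cong refl) (simp add: power2_eq_square algebra_simps)
  also have "\<dots> = variance p"
    using assms(1) unfolding poly_moment_sums[OF assms(2), symmetric]
    by (simp add: variance_def prob_poly_def power2_eq_square algebra_simps)
  finally show ?thesis ..
qed

lemma variance_nonneg: "prob_poly p \<Longrightarrow> variance p \<ge> 0"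
  by (subst variance_eq_sum[of p "degree p"]) (auto simp: prob_poly_def intro!: sum_nonneg)

lemma mean_nonneg: "prob_poly p \<Longrightarrow> mean p \<ge> 0"
  by (subst poly_moment_sums(2)[of p "degree p"]) (auto simp: prob_poly_def intro!: sum_nonneg)

section \<open>Fair coin flips as a smoothing distribution\<close>

definition bitp :: "real poly" where
  "bitp = [:1/2, 1/2:]"

lemma prob_bit: "prob_poly bitp"
  by (auto simp: prob_poly_def bitp_def coeff_pCons split: nat.split)

lemma moments_bit: "mean bitp = 1/2" "variance bitp = 1/4"
  by (simp_all add: mean_def variance_def bitp_def pderiv_pCons power2_eq_square)

text \<open>The coefficients of \<open>(x - 1) * bitp ^ n\<close> are those of \<open>bitp ^ (n + 1)\<close> weighted by the distance to the mean,
  so the norm is a mean absolute deviation.\<close>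

lemma norm1_diff_bit: "norm1 ([:-1, 1:] * bitp ^ n) \<le> 2 / sqrt (real (n + 1))"
proof -
  let ?b = "bitp ^ (n + 1)" and ?N = "n + 1"
  have pb: "prob_poly ?b" by (intro prob_poly_power prob_bit)
  have db: "degree ?b \<le> ?N" using degree_power_le[of bitp ?N] by (simp add: bitp_def)
  have pd: "pderiv ?b = smult (real ?N / 2) (bitp ^ n)"
  proof -
    have "pderiv ?b = smult (real ?N) (bitp ^ n) * pderiv bitp"
      using pderiv_power_Suc[of bitp n] by simp
    also have "pderiv bitp = [:1/2:]" by (simp add: bitp_def pderiv_pCons)
    finally show ?thesis by (simp add: field_simps)
  qed
  \<comment> \<open>As \<open>bitp\<close> is (1 + x) / 2, the polynomial 2 x b' - N b, with b for
    \<open>?b\<close> and N for \<open>?N\<close>, is N / 2 times the left side.\<close>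
  have eq: "[:-1, 1:] * bitp ^ n = smult (2 / real ?N) (smult 2 (pCons 0 (pderiv ?b)) - smult (real ?N) ?b)"
  proof -
    have 1: "smult 2 (pCons 0 (pderiv ?b)) = smult (real ?N) (pCons 0 (bitp ^ n))"
      unfolding pd by (simp, simp add: add_divide_distrib)
    have 2: "?b = smult (1/2) (bitp ^ n + pCons 0 (bitp ^ n))"
      by (simp add: bitp_def mult_pCons_left smult_add_right)
    have "smult (2 / real ?N) (smult 2 (pCons 0 (pderiv ?b)) - smult (real ?N) ?b)
       = smult (2 / real ?N) (smult (real ?N) (pCons 0 (bitp ^ n)) - smult (real ?N) (smult (1/2) (bitp ^ n + pCons 0 (bitp ^ n))))"
      by (rule arg_cong2[OF 1 2])
    also have "\<dots> = smult (2 / real ?N * real ?N) (pCons 0 (bitp ^ n)) - smult (2 / real ?N * real ?N * (1/2)) (bitp ^ n + pCons 0 (bitp ^ n))"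
      by (simp only: smult_diff_right smult_smult mult.assoc)
    also have "2 / real ?N * real ?N = 2"
    proof -
      have "2 / x * x = 2" if "x \<noteq> 0" for x :: real using that by simp
      thus ?thesis by (metis of_nat_eq_0_iff add_is_0 one_neq_zero)
    qed
    finally have "smult (2 / real ?N) (smult 2 (pCons 0 (pderiv ?b)) - smult (real ?N) ?b)
       = smult 2 (pCons 0 (bitp ^ n)) - (bitp ^ n + pCons 0 (bitp ^ n))" by simp
    also have "smult 2 (pCons 0 (bitp ^ n)) = pCons 0 (bitp ^ n) + pCons 0 (bitp ^ n)"
      by (metis mult_2 smult_1_left one_add_one smult_add_left)
    finally show ?thesis by (simp add: mult_pCons_left)
  qed
  have cf: "coeff ([:-1, 1:] * bitp ^ n) i = (2 / real ?N) * (2 * real i - real ?N) * coeff ?b i" for i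
  proof -
    have "coeff (pCons 0 (pderiv ?b)) i = real i * coeff ?b i" by (cases i) (simp_all add: coeff_pderiv)
    thus ?thesis unfolding eq by (simp only: coeff_smult coeff_diff left_diff_distrib right_diff_distrib mult.assoc)
  qed
  have deg: "degree ([:-1, 1:] * bitp ^ n) \<le> ?N"
    using degree_mult_le[of "[:-1, 1:]" "bitp ^ n"] degree_power_le[of bitp n] by (simp add: bitp_def)
  have b0: "coeff ?b i \<ge> 0" for i using pb by (simp add: prob_poly_def)
  have mb: "mean ?b = real ?N / 2" "variance ?b = real ?N / 4"
    using moments_power[of bitp ?N] prob_bit by (auto simp: prob_poly_def moments_bit)
  have vb: "(\<Sum>i\<le>?N. (real i - mean ?b)\<^sup>2 * coeff ?b i) = real ?N / 4"
    using variance_eq_sum[OF pb db] mb(2) by (simp only:)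
  have "norm1 ([:-1, 1:] * bitp ^ n) = (\<Sum>i\<le>?N. (2 / real ?N) * (\<bar>2 * real i - real ?N\<bar> * coeff ?b i))"
    unfolding norm1_altdef[OF deg] cf abs_mult using b0 by (intro sum.cong refl) simp
  also have "\<dots> = (2 / real ?N) * (\<Sum>i\<le>?N. (\<bar>2 * real i - real ?N\<bar> * sqrt (coeff ?b i)) * sqrt (coeff ?b i))"
    unfolding sum_distrib_left using b0 by (intro sum.cong refl) (simp add: mult_ac)
  \<comment> \<open>The mean absolute deviation is at most the standard deviation. For
    \<open>?N\<close> flips the latter is half of \<open>sqrt ?N\<close>, and the deviation is
    doubled here.\<close>
  also have "\<dots> \<le> (2 / real ?N) * (sqrt (\<Sum>i\<le>?N. (\<bar>2 * real i - real ?N\<bar> * sqrt (coeff ?b i))\<^sup>2) * sqrt (\<Sum>i\<le>?N. (sqrt (coeff ?b i))\<^sup>2))"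
    by (intro mult_left_mono Cauchy_Schwarz_sum) auto
  also have "(\<Sum>i\<le>?N. (sqrt (coeff ?b i))\<^sup>2) = 1"
    using b0 poly_moment_sums(1)[OF db] pb by (simp add: prob_poly_def)
  also have "(\<Sum>i\<le>?N. (\<bar>2 * real i - real ?N\<bar> * sqrt (coeff ?b i))\<^sup>2) = (\<Sum>i\<le>?N. 4 * ((real i - mean ?b)\<^sup>2 * coeff ?b i))"
    unfolding mb(1) using b0
    by (intro sum.cong refl) (simp add: power_mult_distrib power2_eq_square field_simps)
  also have "\<dots> = real ?N"
    unfolding sum_distrib_left[symmetric] vb by simp
  also have "2 / real ?N * (sqrt (real ?N) * sqrt 1) = 2 / sqrt (real ?N)"
  proof -
    have "2 / x * (sqrt x * sqrt 1) = 2 / sqrt x" if "x > 0" for x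
      using that by (simp add: field_simps)
    from this[of "real ?N"] show ?thesis by simp
  qed
  finally show ?thesis by (simp add: add.commute)
qed

text \<open>A third of the flips smooths each factor x - 1 to order n^(-1/2), so the cube has order
  n^(-3/2). This exponent beats a number of replacements that grows linearly.\<close>

lemma norm1_diff3_bit: "norm1 ([:-1, 1:] ^ 3 * bitp ^ n) \<le> (2 / sqrt (real (n div 3 + 1))) ^ 3"
proof -
  let ?l = "n div 3"
  let ?a = "[:-1, 1:] * bitp ^ ?l"
  have "bitp ^ n = bitp ^ ?l * bitp ^ ?l * bitp ^ ?l * bitp ^ (n mod 3)"
    unfolding power_add[symmetric] by (rule arg_cong[of _ _ "\<lambda>k. bitp ^ k"]) presburger
  hence "[:-1, 1:] ^ 3 * bitp ^ n = ?a * ?a * ?a * bitp ^ (n mod 3)"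
    by (simp only: power3_eq_cube mult_ac)
  also have "norm1 \<dots> \<le> norm1 (?a * ?a * ?a)"
    by (intro norm1_mult_prob_le prob_poly_power prob_bit)
  also have "\<dots> \<le> norm1 ?a * norm1 ?a * norm1 ?a"
    by (meson norm1_mult norm1_nonneg mult_right_mono order_trans)
  also have "\<dots> = norm1 ?a ^ 3" by (simp add: power3_eq_cube)
  also have "\<dots> \<le> (2 / sqrt (real (?l + 1))) ^ 3"
    using norm1_diff_bit[of ?l] by (intro power_mono) auto
  finally show ?thesis .
qed

text \<open>For a difference of two distributions the hypotheses amount to equal total mass, mean
  and variance, and they make 1 a triple root.\<close>

lemma dvd_diff_cube:
  fixes D :: "real poly"
  assumes "poly D 1 = 0" "poly (pderiv D) 1 = 0" "poly (pderiv (pderiv D)) 1 = 0"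
  shows "\<exists>h. D = [:-1, 1:] ^ 3 * h"
proof -
  from assms(1) obtain D1 where D1: "D = [:-1, 1:] * D1"
    using poly_eq_0_iff_dvd[of D 1] by (auto simp: dvd_def)
  have "pderiv D = D1 + [:-1, 1:] * pderiv D1" unfolding D1 pderiv_mult by (simp add: pderiv_pCons)
  with assms(2) obtain D2 where D2: "D1 = [:-1, 1:] * D2"
    using poly_eq_0_iff_dvd[of D1 1] by (auto simp: dvd_def)
  have d1: "pderiv D1 = D2 + [:-1, 1:] * pderiv D2" unfolding D2 pderiv_mult by (simp add: pderiv_pCons)
  have "pderiv (pderiv D) = pderiv D1 + (pderiv D1 + [:-1, 1:] * pderiv (pderiv D1))"
    unfolding D1 pderiv_mult pderiv_add by (simp add: pderiv_pCons)
  with assms(3) have "poly D2 1 = 0" by (simp add: d1)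
  then obtain h where "D2 = [:-1, 1:] * h"
    using poly_eq_0_iff_dvd[of D2 1] by (auto simp: dvd_def)
  hence "D = [:-1, 1:] ^ 3 * h" unfolding D1 D2 power3_eq_cube by (simp only: mult_ac)
  thus ?thesis by blast
qed

text \<open>Noise W makes the mean an integer and the variance a multiple of 1/2, at a cost independent
  of P.\<close>

lemma match_bits:
  assumes P: "prob_poly P"
  shows "\<exists>W c N h. prob_poly W \<and> real N \<le> 2 * variance P + 3 / 2
    \<and> P * W - monom 1 c * bitp ^ (2 * N) = [:-1, 1:] ^ 3 * h"
proof -
  \<comment> \<open>A Bernoulli variable with success probability \<open>f\<close> rounds the mean
    up to an integer and adds the variance \<open>f * (1 - f)\<close>, at most 1 / 4.\<close>
  define f where "f = real_of_int \<lceil>mean P\<rceil> - mean P"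
  have f: "0 \<le> f" "f < 1" unfolding f_def by linarith+
  define v where "v = variance P + f * (1 - f)"
  have v0: "0 \<le> v" using variance_nonneg[OF P] f by (simp add: v_def)
  have "(f - 1/2)\<^sup>2 \<ge> 0" by simp
  hence "f * (1 - f) \<le> 1 / 4" by (simp add: power2_eq_square algebra_simps)
  hence v1: "v \<le> variance P + 1 / 4" by (simp add: v_def)
  \<comment> \<open>\<open>2 * N\<close> flips have variance \<open>N / 2\<close>, so this is the
    least number of pairs of flips whose variance reaches \<open>v\<close>; \<open>s\<close> is the
    variance still to be added.\<close>
  define N where "N = nat \<lceil>2 * v\<rceil>"
  define s where "s = real N / 2 - v"
  have N: "2 * v \<le> real N" "real N < 2 * v + 1" using v0 unfolding N_def by linarith+
  have s: "0 \<le> s" "s \<le> 1 / 2" using N by (auto simp: s_def)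
  define A where "A = [:1 - f, f:]"
  \<comment> \<open>A symmetric variable on 0, 1, 2 with mean 1 and variance \<open>s\<close>;
    centering it at 1 keeps its support in the naturals.\<close>
  define B where "B = [:s / 2, 1 - s, s / 2:]"
  have pA: "prob_poly A" using f by (auto simp: prob_poly_def A_def coeff_pCons split: nat.split)
  have pB: "prob_poly B" using s by (auto simp: prob_poly_def B_def coeff_pCons split: nat.split)
  have mA: "mean A = f" "variance A = f * (1 - f)"
    by (simp_all add: mean_def variance_def A_def pderiv_pCons power2_eq_square algebra_simps)
  have mB: "mean B = 1" "variance B = s"
    by (simp_all add: mean_def variance_def B_def pderiv_pCons power2_eq_square algebra_simps)
  \<comment> \<open>The shift by \<open>N\<close> equals the mean of the \<open>2 * N\<close> flips,
    so the offset \<open>c\<close> on the other side only has to match the rounded mean plus 1 and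
    is a natural number.\<close>
  define W where "W = A * B * monom 1 N"
  have pW: "prob_poly W" unfolding W_def by (intro prob_poly_mult pA pB prob_poly_monom)
  define c where "c = nat \<lceil>mean P\<rceil> + 1"
  have c: "real c = mean P + f + 1" using mean_nonneg[OF P] by (simp add: c_def f_def)
  define S where "S = monom 1 c * bitp ^ (2 * N)"
  have pS: "prob_poly S" unfolding S_def by (intro prob_poly_mult prob_poly_monom prob_poly_power prob_bit)
  have one: "poly P 1 = 1" "poly A 1 = 1" "poly B 1 = 1" "poly (monom 1 k) 1 = (1::real)" "poly (bitp ^ k) 1 = 1" "poly bitp 1 = 1" for k
    using P pA pB prob_bit prob_poly_power[OF prob_bit] by (auto simp: prob_poly_def poly_monom)
  have mT: "mean (P * W) = mean P + f + 1 + N" "variance (P * W) = N / 2"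
    unfolding W_def by (simp_all add: mean_mult variance_mult one mA mB moments_monom s_def v_def)
  have mS: "mean S = mean P + f + 1 + N" "variance S = N / 2"
    unfolding S_def by (simp_all add: mean_mult variance_mult one moments_power moments_bit moments_monom c)
  have "\<exists>h. P * W - S = [:-1, 1:] ^ 3 * h"
  proof (rule dvd_diff_cube)
    show "poly (P * W - S) 1 = 0" using P pW pS by (simp add: prob_poly_def)
    show 1: "poly (pderiv (P * W - S)) 1 = 0" using mT mS by (simp add: mean_def pderiv_diff)
    show "poly (pderiv (pderiv (P * W - S))) 1 = 0"
      using mT mS by (simp add: variance_def pderiv_diff)
  qed
  \<comment> \<open>The 3 / 2 consists of twice 1 / 4 from rounding the mean and 1 from rounding the
    number of flips.\<close>
  moreover have "real N \<le> 2 * variance P + 3 / 2" using N v1 by linarith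
  ultimately show ?thesis using pW unfolding S_def by blast
qed

text \<open>Lindeberg's replacement argument.\<close>

lemma swap_blocks:
  fixes j :: nat and C \<delta> :: real
  assumes "\<And>i. i < j \<Longrightarrow> prob_poly (T i)" "\<And>i. i < j \<Longrightarrow> prob_poly (S i)"
    and "\<And>i. i < j \<Longrightarrow> T i - S i = [:-1, 1:] ^ 3 * h i" "\<And>i. i < j \<Longrightarrow> norm1 (h i) \<le> C"
    and "norm1 ([:-1, 1:] ^ 3 * K) \<le> \<delta>"
  shows "norm1 (((\<Prod>i<j. T i) - (\<Prod>i<j. S i)) * K) \<le> j * C * \<delta>"
  using assms
proof (induction j)
  case (Suc j)
  let ?A = "\<Prod>i<j. T i" and ?B = "\<Prod>i<j. S i"
  have pp: "prob_poly (\<Prod>i<k. q i)" if "\<And>i. i < k \<Longrightarrow> prob_poly (q i)" for k and q :: "nat \<Rightarrow> real poly"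
    using that by (induction k) (auto intro: prob_poly_mult)
  have pA: "prob_poly ?A" using Suc.prems by (intro pp) auto
  \<comment> \<open>One block is exchanged at a time. The other blocks, \<open>S j\<close> or
    \<open>?A\<close>, are distributions and drop out of the norm, so every exchange is smoothed by
    the reserve \<open>K\<close> alone.\<close>
  have "((\<Prod>i<Suc j. T i) - (\<Prod>i<Suc j. S i)) * K = ((?A - ?B) * K) * S j + ((T j - S j) * K) * ?A"
    by (simp add: algebra_simps)
  hence "norm1 (((\<Prod>i<Suc j. T i) - (\<Prod>i<Suc j. S i)) * K) \<le> norm1 (((?A - ?B) * K) * S j) + norm1 (((T j - S j) * K) * ?A)"
    by (simp add: norm1_add)
  also have "\<dots> \<le> norm1 ((?A - ?B) * K) + norm1 ((T j - S j) * K)"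
    using Suc.prems by (intro add_mono norm1_mult_prob_le pA) auto
  also have "norm1 ((?A - ?B) * K) \<le> j * C * \<delta>" using Suc.prems by (intro Suc.IH) auto
  also have "norm1 ((T j - S j) * K) \<le> C * \<delta>"
  proof -
    have "(T j - S j) * K = h j * ([:-1, 1:] ^ 3 * K)" using Suc.prems by (simp add: mult_ac)
    hence "norm1 ((T j - S j) * K) \<le> norm1 (h j) * norm1 ([:-1, 1:] ^ 3 * K)"
      using norm1_mult[of "h j" "[:-1, 1:] ^ 3 * K"] by (simp only:)
    also have "\<dots> \<le> C * \<delta>" using Suc.prems(4)[of j] Suc.prems(5) order_trans[OF norm1_nonneg Suc.prems(4)[of j]]
      by (intro mult_mono) auto
    finally show ?thesis .
  qed
  finally show ?case by (simp add: algebra_simps)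
qed simp

section \<open>Covariant channels\<close>

lemma coeff_sum_monom_mult:
  fixes r :: "real poly"
  shows "coeff ((\<Sum>j<d. monom (c j) (g j)) * r) x
    = (\<Sum>y\<le>degree r. \<Sum>j<d. if x = g j + y then c j * coeff r y else 0)"
proof -
  have "coeff (monom (c j) (g j) * r) x = (\<Sum>y\<le>degree r. if x = g j + y then c j * coeff r y else 0)" for j
  proof (cases "g j \<le> x \<and> x - g j \<le> degree r")
    case True
    have "(\<Sum>y\<le>degree r. if x = g j + y then c j * coeff r y else 0)
        = (\<Sum>y\<le>degree r. if y = x - g j then c j * coeff r y else 0)"
      using True by (intro sum.cong) auto
    thus ?thesis using True by (simp add: coeff_monom_mult)
  next
    case False
    hence "(\<Sum>y\<le>degree r. if x = g j + y then c j * coeff r y else 0) = 0" by (intro sum.neutral) auto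
    thus ?thesis using False by (auto simp: coeff_monom_mult coeff_eq_0)
  qed
  hence "coeff ((\<Sum>j<d. monom (c j) (g j)) * r) x
    = (\<Sum>j<d. \<Sum>y\<le>degree r. if x = g j + y then c j * coeff r y else 0)"
    by (simp add: sum_distrib_right coeff_sum)
  thus ?thesis by (subst sum.swap)
qed

lemma coeff_sum_monom:
  "coeff (\<Sum>j<d. monom (c j) (g j)) x = (\<Sum>j<d. if g j = x then c j else (0::real))"
  by (simp add: coeff_sum)

text \<open>The channel shifts the energy by the outcome y, taking the amplitude of the output at
  energy x from the input at energy x + y; if the energy distribution of the input is the
  convolution of that of the output with r, the output is exact. The second family of Kraus
  operators discards the remainder of the input space.\<close>

definition kraus_shift :: "nat \<Rightarrow> (nat \<Rightarrow> complex) \<Rightarrow> (nat \<Rightarrow> nat) \<Rightarrow> nat \<Rightarrow> (nat \<Rightarrow> complex) \<Rightarrow> (nat \<Rightarrow> nat)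
    \<Rightarrow> real poly \<Rightarrow> nat + nat \<Rightarrow> nat \<Rightarrow> nat \<Rightarrow> complex" where
  "kraus_shift din \<phi> f dout \<psi> g r =
    (let B = coeff (\<Sum>s<din. monom ((cmod (\<phi> s))\<^sup>2) (f s));
         Q = coeff ((\<Sum>j<dout. monom ((cmod (\<psi> j))\<^sup>2) (g j)) * r)
     in case_sum
      (\<lambda>y j s. if f s = g j + y then complex_of_real (sqrt (coeff r y) / (sqrt (B (f s)) * sqrt (Q (f s)))) * \<psi> j * cnj (\<phi> s) else 0)
      (\<lambda>t j s. if j = 0 then (if t = s then 1 else 0)
         - (if f t = f s \<and> Q (f s) > 0 then \<phi> t * cnj (\<phi> s) / complex_of_real (B (f s)) else 0) else 0))"

text \<open>Applied to \<open>\<phi>\<close>, the operator for shift \<open>y\<close> yields the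
  ideal vector rescaled, at total energy \<open>x\<close>, by the square root of the ratio of the
  coefficients of \<open>B\<close> and of \<open>P * r\<close>. The squared error is therefore a sum
  of squared differences of root probabilities, which the l1 distance dominates. The discarding
  operators have ideal amplitude 0.\<close>

lemma protocol:
  fixes \<phi> \<psi> :: "nat \<Rightarrow> complex" and f g :: "nat \<Rightarrow> nat" and r :: "real poly"
  assumes \<phi>1: "(\<Sum>s<din. (cmod (\<phi> s))\<^sup>2) = 1" and \<psi>1: "(\<Sum>j<dout. (cmod (\<psi> j))\<^sup>2) = 1" and r: "prob_poly r"
    and hin: "\<And>s. s < din \<Longrightarrow> hin s = e0 + \<omega> * real (f s)"
    and hout: "\<And>j. j < dout \<Longrightarrow> \<psi> j \<noteq> 0 \<Longrightarrow> hout j = e1 + \<omega> * real (g j)"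
  defines "B \<equiv> \<Sum>s<din. monom ((cmod (\<phi> s))\<^sup>2) (f s)"
    and "P \<equiv> \<Sum>j<dout. monom ((cmod (\<psi> j))\<^sup>2) (g j)"
    and "K \<equiv> kraus_shift din \<phi> f dout \<psi> g r"
    and "Y \<equiv> {..degree r} <+> {..<din}"
    and "\<alpha> \<equiv> case_sum (\<lambda>y. sqrt (coeff r y)) (\<lambda>t. 0)"
  shows "\<And>a b. a < din \<Longrightarrow> b < din \<Longrightarrow>
      (\<Sum>y\<in>Y. \<Sum>j<dout. cnj (K y j a) * K y j b) = (if a = b then 1 else 0)"
    and "\<And>y. y \<in> Y \<Longrightarrow> \<exists>c. \<forall>j<dout. \<forall>s<din. K y j s \<noteq> 0 \<longrightarrow> hout j - hin s = c"
    and "(\<Sum>y\<in>Y. (\<alpha> y)\<^sup>2) = 1"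
    and "(\<Sum>y\<in>Y. \<Sum>j<dout. (cmod ((\<Sum>s<din. K y j s * \<phi> s) - \<alpha> y * \<psi> j))\<^sup>2) \<le> norm1 (B - P * r)"
proof -
  define b where "b = coeff B"
  define Q where "Q = coeff (P * r)"
  have r0: "coeff r y \<ge> 0" for y using r by (simp add: prob_poly_def)
  have b: "b x = (\<Sum>s<din. if f s = x then (cmod (\<phi> s))\<^sup>2 else 0)" for x
    unfolding b_def B_def by (rule coeff_sum_monom)
  have Q: "Q x = (\<Sum>y\<le>degree r. \<Sum>j<dout. if x = g j + y then (cmod (\<psi> j))\<^sup>2 * coeff r y else 0)" for x
    unfolding Q_def P_def by (rule coeff_sum_monom_mult)
  have b0: "b x \<ge> 0" for x unfolding b by (intro sum_nonneg) auto
  have Q0: "Q x \<ge> 0" for x unfolding Q using r0 by (intro sum_nonneg) auto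
  have bz: "\<phi> s = 0" if "b (f s) = 0" "s < din" for s
  proof -
    have "\<forall>x\<in>{..<din}. (if f x = f s then (cmod (\<phi> x))\<^sup>2 else 0) = 0"
      using that(1) unfolding b by (subst (asm) sum_nonneg_eq_0_iff) auto
    hence "(if f s = f s then (cmod (\<phi> s))\<^sup>2 else 0) = 0" using that(2) by blast
    thus ?thesis by simp
  qed
  \<comment> \<open>On each energy level where \<open>Q\<close> is positive, the projector onto the
    component of \<open>\<phi>\<close> in that level. The shift operators account for this projector
    and the discarding operators for its complement.\<close>
  define Prj where "Prj = (\<lambda>t s. if f t = f s \<and> Q (f s) > 0 then \<phi> t * cnj (\<phi> s) / complex_of_real (b (f s)) else 0)"
  \<comment> \<open>Division by zero makes it 0 where \<open>b x\<close> or \<open>Q x\<close>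
    vanishes. In the first case \<open>\<phi>\<close> has no component at the level, in the second
    the level is left to the discarding operators.\<close>
  define \<gamma> where "\<gamma> = (\<lambda>x. 1 / (sqrt (b x) * sqrt (Q x)))"
  have KL: "K (Inl y) j s = (if f s = g j + y then complex_of_real (sqrt (coeff r y) * \<gamma> (f s)) * \<psi> j * cnj (\<phi> s) else 0)" for y j s
    unfolding K_def kraus_shift_def Let_def P_def[symmetric] B_def[symmetric] Q_def[symmetric] b_def[symmetric] \<gamma>_def by simp
  have KR: "K (Inr t) j s = (if j = 0 then (if t = s then 1 else 0) - Prj t s else 0)" for t j s
    unfolding K_def kraus_shift_def Let_def P_def[symmetric] B_def[symmetric] Q_def[symmetric] b_def[symmetric] Prj_def by simp
  have sumY: "(\<Sum>y\<in>Y. h y) = (\<Sum>y\<le>degree r. h (Inl y)) + (\<Sum>t<din. h (Inr t))" for h :: "nat + nat \<Rightarrow> 'b::comm_monoid_add"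
    unfolding Y_def by (simp add: sum.Plus)
  have dout: "dout > 0" using \<psi>1 by (cases "dout = 0") auto
  have first: "(\<Sum>j<dout. if j = 0 then h else 0) = h" for h :: "'b::comm_monoid_add" using dout by simp
  have \<gamma>2: "\<gamma> x * \<gamma> x * Q x = (if Q x > 0 then 1 / b x else 0)" for x
  proof -
    have "sqrt (b x) * sqrt (b x) = b x" "sqrt (Q x) * sqrt (Q x) = Q x" using b0 Q0 by auto
    hence "\<gamma> x * \<gamma> x = 1 / (b x * Q x)" by (simp add: \<gamma>_def mult_ac)
    thus ?thesis using Q0[of x] by auto
  qed
  have TP1: "(\<Sum>y\<le>degree r. \<Sum>j<dout. cnj (K (Inl y) j s) * K (Inl y) j t) = Prj s t" if st: "s < din" "t < din" for s t
  proof (cases "f s = f t")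
    case False
    hence "(\<Sum>y\<le>degree r. \<Sum>j<dout. cnj (K (Inl y) j s) * K (Inl y) j t) = 0"
      by (intro sum.neutral ballI) (auto simp: KL)
    thus ?thesis using False by (simp add: Prj_def)
  next
    case True
    have "(\<Sum>y\<le>degree r. \<Sum>j<dout. cnj (K (Inl y) j s) * K (Inl y) j t)
      = (\<Sum>y\<le>degree r. \<Sum>j<dout. \<phi> s * cnj (\<phi> t) * complex_of_real (\<gamma> (f t) * \<gamma> (f t) * (if f t = g j + y then (cmod (\<psi> j))\<^sup>2 * coeff r y else 0)))"
    proof (intro sum.cong refl)
      fix y j
      have "complex_of_real (sqrt (coeff r y)) * complex_of_real (sqrt (coeff r y)) = complex_of_real (coeff r y)"
        using r0 by (simp flip: of_real_mult)
      moreover have "complex_of_real ((cmod (\<psi> j))\<^sup>2) = \<psi> j * cnj (\<psi> j)" by (simp add: cmod_sq)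
      ultimately show "cnj (K (Inl y) j s) * K (Inl y) j t = \<phi> s * cnj (\<phi> t) * complex_of_real (\<gamma> (f t) * \<gamma> (f t) * (if f t = g j + y then (cmod (\<psi> j))\<^sup>2 * coeff r y else 0))"
        using True by (auto simp: KL mult_ac simp del: of_real_power)
    qed
    also have "\<dots> = \<phi> s * cnj (\<phi> t) * complex_of_real (\<gamma> (f t) * \<gamma> (f t) * Q (f t))"
      unfolding Q by (simp add: sum_distrib_left)
    also have "\<dots> = Prj s t" unfolding \<gamma>2 using True by (simp add: Prj_def)
    finally show ?thesis .
  qed
  have Prjh: "cnj (Prj s t) = Prj t s" for s t by (auto simp: Prj_def mult_ac)
  have Prjp: "(\<Sum>u<din. Prj s u * Prj u t) = Prj s t" if st: "s < din" "t < din" for s t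
  proof (cases "f s = f t \<and> Q (f t) > 0")
    case False
    hence "(\<Sum>u<din. Prj s u * Prj u t) = 0" by (intro sum.neutral) (auto simp: Prj_def)
    thus ?thesis using False by (auto simp: Prj_def)
  next
    case True
    have "(\<Sum>u<din. Prj s u * Prj u t) = (\<Sum>u<din. \<phi> s * cnj (\<phi> t) / (complex_of_real (b (f t)))\<^sup>2 * complex_of_real (if f u = f t then (cmod (\<phi> u))\<^sup>2 else 0))"
      using True by (intro sum.cong refl) (auto simp: Prj_def power2_eq_square cmod_sq[unfolded power2_eq_square] mult_ac)
    also have "\<dots> = \<phi> s * cnj (\<phi> t) / (complex_of_real (b (f t)))\<^sup>2 * complex_of_real (b (f t))"
      unfolding b by (simp add: sum_distrib_left)
    also have "\<dots> = Prj s t" using True bz[OF _ st(2)] by (auto simp: Prj_def power2_eq_square)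
    finally show ?thesis .
  qed
  show TP: "(\<Sum>y\<in>Y. \<Sum>j<dout. cnj (K y j s) * K y j t) = (if s = t then 1 else 0)" if st: "s < din" "t < din" for s t
  proof -
    have "(\<Sum>u<din. \<Sum>j<dout. cnj (K (Inr u) j s) * K (Inr u) j t)
       = (\<Sum>u<din. ((if u = s then 1 else 0) - Prj s u) * ((if u = t then 1 else 0) - Prj u t))"
    proof (intro sum.cong refl)
      fix u
      have "(\<Sum>j<dout. cnj (K (Inr u) j s) * K (Inr u) j t)
        = (\<Sum>j<dout. if j = 0 then ((if u = s then 1 else 0) - Prj s u) * ((if u = t then 1 else 0) - Prj u t) else 0)"
        by (intro sum.cong refl) (auto simp: KR Prjh)
      thus "(\<Sum>j<dout. cnj (K (Inr u) j s) * K (Inr u) j t) = ((if u = s then 1 else 0) - Prj s u) * ((if u = t then 1 else 0) - Prj u t)"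
        unfolding first .
    qed
    also have "\<dots> = (\<Sum>u<din. (if u = s then (if s = t then 1 else 0) else 0) - (if u = s then Prj s t else 0)
        - (if u = t then Prj s t else 0) + Prj s u * Prj u t)"
      by (intro sum.cong refl) (auto simp: algebra_simps)
    also have "\<dots> = (if s = t then 1 else 0) - Prj s t"
      unfolding sum.distrib sum_subtractf Prjp[OF st] using st by simp
    finally show ?thesis unfolding sumY TP1[OF st] by simp
  qed
  show "\<exists>c. \<forall>j<dout. \<forall>s<din. K y j s \<noteq> 0 \<longrightarrow> hout j - hin s = c" if y: "y \<in> Y" for y
  proof (cases y)
    case (Inl k)
    show ?thesis
    proof (intro exI[of _ "e1 - e0 - \<omega> * real k"] allI impI)
      fix j s assume *: "j < dout" "s < din" "K y j s \<noteq> 0"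
      hence "f s = g j + k" "\<psi> j \<noteq> 0" unfolding Inl KL by (auto split: if_splits)
      thus "hout j - hin s = e1 - e0 - \<omega> * real k" using * by (simp add: hin hout algebra_simps)
    qed
  next
    case (Inr t)
    \<comment> \<open>A discarding operator reads a single input energy and writes basis state 0, so
      its energy difference is constant as well.\<close>
    show ?thesis
    proof (intro exI[of _ "hout 0 - e0 - \<omega> * real (f t)"] allI impI)
      fix j s assume *: "j < dout" "s < din" "K y j s \<noteq> 0"
      hence "j = 0" "f t = f s" unfolding Inr KR by (auto simp: Prj_def split: if_splits)
      thus "hout j - hin s = hout 0 - e0 - \<omega> * real (f t)" using * by (simp add: hin)
    qed
  qed
  have "(\<Sum>y\<in>Y. (\<alpha> y)\<^sup>2) = (\<Sum>y\<le>degree r. coeff r y)" unfolding sumY using r0 by (simp add: \<alpha>_def)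
  thus "(\<Sum>y\<in>Y. (\<alpha> y)\<^sup>2) = 1" using r poly_moment_sums(1)[of r "degree r"] by (simp add: prob_poly_def)
  have v1: "(\<Sum>s<din. K (Inl y) j s * \<phi> s) = complex_of_real (sqrt (coeff r y) * (\<gamma> (g j + y) * b (g j + y))) * \<psi> j" for y j
  proof -
    have "(\<Sum>s<din. K (Inl y) j s * \<phi> s) = (\<Sum>s<din. complex_of_real (sqrt (coeff r y) * (\<gamma> (g j + y) * (if f s = g j + y then (cmod (\<phi> s))\<^sup>2 else 0))) * \<psi> j)"
      by (intro sum.cong refl) (auto simp: KL cmod_sq mult_ac)
    thus ?thesis unfolding b by (simp add: sum_distrib_left sum_distrib_right)
  qed
  have v2: "(\<Sum>s<din. K (Inr t) j s * \<phi> s) = (if j = 0 then if Q (f t) > 0 then 0 else \<phi> t else 0)" if t: "t < din" for t j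
  proof (cases "j = 0")
    case True
    have "(\<Sum>s<din. K (Inr t) j s * \<phi> s) = (\<Sum>s<din. (if s = t then \<phi> t else 0) - Prj t s * \<phi> s)"
      using True by (intro sum.cong refl) (auto simp: KR algebra_simps)
    also have "\<dots> = \<phi> t - (\<Sum>s<din. Prj t s * \<phi> s)" using t by (simp add: sum_subtractf)
    also have "(\<Sum>s<din. Prj t s * \<phi> s) = (if Q (f t) > 0 then \<phi> t else 0)"
    proof (cases "Q (f t) > 0")
      case Qp: True
      have "(\<Sum>s<din. Prj t s * \<phi> s) = (\<Sum>s<din. \<phi> t / complex_of_real (b (f t)) * complex_of_real (if f s = f t then (cmod (\<phi> s))\<^sup>2 else 0))"
        using Qp by (intro sum.cong refl) (auto simp: Prj_def cmod_sq mult_ac)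
      also have "\<dots> = \<phi> t / complex_of_real (b (f t)) * complex_of_real (b (f t))"
        unfolding b by (simp add: sum_distrib_left)
      finally show ?thesis using Qp bz[OF _ t] by auto
    qed (auto simp: Prj_def intro!: sum.neutral)
    finally show ?thesis using True by simp
  qed (simp add: KR)
  define M where "M = Max ((\<lambda>(y,j). g j + y) ` ({..degree r} \<times> {..<dout}) \<union> f ` {..<din} \<union> {degree (B - P * r)})"
  have M: "y \<le> degree r \<Longrightarrow> j < dout \<Longrightarrow> g j + y \<le> M" "s < din \<Longrightarrow> f s \<le> M" "degree (B - P * r) \<le> M" for y j s
    unfolding M_def by (auto intro!: Max_ge)
  have regroup: "(\<Sum>y\<le>degree r. \<Sum>j<dout. h (g j + y) * ((cmod (\<psi> j))\<^sup>2 * coeff r y)) = (\<Sum>x\<le>M. h x * Q x)" for h :: "nat \<Rightarrow> real"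
  proof -
    have "(\<Sum>x\<le>M. h x * Q x) = (\<Sum>x\<le>M. \<Sum>y\<le>degree r. \<Sum>j<dout. if x = g j + y then h x * ((cmod (\<psi> j))\<^sup>2 * coeff r y) else 0)"
      unfolding Q sum_distrib_left by (intro sum.cong refl) auto
    also have "\<dots> = (\<Sum>y\<le>degree r. \<Sum>x\<le>M. \<Sum>j<dout. if x = g j + y then h x * ((cmod (\<psi> j))\<^sup>2 * coeff r y) else 0)"
      by (rule sum.swap)
    also have "\<dots> = (\<Sum>y\<le>degree r. \<Sum>j<dout. \<Sum>x\<le>M. if x = g j + y then h x * ((cmod (\<psi> j))\<^sup>2 * coeff r y) else 0)"
      by (intro sum.cong refl sum.swap)
    also have "\<dots> = (\<Sum>y\<le>degree r. \<Sum>j<dout. h (g j + y) * ((cmod (\<psi> j))\<^sup>2 * coeff r y))"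
      using M(1) by (intro sum.cong refl) auto
    finally show ?thesis ..
  qed
  have regroup2: "(\<Sum>t<din. h (f t) * (cmod (\<phi> t))\<^sup>2) = (\<Sum>x\<le>M. h x * b x)" for h :: "nat \<Rightarrow> real"
  proof -
    have "(\<Sum>x\<le>M. h x * b x) = (\<Sum>x\<le>M. \<Sum>t<din. if f t = x then h x * (cmod (\<phi> t))\<^sup>2 else 0)"
      unfolding b sum_distrib_left by (intro sum.cong refl) auto
    also have "\<dots> = (\<Sum>t<din. \<Sum>x\<le>M. if f t = x then h x * (cmod (\<phi> t))\<^sup>2 else 0)" by (rule sum.swap)
    also have "\<dots> = (\<Sum>t<din. h (f t) * (cmod (\<phi> t))\<^sup>2)" using M(2) by (intro sum.cong refl) simp
    finally show ?thesis ..
  qed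
  have "(\<Sum>y\<in>Y. \<Sum>j<dout. (cmod ((\<Sum>s<din. K y j s * \<phi> s) - \<alpha> y * \<psi> j))\<^sup>2)
     = (\<Sum>y\<le>degree r. \<Sum>j<dout. (\<gamma> (g j + y) * b (g j + y) - 1)\<^sup>2 * ((cmod (\<psi> j))\<^sup>2 * coeff r y))
       + (\<Sum>t<din. (if Q (f t) > 0 then 0 else 1) * (cmod (\<phi> t))\<^sup>2)"
  proof -
    have "(cmod ((\<Sum>s<din. K (Inl y) j s * \<phi> s) - \<alpha> (Inl y) * \<psi> j))\<^sup>2
       = (\<gamma> (g j + y) * b (g j + y) - 1)\<^sup>2 * ((cmod (\<psi> j))\<^sup>2 * coeff r y)" for y j
    proof -
      have "(\<Sum>s<din. K (Inl y) j s * \<phi> s) - \<alpha> (Inl y) * \<psi> j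
        = complex_of_real (sqrt (coeff r y) * (\<gamma> (g j + y) * b (g j + y) - 1)) * \<psi> j"
        unfolding v1 by (simp add: \<alpha>_def algebra_simps)
      thus ?thesis using r0 by (simp only: norm_mult norm_of_real power_mult_distrib power2_abs) (simp add: mult_ac)
    qed
    moreover have "(\<Sum>j<dout. (cmod ((\<Sum>s<din. K (Inr t) j s * \<phi> s) - \<alpha> (Inr t) * \<psi> j))\<^sup>2)
        = (if Q (f t) > 0 then 0 else 1) * (cmod (\<phi> t))\<^sup>2" if "t < din" for t
    proof -
      have "(\<Sum>j<dout. (cmod ((\<Sum>s<din. K (Inr t) j s * \<phi> s) - \<alpha> (Inr t) * \<psi> j))\<^sup>2)
        = (\<Sum>j<dout. if j = 0 then (if Q (f t) > 0 then 0 else 1) * (cmod (\<phi> t))\<^sup>2 else 0)"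
        unfolding v2[OF that] by (intro sum.cong refl) (auto simp: \<alpha>_def)
      thus ?thesis unfolding first .
    qed
    ultimately show ?thesis unfolding sumY by simp
  qed
  also have "\<dots> = (\<Sum>x\<le>M. (\<gamma> x * b x - 1)\<^sup>2 * Q x + (if Q x > 0 then 0 else 1) * b x)"
    unfolding regroup[of "\<lambda>x. (\<gamma> x * b x - 1)\<^sup>2"] regroup2[of "\<lambda>x. if Q x > 0 then 0 else 1"] sum.distrib ..
  \<comment> \<open>Levels with positive \<open>Q\<close> contribute the squared difference of root
    probabilities; on the others the whole input weight is lost, and it equals the l1 difference
    there.\<close>
  also have "\<dots> \<le> (\<Sum>x\<le>M. \<bar>b x - Q x\<bar>)"
  proof (intro sum_mono)
    fix x
    show "(\<gamma> x * b x - 1)\<^sup>2 * Q x + (if Q x > 0 then 0 else 1) * b x \<le> \<bar>b x - Q x\<bar>"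
    proof (cases "Q x > 0")
      case True
      have sb: "sqrt (b x) * sqrt (b x) = b x" using b0 by simp
      have "\<gamma> x * b x = 1 / (sqrt (b x) * sqrt (Q x)) * (sqrt (b x) * sqrt (b x))"
        by (simp only: sb \<gamma>_def)
      also have "\<dots> = sqrt (b x) / sqrt (Q x)"
      proof -
        have "1 / (s * t) * (s * s) = s / t" for s t :: real by (cases "s = 0") simp_all
        thus ?thesis .
      qed
      finally have "\<gamma> x * b x = sqrt (b x) / sqrt (Q x)" .
      hence "(\<gamma> x * b x - 1) * sqrt (Q x) = sqrt (b x) - sqrt (Q x)"
        using True by (simp add: field_simps)
      hence "(\<gamma> x * b x - 1)\<^sup>2 * Q x = (sqrt (b x) - sqrt (Q x))\<^sup>2"
        using True by (metis less_imp_le power_mult_distrib real_sqrt_pow2)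
      thus ?thesis using True sqrt_diff_sq_le[OF b0 Q0, of x x] by simp
    next
      case False
      hence "Q x = 0" using Q0[of x] by simp
      thus ?thesis using b0[of x] by simp
    qed
  qed
  also have "\<dots> = norm1 (B - P * r)"
    unfolding norm1_altdef[OF M(3)] by (simp add: b_def Q_def)
  finally show "(\<Sum>y\<in>Y. \<Sum>j<dout. (cmod ((\<Sum>s<din. K y j s * \<phi> s) - \<alpha> y * \<psi> j))\<^sup>2) \<le> norm1 (B - P * r)" .
qed

section \<open>Channels from Kraus families with definite energy change\<close>

lemma conj_msum_entry:
  assumes X: "X \<in> carrier_mat d d" and Ms: "\<And>M. M \<in> set Ms \<Longrightarrow> M \<in> carrier_mat d d" and ij: "i < d" "j < d"
  shows "(adj X * msum d Ms * X) $$ (i,j) = (\<Sum>M\<leftarrow>Ms. (adj X * M * X) $$ (i,j))"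
  using Ms
proof (induction Ms)
  case Nil
  have "(0\<^sub>m d d :: complex mat) \<in> carrier_mat d d" by simp
  thus ?case using conj_entry[OF X _ ij, of "0\<^sub>m d d"] by (simp add: msum_def del: index_mult_mat)
next
  case (Cons M Ms)
  have M: "M \<in> carrier_mat d d" and S: "msum d Ms \<in> carrier_mat d d"
    using Cons.prems by auto
  have c: "M + msum d Ms \<in> carrier_mat d d" using M S by simp
  have "(adj X * msum d (M # Ms) * X) $$ (i,j) = (adj X * (M + msum d Ms) * X) $$ (i,j)"
    by (simp add: msum_def)
  also have "\<dots> = (adj X * M * X) $$ (i,j) + (adj X * msum d Ms * X) $$ (i,j)"
    unfolding conj_entry[OF X c ij] conj_entry[OF X M ij] conj_entry[OF X S ij] sum.distrib[symmetric]
    using M S by (intro sum.cong refl) (simp add: algebra_simps)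
  finally show ?case using Cons by simp
qed

text \<open>In the energy bases each operator \<open>K y\<close> changes the energy by one fixed
  amount. It therefore commutes with the evolutions up to a phase, which cancels against that of its
  adjoint. The index type is arbitrary so that Kraus operators can be labelled by sums and
  pairs.\<close>

lemma ti_channel:
  fixes K :: "'y \<Rightarrow> nat \<Rightarrow> nat \<Rightarrow> complex"
  assumes fin: "finite Y" and W: "unitary dout W" and Hout: "Hout = W * rdiag dout hout * adj W"
    and Hin: "Hin = 1\<^sub>m din * rdiag din hin * adj (1\<^sub>m din)"
    and tp: "\<And>a b. a < din \<Longrightarrow> b < din \<Longrightarrow>
      (\<Sum>y\<in>Y. \<Sum>j<dout. cnj (K y j a) * K y j b) = (if a = b then 1 else 0)"
    and cov: "\<And>y. y \<in> Y \<Longrightarrow> \<exists>c. \<forall>j<dout. \<forall>s<din. K y j s \<noteq> 0 \<longrightarrow> hout j - hin s = c"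
  shows "\<exists>E. ti_op din Hin dout Hout E \<and> (\<forall>\<sigma>\<in>carrier_mat din din. \<forall>i<dout. \<forall>j<dout.
     (adj W * E \<sigma> * W) $$ (i,j) = (\<Sum>y\<in>Y. \<Sum>a<din. \<Sum>b<din. K y i a * \<sigma> $$ (a,b) * cnj (K y j b)))"
proof -
  from finite_distinct_list[OF fin] obtain ys where ys: "set ys = Y" "distinct ys" by blast
  note w = unitaryD[OF W]
  have cW: "adj W \<in> carrier_mat dout dout" using w by simp
  define k where "k = (\<lambda>y. mat dout din (\<lambda>(j,s). K y j s))"
  have kc: "k y \<in> carrier_mat dout din" for y by (simp add: k_def)
  define M where "M = (\<lambda>y. W * k y)"
  have Mc: "M y \<in> carrier_mat dout din" for y unfolding M_def by (rule mult_carrier_mat[OF w(1) kc])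
  define E where "E = (\<lambda>\<sigma>. msum dout (map (\<lambda>M. M * \<sigma> * adj M) (map M ys)))"
  have term_c: "M y * \<sigma> * adj (M y) \<in> carrier_mat dout dout" if "\<sigma> \<in> carrier_mat din din" for y \<sigma>
    by (rule mult_carrier_mat[OF mult_carrier_mat[OF Mc that] adj_carrier[OF Mc]])
  have Ec: "E \<sigma> \<in> carrier_mat dout dout" if "\<sigma> \<in> carrier_mat din din" for \<sigma>
    unfolding E_def using term_c[OF that] by (intro msum_carrier) auto
  have Ee: "(adj W * E \<sigma> * W) $$ (i,j) = (\<Sum>y\<in>Y. \<Sum>a<din. \<Sum>b<din. K y i a * \<sigma> $$ (a,b) * cnj (K y j b))"
    if s: "\<sigma> \<in> carrier_mat din din" and ij: "i < dout" "j < dout" for \<sigma> i j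
  proof -
    have eq: "adj W * (M y * \<sigma> * adj (M y)) * W = k y * \<sigma> * adj (k y)" for y
    proof -
      have ks: "k y * \<sigma> \<in> carrier_mat dout din" by (rule mult_carrier_mat[OF kc s])
      have kk: "k y * \<sigma> * adj (k y) \<in> carrier_mat dout dout"
        by (rule mult_carrier_mat[OF ks adj_carrier[OF kc]])
      have "M y * \<sigma> * adj (M y) = W * (k y * \<sigma>) * (adj (k y) * adj W)"
        unfolding M_def adj_mult[OF w(1) kc] assoc_mult_mat[OF w(1) kc s] ..
      also have "\<dots> = W * (k y * \<sigma> * adj (k y)) * adj W"
        by (rule assoc4[OF w(1) ks adj_carrier[OF kc] cW])
      finally show ?thesis using conj_conj(2)[OF W kk] by simp
    qed
    have "(adj W * E \<sigma> * W) $$ (i,j) = (\<Sum>y\<leftarrow>ys. (adj W * (M y * \<sigma> * adj (M y)) * W) $$ (i,j))"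
      unfolding E_def using term_c[OF s] by (subst conj_msum_entry[OF w(1) _ ij]) (auto simp: o_def)
    also have "\<dots> = (\<Sum>y\<in>Y. (k y * \<sigma> * adj (k y)) $$ (i,j))"
      unfolding eq ys(1)[symmetric] by (rule sum_list_distinct_conv_sum_set[OF ys(2)])
    also have "\<dots> = (\<Sum>y\<in>Y. \<Sum>a<din. \<Sum>b<din. K y i a * \<sigma> $$ (a,b) * cnj (K y j b))"
      unfolding kraus_entry[OF kc s ij] using ij by (simp add: k_def)
    finally show ?thesis .
  qed
  have "msum din (map (\<lambda>K. adj K * K) (map M ys)) = 1\<^sub>m din"
  proof (rule eq_matI)
    have Gc: "adj (M y) * M y \<in> carrier_mat din din" for y
      by (rule mult_carrier_mat[OF adj_carrier[OF Mc] Mc])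
    have G: "adj (M y) * M y = adj (k y) * k y" for y
    proof -
      have "adj (M y) * M y = (adj (k y) * adj W) * (W * k y)" unfolding M_def adj_mult[OF w(1) kc] ..
      also have "\<dots> = adj (k y) * (adj W * W) * k y" by (rule assoc4[OF adj_carrier[OF kc] cW w(1) kc])
      also have "\<dots> = adj (k y) * k y" unfolding w(2) using right_mult_one_mat[OF adj_carrier[OF kc]] by simp
      finally show ?thesis .
    qed
    have c: "msum din (map (\<lambda>K. adj K * K) (map M ys)) \<in> carrier_mat din din"
      using Gc by (intro msum_carrier) auto
    show "dim_row (msum din (map (\<lambda>K. adj K * K) (map M ys))) = dim_row (1\<^sub>m din :: complex mat)"
      "dim_col (msum din (map (\<lambda>K. adj K * K) (map M ys))) = dim_col (1\<^sub>m din :: complex mat)"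
      using c by (auto simp del: map_map)
    fix a b assume "a < dim_row (1\<^sub>m din :: complex mat)" "b < dim_col (1\<^sub>m din :: complex mat)"
    hence ab: "a < din" "b < din" by auto
    have "msum din (map (\<lambda>K. adj K * K) (map M ys)) $$ (a,b) = (\<Sum>y\<leftarrow>ys. (adj (M y) * M y) $$ (a,b))"
      using Gc by (subst msum_entry[OF _ ab]) (auto simp: o_def)
    also have "\<dots> = (\<Sum>y\<in>Y. (adj (k y) * k y) $$ (a,b))"
      unfolding G ys(1)[symmetric] by (rule sum_list_distinct_conv_sum_set[OF ys(2)])
    also have "\<dots> = (\<Sum>y\<in>Y. \<Sum>j<dout. cnj (K y j a) * K y j b)"
      unfolding kraus_gram_entry[OF kc ab] using ab by (simp add: k_def)
    finally show "msum din (map (\<lambda>K. adj K * K) (map M ys)) $$ (a,b) = 1\<^sub>m din $$ (a,b)"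
      using tp[OF ab] ab by simp
  qed
  hence "cptp din dout E" unfolding cptp_def
    by (intro exI[of _ "map M ys"] conjI) (use Mc in \<open>auto simp: E_def\<close>)
  moreover have "evol Hout t (E \<sigma>) = E (evol Hin t \<sigma>)" if s: "\<sigma> \<in> carrier_mat din din" for \<sigma> t
  proof (rule conj_inject[OF W])
    note U1 = unitary_one[of din]
    have "adj (1\<^sub>m din) = (1\<^sub>m din :: complex mat)" by (rule eq_matI) (auto simp: adj_def)
    hence one: "adj (1\<^sub>m din) * A * 1\<^sub>m din = A" if "A \<in> carrier_mat din din" for A :: "complex mat"
      using that by simp
    have es: "evol Hin t \<sigma> \<in> carrier_mat din din" by (rule evol_carrier[OF U1 Hin s])
    show c1: "evol Hout t (E \<sigma>) \<in> carrier_mat dout dout" by (rule evol_carrier[OF W Hout Ec[OF s]])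
    show c2: "E (evol Hin t \<sigma>) \<in> carrier_mat dout dout" by (rule Ec[OF es])
    show "adj W * evol Hout t (E \<sigma>) * W = adj W * E (evol Hin t \<sigma>) * W"
    proof (rule eq_matI)
      fix i j assume "i < dim_row (adj W * E (evol Hin t \<sigma>) * W)" "j < dim_col (adj W * E (evol Hin t \<sigma>) * W)"
      hence ij: "i < dout" "j < dout" using w by auto
      have "(adj W * evol Hout t (E \<sigma>) * W) $$ (i,j) = (\<Sum>y\<in>Y. \<Sum>a<din. \<Sum>b<din.
          cis (- (hout i - hout j) * t) * (K y i a * \<sigma> $$ (a,b) * cnj (K y j b)))"
        unfolding evol_entry[OF W Hout Ec[OF s] ij] Ee[OF s ij] sum_distrib_left ..
      also have "\<dots> = (\<Sum>y\<in>Y. \<Sum>a<din. \<Sum>b<din. K y i a * evol Hin t \<sigma> $$ (a,b) * cnj (K y j b))"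
      proof (intro sum.cong refl)
        fix y a b assume *: "y \<in> Y" "a \<in> {..<din}" "b \<in> {..<din}"
        have ev: "evol Hin t \<sigma> $$ (a,b) = cis (- (hin a - hin b) * t) * \<sigma> $$ (a,b)"
          using evol_entry[OF U1 Hin s, of a b t] * unfolding one[OF es] one[OF s] by simp
        show "cis (- (hout i - hout j) * t) * (K y i a * \<sigma> $$ (a,b) * cnj (K y j b))
           = K y i a * evol Hin t \<sigma> $$ (a,b) * cnj (K y j b)"
        proof (cases "K y i a = 0 \<or> K y j b = 0")
          case False
          from cov[OF *(1)] obtain c where "\<forall>j<dout. \<forall>s<din. K y j s \<noteq> 0 \<longrightarrow> hout j - hin s = c" by blast
          hence "hout i - hin a = c" "hout j - hin b = c" using * ij False by auto
          hence "hout i - hout j = hin a - hin b" by simp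
          thus ?thesis unfolding ev by (simp add: mult_ac)
        qed auto
      qed
      also have "\<dots> = (adj W * E (evol Hin t \<sigma>) * W) $$ (i,j)" unfolding Ee[OF es ij] ..
      finally show "(adj W * evol Hout t (E \<sigma>) * W) $$ (i,j) = (adj W * E (evol Hin t \<sigma>) * W) $$ (i,j)" .
    qed (use w c1 c2 in auto)
  qed
  ultimately have "ti_op din Hin dout Hout E" by (simp add: ti_op_def)
  thus ?thesis using Ee by blast
qed

text \<open>The index \<open>y\<close> labels branches of an environment, so that \<open>v\<close>
  and \<open>u\<close> are purifications at squared distance at most \<delta>. A difference of
  squared moduli is at most |z - w| (|z| + |w|), and the Cauchy-Schwarz inequality over outcomes and
  branches leaves \<open>sqrt \<delta>\<close> times a norm of at most 2.\<close>

lemma ensemble_distance: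
  fixes v u :: "'y \<Rightarrow> nat \<Rightarrow> complex"
  assumes V: "unitary d V" and D: "D \<in> carrier_mat d d"
    and De: "\<And>i j. i < d \<Longrightarrow> j < d \<Longrightarrow> D $$ (i,j) = (\<Sum>y\<in>Y. v y i * cnj (v y j) - u y i * cnj (u y j))"
    and v1: "(\<Sum>y\<in>Y. \<Sum>i<d. (cmod (v y i))\<^sup>2) = 1" and u1: "(\<Sum>y\<in>Y. \<Sum>i<d. (cmod (u y i))\<^sup>2) = 1"
    and vu: "(\<Sum>y\<in>Y. \<Sum>i<d. (cmod (v y i - u y i))\<^sup>2) \<le> \<delta>"
  shows "(\<Sum>x<d. cmod ((adj V * D * V) $$ (x,x))) \<le> 2 * sqrt \<delta>"
proof -
  define a where "a = (\<lambda>w x. \<Sum>i<d. cnj (V $$ (i,x)) * w i)"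
  have pars: "(\<Sum>x<d. (cmod (a w x))\<^sup>2) = (\<Sum>i<d. (cmod (w i))\<^sup>2)" for w
  proof -
    have "cmod (a w x) = cmod (\<Sum>i<d. V $$ (i,x) * cnj (w i))" for x
      unfolding a_def by (subst complex_mod_cnj[symmetric]) (simp add: cnj_sum)
    thus ?thesis using parseval[OF V, of "\<lambda>i. cnj (w i)"] by simp
  qed
  have lin: "a (\<lambda>i. w i - w' i) x = a w x - a w' x" for w w' x
    by (simp add: a_def sum_subtractf right_diff_distrib)
  have diag: "(adj V * D * V) $$ (x,x) = (\<Sum>y\<in>Y. a (v y) x * cnj (a (v y) x) - a (u y) x * cnj (a (u y) x))" if x: "x < d" for x
  proof -
    have "(adj V * D * V) $$ (x,x) = (\<Sum>i<d. \<Sum>j<d. \<Sum>y\<in>Y. cnj (V $$ (i,x)) * (v y i * cnj (v y j) - u y i * cnj (u y j)) * V $$ (j,x))"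
      unfolding conj_entry[OF unitaryD(1)[OF V] D x x]
      by (intro sum.cong refl) (simp add: De sum_distrib_left sum_distrib_right)
    also have "\<dots> = (\<Sum>i<d. \<Sum>y\<in>Y. \<Sum>j<d. cnj (V $$ (i,x)) * (v y i * cnj (v y j) - u y i * cnj (u y j)) * V $$ (j,x))"
      by (intro sum.cong refl sum.swap)
    also have "\<dots> = (\<Sum>y\<in>Y. \<Sum>i<d. \<Sum>j<d. cnj (V $$ (i,x)) * (v y i * cnj (v y j) - u y i * cnj (u y j)) * V $$ (j,x))"
      by (rule sum.swap)
    also have "\<dots> = (\<Sum>y\<in>Y. a (v y) x * cnj (a (v y) x) - a (u y) x * cnj (a (u y) x))"
      unfolding a_def cnj_sum sum_product sum_subtractf[symmetric]
      by (intro sum.cong refl) (simp add: algebra_simps)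
    finally show ?thesis .
  qed
  have bnd: "cmod (z * cnj z - w * cnj w) \<le> cmod (z - w) * (cmod z + cmod w)" for z w :: complex
  proof -
    have "z * cnj z - w * cnj w = complex_of_real ((cmod z)\<^sup>2 - (cmod w)\<^sup>2)" by (simp add: cmod_sq)
    hence "cmod (z * cnj z - w * cnj w) = \<bar>(cmod z)\<^sup>2 - (cmod w)\<^sup>2\<bar>" by (metis norm_of_real)
    also have "\<dots> = \<bar>cmod z - cmod w\<bar> * (cmod z + cmod w)"
      by (simp add: power2_eq_square square_diff_square_factored abs_mult)
    also have "\<dots> \<le> cmod (z - w) * (cmod z + cmod w)"
      by (intro mult_right_mono norm_triangle_ineq3) auto
    finally show ?thesis .
  qed
  let ?S = "{..<d} \<times> Y"
  have "(\<Sum>x<d. cmod ((adj V * D * V) $$ (x,x)))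
      \<le> (\<Sum>x<d. \<Sum>y\<in>Y. cmod (a (v y) x - a (u y) x) * (cmod (a (v y) x) + cmod (a (u y) x)))"
    by (intro sum_mono) (simp add: diag bnd sum_norm_le del: index_mult_mat)
  also have "\<dots> = (\<Sum>(x,y)\<in>?S. cmod (a (v y) x - a (u y) x) * (cmod (a (v y) x) + cmod (a (u y) x)))"
    by (rule sum.cartesian_product)
  also have "\<dots> \<le> sqrt (\<Sum>(x,y)\<in>?S. (cmod (a (v y) x - a (u y) x))\<^sup>2) * sqrt (\<Sum>(x,y)\<in>?S. (cmod (a (v y) x) + cmod (a (u y) x))\<^sup>2)"
    using Cauchy_Schwarz_sum[of "\<lambda>(x,y). cmod (a (v y) x - a (u y) x)" "\<lambda>(x,y). cmod (a (v y) x) + cmod (a (u y) x)" ?S]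
    by (simp add: case_prod_beta)
  also have "\<dots> \<le> sqrt \<delta> * sqrt 4"
  proof (intro mult_mono real_sqrt_le_mono)
    have "(\<Sum>(x,y)\<in>?S. (cmod (a (v y) x - a (u y) x))\<^sup>2) = (\<Sum>x<d. \<Sum>y\<in>Y. (cmod (a (\<lambda>i. v y i - u y i) x))\<^sup>2)"
      by (simp add: sum.cartesian_product lin)
    also have "\<dots> = (\<Sum>y\<in>Y. \<Sum>x<d. (cmod (a (\<lambda>i. v y i - u y i) x))\<^sup>2)" by (rule sum.swap)
    finally show "(\<Sum>(x,y)\<in>?S. (cmod (a (v y) x - a (u y) x))\<^sup>2) \<le> \<delta>" using vu by (simp add: pars)
    have "(\<Sum>(x,y)\<in>?S. (cmod (a (v y) x) + cmod (a (u y) x))\<^sup>2) \<le> (\<Sum>x<d. \<Sum>y\<in>Y. 2 * (cmod (a (v y) x))\<^sup>2 + 2 * (cmod (a (u y) x))\<^sup>2)"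
    proof -
      have "(s + t)\<^sup>2 \<le> 2 * s\<^sup>2 + 2 * t\<^sup>2" for s t :: real
        using zero_le_power2[of "s - t"] by (simp add: power2_eq_square algebra_simps)
      thus ?thesis unfolding sum.cartesian_product[symmetric] by (intro sum_mono)
    qed
    also have "\<dots> = (\<Sum>y\<in>Y. \<Sum>x<d. 2 * (cmod (a (v y) x))\<^sup>2 + 2 * (cmod (a (u y) x))\<^sup>2)" by (rule sum.swap)
    also have "\<dots> = 4" by (simp add: sum.distrib pars v1 u1 flip: sum_distrib_left)
    finally show "(\<Sum>(x,y)\<in>?S. (cmod (a (v y) x) + cmod (a (u y) x))\<^sup>2) \<le> 4" .
  next
    have "0 \<le> (\<Sum>y\<in>Y. \<Sum>i<d. (cmod (v y i - u y i))\<^sup>2)" by (intro sum_nonneg) auto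
    thus "0 \<le> sqrt \<delta>" using vu by simp
  qed (auto intro!: sum_nonneg)
  finally show ?thesis by simp
qed

lemma kraus_norm_preserving:
  fixes K :: "'y \<Rightarrow> nat \<Rightarrow> nat \<Rightarrow> complex"
  assumes tp: "\<And>a b. a < din \<Longrightarrow> b < din \<Longrightarrow>
      (\<Sum>y\<in>Y. \<Sum>j<dout. cnj (K y j a) * K y j b) = (if a = b then 1 else 0)"
  shows "(\<Sum>y\<in>Y. \<Sum>j<dout. (cmod (\<Sum>s<din. K y j s * \<phi> s))\<^sup>2) = (\<Sum>s<din. (cmod (\<phi> s))\<^sup>2)"
proof -
  let ?F = "\<lambda>y j a b. (cnj (K y j a) * K y j b) * (cnj (\<phi> a) * \<phi> b)"
  have "complex_of_real (\<Sum>y\<in>Y. \<Sum>j<dout. (cmod (\<Sum>s<din. K y j s * \<phi> s))\<^sup>2) = (\<Sum>y\<in>Y. \<Sum>j<dout. \<Sum>a<din. \<Sum>b<din. ?F y j a b)"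
    unfolding of_real_sum of_real_power cmod_sq cnj_sum
    by (intro sum.cong refl) (subst mult.commute, simp only: sum_product, simp add: mult_ac)
  also have "\<dots> = (\<Sum>y\<in>Y. \<Sum>a<din. \<Sum>j<dout. \<Sum>b<din. ?F y j a b)" by (intro sum.cong refl sum.swap)
  also have "\<dots> = (\<Sum>y\<in>Y. \<Sum>a<din. \<Sum>b<din. \<Sum>j<dout. ?F y j a b)" by (intro sum.cong refl sum.swap)
  also have "\<dots> = (\<Sum>a<din. \<Sum>y\<in>Y. \<Sum>b<din. \<Sum>j<dout. ?F y j a b)" by (rule sum.swap)
  also have "\<dots> = (\<Sum>a<din. \<Sum>b<din. \<Sum>y\<in>Y. \<Sum>j<dout. ?F y j a b)" by (intro sum.cong refl sum.swap)
  also have "\<dots> = (\<Sum>a<din. \<Sum>b<din. if a = b then cnj (\<phi> a) * \<phi> b else 0)"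
    unfolding sum_distrib_right[symmetric] by (intro sum.cong refl) (simp add: tp)
  also have "\<dots> = complex_of_real (\<Sum>s<din. (cmod (\<phi> s))\<^sup>2)"
    unfolding of_real_sum of_real_power cmod_sq by (simp add: mult.commute)
  finally show ?thesis by (simp only: of_real_eq_iff)
qed

section \<open>Approximation by coin flips\<close>

text \<open>A word labels one product of ensemble members in the expansion of the n-th tensor power
  of a mixture.\<close>

definition lsts :: "'i set \<Rightarrow> nat \<Rightarrow> 'i list set" where
  "lsts I n = {xs. set xs \<subseteq> I \<and> length xs = n}"

lemma finite_lsts [simp]: "finite I \<Longrightarrow> finite (lsts I n)"
  unfolding lsts_def by (rule finite_lists_length_eq)

lemma lsts_0 [simp]: "lsts I 0 = {[]}"
  by (auto simp: lsts_def)

lemma sum_lsts_Suc: "(\<Sum>xs\<in>lsts I (Suc n). f xs) = (\<Sum>i\<in>I. \<Sum>xs\<in>lsts I n. f (i # xs))"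
proof -
  have eq: "lsts I (Suc n) = (\<lambda>(i,xs). i # xs) ` (I \<times> lsts I n)"
    by (auto simp: lsts_def length_Suc_conv image_iff)
  have inj: "inj_on (\<lambda>(i,xs). i # xs) (I \<times> lsts I n)" by (auto simp: inj_on_def)
  have "(\<Sum>xs\<in>lsts I (Suc n). f xs) = (\<Sum>(i,xs)\<in>I \<times> lsts I n. f (i # xs))"
    unfolding eq sum.reindex[OF inj] by (intro sum.cong) auto
  thus ?thesis by (simp add: sum.cartesian_product)
qed

lemma sum_lsts_add: "(\<Sum>xs\<in>lsts I (a + b). f xs) = (\<Sum>xs\<in>lsts I a. \<Sum>ys\<in>lsts I b. f (xs @ ys))"
  by (induction a arbitrary: f) (auto simp: sum_lsts_Suc)

lemma prod_sum_lsts: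
  fixes f :: "nat \<Rightarrow> 'i \<Rightarrow> 'a::comm_semiring_1"
  shows "(\<Prod>l<n. \<Sum>i\<in>I. f l i) = (\<Sum>xs\<in>lsts I n. \<Prod>l<n. f l (xs ! l))"
proof (induction n arbitrary: f)
  case (Suc n)
  have "(\<Prod>l<Suc n. \<Sum>i\<in>I. f l i) = (\<Sum>i\<in>I. f 0 i) * (\<Sum>xs\<in>lsts I n. \<Prod>l<n. f (Suc l) (xs ! l))"
    unfolding prod.lessThan_Suc_shift Suc[of "\<lambda>l. f (Suc l)"] ..
  also have "\<dots> = (\<Sum>xs\<in>lsts I (Suc n). \<Prod>l<Suc n. f l (xs ! l))"
    unfolding sum_lsts_Suc prod.lessThan_Suc_shift sum_product by simp
  finally show ?case .
qed simp

text \<open>With real values it is the probability of a word; with polynomial values, the generating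
  polynomial of the total energy of the product state.\<close>

definition wt :: "('i \<Rightarrow> 'a::comm_semiring_1) \<Rightarrow> 'i list \<Rightarrow> 'a" where
  "wt q xs = prod_list (map q xs)"

lemma wt_simps [simp]: "wt q [] = 1" "wt q (x # xs) = q x * wt q xs" "wt q (xs @ ys) = wt q xs * wt q ys"
  by (auto simp: wt_def)

lemma wt_nth: "wt q xs = (\<Prod>l<length xs. q (xs ! l))"
  by (induction xs) (auto simp: prod.lessThan_Suc_shift simp del: prod.lessThan_Suc)

lemma wt_nonneg:
  fixes q :: "'i \<Rightarrow> real"
  shows "(\<And>i. i \<in> I \<Longrightarrow> q i \<ge> 0) \<Longrightarrow> xs \<in> lsts I n \<Longrightarrow> wt q xs \<ge> 0"
  by (auto simp: wt_nth lsts_def intro!: prod_nonneg) (metis nth_mem subsetD)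

lemma sum_wt:
  fixes q :: "'i \<Rightarrow> 'a::comm_semiring_1"
  shows "sum q I = 1 \<Longrightarrow> (\<Sum>xs\<in>lsts I n. wt q xs) = 1"
  by (induction n) (auto simp: sum_lsts_Suc simp flip: sum_distrib_left)

lemma prob_poly_wt: "(\<And>i. i \<in> I \<Longrightarrow> prob_poly (p i)) \<Longrightarrow> set xs \<subseteq> I \<Longrightarrow> prob_poly (wt p xs)"
  unfolding wt_def by (intro prob_poly_prod_list) auto

text \<open>Variances of independent summands add, and every letter of a random word has the same
  law \<open>q\<close>.\<close>

lemma sum_wt_variance:
  fixes q :: "'i \<Rightarrow> real"
  assumes "sum q I = 1" "\<And>i. i \<in> I \<Longrightarrow> prob_poly (p i)"
  shows "(\<Sum>xs\<in>lsts I n. wt q xs * variance (wt p xs)) = n * (\<Sum>i\<in>I. q i * variance (p i))"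
proof (induction n)
  case (Suc n)
  have "(\<Sum>xs\<in>lsts I (Suc n). wt q xs * variance (wt p xs))
     = (\<Sum>i\<in>I. \<Sum>xs\<in>lsts I n. q i * variance (p i) * wt q xs + q i * (wt q xs * variance (wt p xs)))"
    unfolding sum_lsts_Suc
  proof (intro sum.cong refl)
    fix i xs assume "i \<in> I" "xs \<in> lsts I n"
    hence "variance (p i * wt p xs) = variance (p i) + variance (wt p xs)"
      using assms(2) prob_poly_wt[of I p xs] by (intro variance_mult) (auto simp: prob_poly_def lsts_def)
    thus "wt q (i # xs) * variance (wt p (i # xs)) = q i * variance (p i) * wt q xs + q i * (wt q xs * variance (wt p xs))"
      by (simp add: algebra_simps)
  qed
  also have "\<dots> = (\<Sum>i\<in>I. q i * variance (p i)) * (\<Sum>xs\<in>lsts I n. wt q xs)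
      + (\<Sum>i\<in>I. q i) * (\<Sum>xs\<in>lsts I n. wt q xs * variance (wt p xs))"
    by (simp add: sum.distrib sum_product)
  also have "\<dots> = Suc n * (\<Sum>i\<in>I. q i * variance (p i))"
    by (simp add: assms(1) sum_wt Suc algebra_simps)
  finally show ?case .
qed simp

section \<open>Replacement of blocks and the average error\<close>

definition blk :: "nat \<Rightarrow> nat \<Rightarrow> 'i list \<Rightarrow> 'i list" where
  "blk b i xs = take b (drop (b * i) xs)"

lemma wt_blocks: "wt p xs = (\<Prod>i<j. wt p (blk b i xs)) * wt p (drop (b * j) xs)"
proof (induction j)
  case (Suc j)
  have "drop (b * j) xs = blk b j xs @ drop (b * Suc j) xs"
    unfolding blk_def by (metis append_take_drop_id drop_drop mult_Suc_right)
  hence "wt p (drop (b * j) xs) = wt p (blk b j xs) * wt p (drop (b * Suc j) xs)"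
    by (metis wt_simps(3))
  thus ?case using Suc by (simp add: mult_ac)
qed simp

lemma blk_lsts:
  assumes "xs \<in> lsts I (b * j + r)" "i < j"
  shows "blk b i xs \<in> lsts I b"
proof -
  have "b * Suc i \<le> b * j" using assms(2) by (intro mult_le_mono2) simp
  thus ?thesis using assms(1) set_take_subset[of b "drop (b * i) xs"] set_drop_subset[of "b * i" xs]
    by (auto simp: lsts_def blk_def)
qed

text \<open>Blocks of length \<open>b\<close> are exchanged for coin flips and the remainder of
  length \<open>r < b\<close> is dropped. \<open>N\<close> and \<open>C\<close> are fixed before the
  word is: there are only finitely many blocks and remainders of bounded length, which makes the
  error constants uniform in \<open>j\<close>.\<close>

lemma bit_approximation:
  fixes p :: "'i \<Rightarrow> real poly"
  assumes fin: "finite I" and p: "\<And>i. i \<in> I \<Longrightarrow> prob_poly (p i)"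
  shows "\<exists>N C. (\<forall>ys\<in>lsts I b. real (N ys) \<le> 2 * variance (wt p ys) + 3 / 2) \<and> C \<ge> 0
    \<and> (\<forall>j r xs L. r < b \<longrightarrow> xs \<in> lsts I (b * j + r) \<longrightarrow> (\<exists>c R. prob_poly R \<and>
       norm1 (wt p xs * R - monom 1 c * bitp ^ (2 * (\<Sum>i<j. N (blk b i xs)) + L))
         \<le> j * C * (2 / sqrt (real (L div 3 + 1))) ^ 3 + C * (2 / sqrt (real (L + 1)))))"
proof -
  have "\<forall>ys\<in>lsts I b. \<exists>t. case t of (W, c, N, h) \<Rightarrow> prob_poly W \<and> real N \<le> 2 * variance (wt p ys) + 3 / 2
    \<and> wt p ys * W - monom 1 c * bitp ^ (2 * N) = [:-1, 1:] ^ 3 * h"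
  proof
    fix ys assume "ys \<in> lsts I b"
    hence "prob_poly (wt p ys)" using prob_poly_wt[of I p ys] p by (auto simp: lsts_def)
    from match_bits[OF this] obtain W c N h where "prob_poly W \<and> real N \<le> 2 * variance (wt p ys) + 3 / 2
      \<and> wt p ys * W - monom 1 c * bitp ^ (2 * N) = [:-1, 1:] ^ 3 * h" by blast
    thus "\<exists>t. case t of (W, c, N, h) \<Rightarrow> prob_poly W \<and> real N \<le> 2 * variance (wt p ys) + 3 / 2
      \<and> wt p ys * W - monom 1 c * bitp ^ (2 * N) = [:-1, 1:] ^ 3 * h"
      by (intro exI[of _ "(W, c, N, h)"]) simp
  qed
  from bchoice[OF this] obtain t where t: "\<forall>ys\<in>lsts I b. case t ys of (W, c, N, h) \<Rightarrow> prob_poly W \<and> real N \<le> 2 * variance (wt p ys) + 3 / 2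
    \<and> wt p ys * W - monom 1 c * bitp ^ (2 * N) = [:-1, 1:] ^ 3 * h" by blast
  define W where "W = (\<lambda>ys. fst (t ys))"
  define c where "c = (\<lambda>ys. fst (snd (t ys)))"
  define N where "N = (\<lambda>ys. fst (snd (snd (t ys))))"
  define h where "h = (\<lambda>ys. snd (snd (snd (t ys))))"
  have t: "prob_poly (W ys)" "real (N ys) \<le> 2 * variance (wt p ys) + 3 / 2"
    "wt p ys * W ys - monom 1 (c ys) * bitp ^ (2 * N ys) = [:-1, 1:] ^ 3 * h ys" if "ys \<in> lsts I b" for ys
  proof -
    obtain W' c' N' h' where "t ys = (W', c', N', h')" by (cases "t ys")
    thus "prob_poly (W ys)" "real (N ys) \<le> 2 * variance (wt p ys) + 3 / 2"
      "wt p ys * W ys - monom 1 (c ys) * bitp ^ (2 * N ys) = [:-1, 1:] ^ 3 * h ys"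
      using bspec[OF t that] by (simp_all add: W_def c_def N_def h_def)
  qed
  \<comment> \<open>A remainder is replaced by the point mass at 0, whose polynomial is 1. The
    difference vanishes at 1, which yields one factor x - 1, enough for a single
    replacement.\<close>
  define u where "u = (\<lambda>zs. (wt p zs - 1) div [:-1, 1:])"
  have u: "wt p zs - 1 = [:-1, 1:] * u zs" if "set zs \<subseteq> I" for zs
  proof -
    have "poly (wt p zs - 1) 1 = 0" using prob_poly_wt[of I p zs] p that by (auto simp: prob_poly_def)
    hence "[:-1, 1:] dvd wt p zs - 1" using poly_eq_0_iff_dvd[of "wt p zs - 1" 1] by simp
    thus ?thesis unfolding u_def by (simp only: dvd_mult_div_cancel)
  qed
  define C1 where "C1 = (\<Sum>ys\<in>lsts I b. norm1 (h ys))"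
  define C2 where "C2 = (\<Sum>r<b. \<Sum>zs\<in>lsts I r. norm1 (u zs))"
  have C1: "norm1 (h ys) \<le> C1" if "ys \<in> lsts I b" for ys
    unfolding C1_def using fin that by (intro member_le_sum) auto
  have C2: "norm1 (u zs) \<le> C2" if "r < b" "zs \<in> lsts I r" for r zs
  proof -
    have "norm1 (u zs) \<le> (\<Sum>zs\<in>lsts I r. norm1 (u zs))" using fin that by (intro member_le_sum) auto
    also have "\<dots> \<le> C2" unfolding C2_def using that by (intro member_le_sum) (auto intro: sum_nonneg)
    finally show ?thesis .
  qed
  have nn: "C1 \<ge> 0" "C2 \<ge> 0" by (auto simp: C1_def C2_def intro!: sum_nonneg)
  have "\<exists>c' R. prob_poly R \<and> norm1 (wt p xs * R - monom 1 c' * bitp ^ (2 * (\<Sum>i<j. N (blk b i xs)) + L))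
      \<le> j * (C1 + C2) * (2 / sqrt (real (L div 3 + 1))) ^ 3 + (C1 + C2) * (2 / sqrt (real (L + 1)))"
    if r: "r < b" and xs: "xs \<in> lsts I (b * j + r)" for j r xs L
  proof -
    let ?B = "\<lambda>i. blk b i xs"
    note B = blk_lsts[OF xs]
    let ?T = "\<lambda>i. wt p (?B i) * W (?B i)" and ?S = "\<lambda>i. monom 1 (c (?B i)) * bitp ^ (2 * N (?B i))"
    let ?z = "drop (b * j) xs"
    let ?Q = "wt p ?z" and ?K = "bitp ^ L"
    have z: "?z \<in> lsts I r" using xs set_drop_subset[of "b * j" xs] by (auto simp: lsts_def)
    have pB: "prob_poly (wt p (?B i))" if "i < j" for i
      using prob_poly_wt[of I p] p B[OF that] by (auto simp: lsts_def)
    have pQ: "prob_poly ?Q" using prob_poly_wt[of I p] p z by (auto simp: lsts_def)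
    have pp: "prob_poly (\<Prod>i<k. q i)" if "\<And>i. i < k \<Longrightarrow> prob_poly (q i)" for k :: nat and q :: "nat \<Rightarrow> real poly"
      using that by (induction k) (auto intro: prob_poly_mult)
    have pS: "prob_poly (?S i)" for i by (intro prob_poly_mult prob_poly_monom prob_poly_power prob_bit)
    \<comment> \<open>The noise of all blocks together with the spare flips. The same spare flips
      appear in the target, so they smooth both differences below.\<close>
    define R where "R = (\<Prod>i<j. W (?B i)) * ?K"
    have pR: "prob_poly R" unfolding R_def
      using t(1) B by (intro prob_poly_mult pp prob_poly_power prob_bit) auto
    have S: "(\<Prod>i<j. ?S i) = monom 1 (\<Sum>i<j. c (?B i)) * bitp ^ (2 * (\<Sum>i<j. N (?B i)))"
    proof -
      have "(\<Prod>i<k. monom 1 (c' i)) = monom (1::real) (\<Sum>i<k. c' i)" for k :: nat and c'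
        by (induction k) (auto simp: mult_monom add.commute)
      thus ?thesis unfolding prod.distrib power_sum[symmetric] sum_distrib_left by simp
    qed
    have "wt p xs * R - monom 1 (\<Sum>i<j. c (?B i)) * bitp ^ (2 * (\<Sum>i<j. N (?B i)) + L)
      = (\<Prod>i<j. ?T i) * ?Q * ?K - (\<Prod>i<j. ?S i) * ?K"
      unfolding S R_def by (subst wt_blocks[where b = b and j = j]) (simp add: prod.distrib power_add mult_ac)
    also have "\<dots> = (((\<Prod>i<j. ?T i) - (\<Prod>i<j. ?S i)) * ?K) * ?Q + ((?Q - 1) * ?K) * (\<Prod>i<j. ?S i)"
      by (simp add: algebra_simps)
    finally have "norm1 (wt p xs * R - monom 1 (\<Sum>i<j. c (?B i)) * bitp ^ (2 * (\<Sum>i<j. N (?B i)) + L))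
      \<le> norm1 ((((\<Prod>i<j. ?T i) - (\<Prod>i<j. ?S i)) * ?K) * ?Q) + norm1 (((?Q - 1) * ?K) * (\<Prod>i<j. ?S i))"
      by (simp only: norm1_add)
    also have "\<dots> \<le> norm1 (((\<Prod>i<j. ?T i) - (\<Prod>i<j. ?S i)) * ?K) + norm1 ((?Q - 1) * ?K)"
      using pS by (intro add_mono norm1_mult_prob_le pQ pp)
    also have "norm1 (((\<Prod>i<j. ?T i) - (\<Prod>i<j. ?S i)) * ?K) \<le> j * C1 * (2 / sqrt (real (L div 3 + 1))) ^ 3"
    proof (rule swap_blocks)
      show "prob_poly (?T i)" if "i < j" for i using pB[OF that] t(1)[OF B[OF that]] by (rule prob_poly_mult)
      show "?T i - ?S i = [:-1, 1:] ^ 3 * h (?B i)" if "i < j" for i by (rule t(3)[OF B[OF that]])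
      show "norm1 (h (?B i)) \<le> C1" if "i < j" for i by (rule C1[OF B[OF that]])
    qed (use pS norm1_diff3_bit in auto)
    also have "norm1 ((?Q - 1) * ?K) \<le> C2 * (2 / sqrt (real (L + 1)))"
    proof -
      have "(?Q - 1) * ?K = u ?z * ([:-1, 1:] * ?K)"
        using u[of ?z] z by (simp only: lsts_def mem_Collect_eq mult_ac)
      hence "norm1 ((?Q - 1) * ?K) \<le> norm1 (u ?z) * norm1 ([:-1, 1:] * ?K)" by (simp only: norm1_mult)
      also have "\<dots> \<le> C2 * (2 / sqrt (real (L + 1)))"
        using C2[OF r z] nn by (intro mult_mono norm1_diff_bit) auto
      finally show ?thesis .
    qed
    finally have "norm1 (wt p xs * R - monom 1 (\<Sum>i<j. c (?B i)) * bitp ^ (2 * (\<Sum>i<j. N (?B i)) + L))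
      \<le> j * C1 * (2 / sqrt (real (L div 3 + 1))) ^ 3 + C2 * (2 / sqrt (real (L + 1)))" by simp
    also have "\<dots> \<le> j * (C1 + C2) * (2 / sqrt (real (L div 3 + 1))) ^ 3 + (C1 + C2) * (2 / sqrt (real (L + 1)))"
      using nn by (intro add_mono mult_right_mono mult_left_mono) auto
    finally show ?thesis using pR by blast
  qed
  thus ?thesis using t(2) nn
    by (intro exI[of _ N] exI[of _ "C1 + C2"] conjI ballI allI impI) auto
qed

text \<open>The blocks of a random word are independent with the same law, and the remainder sums
  out to 1. This supplies the exponential moment of the total cost.\<close>

lemma sum_wt_blocks:
  fixes q :: "'i \<Rightarrow> 'a::comm_semiring_1"
  assumes "sum q I = 1"
  shows "(\<Sum>xs\<in>lsts I (b * j + r). wt q xs * (\<Prod>i<j. F (blk b i xs))) = (\<Sum>ys\<in>lsts I b. wt q ys * F ys) ^ j"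
proof (induction j)
  case 0
  show ?case using sum_wt[OF assms] by simp
next
  case (Suc j)
  have "(\<Sum>xs\<in>lsts I (b * Suc j + r). wt q xs * (\<Prod>i<Suc j. F (blk b i xs)))
     = (\<Sum>ys\<in>lsts I b. \<Sum>xs\<in>lsts I (b * j + r). wt q (ys @ xs) * (\<Prod>i<Suc j. F (blk b i (ys @ xs))))"
  proof -
    have "b * Suc j + r = b + (b * j + r)" by simp
    thus ?thesis by (simp only: sum_lsts_add)
  qed
  also have "\<dots> = (\<Sum>ys\<in>lsts I b. \<Sum>xs\<in>lsts I (b * j + r). (wt q ys * F ys) * (wt q xs * (\<Prod>i<j. F (blk b i xs))))"
  proof (intro sum.cong refl)
    fix ys xs assume "ys \<in> lsts I b"
    hence l: "length ys = b" by (simp add: lsts_def)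
    have "blk b 0 (ys @ xs) = ys" "blk b (Suc i) (ys @ xs) = blk b i xs" for i
      using l by (auto simp: blk_def)
    thus "wt q (ys @ xs) * (\<Prod>i<Suc j. F (blk b i (ys @ xs))) = (wt q ys * F ys) * (wt q xs * (\<Prod>i<j. F (blk b i xs)))"
      unfolding prod.lessThan_Suc_shift by (simp add: mult_ac)
  qed
  also have "\<dots> = (\<Sum>ys\<in>lsts I b. wt q ys * F ys) ^ Suc j"
    unfolding sum_product[symmetric] Suc by simp
  finally show ?case .
qed

text \<open>Exponential Markov inequality.\<close>

lemma block_cost_tail:
  fixes q :: "'i \<Rightarrow> real" and N :: "'i list \<Rightarrow> nat"
  assumes fin: "finite I" and q: "\<And>i. i \<in> I \<Longrightarrow> q i \<ge> 0" and q1: "sum q I = 1" and \<delta>: "\<delta> > 0"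
  shows "\<exists>\<theta>. 0 \<le> \<theta> \<and> \<theta> < 1 \<and> (\<forall>j r. (\<Sum>xs\<in>lsts I (b * j + r).
     if ((\<Sum>ys\<in>lsts I b. wt q ys * N ys) + \<delta>) * j \<le> (\<Sum>i<j. real (N (blk b i xs))) then wt q xs else 0) \<le> \<theta> ^ j)"
proof -
  define \<mu> where "\<mu> = (\<Sum>ys\<in>lsts I b. wt q ys * N ys)"
  define G where "G = (\<lambda>x. \<Sum>ys\<in>lsts I b. wt q ys * exp (x * (N ys - (\<mu> + \<delta>))))"
  have w0: "wt q xs \<ge> 0" if "xs \<in> lsts I n" for xs n using wt_nonneg q that by blast
  \<comment> \<open>\<open>G\<close> is the exponential moment of one block. It equals 1 at 0 and
    has slope \<open>- \<delta>\<close> there, so it is below 1 at some positive \<open>x\<close>;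
    this value serves as the rate \<open>\<theta>\<close>.\<close>
  have "(G has_real_derivative (\<Sum>ys\<in>lsts I b. wt q ys * (N ys - (\<mu> + \<delta>)))) (at 0)"
    unfolding G_def by (auto intro!: derivative_eq_intros sum.cong)
  also have "(\<Sum>ys\<in>lsts I b. wt q ys * (N ys - (\<mu> + \<delta>))) = - \<delta>"
    using sum_wt[OF q1, of b]
    by (simp add: right_diff_distrib sum_subtractf \<mu>_def flip: sum_distrib_right)
  finally obtain d where d: "d > 0" "\<And>h. h > 0 \<Longrightarrow> h < d \<Longrightarrow> G h < G 0"
    using DERIV_neg_dec_right[of G "- \<delta>" 0] \<delta> by auto
  define x where "x = d / 2"
  have x: "x > 0" using d by (simp add: x_def)
  have "G 0 = 1" using sum_wt[OF q1, of b] by (simp add: G_def)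
  hence G1: "G x < 1" using d(2)[of x] d(1) by (simp add: x_def)
  have G0: "G x \<ge> 0" unfolding G_def using w0 by (intro sum_nonneg mult_nonneg_nonneg) auto
  have "(\<Sum>xs\<in>lsts I (b * j + r). if (\<mu> + \<delta>) * j \<le> (\<Sum>i<j. real (N (blk b i xs))) then wt q xs else 0) \<le> G x ^ j" for j r
  proof -
    have "(\<Sum>xs\<in>lsts I (b * j + r). if (\<mu> + \<delta>) * j \<le> (\<Sum>i<j. real (N (blk b i xs))) then wt q xs else 0)
      \<le> (\<Sum>xs\<in>lsts I (b * j + r). wt q xs * (\<Prod>i<j. exp (x * (N (blk b i xs) - (\<mu> + \<delta>)))))"
    proof (intro sum_mono)
      fix xs assume xs: "xs \<in> lsts I (b * j + r)"
      have e: "(\<Prod>i<j. exp (x * (N (blk b i xs) - (\<mu> + \<delta>)))) = exp (x * ((\<Sum>i<j. real (N (blk b i xs))) - (\<mu> + \<delta>) * j))"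
        by (simp add: exp_sum[symmetric] sum_distrib_left[symmetric] sum_subtractf mult.commute)
      show "(if (\<mu> + \<delta>) * j \<le> (\<Sum>i<j. real (N (blk b i xs))) then wt q xs else 0)
        \<le> wt q xs * (\<Prod>i<j. exp (x * (N (blk b i xs) - (\<mu> + \<delta>))))"
      proof (cases "(\<mu> + \<delta>) * j \<le> (\<Sum>i<j. real (N (blk b i xs)))")
        case True
        hence "1 \<le> exp (x * ((\<Sum>i<j. real (N (blk b i xs))) - (\<mu> + \<delta>) * j))" using x by simp
        thus ?thesis unfolding e using True w0[OF xs] mult_left_mono[of 1 _ "wt q xs"] by fastforce
      next
        case False
        thus ?thesis unfolding e using w0[OF xs] by simp
      qed
    qed
    also have "\<dots> = G x ^ j"
      unfolding G_def by (rule sum_wt_blocks[OF q1, where F = "\<lambda>ys. exp (x * (N ys - (\<mu> + \<delta>)))"])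
    finally show ?thesis .
  qed
  thus ?thesis using G0 G1 unfolding \<mu>_def by blast
qed

text \<open>The number of flips that a random word needs rarely exceeds its mean by much, and that
  mean stays below \<open>R * n\<close> by a linear margin, which provides the spare flips. For the
  rare words that need too many, the trivial error 2 is accepted; only the average over words has to
  vanish.\<close>

lemma typical_error:
  fixes q :: "'i \<Rightarrow> real" and p :: "'i \<Rightarrow> real poly"
  assumes fin: "finite I" and q: "\<And>i. i \<in> I \<Longrightarrow> q i \<ge> 0" and q1: "sum q I = 1"
    and p: "\<And>i. i \<in> I \<Longrightarrow> prob_poly (p i)"
    and R: "4 * (\<Sum>i\<in>I. q i * variance (p i)) < R"
  shows "\<exists>\<eta> r c. \<eta> \<longlonglongrightarrow> 0 \<and> (\<forall>n. \<forall>xs\<in>lsts I n. prob_poly (r n xs))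
    \<and> (\<forall>n. (\<Sum>xs\<in>lsts I n. wt q xs * norm1 (monom 1 (c n xs) * bitp ^ nat \<lceil>R * real n\<rceil> - wt p xs * r n xs)) \<le> \<eta> n)"
proof -
  define v where "v = (\<Sum>i\<in>I. q i * variance (p i))"
  have v0: "v \<ge> 0" unfolding v_def using q p variance_nonneg by (intro sum_nonneg mult_nonneg_nonneg) auto
  \<comment> \<open>A block is allowed \<open>2 * (\<mu> + 1)\<close> flips with
    \<open>\<mu>\<close> at most \<open>2 * b * v + 3 / 2\<close>, hence at most
    \<open>4 * v + 5 / b\<close> flips per copy. This length pushes \<open>5 / b\<close> below the
    gap to \<open>R\<close>.\<close>
  define b where "b = nat \<lceil>5 / (R - 4 * v)\<rceil> + 1"
  have gap: "R - 4 * v > 0" using R by (simp add: v_def)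
  have b0: "b > 0" by (simp add: b_def)
  have b: "5 / b < R - 4 * v"
  proof -
    have "5 / (R - 4 * v) < b" unfolding b_def using real_nat_ceiling_ge[of "5 / (R - 4 * v)"] by simp
    thus ?thesis using gap b0 by (simp add: field_simps)
  qed
  from bit_approximation[where p = p and I = I and b = b, OF fin p] obtain N C
    where N: "\<And>ys. ys \<in> lsts I b \<Longrightarrow> real (N ys) \<le> 2 * variance (wt p ys) + 3 / 2" and C: "C \<ge> 0"
    and approx: "\<And>j r xs L. r < b \<Longrightarrow> xs \<in> lsts I (b * j + r) \<Longrightarrow> \<exists>c R. prob_poly R \<and>
       norm1 (wt p xs * R - monom 1 c * bitp ^ (2 * (\<Sum>i<j. N (blk b i xs)) + L))
         \<le> j * C * (2 / sqrt (real (L div 3 + 1))) ^ 3 + C * (2 / sqrt (real (L + 1)))"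
    by metis
  have w0: "wt q xs \<ge> 0" if "xs \<in> lsts I n" for xs n using wt_nonneg q that by blast
  define \<mu> where "\<mu> = (\<Sum>ys\<in>lsts I b. wt q ys * N ys)"
  have \<mu>: "\<mu> \<le> 2 * b * v + 3 / 2"
  proof -
    have "\<mu> \<le> (\<Sum>ys\<in>lsts I b. 2 * (wt q ys * variance (wt p ys)) + 3 / 2 * wt q ys)"
      unfolding \<mu>_def using mult_left_mono[OF N w0] by (intro sum_mono) (fastforce simp: algebra_simps)
    also have "\<dots> = 2 * b * v + 3 / 2"
      using sum_wt[OF q1, of b] sum_wt_variance[where n = b and q = q and p = p, OF q1 p]
      unfolding sum.distrib sum_distrib_left[symmetric] v_def by simp
    finally show ?thesis .
  qed
  \<comment> \<open>The guaranteed number of spare flips per copy on typical words.\<close>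
  define \<epsilon> where "\<epsilon> = R - 2 * (\<mu> + 1) / b"
  have \<epsilon>: "\<epsilon> > 0"
  proof -
    have "2 * (\<mu> + 1) / b \<le> (4 * b * v + 5) / b" using \<mu> by (intro divide_right_mono) auto
    also have "\<dots> = 4 * v + 5 / b" using b0 by (simp add: field_simps)
    finally show ?thesis using b by (simp add: \<epsilon>_def)
  qed
  from block_cost_tail[where I = I and q = q and \<delta> = 1 and b = b and N = N, OF fin q q1] obtain \<theta> where \<theta>: "0 \<le> \<theta>" "\<theta> < 1"
    and tail: "\<And>j r. (\<Sum>xs\<in>lsts I (b * j + r). if (\<mu> + 1) * j \<le> (\<Sum>i<j. real (N (blk b i xs))) then wt q xs else 0) \<le> \<theta> ^ j"
    unfolding \<mu>_def by auto
  define m where "m = (\<lambda>n::nat. nat \<lceil>R * real n\<rceil>)"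
  \<comment> \<open>At most \<open>n\<close> block replacements of order n^(-3/2) and one dropped
    remainder of order n^(-1/2).\<close>
  define \<eta>0 where "\<eta>0 = (\<lambda>n::nat. n * C * (2 / sqrt (\<epsilon> * n / 3)) ^ 3 + C * (2 / sqrt (\<epsilon> * n)))"
  have R0: "R > 0" using gap v0 by simp
  have main: "\<exists>c r. prob_poly r \<and> norm1 (monom 1 c * bitp ^ m n - wt p xs * r)
     \<le> \<eta>0 n + (if (\<mu> + 1) * (n div b) \<le> (\<Sum>i<n div b. real (N (blk b i xs))) then 2 else 0)"
    if n: "n > 0" and xs: "xs \<in> lsts I n" for n xs
  proof (cases "(\<mu> + 1) * (n div b) \<le> (\<Sum>i<n div b. real (N (blk b i xs)))")
    case True
    have pw: "prob_poly (wt p xs)" using prob_poly_wt[of I p] p xs by (auto simp: lsts_def)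
    \<comment> \<open>For an atypical word no shift and no noise are used: two distributions are
      never further apart than 2.\<close>
    have "norm1 (monom 1 0 * bitp ^ m n - wt p xs * 1) \<le> norm1 (monom 1 0 * bitp ^ m n) + norm1 (smult (-1) (wt p xs))"
      using norm1_add[of "monom 1 0 * bitp ^ m n" "smult (-1) (wt p xs)"] by simp
    also have "\<dots> = 2"
      using norm1_prob_poly[OF pw] norm1_prob_poly[OF prob_poly_mult[OF prob_poly_monom prob_poly_power[OF prob_bit]]]
      by (simp only: norm1_smult)
    also have "\<dots> \<le> \<eta>0 n + 2" using C \<epsilon> by (simp add: \<eta>0_def)
    finally have "norm1 (monom 1 0 * bitp ^ m n - wt p xs * 1) \<le> \<eta>0 n + 2" .
    thus ?thesis using True prob_poly_1 by (simp only: if_True) blast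
  next
    case False
    define j where "j = n div b"
    define T where "T = (\<Sum>i<j. N (blk b i xs))"
    have jb: "real j * b \<le> n"
    proof -
      have "j * b \<le> n" unfolding j_def by (rule div_times_less_eq_dividend)
      thus ?thesis by (metis of_nat_le_iff of_nat_mult)
    qed
    have \<mu>0: "\<mu> \<ge> 0" unfolding \<mu>_def using w0 by (intro sum_nonneg mult_nonneg_nonneg) auto
    have "2 * real T \<le> 2 * ((\<mu> + 1) * j)" using False by (simp add: T_def j_def)
    also have "\<dots> = 2 * (\<mu> + 1) / b * (j * b)" using b0 by simp
    also have "\<dots> \<le> 2 * (\<mu> + 1) / b * n" using jb \<mu>0 by (intro mult_left_mono) auto
    finally have T: "2 * real T \<le> (R - \<epsilon>) * n" by (simp add: \<epsilon>_def)
    have mR: "R * n \<le> real (m n)" unfolding m_def by (rule real_nat_ceiling_ge)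
    have \<epsilon>n: "\<epsilon> * n > 0" using \<epsilon> n by simp
    have "real (2 * T) \<le> real (m n)" using T mR \<epsilon>n by (simp add: algebra_simps)
    hence Tm: "2 * T \<le> m n" by (simp only: of_nat_le_iff)
    define L where "L = m n - 2 * T"
    have L: "\<epsilon> * n \<le> real L" "m n = 2 * T + L"
      unfolding L_def using Tm T mR by (auto simp: of_nat_diff algebra_simps)
    have xs': "xs \<in> lsts I (b * j + n mod b)" using xs by (simp add: j_def)
    from approx[OF mod_less_divisor[OF b0] xs', of L] obtain c r where r: "prob_poly r"
      and e: "norm1 (wt p xs * r - monom 1 c * bitp ^ m n) \<le> j * C * (2 / sqrt (real (L div 3 + 1))) ^ 3 + C * (2 / sqrt (real (L + 1)))"
      unfolding L(2) T_def by blast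
    have "norm1 (monom 1 c * bitp ^ m n - wt p xs * r) = norm1 (smult (-1) (wt p xs * r - monom 1 c * bitp ^ m n))"
      by (simp add: smult_diff_right)
    also have "\<dots> \<le> j * C * (2 / sqrt (real (L div 3 + 1))) ^ 3 + C * (2 / sqrt (real (L + 1)))"
      using e unfolding norm1_smult by simp
    also have "\<dots> \<le> \<eta>0 n"
      unfolding \<eta>0_def
    proof (intro add_mono mult_mono power_mono divide_left_mono real_sqrt_le_mono)
      have "j \<le> n" unfolding j_def by (rule div_le_dividend)
      thus "real j \<le> real n" by simp
      have "L \<le> 3 * (L div 3 + 1)" by presburger
      hence "real L \<le> real (3 * (L div 3 + 1))" by (simp only: of_nat_le_iff)
      hence "real L \<le> 3 * real (L div 3 + 1)" by (simp only: of_nat_mult of_nat_numeral)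
      thus "\<epsilon> * n / 3 \<le> real (L div 3 + 1)" using L by simp
      show "\<epsilon> * n \<le> real (L + 1)" using L by simp
      show "0 < sqrt (real (L div 3 + 1)) * sqrt (\<epsilon> * n / 3)" "0 < sqrt (real (L + 1)) * sqrt (\<epsilon> * n)"
        using \<epsilon>n by (auto intro!: mult_pos_pos)
    qed (use C \<epsilon>n in auto)
    finally show ?thesis using False r by auto
  qed
  have "\<forall>n xs. \<exists>t. xs \<in> lsts I n \<longrightarrow> prob_poly (snd t) \<and> (n > 0 \<longrightarrow> norm1 (monom 1 (fst t) * bitp ^ m n - wt p xs * snd t)
     \<le> \<eta>0 n + (if (\<mu> + 1) * (n div b) \<le> (\<Sum>i<n div b. real (N (blk b i xs))) then 2 else 0))"
  proof (intro allI)
    fix n xs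
    show "\<exists>t. xs \<in> lsts I n \<longrightarrow> prob_poly (snd t) \<and> (n > 0 \<longrightarrow> norm1 (monom 1 (fst t) * bitp ^ m n - wt p xs * snd t)
     \<le> \<eta>0 n + (if (\<mu> + 1) * (n div b) \<le> (\<Sum>i<n div b. real (N (blk b i xs))) then 2 else 0))"
    proof (cases "n > 0 \<and> xs \<in> lsts I n")
      case True
      then obtain c r where "prob_poly r" "norm1 (monom 1 c * bitp ^ m n - wt p xs * r)
     \<le> \<eta>0 n + (if (\<mu> + 1) * (n div b) \<le> (\<Sum>i<n div b. real (N (blk b i xs))) then 2 else 0)"
        using main by blast
      thus ?thesis by (intro exI[of _ "(c, r)"]) simp
    next
      case False
      thus ?thesis by (intro exI[of _ "(0, 1)"]) auto
    qed
  qed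
  from this[unfolded choice_iff] obtain t where t: "\<And>n xs. xs \<in> lsts I n \<Longrightarrow> prob_poly (snd (t n xs)) \<and> (n > 0 \<longrightarrow> norm1 (monom 1 (fst (t n xs)) * bitp ^ m n - wt p xs * snd (t n xs))
     \<le> \<eta>0 n + (if (\<mu> + 1) * (n div b) \<le> (\<Sum>i<n div b. real (N (blk b i xs))) then 2 else 0))"
    by blast
  define c where "c = (\<lambda>n xs. fst (t n xs))"
  define r where "r = (\<lambda>n xs. snd (t n xs))"
  \<comment> \<open>The estimate is established for positive \<open>n\<close> only. At
    \<open>n = 0\<close> the actual error is taken, which does not affect the limit.\<close>
  define \<eta> where "\<eta> = (\<lambda>n. if n = 0 then (\<Sum>xs\<in>lsts I 0. wt q xs * norm1 (monom 1 (c 0 xs) * bitp ^ m 0 - wt p xs * r 0 xs))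
     else \<eta>0 n + 2 * \<theta> ^ (n div b))"
  have bound: "(\<Sum>xs\<in>lsts I n. wt q xs * norm1 (monom 1 (c n xs) * bitp ^ m n - wt p xs * r n xs)) \<le> \<eta> n" for n
  proof (cases "n = 0")
    case False
    have "(\<Sum>xs\<in>lsts I n. wt q xs * norm1 (monom 1 (c n xs) * bitp ^ m n - wt p xs * r n xs))
      \<le> (\<Sum>xs\<in>lsts I n. \<eta>0 n * wt q xs + 2 * (if (\<mu> + 1) * (n div b) \<le> (\<Sum>i<n div b. real (N (blk b i xs))) then wt q xs else 0))"
    proof (intro sum_mono)
      fix xs assume xs: "xs \<in> lsts I n"
      have "wt q xs * norm1 (monom 1 (c n xs) * bitp ^ m n - wt p xs * r n xs)
        \<le> wt q xs * (\<eta>0 n + (if (\<mu> + 1) * (n div b) \<le> (\<Sum>i<n div b. real (N (blk b i xs))) then 2 else 0))"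
        using t[OF xs] False w0[OF xs] unfolding c_def r_def by (intro mult_left_mono) auto
      also have "\<dots> = \<eta>0 n * wt q xs + 2 * (if (\<mu> + 1) * (n div b) \<le> (\<Sum>i<n div b. real (N (blk b i xs))) then wt q xs else 0)"
        by (simp add: algebra_simps)
      finally show "wt q xs * norm1 (monom 1 (c n xs) * bitp ^ m n - wt p xs * r n xs) \<le> \<dots>" .
    qed
    also have "\<dots> \<le> \<eta>0 n * 1 + 2 * \<theta> ^ (n div b)"
      unfolding sum.distrib sum_distrib_left[symmetric] sum_wt[OF q1]
      using tail[where j = "n div b" and r = "n mod b"] C \<epsilon> by (intro add_mono mult_left_mono) (auto simp: mult_div_mod_eq \<eta>0_def)
    finally show ?thesis using False by (simp add: \<eta>_def)
  qed (simp add: \<eta>_def)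
  have "\<eta>0 \<longlonglongrightarrow> 0" unfolding \<eta>0_def using \<epsilon> by real_asymp
  moreover have "(\<lambda>n. \<theta> ^ (n div b)) \<longlonglongrightarrow> 0"
  proof -
    have "filterlim (\<lambda>n. n div b) sequentially sequentially"
      unfolding filterlim_at_top
    proof
      fix Z
      show "\<forall>\<^sub>F n in sequentially. Z \<le> n div b"
        using eventually_ge_at_top[of "Z * b"] by eventually_elim (use b0 in \<open>simp add: less_eq_div_iff_mult_less_eq\<close>)
    qed
    moreover have "(\<lambda>n. \<theta> ^ n) \<longlonglongrightarrow> 0" using \<theta> by (intro LIMSEQ_power_zero) auto
    ultimately show ?thesis by (rule filterlim_compose[rotated])
  qed
  ultimately have "(\<lambda>n. \<eta>0 n + 2 * \<theta> ^ (n div b)) \<longlonglongrightarrow> 0 + 2 * 0"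
    by (intro tendsto_add tendsto_mult tendsto_const)
  moreover have "\<forall>\<^sub>F n in sequentially. \<eta>0 n + 2 * \<theta> ^ (n div b) = \<eta> n"
    using eventually_gt_at_top[of 0] by eventually_elim (simp add: \<eta>_def)
  ultimately have "\<eta> \<longlonglongrightarrow> 0" using Lim_transform_eventually[of _ 0 sequentially \<eta>] by simp
  moreover have "\<forall>n. \<forall>xs\<in>lsts I n. prob_poly (r n xs)" using t by (auto simp: r_def)
  ultimately show ?thesis using bound unfolding m_def by blast
qed

section \<open>Decomposition with minimal average variance\<close>

text \<open>The Hamiltonian in the eigenbasis of \<rho>, each entry weighted by the ratio of the
  geometric to the arithmetic mean of the two eigenvalues; the ratio is 0 where both vanish.\<close>

definition yu_op :: "nat \<Rightarrow> complex mat \<Rightarrow> (nat \<Rightarrow> real) \<Rightarrow> complex mat" where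
  "yu_op d A p = mat d d (\<lambda>(j,k). complex_of_real (2 * sqrt (p j) * sqrt (p k) / (p j + p k)) * A $$ (j,k))"

lemma yu_op_hermitian:
  assumes "hermitian d A"
  shows "hermitian d (yu_op d A p)"
proof (rule hermitianI)
  fix i j assume ij: "i < d" "j < d"
  have c: "2 * sqrt (p j) * sqrt (p i) / (p j + p i) = 2 * sqrt (p i) * sqrt (p j) / (p i + p j)"
    by (simp add: mult_ac add.commute)
  have "yu_op d A p $$ (j,i) = complex_of_real (2 * sqrt (p i) * sqrt (p j) / (p i + p j)) * cnj (A $$ (i,j))"
    unfolding c[symmetric] hermitian_entry[OF assms ij, symmetric] using ij by (simp add: yu_op_def)
  thus "yu_op d A p $$ (j,i) = cnj (yu_op d A p $$ (i,j))" using ij by (simp add: yu_op_def)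
qed (simp add: yu_op_def)

text \<open>The operator Z with sqrt rho H sqrt rho = (rho Z + Z rho) / 2 has the property that the
  projected vectors sqrt rho |e_k>, for e_k an eigenvector of Z, have its eigenvalues as mean energies.\<close>

lemma yu_mean_energy:
  fixes G V :: "nat \<Rightarrow> nat \<Rightarrow> complex" and p E z :: "nat \<Rightarrow> real" and S :: "nat set"
  assumes A: "hermitian d A" and p: "\<And>j. j < d \<Longrightarrow> p j \<ge> 0"
    and G1: "\<And>j k. j < d \<Longrightarrow> k < d \<Longrightarrow> (\<Sum>a<d. cnj (G a j) * G a k) = (if j = k then 1 else 0)"
    and G2: "\<And>a b. a < d \<Longrightarrow> b < d \<Longrightarrow> (\<Sum>j<d. G a j * cnj (G b j)) = (if a = b then 1 else 0)"
    and AG: "\<And>j k. j < d \<Longrightarrow> k < d \<Longrightarrow> A $$ (j,k) = (\<Sum>a<d. cnj (G a j) * E a * G a k)"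
    and S: "S \<subseteq> {..<d}"
    and SR: "\<And>a b. a < d \<Longrightarrow> b < d \<Longrightarrow> (\<Sum>j<d. G a j * p j * cnj (G b j)) \<noteq> 0 \<Longrightarrow> a \<in> S \<longleftrightarrow> b \<in> S"
    and ZV: "\<And>j. j < d \<Longrightarrow> (\<Sum>l<d. yu_op d A p $$ (j,l) * V l k) = z k * V j k"
  defines "M \<equiv> \<lambda>a. \<Sum>j<d. G a j * sqrt (p j) * V j k"
  shows "(\<Sum>a\<in>S. E a * (cmod (M a))\<^sup>2) = z k * (\<Sum>a\<in>S. (cmod (M a))\<^sup>2)"
proof -
  let ?Z = "\<lambda>j l. yu_op d A p $$ (j,l)"
  have Slt: "a < d" if "a \<in> S" for a using S that by auto
  define R where "R = (\<lambda>a b. \<Sum>j<d. G a j * p j * cnj (G b j))"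
  define P where "P = (\<lambda>j k. \<Sum>a\<in>S. cnj (G a j) * G a k)"
  define B where "B = (\<lambda>j k. \<Sum>a\<in>S. cnj (G a j) * E a * G a k)"
  have RG: "(\<Sum>b<d. R a b * G b k) = p k * G a k" if "a < d" "k < d" for a k
  proof -
    have "(\<Sum>b<d. R a b * G b k) = (\<Sum>b<d. \<Sum>j<d. (G a j * p j) * (cnj (G b j) * G b k))"
      by (simp add: R_def sum_distrib_left sum_distrib_right mult_ac)
    also have "\<dots> = (\<Sum>j<d. \<Sum>b<d. (G a j * p j) * (cnj (G b j) * G b k))" by (rule sum.swap)
    also have "\<dots> = (\<Sum>j<d. if j = k then G a j * p j else 0)"
      unfolding sum_distrib_left[symmetric] using that by (intro sum.cong refl) (simp add: G1)
    finally show ?thesis using that by (simp add: mult.commute)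
  qed
  have GR: "(\<Sum>a<d. cnj (G a j) * R a b) = p j * cnj (G b j)" if "b < d" "j < d" for b j
  proof -
    have "(\<Sum>a<d. cnj (G a j) * R a b) = (\<Sum>a<d. \<Sum>l<d. (p l * cnj (G b l)) * (cnj (G a j) * G a l))"
      by (simp add: R_def sum_distrib_left sum_distrib_right mult_ac)
    also have "\<dots> = (\<Sum>l<d. \<Sum>a<d. (p l * cnj (G b l)) * (cnj (G a j) * G a l))" by (rule sum.swap)
    also have "\<dots> = (\<Sum>l<d. if j = l then p l * cnj (G b l) else 0)"
      unfolding sum_distrib_left[symmetric] using that by (intro sum.cong refl) (simp add: G1)
    finally show ?thesis using that by simp
  qed
  \<comment> \<open>\<open>S\<close> is a union of blocks of \<rho> in the energy basis, so its
    projector, here \<open>P\<close>, commutes with \<rho> and connects equal eigenvalues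
    only.\<close>
  have Pp: "P j l = 0 \<or> p j = p l" if jl: "j < d" "l < d" for j l
  proof -
    have "p l * P j l = (\<Sum>a\<in>S. cnj (G a j) * (\<Sum>b<d. R a b * G b l))"
      unfolding P_def sum_distrib_left[of "complex_of_real (p l)"]
    proof (rule sum.cong[OF refl])
      fix a assume "a \<in> S"
      hence "(\<Sum>b<d. R a b * G b l) = p l * G a l" using jl Slt by (simp add: RG)
      thus "p l * (cnj (G a j) * G a l) = cnj (G a j) * (\<Sum>b<d. R a b * G b l)"
        by (simp only: mult.left_commute)
    qed
    also have "\<dots> = (\<Sum>a\<in>S. \<Sum>b<d. cnj (G a j) * R a b * G b l)" by (simp add: sum_distrib_left mult.assoc)
    also have "\<dots> = (\<Sum>a\<in>S. \<Sum>b\<in>S. cnj (G a j) * R a b * G b l)"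
    proof (rule sum.cong[OF refl])
      fix a assume a: "a \<in> S"
      show "(\<Sum>b<d. cnj (G a j) * R a b * G b l) = (\<Sum>b\<in>S. cnj (G a j) * R a b * G b l)"
        using S SR[of a] Slt[OF a] a unfolding R_def by (intro sum.mono_neutral_right) auto
    qed
    also have "\<dots> = (\<Sum>b\<in>S. \<Sum>a\<in>S. cnj (G a j) * R a b * G b l)" by (rule sum.swap)
    also have "\<dots> = (\<Sum>b\<in>S. \<Sum>a<d. cnj (G a j) * R a b * G b l)"
    proof (rule sum.cong[OF refl])
      fix b assume b: "b \<in> S"
      show "(\<Sum>a\<in>S. cnj (G a j) * R a b * G b l) = (\<Sum>a<d. cnj (G a j) * R a b * G b l)"
        using S SR[of _ b] Slt[OF b] b unfolding R_def by (intro sum.mono_neutral_left) auto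
    qed
    also have "\<dots> = (\<Sum>b\<in>S. p j * cnj (G b j) * G b l)"
      unfolding sum_distrib_right[symmetric] using jl Slt by (intro sum.cong refl) (simp add: GR)
    also have "\<dots> = p j * P j l" by (simp add: P_def sum_distrib_left mult.assoc)
    finally show ?thesis by auto
  qed
  \<comment> \<open>\<open>P\<close> is diagonal in the energy basis and hence commutes with the
    Hamiltonian; \<open>B\<close> is their product.\<close>
  have PA: "(\<Sum>l<d. P j l * A $$ (l,k)) = B j k" if jk: "j < d" "k < d" for j k
  proof -
    have "(\<Sum>l<d. P j l * A $$ (l,k)) = (\<Sum>l<d. \<Sum>a\<in>S. \<Sum>b<d. (cnj (G a j) * E b * G b k) * (G a l * cnj (G b l)))"
      using jk by (intro sum.cong refl) (simp add: P_def AG sum_product mult_ac)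
    also have "\<dots> = (\<Sum>a\<in>S. \<Sum>l<d. \<Sum>b<d. (cnj (G a j) * E b * G b k) * (G a l * cnj (G b l)))" by (rule sum.swap)
    also have "\<dots> = (\<Sum>a\<in>S. \<Sum>b<d. \<Sum>l<d. (cnj (G a j) * E b * G b k) * (G a l * cnj (G b l)))" by (intro sum.cong refl sum.swap)
    also have "\<dots> = (\<Sum>a\<in>S. \<Sum>b<d. if a = b then cnj (G a j) * E b * G b k else 0)"
      unfolding sum_distrib_left[symmetric] using Slt by (intro sum.cong refl) (simp add: G2)
    also have "\<dots> = B j k" unfolding B_def using Slt by (intro sum.cong refl) simp
    finally show ?thesis .
  qed
  have AP: "(\<Sum>l<d. A $$ (j,l) * P l k) = B j k" if jk: "j < d" "k < d" for j k
  proof -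
    have "(\<Sum>l<d. A $$ (j,l) * P l k) = (\<Sum>l<d. \<Sum>a\<in>S. \<Sum>b<d. (cnj (G b j) * E b * G a k) * (G b l * cnj (G a l)))"
    proof (intro sum.cong refl)
      fix l assume "l \<in> {..<d}"
      hence "A $$ (j,l) * P l k = P l k * (\<Sum>b<d. cnj (G b j) * E b * G b l)" using jk by (simp add: AG)
      thus "A $$ (j,l) * P l k = (\<Sum>a\<in>S. \<Sum>b<d. (cnj (G b j) * E b * G a k) * (G b l * cnj (G a l)))"
        by (simp add: P_def sum_product mult_ac)
    qed
    also have "\<dots> = (\<Sum>a\<in>S. \<Sum>l<d. \<Sum>b<d. (cnj (G b j) * E b * G a k) * (G b l * cnj (G a l)))" by (rule sum.swap)
    also have "\<dots> = (\<Sum>a\<in>S. \<Sum>b<d. \<Sum>l<d. (cnj (G b j) * E b * G a k) * (G b l * cnj (G a l)))" by (intro sum.cong refl sum.swap)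
    also have "\<dots> = (\<Sum>a\<in>S. \<Sum>b<d. if b = a then cnj (G b j) * E b * G a k else 0)"
      unfolding sum_distrib_left[symmetric] using Slt by (intro sum.cong refl) (simp add: G2)
    also have "\<dots> = B j k" unfolding B_def using Slt by (intro sum.cong refl) simp
    finally show ?thesis .
  qed
  define \<zeta> where "\<zeta> = (\<lambda>s t. 2 * sqrt s * sqrt t / (s + t) :: real)"
  have Z: "?Z j l = \<zeta> (p j) (p l) * A $$ (j,l)" if "j < d" "l < d" for j l
    using that by (simp add: yu_op_def \<zeta>_def)
  \<comment> \<open>Since \<open>P\<close> connects equal eigenvalues only, the weight of
    \<open>?Z\<close> can be pulled out of the sum. Thus \<open>P\<close> commutes with
    \<open>?Z\<close> as well.\<close>
  have PZ: "(\<Sum>l<d. P j l * ?Z l k) = \<zeta> (p j) (p k) * B j k" if jk: "j < d" "k < d" for j k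
    unfolding PA[OF jk, symmetric] sum_distrib_left
  proof (intro sum.cong refl)
    fix l assume "l \<in> {..<d}"
    thus "P j l * ?Z l k = \<zeta> (p j) (p k) * (P j l * A $$ (l,k))"
      using Pp[of j l] jk by (auto simp: Z)
  qed
  have ZP: "(\<Sum>l<d. ?Z j l * P l k) = \<zeta> (p j) (p k) * B j k" if jk: "j < d" "k < d" for j k
    unfolding AP[OF jk, symmetric] sum_distrib_left
  proof (intro sum.cong refl)
    fix l assume "l \<in> {..<d}"
    thus "?Z j l * P l k = \<zeta> (p j) (p k) * (A $$ (j,l) * P l k)"
      using Pp[of l k] jk by (auto simp: Z)
  qed
  have \<zeta>: "sqrt (p i) * sqrt (p j) = (p i + p j) / 2 * \<zeta> (p i) (p j)" if "i < d" "j < d" for i j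
    using p[OF that(1)] p[OF that(2)] by (cases "p i + p j = 0") (auto simp: \<zeta>_def)
  \<comment> \<open>The expectation of \<rho> \<open>P\<close> in column \<open>k\<close> of
    \<open>V\<close>, that is, the weight of the projected vector.\<close>
  define Q where "Q = (\<Sum>i<d. \<Sum>j<d. cnj (V i k) * (p i * P i j) * V j k)"
  have expand: "(\<Sum>a\<in>S. f a * (M a * cnj (M a))) = (\<Sum>i<d. \<Sum>j<d. cnj (V i k) * ((sqrt (p i) * sqrt (p j)) * (\<Sum>a\<in>S. cnj (G a i) * f a * G a j)) * V j k)"
    for f :: "nat \<Rightarrow> complex"
  proof -
    let ?F = "\<lambda>a i j. cnj (V i k) * ((sqrt (p i) * sqrt (p j)) * (cnj (G a i) * f a * G a j)) * V j k"
    have "(\<Sum>a\<in>S. f a * (M a * cnj (M a))) = (\<Sum>a\<in>S. f a * (cnj (M a) * M a))" by (simp add: mult.commute)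
    also have "\<dots> = (\<Sum>a\<in>S. \<Sum>i<d. \<Sum>j<d. ?F a i j)"
      by (simp only: M_def cnj_sum sum_product, simp only: sum_distrib_left, intro sum.cong refl) (simp add: mult_ac)
    also have "\<dots> = (\<Sum>i<d. \<Sum>a\<in>S. \<Sum>j<d. ?F a i j)" by (rule sum.swap)
    also have "\<dots> = (\<Sum>i<d. \<Sum>j<d. \<Sum>a\<in>S. ?F a i j)" by (intro sum.cong refl sum.swap)
    finally show ?thesis by (simp add: sum_distrib_left sum_distrib_right)
  qed
  have norm: "complex_of_real (\<Sum>a\<in>S. (cmod (M a))\<^sup>2) = Q"
  proof -
    have "complex_of_real (\<Sum>a\<in>S. (cmod (M a))\<^sup>2) = (\<Sum>a\<in>S. 1 * (M a * cnj (M a)))"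
      by (simp add: cmod_sq)
    also have "\<dots> = Q" unfolding expand Q_def
    proof (intro sum.cong refl)
      fix i j assume ij: "i \<in> {..<d}" "j \<in> {..<d}"
      have "P i j = 0 \<or> sqrt (p i) * sqrt (p j) = p i" using Pp[of i j] p[of i] ij by auto
      hence "complex_of_real (sqrt (p i) * sqrt (p j)) * P i j = p i * P i j"
        by (elim disjE) (simp_all only: mult_zero_right)
      thus "cnj (V i k) * ((sqrt (p i) * sqrt (p j)) * (\<Sum>a\<in>S. cnj (G a i) * 1 * G a j)) * V j k = cnj (V i k) * (p i * P i j) * V j k"
        by (simp add: P_def)
    qed
    finally show ?thesis .
  qed
  have Q': "Q = (\<Sum>i<d. \<Sum>j<d. cnj (V i k) * (p j * P i j) * V j k)"
    unfolding Q_def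
  proof (intro sum.cong refl)
    fix i j assume "i \<in> {..<d}" "j \<in> {..<d}"
    thus "cnj (V i k) * (p i * P i j) * V j k = cnj (V i k) * (p j * P i j) * V j k" using Pp[of i j] by auto
  qed
  have VZ: "(\<Sum>i<d. cnj (V i k) * ?Z i l) = z k * cnj (V l k)" if l: "l < d" for l
  proof -
    have "(\<Sum>i<d. cnj (V i k) * ?Z i l) = cnj (\<Sum>i<d. ?Z l i * V i k)"
      unfolding cnj_sum
    proof (intro sum.cong refl)
      fix i assume "i \<in> {..<d}"
      hence "?Z i l = cnj (?Z l i)" using l by (intro hermitian_entry[OF yu_op_hermitian[OF A]]) auto
      thus "cnj (V i k) * ?Z i l = cnj (?Z l i * V i k)" by (simp add: mult.commute)
    qed
    thus ?thesis unfolding ZV[OF l] by simp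
  qed
  have "complex_of_real (\<Sum>a\<in>S. E a * (cmod (M a))\<^sup>2) = (\<Sum>a\<in>S. complex_of_real (E a) * (M a * cnj (M a)))"
    by (simp add: cmod_sq)
  also have "\<dots> = (\<Sum>i<d. \<Sum>j<d. cnj (V i k) * ((sqrt (p i) * sqrt (p j)) * B i j) * V j k)"
    unfolding expand B_def ..
  \<comment> \<open>The product of roots is the arithmetic mean times the weight of
    \<open>?Z\<close>. With \<open>?Z\<close> acting on its eigenvector once to the right and once
    to the left, each half contributes \<open>z k / 2 * Q\<close>.\<close>
  also have "\<dots> = (\<Sum>i<d. \<Sum>j<d. cnj (V i k) * (p i / 2 * (\<Sum>l<d. P i l * ?Z l j)) * V j k)
      + (\<Sum>i<d. \<Sum>j<d. cnj (V i k) * (p j / 2 * (\<Sum>l<d. ?Z i l * P l j)) * V j k)"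
    unfolding sum.distrib[symmetric]
  proof (intro sum.cong refl)
    fix i j assume ij: "i \<in> {..<d}" "j \<in> {..<d}"
    note ij' = ij[unfolded lessThan_iff]
    have "complex_of_real (sqrt (p i)) * complex_of_real (sqrt (p j)) = complex_of_real ((p i + p j) / 2 * \<zeta> (p i) (p j))"
      using \<zeta>[of i j] ij by (metis lessThan_iff of_real_mult)
    also have "\<dots> = (p i / 2) * \<zeta> (p i) (p j) + (p j / 2) * \<zeta> (p i) (p j)" by (simp add: algebra_simps add_divide_distrib)
    finally have e: "complex_of_real (sqrt (p i)) * complex_of_real (sqrt (p j)) = (p i / 2) * \<zeta> (p i) (p j) + (p j / 2) * \<zeta> (p i) (p j)" .
    show "cnj (V i k) * ((sqrt (p i) * sqrt (p j)) * B i j) * V j k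
      = cnj (V i k) * (p i / 2 * (\<Sum>l<d. P i l * ?Z l j)) * V j k + cnj (V i k) * (p j / 2 * (\<Sum>l<d. ?Z i l * P l j)) * V j k"
      unfolding PZ[OF ij'] ZP[OF ij'] of_real_mult e by (simp add: algebra_simps)
  qed
  also have "(\<Sum>i<d. \<Sum>j<d. cnj (V i k) * (p i / 2 * (\<Sum>l<d. P i l * ?Z l j)) * V j k) = z k / 2 * Q"
  proof -
    let ?F = "\<lambda>i j l. (cnj (V i k) * p i / 2 * P i l) * (?Z l j * V j k)"
    have "(\<Sum>i<d. \<Sum>j<d. cnj (V i k) * (p i / 2 * (\<Sum>l<d. P i l * ?Z l j)) * V j k) = (\<Sum>i<d. \<Sum>j<d. \<Sum>l<d. ?F i j l)"
      by (intro sum.cong refl) (simp add: sum_distrib_left sum_distrib_right mult_ac)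
    also have "\<dots> = (\<Sum>i<d. \<Sum>l<d. \<Sum>j<d. ?F i j l)" by (intro sum.cong refl sum.swap)
    also have "\<dots> = (\<Sum>i<d. \<Sum>l<d. (cnj (V i k) * p i / 2 * P i l) * (z k * V l k))"
      unfolding sum_distrib_left[symmetric] by (intro sum.cong refl) (simp add: ZV)
    also have "\<dots> = z k / 2 * Q" unfolding Q_def sum_distrib_left by (intro sum.cong refl) (simp add: mult_ac)
    finally show ?thesis .
  qed
  also have "(\<Sum>i<d. \<Sum>j<d. cnj (V i k) * (p j / 2 * (\<Sum>l<d. ?Z i l * P l j)) * V j k) = z k / 2 * Q"
  proof -
    let ?F = "\<lambda>i j l. (cnj (V i k) * ?Z i l) * (p j / 2 * P l j * V j k)"
    have "(\<Sum>i<d. \<Sum>j<d. cnj (V i k) * (p j / 2 * (\<Sum>l<d. ?Z i l * P l j)) * V j k) = (\<Sum>i<d. \<Sum>j<d. \<Sum>l<d. ?F i j l)"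
      by (intro sum.cong refl) (simp add: sum_distrib_left sum_distrib_right mult_ac)
    also have "\<dots> = (\<Sum>j<d. \<Sum>i<d. \<Sum>l<d. ?F i j l)" by (rule sum.swap)
    also have "\<dots> = (\<Sum>j<d. \<Sum>l<d. \<Sum>i<d. ?F i j l)" by (intro sum.cong refl sum.swap)
    also have "\<dots> = (\<Sum>j<d. \<Sum>l<d. (z k * cnj (V l k)) * (p j / 2 * P l j * V j k))"
      unfolding sum_distrib_right[symmetric] by (intro sum.cong refl) (simp add: VZ)
    also have "\<dots> = (\<Sum>l<d. \<Sum>j<d. (z k * cnj (V l k)) * (p j / 2 * P l j * V j k))" by (rule sum.swap)
    also have "\<dots> = z k / 2 * Q" unfolding Q' sum_distrib_left by (intro sum.cong refl) (simp add: mult_ac)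
    finally show ?thesis .
  qed
  also have "z k / 2 * Q + z k / 2 * Q = complex_of_real (z k * (\<Sum>a\<in>S. (cmod (M a))\<^sup>2))"
    unfolding of_real_mult norm by simp
  finally show ?thesis by (simp only: of_real_eq_iff)
qed

text \<open>The left side is the trace of \<rho> (A^2 - Z^2) with Z the weighted matrix. After
  symmetrization in the indices, (p j + p k)^2 - 4 p j p k = (p j - p k)^2 produces the weights of
  the Fisher information, and the right side is a quarter of it.\<close>

lemma yu_variance:
  assumes A: "hermitian d A" and p: "\<And>j. j < d \<Longrightarrow> p j \<ge> 0"
  shows "(\<Sum>j<d. \<Sum>k<d. p j * ((cmod (A $$ (j,k)))\<^sup>2 - (cmod (yu_op d A p $$ (j,k)))\<^sup>2))
    = (\<Sum>j<d. \<Sum>k<d. if p j + p k > 0 then (p j - p k)\<^sup>2 / (p j + p k) * (cmod (A $$ (j,k)))\<^sup>2 else 0) / 2"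
proof -
  let ?L = "\<lambda>j k. (cmod (A $$ (j,k)))\<^sup>2 - (cmod (yu_op d A p $$ (j,k)))\<^sup>2"
  have sym: "?L j k = ?L k j" if "j < d" "k < d" for j k
    using hermitian_entry[OF A that] hermitian_entry[OF yu_op_hermitian[OF A] that, of p] by simp
  have "(\<Sum>j<d. \<Sum>k<d. p j * ?L j k) = (\<Sum>j<d. \<Sum>k<d. p k * ?L k j)" by (rule sum.swap)
  also have "\<dots> = (\<Sum>j<d. \<Sum>k<d. p k * ?L j k)"
    by (intro sum.cong refl) (metis sym lessThan_iff)
  finally have "2 * (\<Sum>j<d. \<Sum>k<d. p j * ?L j k) = (\<Sum>j<d. \<Sum>k<d. (p j + p k) * ?L j k)"
    unfolding distrib_right sum.distrib by linarith
  also have "\<dots> = (\<Sum>j<d. \<Sum>k<d. if p j + p k > 0 then (p j - p k)\<^sup>2 / (p j + p k) * (cmod (A $$ (j,k)))\<^sup>2 else 0)"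
  proof (intro sum.cong refl)
    fix j k assume jk: "j \<in> {..<d}" "k \<in> {..<d}"
    have p0: "p j \<ge> 0" "p k \<ge> 0" using p jk by auto
    have L: "?L j k = (1 - 4 * (p j * p k) / (p j + p k)\<^sup>2) * (cmod (A $$ (j,k)))\<^sup>2"
    proof -
      have "(2 * sqrt (p j) * sqrt (p k) / (p j + p k))\<^sup>2 = 4 * (p j * p k) / (p j + p k)\<^sup>2"
        using p0 by (simp add: power_divide power_mult_distrib)
      moreover have "(cmod (yu_op d A p $$ (j,k)))\<^sup>2 = (2 * sqrt (p j) * sqrt (p k) / (p j + p k))\<^sup>2 * (cmod (A $$ (j,k)))\<^sup>2"
        using jk by (simp add: yu_op_def norm_mult power_mult_distrib norm_divide power_divide flip: of_real_add)
      ultimately show ?thesis by (simp add: algebra_simps)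
    qed
    show "(p j + p k) * ?L j k = (if p j + p k > 0 then (p j - p k)\<^sup>2 / (p j + p k) * (cmod (A $$ (j,k)))\<^sup>2 else 0)"
    proof (cases "p j + p k > 0")
      case True
      have "s * ((1 - 4 * (a * b) / s\<^sup>2) * c) = (a - b)\<^sup>2 / s * c" if "s > 0" "s = a + b" for s a b c :: real
      proof -
        have "s * (1 - 4 * (a * b) / s\<^sup>2) = (s\<^sup>2 - 4 * (a * b)) / s"
          using that(1) by (simp add: field_simps power2_eq_square)
        also have "s\<^sup>2 - 4 * (a * b) = (a - b)\<^sup>2" unfolding that(2) by (simp add: power2_eq_square algebra_simps)
        finally show ?thesis by (metis mult.assoc)
      qed
      thus ?thesis unfolding L using True by simp
    next
      case False
      hence "p j + p k = 0" using p0 by simp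
      thus ?thesis by simp
    qed
  qed
  finally show ?thesis by simp
qed

section \<open>Ensembles supported on energy lattices\<close>

lemma moments_sum_monom:
  fixes c :: "nat \<Rightarrow> real"
  shows "poly (\<Sum>a<d. monom (c a) (g a)) 1 = (\<Sum>a<d. c a)"
    and "mean (\<Sum>a<d. monom (c a) (g a)) = (\<Sum>a<d. c a * real (g a))"
    and "poly (pderiv (pderiv (\<Sum>a<d. monom (c a) (g a)))) 1 + mean (\<Sum>a<d. monom (c a) (g a)) = (\<Sum>a<d. c a * (real (g a))\<^sup>2)"
proof -
  show "poly (\<Sum>a<d. monom (c a) (g a)) 1 = (\<Sum>a<d. c a)" by (simp add: poly_sum poly_monom)
  show m: "mean (\<Sum>a<d. monom (c a) (g a)) = (\<Sum>a<d. c a * real (g a))" for d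
    unfolding mean_def by (induction d) (auto simp: pderiv_add pderiv_monom poly_monom)
  have "poly (pderiv (pderiv (\<Sum>a<d. monom (c a) (g a)))) 1 = (\<Sum>a<d. c a * (real (g a))\<^sup>2 - c a * real (g a))"
  proof (induction d)
    case (Suc d)
    have "real (g d - Suc 0) * (real (g d) * c d) = c d * (real (g d))\<^sup>2 - c d * real (g d)"
      by (cases "g d") (auto simp: power2_eq_square algebra_simps)
    thus ?case using Suc by (simp add: pderiv_add pderiv_monom poly_monom)
  qed simp
  thus "poly (pderiv (pderiv (\<Sum>a<d. monom (c a) (g a)))) 1 + mean (\<Sum>a<d. monom (c a) (g a)) = (\<Sum>a<d. c a * (real (g a))\<^sup>2)"
    unfolding m by (simp add: sum_subtractf)
qed

lemma prob_poly_sum_monom: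
  fixes c :: "nat \<Rightarrow> real"
  assumes "\<And>a. a < d \<Longrightarrow> c a \<ge> 0" "(\<Sum>a<d. c a) = 1"
  shows "prob_poly (\<Sum>a<d. monom (c a) (g a))"
  unfolding prob_poly_def moments_sum_monom(1)
  using assms by (auto simp: coeff_sum_monom intro!: sum_nonneg)

lemma cis_eq_imp: "cis x = cis y \<Longrightarrow> \<exists>n::int. x = y + 2 * pi * n"
  using sin_cos_eq_iff[of x y] by (simp add: complex_eq_iff)

text \<open>The members are the vectors sqrt \<rho> |e_k>, with e_k the eigenvectors of
  \<open>yu_op\<close>, cut into energy classes modulo \<open>2 * pi / \<tau>\<close>; an index
  pairs \<open>k\<close> with the phase that names the class. The cut keeps the mixture because
  \<rho> has no coherence between classes. It also keeps the average variance, because all pieces of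
  one vector have the same mean energy.\<close>

lemma yu_ensemble:
  assumes W: "unitary d W" and Hd: "H = W * rdiag d E * adj W"
    and \<rho>: "density d \<rho>" and sd: "spectral_decomp d \<rho> U p" and \<tau>: "\<tau> > 0" and per: "evol H \<tau> \<rho> = \<rho>"
  shows "\<exists>(I :: (nat \<times> complex) set) q \<psi> g e. finite I \<and> (\<forall>i\<in>I. q i > 0) \<and> sum q I = 1
    \<and> (\<forall>i\<in>I. (\<Sum>a<d. (cmod (\<psi> i a))\<^sup>2) = 1)
    \<and> (\<forall>a<d. \<forall>b<d. (adj W * \<rho> * W) $$ (a,b) = (\<Sum>i\<in>I. complex_of_real (q i) * (\<psi> i a * cnj (\<psi> i b))))
    \<and> (\<forall>i\<in>I. \<forall>a<d. \<psi> i a \<noteq> 0 \<longrightarrow> E a = e i + 2 * pi / \<tau> * real (g i a))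
    \<and> 4 * (\<Sum>i\<in>I. q i * variance (\<Sum>a<d. monom ((cmod (\<psi> i a))\<^sup>2) (g i a))) = (\<tau> / (2 * pi))\<^sup>2 * qfi_of_decomp d H U p"
proof -
  have U: "unitary d U" and \<rho>d: "\<rho> = U * rdiag d p * adj U" using sd by (auto simp: spectral_decomp_def)
  have rpsd: "psd d \<rho>" using \<rho> by (simp add: density_def)
  have rc: "\<rho> \<in> carrier_mat d d" using rpsd by (simp add: psd_def hermitian_def)
  have p: "\<And>j. j < d \<Longrightarrow> p j \<ge> 0" using psd_eigen_nonneg[OF rpsd U \<rho>d] .
  note w = unitaryD[OF W] and u = unitaryD[OF U]
  have cW: "adj W \<in> carrier_mat d d" and cU: "adj U \<in> carrier_mat d d" using w u by auto
  have H: "hermitian d H"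
  proof -
    have "hermitian d (rdiag d E)" by (rule hermitianI) (auto simp: rdiag_def)
    from hermitian_conj[OF this cW] show ?thesis by (simp add: Hd)
  qed
  define A where "A = adj U * H * U"
  have A: "hermitian d A" unfolding A_def by (rule hermitian_conj[OF H u(1)])
  define Gm where "Gm = adj W * U"
  have Gu: "unitary d Gm" unfolding Gm_def by (intro unitary_mult unitary_adj W U)
  note gu = unitaryD[OF Gu]
  define R where "R = adj W * \<rho> * W"
  have Re: "R $$ (a,b) = (\<Sum>j<d. Gm $$ (a,j) * p j * cnj (Gm $$ (b,j)))" if "a < d" "b < d" for a b
  proof -
    have "Gm * rdiag d p * adj Gm = (adj W * U) * rdiag d p * (adj U * W)"
      unfolding Gm_def by (simp add: adj_mult[OF cW u(1)])
    also have "\<dots> = adj W * (U * rdiag d p) * (adj U * W)"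
      by (subst assoc_mult_mat[OF cW u(1)]) (auto simp: rdiag_def)
    also have "\<dots> = adj W * (U * rdiag d p * adj U) * W"
      by (rule assoc4[of _ d d _ d _ d _ d]) (use w u in \<open>auto simp: rdiag_cdiag\<close>)
    finally have "R = Gm * rdiag d p * adj Gm" by (simp add: R_def \<rho>d)
    thus ?thesis unfolding rdiag_cdiag using cdiag_conj_entry[OF gu(1) that] by simp
  qed
  have AG: "A $$ (j,k) = (\<Sum>a<d. cnj (Gm $$ (a,j)) * E a * Gm $$ (a,k))" if jk: "j < d" "k < d" for j k
  proof -
    have cE: "rdiag d E \<in> carrier_mat d d" by (simp add: rdiag_cdiag)
    have "A = adj Gm * rdiag d E * Gm" unfolding A_def Hd Gm_def by (rule conj_conj_mult[OF u(1) w(1) cE])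
    hence "A $$ (j,k) = (adj Gm * cdiag d (\<lambda>i. E i) * adj (adj Gm)) $$ (j,k)" by (simp add: rdiag_cdiag)
    also have "\<dots> = (\<Sum>a<d. adj Gm $$ (j,a) * E a * cnj (adj Gm $$ (k,a)))"
      by (rule cdiag_conj_entry) (use gu jk in auto)
    also have "\<dots> = (\<Sum>a<d. cnj (Gm $$ (a,j)) * E a * Gm $$ (a,k))"
      using jk by (intro sum.cong refl) (simp add: adj_entry[OF gu(1)])
    finally show ?thesis .
  qed
  from hermitian_spectral[OF yu_op_hermitian[OF A]] obtain Vm z where Vu: "unitary d Vm"
    and Zd: "yu_op d A p = Vm * rdiag d z * adj Vm" by blast
  note v = unitaryD[OF Vu]
  have ZV: "(\<Sum>j<d. yu_op d A p $$ (k,j) * Vm $$ (j,x)) = z x * Vm $$ (k,x)" if kx: "k < d" "x < d" for k x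
  proof -
    have "yu_op d A p * Vm = Vm * rdiag d z"
    proof -
      have "Vm * rdiag d z \<in> carrier_mat d d" using v by (simp add: rdiag_cdiag)
      thus ?thesis unfolding Zd using v
        by (subst assoc_mult_mat[of _ d d _ d _ d]) (auto simp: right_mult_one_mat[of _ d d])
    qed
    hence "(\<Sum>j<d. yu_op d A p $$ (k,j) * Vm $$ (j,x)) = (Vm * rdiag d z) $$ (k,x)"
      using mult_entry[OF _ v(1) kx, of "yu_op d A p"] hermitian_carrier[OF yu_op_hermitian[OF A]] by simp
    also have "\<dots> = (\<Sum>j<d. Vm $$ (k,j) * rdiag d z $$ (j,x))"
      using kx v by (intro mult_entry) (auto simp: rdiag_cdiag)
    also have "\<dots> = (\<Sum>j<d. if j = x then Vm $$ (k,x) * z x else 0)"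
      using kx by (intro sum.cong refl) (auto simp: rdiag_cdiag cdiag_entry)
    finally show ?thesis using kx by (simp add: mult.commute)
  qed
  define M where "M = (\<lambda>a k. \<Sum>j<d. Gm $$ (a,j) * sqrt (p j) * Vm $$ (j,k))"
  \<comment> \<open>Two energies have the same phase exactly if they differ by an integer multiple
    of \<open>2 * pi / \<tau>\<close>.\<close>
  define vv where "vv = (\<lambda>a. cis (- E a * \<tau>))"
  have Rv: "vv a = vv b" if ab: "a < d" "b < d" and nz: "R $$ (a,b) \<noteq> 0" for a b
  proof -
    have "R $$ (a,b) = cis (- (E a - E b) * \<tau>) * R $$ (a,b)"
      using evol_entry[OF W Hd rc ab, of \<tau>] unfolding per R_def .
    hence "cis (- (E a - E b) * \<tau>) = 1" using nz by simp
    moreover have "vv a = cis (- (E a - E b) * \<tau>) * vv b" by (simp add: vv_def cis_mult algebra_simps)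
    ultimately show ?thesis by simp
  qed
  define S where "S = (\<lambda>c. {a \<in> {..<d}. vv a = c})"
  define Q where "Q = (\<lambda>(k,c). \<Sum>a\<in>S c. (cmod (M a k))\<^sup>2)"
  define Cl where "Cl = vv ` {..<d}"
  have Sf: "finite (S c)" "S c \<subseteq> {..<d}" for c by (auto simp: S_def)
  have Q0: "Q i \<ge> 0" for i by (auto simp: Q_def split: prod.split intro!: sum_nonneg)
  have Qz: "M a k = 0" if "Q (k,c) = 0" "a \<in> S c" for k c a
  proof -
    have "\<forall>a\<in>S c. (cmod (M a k))\<^sup>2 = 0"
      using that(1) Sf unfolding Q_def prod.case by (subst (asm) sum_nonneg_eq_0_iff) auto
    thus ?thesis using that(2) by simp
  qed
  have energy: "(\<Sum>a\<in>S c. E a * (cmod (M a k))\<^sup>2) = z k * Q (k,c)" if k: "k < d" for k c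
    unfolding Q_def prod.case M_def
    by (rule yu_mean_energy[where G = "\<lambda>a j. Gm $$ (a,j)" and V = "\<lambda>j k. Vm $$ (j,k)" and A = A and p = p and d = d])
       (use A p unitary_sum[OF Gu] AG Sf Rv ZV k Re in \<open>auto simp: S_def\<close>)
  \<comment> \<open>Pieces of weight 0 cannot be normalized and are left out.\<close>
  define I where "I = {i \<in> {..<d} \<times> Cl. Q i > 0}"
  have fI: "finite I" by (simp add: I_def Cl_def)
  have group: "(\<Sum>c\<in>Cl. \<Sum>a\<in>S c. h a) = (\<Sum>a<d. h a)" for h :: "nat \<Rightarrow> 'b::comm_monoid_add"
    unfolding S_def Cl_def by (rule sum.group) auto
  have sumI: "(\<Sum>i\<in>I. h i) = (\<Sum>k<d. \<Sum>c\<in>Cl. h (k,c))" if "\<And>k c. k < d \<Longrightarrow> c \<in> Cl \<Longrightarrow> Q (k,c) = 0 \<Longrightarrow> h (k,c) = 0"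
    for h :: "nat \<times> complex \<Rightarrow> 'b::comm_monoid_add"
  proof -
    have "(\<Sum>i\<in>I. h i) = (\<Sum>i\<in>{..<d} \<times> Cl. h i)"
    proof (rule sum.mono_neutral_left)
      show "\<forall>i\<in>{..<d} \<times> Cl - I. h i = 0"
      proof
        fix i assume i: "i \<in> {..<d} \<times> Cl - I"
        hence "\<not> Q i > 0" by (auto simp: I_def)
        hence "Q i = 0" using Q0[of i] by simp
        thus "h i = 0" using that[of "fst i" "snd i"] i by auto
      qed
    qed (auto simp: I_def Cl_def)
    thus ?thesis by (simp add: sum.cartesian_product case_prod_beta)
  qed
  define \<psi> where "\<psi> = (\<lambda>(k,c) a. if a \<in> S c then M a k / sqrt (Q (k,c)) else 0)"
  define \<omega> where "\<omega> = 2 * pi / \<tau>"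
  have \<omega>: "\<omega> > 0" using \<tau> by (simp add: \<omega>_def)
  \<comment> \<open>The lowest energy of a class is taken as origin, so that lattice positions are
    natural numbers and can serve as exponents.\<close>
  define e where "e = (\<lambda>(k::nat,c). Min (E ` S c))"
  define g where "g = (\<lambda>i a. nat \<lfloor>(E a - e i) / \<omega>\<rfloor>)"
  have lat: "E a = e (k,c) + \<omega> * real (g (k,c) a)" if a: "a \<in> S c" for k c a
  proof -
    have ne: "E ` S c \<noteq> {}" "finite (E ` S c)" using a Sf by auto
    from Min_in[OF ne(2,1)] obtain b where b: "b \<in> S c" "e (k,c) = E b" by (auto simp: e_def)
    have "cis (- E b * \<tau>) = cis (- E a * \<tau>)" using a b by (simp add: S_def vv_def)
    from cis_eq_imp[OF this] obtain n :: int where "- E b * \<tau> = - E a * \<tau> + 2 * pi * n" by blast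
    hence "(E a - E b) * \<tau> = 2 * pi * n" by (simp add: algebra_simps)
    hence n: "E a - E b = \<omega> * n" using \<tau> by (simp add: \<omega>_def field_simps)
    have "E b \<le> E a" using Min_le[OF ne(2), of "E a"] a b by (simp add: e_def)
    hence "n \<ge> 0" using n \<omega> by (metis diff_ge_0_iff_ge of_int_0_le_iff zero_le_mult_iff not_le less_imp_le)
    moreover have "(E a - e (k,c)) / \<omega> = n" using n \<omega> b by simp
    ultimately show ?thesis using n b by (simp add: g_def)
  qed
  have \<psi>1: "(\<Sum>a<d. (cmod (\<psi> (k,c) a))\<^sup>2 * h a) = (\<Sum>a\<in>S c. h a * (cmod (M a k))\<^sup>2) / Q (k,c)" if "Q (k,c) > 0" for k c h
  proof -
    have "(\<Sum>a<d. (cmod (\<psi> (k,c) a))\<^sup>2 * h a) = (\<Sum>a\<in>S c. (cmod (\<psi> (k,c) a))\<^sup>2 * h a)"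
      using Sf by (intro sum.mono_neutral_right) (auto simp: \<psi>_def)
    also have "\<dots> = (\<Sum>a\<in>S c. h a * (cmod (M a k))\<^sup>2 / Q (k,c))"
      using that by (intro sum.cong refl) (simp add: \<psi>_def norm_divide power_divide)
    finally show ?thesis by (simp add: sum_divide_distrib)
  qed
  have \<psi>n: "(\<Sum>a<d. (cmod (\<psi> (k,c) a))\<^sup>2) = 1" if "Q (k,c) > 0" for k c
    using \<psi>1[OF that, of "\<lambda>_. 1"] that by (simp add: Q_def)
  \<comment> \<open>Before the cut the vectors already reproduce \<rho>, by unitarity of
    \<open>Vm\<close>.\<close>
  have VV: "(\<Sum>k<d. M a k * cnj (M b k)) = R $$ (a,b)" if ab: "a < d" "b < d" for a b
  proof -
    let ?F = "\<lambda>j l k. (Gm $$ (a,j) * sqrt (p j) * cnj (Gm $$ (b,l)) * sqrt (p l)) * (Vm $$ (j,k) * cnj (Vm $$ (l,k)))"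
    have "(\<Sum>k<d. M a k * cnj (M b k)) = (\<Sum>k<d. \<Sum>j<d. \<Sum>l<d. ?F j l k)"
      unfolding M_def cnj_sum sum_product by (intro sum.cong refl) (simp add: mult_ac)
    also have "\<dots> = (\<Sum>j<d. \<Sum>k<d. \<Sum>l<d. ?F j l k)" by (rule sum.swap)
    also have "\<dots> = (\<Sum>j<d. \<Sum>l<d. \<Sum>k<d. ?F j l k)" by (intro sum.cong refl sum.swap)
    also have "\<dots> = (\<Sum>j<d. \<Sum>l<d. if j = l then Gm $$ (a,j) * p j * cnj (Gm $$ (b,j)) else 0)"
    proof (intro sum.cong refl)
      fix j l assume jl: "j \<in> {..<d}" "l \<in> {..<d}"
      have s: "complex_of_real (sqrt (p j)) * complex_of_real (sqrt (p j)) = p j"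
        using p[of j] jl by (simp flip: of_real_mult)
      have "(\<Sum>k<d. ?F j l k) = (Gm $$ (a,j) * sqrt (p j) * cnj (Gm $$ (b,l)) * sqrt (p l)) * (if j = l then 1 else 0)"
        unfolding sum_distrib_left[symmetric] using unitary_sum(2)[OF Vu, of j l] jl by simp
      thus "(\<Sum>k<d. ?F j l k) = (if j = l then Gm $$ (a,j) * p j * cnj (Gm $$ (b,j)) else 0)"
        using s by (auto simp: mult_ac)
    qed
    also have "\<dots> = R $$ (a,b)" using ab by (simp add: Re)
    finally show ?thesis .
  qed
  have Rsum: "R $$ (a,b) = (\<Sum>i\<in>I. complex_of_real (Q i) * (\<psi> i a * cnj (\<psi> i b)))" if ab: "a < d" "b < d" for a b
  proof -
    have "(\<Sum>i\<in>I. complex_of_real (Q i) * (\<psi> i a * cnj (\<psi> i b))) = (\<Sum>k<d. \<Sum>c\<in>Cl. complex_of_real (Q (k,c)) * (\<psi> (k,c) a * cnj (\<psi> (k,c) b)))"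
      by (rule sumI) simp
    also have "\<dots> = (\<Sum>k<d. \<Sum>c\<in>Cl. if c = vv a then (if vv a = vv b then M a k * cnj (M b k) else 0) else 0)"
    proof (intro sum.cong refl)
      fix k c
      show "complex_of_real (Q (k,c)) * (\<psi> (k,c) a * cnj (\<psi> (k,c) b)) = (if c = vv a then (if vv a = vv b then M a k * cnj (M b k) else 0) else 0)"
      proof (cases "a \<in> S c \<and> b \<in> S c")
        case True
        hence vab: "c = vv a" "vv a = vv b" by (auto simp: S_def)
        show ?thesis
        proof (cases "Q (k,c) = 0")
          case z: True
          thus ?thesis using Qz[OF z] True vab by simp
        next
          case False
          have s: "complex_of_real (sqrt (Q (k,c))) * complex_of_real (sqrt (Q (k,c))) = Q (k,c)"
            using Q0[of "(k,c)"] by (simp flip: of_real_mult)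
          have "complex_of_real (Q (k,c)) * (\<psi> (k,c) a * cnj (\<psi> (k,c) b))
            = complex_of_real (Q (k,c)) * (M a k * cnj (M b k)) / (complex_of_real (sqrt (Q (k,c))) * complex_of_real (sqrt (Q (k,c))))"
            using True by (simp add: \<psi>_def)
          also have "\<dots> = M a k * cnj (M b k)" unfolding s using False by simp
          finally show ?thesis using vab by simp
        qed
      next
        case False
        thus ?thesis using ab by (auto simp: \<psi>_def S_def)
      qed
    qed
    also have "\<dots> = (\<Sum>k<d. if vv a = vv b then M a k * cnj (M b k) else 0)"
      using ab by (intro sum.cong refl) (simp add: Cl_def)
    also have "\<dots> = R $$ (a,b)" using VV[OF ab] Rv[OF ab] by (cases "vv a = vv b") auto
    finally show ?thesis ..
  qed
  have Mrow: "(\<Sum>k<d. (cmod (M a k))\<^sup>2) = (\<Sum>j<d. p j * (cmod (Gm $$ (a,j)))\<^sup>2)" if a: "a < d" for a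
  proof -
    have "complex_of_real (\<Sum>k<d. (cmod (M a k))\<^sup>2) = R $$ (a,a)"
      using VV[OF a a] by (simp add: cmod_sq)
    also have "\<dots> = complex_of_real (\<Sum>j<d. p j * (cmod (Gm $$ (a,j)))\<^sup>2)"
      unfolding Re[OF a a] by (simp add: cmod_sq mult_ac)
    finally show ?thesis by (simp only: of_real_eq_iff)
  qed
  have Mcol: "(\<Sum>a<d. (cmod (M a k))\<^sup>2) = (\<Sum>j<d. p j * (cmod (Vm $$ (j,k)))\<^sup>2)" if k: "k < d" for k
  proof -
    have "(cmod (M a k))\<^sup>2 = (cmod (\<Sum>j<d. adj Gm $$ (j,a) * cnj (sqrt (p j) * Vm $$ (j,k))))\<^sup>2" if "a < d" for a
    proof -
      have "cnj (M a k) = (\<Sum>j<d. adj Gm $$ (j,a) * cnj (sqrt (p j) * Vm $$ (j,k)))"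
        unfolding M_def cnj_sum using that by (intro sum.cong refl) (simp add: adj_entry[OF gu(1)] mult_ac)
      thus ?thesis by (metis complex_mod_cnj)
    qed
    hence "(\<Sum>a<d. (cmod (M a k))\<^sup>2) = (\<Sum>a<d. (cmod (\<Sum>j<d. adj Gm $$ (j,a) * cnj (sqrt (p j) * Vm $$ (j,k))))\<^sup>2)" by simp
    also have "\<dots> = (\<Sum>j<d. (cmod (cnj (sqrt (p j) * Vm $$ (j,k))))\<^sup>2)"
      by (rule parseval[OF unitary_adj[OF Gu]])
    also have "\<dots> = (\<Sum>j<d. p j * (cmod (Vm $$ (j,k)))\<^sup>2)"
      using p by (intro sum.cong refl) (simp add: norm_mult power_mult_distrib)
    finally show ?thesis .
  qed
  have Qsum: "sum Q I = 1"
  proof -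
    have "sum Q I = (\<Sum>k<d. \<Sum>c\<in>Cl. Q (k,c))" by (rule sumI) simp
    also have "\<dots> = (\<Sum>k<d. \<Sum>a<d. (cmod (M a k))\<^sup>2)" by (simp add: Q_def group)
    also have "\<dots> = (\<Sum>k<d. \<Sum>j<d. p j * (cmod (Vm $$ (j,k)))\<^sup>2)" by (simp add: Mcol)
    also have "\<dots> = (\<Sum>j<d. \<Sum>k<d. p j * (cmod (Vm $$ (j,k)))\<^sup>2)" by (rule sum.swap)
    also have "\<dots> = (\<Sum>j<d. p j)" by (simp add: unitary_row_sum(1)[OF Vu] flip: sum_distrib_left)
    also have "\<dots> = 1"
    proof -
      have "mtrace \<rho> = complex_of_real (\<Sum>j<d. p j)" unfolding \<rho>d rdiag_cdiag mtrace_conj[OF U] by simp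
      thus ?thesis using \<rho> by (metis density_def of_real_eq_1_iff)
    qed
    finally show ?thesis .
  qed
  \<comment> \<open>The mean energy is \<open>z k\<close> in every class, so a piece contributes its
    second moment minus the square of \<open>z k\<close> times its weight; both terms are additive
    over the classes.\<close>
  have var: "\<omega>\<^sup>2 * (Q (k,c) * variance (\<Sum>a<d. monom ((cmod (\<psi> (k,c) a))\<^sup>2) (g (k,c) a)))
      = (\<Sum>a\<in>S c. (E a)\<^sup>2 * (cmod (M a k))\<^sup>2) - (z k)\<^sup>2 * Q (k,c)" if k: "k < d" and Qp: "Q (k,c) > 0" for k c
  proof -
    let ?c = "\<lambda>a. (cmod (\<psi> (k,c) a))\<^sup>2" and ?g = "\<lambda>a. real (g (k,c) a)" and ?e = "e (k,c)"
    have E: "?c a * E a = ?c a * (?e + \<omega> * ?g a)" "?c a * (E a)\<^sup>2 = ?c a * (?e + \<omega> * ?g a)\<^sup>2" for a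
      using lat[of a c k] by (auto simp: \<psi>_def)
    have 1: "z k = ?e + \<omega> * (\<Sum>a<d. ?c a * ?g a)"
    proof -
      have "(\<Sum>a<d. ?c a * E a) = z k" unfolding \<psi>1[OF Qp] energy[OF k] using Qp by simp
      moreover have "(\<Sum>a<d. ?c a * E a) = ?e * (\<Sum>a<d. ?c a) + \<omega> * (\<Sum>a<d. ?c a * ?g a)"
        unfolding E sum_distrib_left sum.distrib[symmetric] by (intro sum.cong refl) (simp add: algebra_simps)
      ultimately show ?thesis using \<psi>n[OF Qp] by simp
    qed
    have 2: "(\<Sum>a\<in>S c. (E a)\<^sup>2 * (cmod (M a k))\<^sup>2) / Q (k,c) = ?e\<^sup>2 + 2 * ?e * \<omega> * (\<Sum>a<d. ?c a * ?g a) + \<omega>\<^sup>2 * (\<Sum>a<d. ?c a * (?g a)\<^sup>2)"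
    proof -
      have "(\<Sum>a<d. ?c a * (E a)\<^sup>2) = ?e\<^sup>2 * (\<Sum>a<d. ?c a) + 2 * ?e * \<omega> * (\<Sum>a<d. ?c a * ?g a) + \<omega>\<^sup>2 * (\<Sum>a<d. ?c a * (?g a)\<^sup>2)"
        unfolding E sum_distrib_left sum.distrib[symmetric] by (intro sum.cong refl) (simp add: power2_eq_square algebra_simps)
      thus ?thesis unfolding \<psi>1[OF Qp] using \<psi>n[OF Qp] by simp
    qed
    have v: "variance (\<Sum>a<d. monom (?c a) (g (k,c) a)) = (\<Sum>a<d. ?c a * (?g a)\<^sup>2) - (\<Sum>a<d. ?c a * ?g a)\<^sup>2"
      unfolding variance_def moments_sum_monom(3) unfolding moments_sum_monom(2) ..
    have "\<omega>\<^sup>2 * variance (\<Sum>a<d. monom (?c a) (g (k,c) a)) = (\<Sum>a\<in>S c. (E a)\<^sup>2 * (cmod (M a k))\<^sup>2) / Q (k,c) - (z k)\<^sup>2"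
      unfolding 2 1 v by (simp add: power2_eq_square algebra_simps)
    hence "Q (k,c) * (\<omega>\<^sup>2 * variance (\<Sum>a<d. monom (?c a) (g (k,c) a))) = (\<Sum>a\<in>S c. (E a)\<^sup>2 * (cmod (M a k))\<^sup>2) - Q (k,c) * (z k)\<^sup>2"
      using Qp by (simp add: right_diff_distrib)
    thus ?thesis by (simp add: mult_ac)
  qed
  let ?v = "\<lambda>i. variance (\<Sum>a<d. monom ((cmod (\<psi> i a))\<^sup>2) (g i a))"
  have "\<omega>\<^sup>2 * (\<Sum>i\<in>I. Q i * ?v i) = (\<Sum>i\<in>I. (\<Sum>a\<in>S (snd i). (E a)\<^sup>2 * (cmod (M a (fst i)))\<^sup>2) - (z (fst i))\<^sup>2 * Q i)"
    unfolding sum_distrib_left using var by (intro sum.cong refl) (auto simp: I_def)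
  also have "\<dots> = (\<Sum>k<d. \<Sum>c\<in>Cl. (\<Sum>a\<in>S c. (E a)\<^sup>2 * (cmod (M a k))\<^sup>2) - (z k)\<^sup>2 * Q (k,c))"
    by (subst sumI) (auto simp: Qz)
  also have "\<dots> = (\<Sum>k<d. (\<Sum>a<d. (E a)\<^sup>2 * (cmod (M a k))\<^sup>2) - (z k)\<^sup>2 * (\<Sum>a<d. (cmod (M a k))\<^sup>2))"
    unfolding sum_subtractf group sum_distrib_left[symmetric] by (simp add: Q_def group)
  also have "\<dots> = (\<Sum>a<d. (E a)\<^sup>2 * (\<Sum>k<d. (cmod (M a k))\<^sup>2)) - (\<Sum>k<d. (z k)\<^sup>2 * (\<Sum>j<d. p j * (cmod (Vm $$ (j,k)))\<^sup>2))"
    unfolding sum_subtractf sum_distrib_left[of _ _ "{..<d}"] using Mcol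
    by (subst sum.swap) (simp flip: sum_distrib_left)
  \<comment> \<open>By Parseval's identity the second moment of the energy becomes the trace of
    \<rho> A^2 in the eigenbasis of \<rho>.\<close>
  also have "(\<Sum>a<d. (E a)\<^sup>2 * (\<Sum>k<d. (cmod (M a k))\<^sup>2)) = (\<Sum>j<d. p j * (\<Sum>k<d. (cmod (A $$ (j,k)))\<^sup>2))"
  proof -
    have "(\<Sum>a<d. (E a)\<^sup>2 * (\<Sum>k<d. (cmod (M a k))\<^sup>2)) = (\<Sum>a<d. \<Sum>j<d. p j * (cmod (cnj (Gm $$ (a,j)) * E a))\<^sup>2)"
      by (intro sum.cong refl) (simp add: Mrow sum_distrib_left norm_mult power_mult_distrib mult_ac)
    also have "\<dots> = (\<Sum>j<d. p j * (\<Sum>a<d. (cmod (cnj (Gm $$ (a,j)) * E a))\<^sup>2))"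
      by (subst sum.swap) (simp add: sum_distrib_left)
    also have "\<dots> = (\<Sum>j<d. p j * (\<Sum>k<d. (cmod (A $$ (j,k)))\<^sup>2))"
    proof (rule sum.cong[OF refl])
      fix j assume j: "j \<in> {..<d}"
      have "(\<Sum>a<d. (cmod (cnj (Gm $$ (a,j)) * E a))\<^sup>2) = (\<Sum>k<d. (cmod (\<Sum>a<d. Gm $$ (a,k) * (cnj (Gm $$ (a,j)) * E a)))\<^sup>2)"
        by (rule parseval[OF Gu, symmetric])
      also have "\<dots> = (\<Sum>k<d. (cmod (A $$ (j,k)))\<^sup>2)"
        using j by (intro sum.cong refl) (simp add: AG mult_ac)
      finally show "p j * (\<Sum>a<d. (cmod (cnj (Gm $$ (a,j)) * E a))\<^sup>2) = p j * (\<Sum>k<d. (cmod (A $$ (j,k)))\<^sup>2)" by simp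
    qed
    finally show ?thesis .
  qed
  \<comment> \<open>The eigenvector equation turns \<open>z k * Vm $$ (j,k)\<close> into row
    \<open>j\<close> of \<open>yu_op\<close> applied to column \<open>k\<close>, and Parseval's
    identity for \<open>Vm\<close> then removes the eigenvectors.\<close>
  also have "(\<Sum>k<d. (z k)\<^sup>2 * (\<Sum>j<d. p j * (cmod (Vm $$ (j,k)))\<^sup>2)) = (\<Sum>j<d. p j * (\<Sum>k<d. (cmod (yu_op d A p $$ (j,k)))\<^sup>2))"
  proof -
    have "(\<Sum>k<d. (z k)\<^sup>2 * (\<Sum>j<d. p j * (cmod (Vm $$ (j,k)))\<^sup>2)) = (\<Sum>k<d. \<Sum>j<d. p j * (cmod (z k * Vm $$ (j,k)))\<^sup>2)"
      by (intro sum.cong refl) (simp add: sum_distrib_left norm_mult power_mult_distrib mult_ac)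
    also have "\<dots> = (\<Sum>j<d. p j * (\<Sum>k<d. (cmod (z k * Vm $$ (j,k)))\<^sup>2))"
      by (subst sum.swap) (simp add: sum_distrib_left)
    also have "\<dots> = (\<Sum>j<d. p j * (\<Sum>k<d. (cmod (\<Sum>l<d. Vm $$ (l,k) * yu_op d A p $$ (j,l)))\<^sup>2))"
      by (intro sum.cong refl arg_cong2[where f = "(*)"]) (simp add: ZV[symmetric] mult.commute)
    finally show ?thesis unfolding parseval[OF Vu] .
  qed
  also have "(\<Sum>j<d. p j * (\<Sum>k<d. (cmod (A $$ (j,k)))\<^sup>2)) - (\<Sum>j<d. p j * (\<Sum>k<d. (cmod (yu_op d A p $$ (j,k)))\<^sup>2))
     = (\<Sum>j<d. \<Sum>k<d. p j * ((cmod (A $$ (j,k)))\<^sup>2 - (cmod (yu_op d A p $$ (j,k)))\<^sup>2))"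
    by (simp add: sum_subtractf right_diff_distrib sum_distrib_left)
  also have "\<dots> = qfi_of_decomp d H U p / 4"
    unfolding qfi_of_decomp_def A_def[symmetric]
    by (subst yu_variance[where p = p, OF A p]) simp_all
  finally have tot: "\<omega>\<^sup>2 * (\<Sum>i\<in>I. Q i * ?v i) = qfi_of_decomp d H U p / 4" .
  have "4 * (\<Sum>i\<in>I. Q i * ?v i) = (\<tau> / (2 * pi))\<^sup>2 * (4 * (\<omega>\<^sup>2 * (\<Sum>i\<in>I. Q i * ?v i)))"
    using \<tau> by (simp add: \<omega>_def power_divide)
  hence fin: "4 * (\<Sum>i\<in>I. Q i * ?v i) = (\<tau> / (2 * pi))\<^sup>2 * qfi_of_decomp d H U p" unfolding tot by simp
  have a1: "\<forall>i\<in>I. Q i > 0" by (simp add: I_def)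
  have a2: "\<forall>i\<in>I. (\<Sum>a<d. (cmod (\<psi> i a))\<^sup>2) = 1"
  proof
    fix i assume "i \<in> I"
    thus "(\<Sum>a<d. (cmod (\<psi> i a))\<^sup>2) = 1" using \<psi>n[of "fst i" "snd i"] by (simp add: I_def)
  qed
  have a3: "\<forall>a<d. \<forall>b<d. (adj W * \<rho> * W) $$ (a,b) = (\<Sum>i\<in>I. complex_of_real (Q i) * (\<psi> i a * cnj (\<psi> i b)))"
    using Rsum by (simp add: R_def)
  have a4: "\<forall>i\<in>I. \<forall>a<d. \<psi> i a \<noteq> 0 \<longrightarrow> E a = e i + 2 * pi / \<tau> * real (g i a)"
  proof (intro ballI allI impI)
    fix i a assume "\<psi> i a \<noteq> 0"
    hence "a \<in> S (snd i)" by (auto simp: \<psi>_def split: prod.splits if_splits)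
    from lat[OF this, of "fst i"] show "E a = e i + 2 * pi / \<tau> * real (g i a)" by (simp add: \<omega>_def)
  qed
  show ?thesis
    by (intro exI[of _ I] exI[of _ Q] exI[of _ \<psi>] exI[of _ g] exI[of _ e] conjI fI Qsum a1 a2 a3 a4 fin)
qed

section \<open>The coherence cost\<close>

lemma monom_prod: "(\<Prod>l<n. monom (c l) (k l)) = monom (\<Prod>l<n. c l) (\<Sum>l<n. k l :: nat)"
  for c :: "nat \<Rightarrow> real"
  by (induction n) (auto simp: mult_monom)

lemma sum_monom_dig:
  fixes c :: "nat \<Rightarrow> nat \<Rightarrow> real"
  shows "(\<Sum>i<d ^ n. monom (\<Prod>l<n. c l (dig d l i)) (\<Sum>l<n. k l (dig d l i))) = (\<Prod>l<n. \<Sum>a<d. monom (c l a) (k l a))"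
  using sum_prod_dig[where f = "\<lambda>l a. monom (c l a) (k l a)" and n = n and d = d] by (simp add: monom_prod)

text \<open>Digit 0 is the upper level, half a lattice spacing above zero, so the energy is that of
  all bits in the lower level plus one spacing for each digit 0.\<close>

lemma cbits_energy_lattice:
  assumes "\<tau> > 0"
  shows "esum 2 m (cbit_energy \<tau>) s = - (pi * m / \<tau>) + 2 * pi / \<tau> * real (\<Sum>l<m. if dig 2 l s = 0 then 1 else 0)"
proof -
  have "esum 2 m (cbit_energy \<tau>) s = (\<Sum>l<m. - (pi / \<tau>) + 2 * pi / \<tau> * real (if dig 2 l s = 0 then 1 else 0))"
    unfolding esum_def using assms by (intro sum.cong refl) (auto simp: cbit_energy_def field_simps)
  thus ?thesis by (simp add: sum.distrib sum_subtractf sum_distrib_left)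
qed

lemma cbits_poly: "(\<Sum>s<2 ^ m. monom ((cmod (cbits_amp \<tau> m 0 s))\<^sup>2) (c + (\<Sum>l<m. if dig 2 l s = 0 then 1 else 0)))
   = monom 1 c * bitp ^ m"
proof -
  have "(\<Sum>s<2 ^ m. monom ((cmod (cbits_amp \<tau> m 0 s))\<^sup>2) (c + (\<Sum>l<m. if dig 2 l s = 0 then 1 else 0)))
    = monom 1 c * (\<Sum>s<2 ^ m. monom (\<Prod>l<m. 1/2 :: real) (\<Sum>l<m. if dig 2 l s = 0 then 1 else 0))"
    unfolding sum_distrib_left
    by (intro sum.cong refl) (simp add: mult_monom cbits_amp_def norm_divide power_divide)
  also have "(\<Sum>s<2 ^ m. monom (\<Prod>l<m. 1/2 :: real) (\<Sum>l<m. if dig 2 l s = 0 then 1 else 0))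
    = (\<Prod>l<m. \<Sum>a<2. monom (1/2 :: real) (if a = (0::nat) then 1 else 0))"
    by (rule sum_monom_dig[where c = "\<lambda>_ _. 1/2" and k = "\<lambda>_ a. if a = 0 then 1 else 0"])
  also have "(\<Sum>a<2. monom (1/2 :: real) (if a = (0::nat) then 1 else 0)) = bitp"
    by (simp add: numeral_2_eq_2 bitp_def monom_Suc monom_0)
  finally show ?thesis by simp
qed

text \<open>The channel draws a word with its probability and runs the shift protocol for that word.
  The drawing is built into the Kraus operators as a factor \<open>sqrt (wt q xs)\<close>.\<close>

lemma qfi_achievable:
  assumes H: "hermitian d H" and \<rho>: "density d \<rho>" and sd: "spectral_decomp d \<rho> U p"
    and \<tau>: "\<tau> > 0" and per: "evol H \<tau> \<rho> = \<rho>" and Rbig: "(\<tau> / (2 * pi))\<^sup>2 * qfi_of_decomp d H U p < R"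
  shows "achievable d H \<rho> \<tau> R"
proof -
  from hermitian_spectral[OF H] obtain W E where W: "unitary d W" and Hd: "H = W * rdiag d E * adj W"
    by blast
  note w = unitaryD[OF W]
  have rh: "hermitian d \<rho>" using \<rho> by (simp add: density_def psd_def)
  note rc = hermitian_carrier[OF rh]
  from yu_ensemble[OF W Hd \<rho> sd \<tau> per] obtain I :: "(nat \<times> complex) set" and q \<psi> g e where fI: "finite I"
    and q: "\<forall>i\<in>I. q i > 0" and q1: "sum q I = 1"
    and \<psi>1: "\<forall>i\<in>I. (\<Sum>a<d. (cmod (\<psi> i a))\<^sup>2) = 1"
    and dec: "\<forall>a<d. \<forall>b<d. (adj W * \<rho> * W) $$ (a,b) = (\<Sum>i\<in>I. complex_of_real (q i) * (\<psi> i a * cnj (\<psi> i b)))"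
    and lat: "\<forall>i\<in>I. \<forall>a<d. \<psi> i a \<noteq> 0 \<longrightarrow> E a = e i + 2 * pi / \<tau> * real (g i a)"
    and var: "4 * (\<Sum>i\<in>I. q i * variance (\<Sum>a<d. monom ((cmod (\<psi> i a))\<^sup>2) (g i a))) = (\<tau> / (2 * pi))\<^sup>2 * qfi_of_decomp d H U p"
    by blast
  define pp where "pp = (\<lambda>i. \<Sum>a<d. monom ((cmod (\<psi> i a))\<^sup>2) (g i a))"
  have ppr: "prob_poly (pp i)" if "i \<in> I" for i
    unfolding pp_def using \<psi>1 that by (intro prob_poly_sum_monom) auto
  have q0: "q i \<ge> 0" if "i \<in> I" for i using q that by (simp add: less_imp_le)
  have small: "4 * (\<Sum>i\<in>I. q i * variance (pp i)) < R" using var Rbig by (simp add: pp_def)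
  from typical_error[where I = I and q = q and p = pp and R = R, OF fI q0 q1 ppr small]
  obtain \<eta> r c where \<eta>: "\<eta> \<longlonglongrightarrow> 0" and r: "\<forall>n. \<forall>xs\<in>lsts I n. prob_poly (r n xs)"
    and err: "\<forall>n. (\<Sum>xs\<in>lsts I n. wt q xs * norm1 (monom 1 (c n xs) * bitp ^ nat \<lceil>R * real n\<rceil> - wt pp xs * r n xs)) \<le> \<eta> n"
    by blast
  define m where "m = (\<lambda>n::nat. nat \<lceil>R * real n\<rceil>)"
  define \<omega> where "\<omega> = 2 * pi / \<tau>"
  have main: "\<exists>\<E>. ti_op (2 ^ m n) (ham_copies 2 (cbit_ham \<tau>) (m n)) (d ^ n) (ham_copies d H n) \<E>
     \<and> 0 \<le> trace_norm (\<E> (tpow cbit_state (m n)) - tpow \<rho> n)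
     \<and> trace_norm (\<E> (tpow cbit_state (m n)) - tpow \<rho> n) \<le> 2 * sqrt (\<eta> n)" for n
  proof -
    let ?m = "m n" and ?din = "(2::nat) ^ m n" and ?D = "d ^ n" and ?Wn = "tpow W n"
    let ?hin = "esum 2 (m n) (cbit_energy \<tau>)" and ?hout = "esum d n E" and ?\<phi> = "cbits_amp \<tau> (m n) 0"
    have Wn: "unitary ?D ?Wn" by (rule tpow_unitary[OF W])
    note wn = unitaryD[OF Wn]
    note Hn = ham_copies_diag[OF W Hd, of n]
    define \<Psi> where "\<Psi> = (\<lambda>xs j. \<Prod>l<n. \<psi> (xs ! l) (dig d l j))"
    define \<Gamma> where "\<Gamma> = (\<lambda>xs j. \<Sum>l<n. g (xs ! l) (dig d l j))"
    define f where "f = (\<lambda>xs s. c n xs + (\<Sum>l<?m. if dig 2 l s = 0 then 1 else 0))"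
    have nth: "xs ! l \<in> I" if "xs \<in> lsts I n" "l < n" for xs l
      using that nth_mem[of l xs] by (auto simp: lsts_def)
    have \<phi>1: "(\<Sum>s<?din. (cmod (?\<phi> s))\<^sup>2) = 1" by (rule cbits_evol_outer(3))
    \<comment> \<open>The offset \<open>c n xs\<close> is absorbed into the origin of the input
      energies; covariance only sees energy differences.\<close>
    have hin: "?hin s = (- (pi * ?m / \<tau>) - \<omega> * c n xs) + \<omega> * real (f xs s)" for xs s
      unfolding cbits_energy_lattice[OF \<tau>] f_def \<omega>_def of_nat_add by (simp add: algebra_simps)
    have \<Psi>1: "(\<Sum>j<?D. (cmod (\<Psi> xs j))\<^sup>2) = 1" if xs: "xs \<in> lsts I n" for xs
    proof -
      have "(\<Sum>j<?D. (cmod (\<Psi> xs j))\<^sup>2) = (\<Sum>j<?D. \<Prod>l<n. (cmod (\<psi> (xs ! l) (dig d l j)))\<^sup>2)"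
        by (simp add: \<Psi>_def prod_norm[symmetric] prod_power_distrib)
      also have "\<dots> = (\<Prod>l<n. \<Sum>a<d. (cmod (\<psi> (xs ! l) a))\<^sup>2)"
        by (rule sum_prod_dig[where f = "\<lambda>l a. (cmod (\<psi> (xs ! l) a))\<^sup>2"])
      also have "\<dots> = 1" using \<psi>1 nth[OF xs] by simp
      finally show ?thesis .
    qed
    have hout: "?hout j = (\<Sum>l<n. e (xs ! l)) + \<omega> * real (\<Gamma> xs j)"
      if xs: "xs \<in> lsts I n" and j: "j < ?D" and nz: "\<Psi> xs j \<noteq> 0" for xs j
    proof -
      have "E (dig d l j) = e (xs ! l) + \<omega> * real (g (xs ! l) (dig d l j))" if l: "l < n" for l
        using lat nth[OF xs l] dig_less_pow[OF j l] nz l by (simp add: \<Psi>_def \<omega>_def)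
      thus ?thesis by (simp add: esum_def \<Gamma>_def sum.distrib sum_distrib_left)
    qed
    have PP: "(\<Sum>j<?D. monom ((cmod (\<Psi> xs j))\<^sup>2) (\<Gamma> xs j)) = wt pp xs" if xs: "xs \<in> lsts I n" for xs
    proof -
      have "(\<Sum>j<?D. monom ((cmod (\<Psi> xs j))\<^sup>2) (\<Gamma> xs j))
        = (\<Sum>j<?D. monom (\<Prod>l<n. (cmod (\<psi> (xs ! l) (dig d l j)))\<^sup>2) (\<Sum>l<n. g (xs ! l) (dig d l j)))"
        by (simp add: \<Psi>_def \<Gamma>_def prod_norm[symmetric] prod_power_distrib)
      also have "\<dots> = (\<Prod>l<n. \<Sum>a<d. monom ((cmod (\<psi> (xs ! l) a))\<^sup>2) (g (xs ! l) a))"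
        by (rule sum_monom_dig[where c = "\<lambda>l a. (cmod (\<psi> (xs ! l) a))\<^sup>2" and k = "\<lambda>l a. g (xs ! l) a"])
      also have "\<dots> = wt pp xs" using xs by (simp add: wt_nth lsts_def pp_def)
      finally show ?thesis .
    qed
    have BB: "(\<Sum>s<?din. monom ((cmod (?\<phi> s))\<^sup>2) (f xs s)) = monom 1 (c n xs) * bitp ^ ?m" for xs
      unfolding f_def by (rule cbits_poly)
    define K where "K = (\<lambda>xs. kraus_shift ?din ?\<phi> (f xs) ?D (\<Psi> xs) (\<Gamma> xs) (r n xs))"
    define Y where "Y = (\<lambda>xs. {..degree (r n xs)} <+> {..<?din})"
    define \<alpha> where "\<alpha> = (\<lambda>xs. case_sum (\<lambda>y. sqrt (coeff (r n xs) y)) (\<lambda>t::nat. 0))"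
    have rx: "prob_poly (r n xs)" if "xs \<in> lsts I n" for xs using r that by blast
    have tp: "(\<Sum>y\<in>Y xs. \<Sum>j<?D. cnj (K xs y j a) * K xs y j b) = (if a = b then 1 else 0)"
      if xs: "xs \<in> lsts I n" and ab: "a < ?din" "b < ?din" for xs a b
      unfolding K_def Y_def by (rule protocol(1)[where f = "f xs" and \<psi> = "\<Psi> xs" and g = "\<Gamma> xs" and hin = ?hin and hout = ?hout, OF \<phi>1 \<Psi>1[OF xs] rx[OF xs] hin hout[OF xs] ab])
    have cov: "\<exists>k. \<forall>j<?D. \<forall>s<?din. K xs y j s \<noteq> 0 \<longrightarrow> ?hout j - ?hin s = k"
      if xs: "xs \<in> lsts I n" and y: "y \<in> Y xs" for xs y
      unfolding K_def by (rule protocol(2)[where f = "f xs" and \<psi> = "\<Psi> xs" and g = "\<Gamma> xs" and hin = ?hin and hout = ?hout, OF \<phi>1 \<Psi>1[OF xs] rx[OF xs] hin hout[OF xs]]) (use y in \<open>auto simp: Y_def\<close>)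
    have a1: "(\<Sum>y\<in>Y xs. (\<alpha> xs y)\<^sup>2) = 1" if xs: "xs \<in> lsts I n" for xs
      unfolding \<alpha>_def Y_def by (rule protocol(3)[where f = "f xs" and \<psi> = "\<Psi> xs" and g = "\<Gamma> xs" and hin = ?hin and hout = ?hout, OF \<phi>1 \<Psi>1[OF xs] rx[OF xs] hin hout[OF xs]])
    have e1: "(\<Sum>y\<in>Y xs. \<Sum>j<?D. (cmod ((\<Sum>s<?din. K xs y j s * ?\<phi> s) - \<alpha> xs y * \<Psi> xs j))\<^sup>2)
        \<le> norm1 (monom 1 (c n xs) * bitp ^ ?m - wt pp xs * r n xs)" if xs: "xs \<in> lsts I n" for xs
    proof -
      have "(\<Sum>y\<in>Y xs. \<Sum>j<?D. (cmod ((\<Sum>s<?din. K xs y j s * ?\<phi> s) - \<alpha> xs y * \<Psi> xs j))\<^sup>2)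
        \<le> norm1 ((\<Sum>s<?din. monom ((cmod (?\<phi> s))\<^sup>2) (f xs s)) - (\<Sum>j<?D. monom ((cmod (\<Psi> xs j))\<^sup>2) (\<Gamma> xs j)) * r n xs)"
        unfolding K_def Y_def \<alpha>_def by (rule protocol(4)[where f = "f xs" and \<psi> = "\<Psi> xs" and g = "\<Gamma> xs" and hin = ?hin and hout = ?hout, OF \<phi>1 \<Psi>1[OF xs] rx[OF xs] hin hout[OF xs]])
      thus ?thesis unfolding BB PP[OF xs] .
    qed
    define YY where "YY = Sigma (lsts I n) Y"
    define KK where "KK = (\<lambda>z j s. complex_of_real (sqrt (wt q (fst z))) * K (fst z) (snd z) j s)"
    have fYY: "finite YY" unfolding YY_def Y_def using fI by auto
    have sumYY: "(\<Sum>z\<in>YY. h (fst z) (snd z)) = (\<Sum>xs\<in>lsts I n. \<Sum>y\<in>Y xs. h xs y)"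
      for h :: "(nat \<times> complex) list \<Rightarrow> nat + nat \<Rightarrow> 'z::comm_monoid_add"
      unfolding YY_def using fI by (subst sum.Sigma) (auto simp: Y_def case_prod_beta)
    have w0: "wt q xs \<ge> 0" if "xs \<in> lsts I n" for xs using wt_nonneg q0 that by blast
    have sw: "complex_of_real (sqrt (wt q xs)) * complex_of_real (sqrt (wt q xs)) = wt q xs" if "xs \<in> lsts I n" for xs
      using w0[OF that] by (simp flip: of_real_mult)
    have wq1: "(\<Sum>xs\<in>lsts I n. wt q xs) = 1" by (rule sum_wt[OF q1])
    have TP: "(\<Sum>z\<in>YY. \<Sum>j<?D. cnj (KK z j a) * KK z j b) = (if a = b then 1 else 0)"
      if ab: "a < ?din" "b < ?din" for a b
    proof -
      have "(\<Sum>z\<in>YY. \<Sum>j<?D. cnj (KK z j a) * KK z j b)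
         = (\<Sum>xs\<in>lsts I n. \<Sum>y\<in>Y xs. \<Sum>j<?D. (complex_of_real (sqrt (wt q xs)) * complex_of_real (sqrt (wt q xs))) * (cnj (K xs y j a) * K xs y j b))"
        unfolding KK_def by (subst sumYY[symmetric]) (simp add: mult_ac)
      also have "\<dots> = (\<Sum>xs\<in>lsts I n. complex_of_real (wt q xs) * (if a = b then 1 else 0))"
      proof (rule sum.cong[OF refl])
        fix xs assume xs: "xs \<in> lsts I n"
        show "(\<Sum>y\<in>Y xs. \<Sum>j<?D. (complex_of_real (sqrt (wt q xs)) * complex_of_real (sqrt (wt q xs))) * (cnj (K xs y j a) * K xs y j b))
          = complex_of_real (wt q xs) * (if a = b then 1 else 0)"
          unfolding sum_distrib_left[symmetric] tp[OF xs ab] sw[OF xs] ..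
      qed
      also have "\<dots> = complex_of_real (\<Sum>xs\<in>lsts I n. wt q xs) * (if a = b then 1 else 0)"
        unfolding of_real_sum sum_distrib_right ..
      finally show ?thesis unfolding wq1 by simp
    qed
    have COV: "\<exists>k. \<forall>j<?D. \<forall>s<?din. KK z j s \<noteq> 0 \<longrightarrow> ?hout j - ?hin s = k" if z: "z \<in> YY" for z
    proof -
      have "fst z \<in> lsts I n" "snd z \<in> Y (fst z)" using z by (auto simp: YY_def)
      from cov[OF this] show ?thesis by (auto simp: KK_def)
    qed
    from ti_channel[OF fYY Wn Hn cbits_diag TP COV] obtain \<E> where
      ti: "ti_op ?din (ham_copies 2 (cbit_ham \<tau>) ?m) ?D (ham_copies d H n) \<E>"
      and \<E>: "\<And>\<sigma> i j. \<sigma> \<in> carrier_mat ?din ?din \<Longrightarrow> i < ?D \<Longrightarrow> j < ?D \<Longrightarrow>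
        (adj ?Wn * \<E> \<sigma> * ?Wn) $$ (i,j) = (\<Sum>y\<in>YY. \<Sum>a<?din. \<Sum>b<?din. KK y i a * \<sigma> $$ (a,b) * cnj (KK y j b))"
      by blast
    have cp: "cptp ?din ?D \<E>" using ti by (simp add: ti_op_def)
    let ?\<Phi> = "tpow cbit_state ?m"
    have \<Phi>: "?\<Phi> = outer ?din ?\<phi>" by (rule cbits_evol_outer(1))
    have \<Phi>h: "hermitian ?din ?\<Phi>"
      by (rule hermitian_tpow) (rule hermitianI, auto simp: cbit_state_def)
    have dh: "hermitian ?D (\<E> ?\<Phi> - tpow \<rho> n)"
      by (rule hermitian_minus[OF cptp_hermitian[OF cp \<Phi>h] hermitian_tpow[OF rh]])
    note c1 = hermitian_carrier[OF cptp_hermitian[OF cp \<Phi>h]] and c2 = hermitian_carrier[OF hermitian_tpow[OF rh, of n]]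
    define Dm where "Dm = adj ?Wn * (\<E> ?\<Phi> - tpow \<rho> n) * ?Wn"
    have Dc: "Dm \<in> carrier_mat ?D ?D" unfolding Dm_def using wn(1) hermitian_carrier[OF dh] by simp
    define v where "v = (\<lambda>z i. \<Sum>s<?din. KK z i s * ?\<phi> s)"
    define u where "u = (\<lambda>z i. complex_of_real (sqrt (wt q (fst z))) * (\<alpha> (fst z) (snd z) * \<Psi> (fst z) i))"
    have De: "Dm $$ (i,j) = (\<Sum>z\<in>YY. v z i * cnj (v z j) - u z i * cnj (u z j))" if ij: "i < ?D" "j < ?D" for i j
    proof -
      have 1: "(adj ?Wn * \<E> ?\<Phi> * ?Wn) $$ (i,j) = (\<Sum>z\<in>YY. v z i * cnj (v z j))"
        unfolding \<Phi> \<E>[OF outer_carrier ij] v_def cnj_sum sum_product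
        by (intro sum.cong refl) (simp add: outer_entry mult_ac)
      have 2: "(adj ?Wn * tpow \<rho> n * ?Wn) $$ (i,j) = (\<Sum>z\<in>YY. u z i * cnj (u z j))"
      proof -
        have rr: "adj W * \<rho> * W \<in> carrier_mat d d" using w rc by simp
        have "(adj ?Wn * tpow \<rho> n * ?Wn) $$ (i,j) = (\<Prod>l<n. (adj W * \<rho> * W) $$ (dig d l i, dig d l j))"
          unfolding tpow_conj[OF w(1) rc] by (rule tpow_entry[OF rr ij])
        also have "\<dots> = (\<Prod>l<n. \<Sum>k\<in>I. complex_of_real (q k) * (\<psi> k (dig d l i) * cnj (\<psi> k (dig d l j))))"
          using dec dig_less_pow[OF ij(1)] dig_less_pow[OF ij(2)] by (intro prod.cong refl) simp
        also have "\<dots> = (\<Sum>xs\<in>lsts I n. \<Prod>l<n. complex_of_real (q (xs ! l)) * (\<psi> (xs ! l) (dig d l i) * cnj (\<psi> (xs ! l) (dig d l j))))"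
          by (rule prod_sum_lsts[where f = "\<lambda>l k. complex_of_real (q k) * (\<psi> k (dig d l i) * cnj (\<psi> k (dig d l j)))"])
        \<comment> \<open>The outcome weights of a word add up to 1, so the target splits into the
          same branches as the output and the two can be compared branch by branch.\<close>
        also have "\<dots> = (\<Sum>xs\<in>lsts I n. complex_of_real (wt q xs) * (\<Psi> xs i * cnj (\<Psi> xs j)) * complex_of_real (\<Sum>y\<in>Y xs. (\<alpha> xs y)\<^sup>2))"
          using a1 by (intro sum.cong refl) (simp add: wt_nth lsts_def \<Psi>_def prod.distrib)
        also have "\<dots> = (\<Sum>xs\<in>lsts I n. \<Sum>y\<in>Y xs. complex_of_real (wt q xs) * (\<Psi> xs i * cnj (\<Psi> xs j)) * complex_of_real ((\<alpha> xs y)\<^sup>2))"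
          unfolding of_real_sum sum_distrib_left ..
        also have "\<dots> = (\<Sum>xs\<in>lsts I n. \<Sum>y\<in>Y xs. u (xs,y) i * cnj (u (xs,y) j))"
        proof (intro sum.cong refl)
          fix xs y assume xs: "xs \<in> lsts I n"
          show "complex_of_real (wt q xs) * (\<Psi> xs i * cnj (\<Psi> xs j)) * complex_of_real ((\<alpha> xs y)\<^sup>2) = u (xs,y) i * cnj (u (xs,y) j)"
            unfolding sw[OF xs, symmetric] by (simp add: u_def power2_eq_square mult_ac)
        qed
        also have "\<dots> = (\<Sum>z\<in>YY. u z i * cnj (u z j))"
          using sumYY[of "\<lambda>xs y. u (xs,y) i * cnj (u (xs,y) j)"] by simp
        finally show ?thesis .
      qed
      show ?thesis unfolding Dm_def minus_conj_entry[OF wn(1) c1 c2 ij] 1 2 sum_subtractf ..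
    qed
    have v1: "(\<Sum>z\<in>YY. \<Sum>i<?D. (cmod (v z i))\<^sup>2) = 1"
      unfolding v_def using kraus_norm_preserving[where \<phi> = ?\<phi>, OF TP] \<phi>1 by simp
    have u1: "(\<Sum>z\<in>YY. \<Sum>i<?D. (cmod (u z i))\<^sup>2) = 1"
    proof -
      have "(\<Sum>z\<in>YY. \<Sum>i<?D. (cmod (u z i))\<^sup>2) = (\<Sum>xs\<in>lsts I n. \<Sum>y\<in>Y xs. \<Sum>i<?D. (cmod (u (xs,y) i))\<^sup>2)"
        using sumYY[of "\<lambda>xs y. \<Sum>i<?D. (cmod (u (xs,y) i))\<^sup>2"] by simp
      also have "\<dots> = (\<Sum>xs\<in>lsts I n. \<Sum>y\<in>Y xs. wt q xs * ((\<alpha> xs y)\<^sup>2 * (\<Sum>i<?D. (cmod (\<Psi> xs i))\<^sup>2)))"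
        unfolding sum_distrib_left using w0
        by (intro sum.cong refl) (simp add: u_def norm_mult power_mult_distrib)
      also have "\<dots> = (\<Sum>xs\<in>lsts I n. wt q xs)"
        using \<Psi>1 a1 by (intro sum.cong refl) (simp flip: sum_distrib_left)
      finally show ?thesis unfolding wq1 .
    qed
    have vu: "(\<Sum>z\<in>YY. \<Sum>i<?D. (cmod (v z i - u z i))\<^sup>2) \<le> \<eta> n"
    proof -
      have "(\<Sum>z\<in>YY. \<Sum>i<?D. (cmod (v z i - u z i))\<^sup>2) = (\<Sum>xs\<in>lsts I n. \<Sum>y\<in>Y xs. \<Sum>i<?D. (cmod (v (xs,y) i - u (xs,y) i))\<^sup>2)"
        using sumYY[of "\<lambda>xs y. \<Sum>i<?D. (cmod (v (xs,y) i - u (xs,y) i))\<^sup>2"] by simp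
      also have "\<dots> = (\<Sum>xs\<in>lsts I n. wt q xs * (\<Sum>y\<in>Y xs. \<Sum>j<?D. (cmod ((\<Sum>s<?din. K xs y j s * ?\<phi> s) - \<alpha> xs y * \<Psi> xs j))\<^sup>2))"
        unfolding sum_distrib_left
      proof (intro sum.cong refl)
        fix xs y j assume xs: "xs \<in> lsts I n"
        have "v (xs,y) j - u (xs,y) j = complex_of_real (sqrt (wt q xs)) * ((\<Sum>s<?din. K xs y j s * ?\<phi> s) - \<alpha> xs y * \<Psi> xs j)"
          by (simp add: v_def u_def KK_def right_diff_distrib sum_distrib_left mult.assoc)
        thus "(cmod (v (xs,y) j - u (xs,y) j))\<^sup>2 = wt q xs * (cmod ((\<Sum>s<?din. K xs y j s * ?\<phi> s) - \<alpha> xs y * \<Psi> xs j))\<^sup>2"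
          using w0[OF xs] by (simp only: norm_mult power_mult_distrib norm_of_real power2_abs real_sqrt_pow2)
      qed
      also have "\<dots> \<le> (\<Sum>xs\<in>lsts I n. wt q xs * norm1 (monom 1 (c n xs) * bitp ^ ?m - wt pp xs * r n xs))"
        by (intro sum_mono mult_left_mono e1 w0)
      also have "\<dots> \<le> \<eta> n" using err by (simp add: m_def)
      finally show ?thesis .
    qed
    from trace_norm_attained[OF dh] obtain X where X: "unitary ?D X"
      and tn: "trace_norm (\<E> ?\<Phi> - tpow \<rho> n) = (\<Sum>i<?D. cmod ((adj X * (\<E> ?\<Phi> - tpow \<rho> n) * X) $$ (i,i)))" by blast
    \<comment> \<open>The basis that realizes the trace norm, expressed in the energy basis in which
      \<open>Dm\<close> is given.\<close>
    let ?V = "adj ?Wn * X"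
    have V: "unitary ?D ?V" by (intro unitary_mult unitary_adj Wn X)
    have "adj X * (\<E> ?\<Phi> - tpow \<rho> n) * X = adj ?V * Dm * ?V"
      unfolding Dm_def by (rule conj_change_basis[OF Wn unitaryD(1)[OF X] hermitian_carrier[OF dh]])
    hence "trace_norm (\<E> ?\<Phi> - tpow \<rho> n) \<le> 2 * sqrt (\<eta> n)"
      unfolding tn using ensemble_distance[OF V Dc De v1 u1 vu] by simp
    moreover have "0 \<le> trace_norm (\<E> ?\<Phi> - tpow \<rho> n)" unfolding tn by (intro sum_nonneg) auto
    ultimately show ?thesis using ti by blast
  qed
  have "\<forall>n. \<exists>\<E>. ti_op (2 ^ m n) (ham_copies 2 (cbit_ham \<tau>) (m n)) (d ^ n) (ham_copies d H n) \<E>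
     \<and> 0 \<le> trace_norm (\<E> (tpow cbit_state (m n)) - tpow \<rho> n)
     \<and> trace_norm (\<E> (tpow cbit_state (m n)) - tpow \<rho> n) \<le> 2 * sqrt (\<eta> n)"
    using main by blast
  from choice[OF this] obtain \<E> where \<E>: "\<forall>n. ti_op (2 ^ m n) (ham_copies 2 (cbit_ham \<tau>) (m n)) (d ^ n) (ham_copies d H n) (\<E> n)
     \<and> 0 \<le> trace_norm (\<E> n (tpow cbit_state (m n)) - tpow \<rho> n)
     \<and> trace_norm (\<E> n (tpow cbit_state (m n)) - tpow \<rho> n) \<le> 2 * sqrt (\<eta> n)" by blast
  have "(\<lambda>n. 2 * sqrt (\<eta> n)) \<longlonglongrightarrow> 2 * sqrt 0"
    by (intro tendsto_mult tendsto_const tendsto_real_sqrt \<eta>)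
  hence lim: "(\<lambda>n. 2 * sqrt (\<eta> n)) \<longlonglongrightarrow> 0" by simp
  have "(\<lambda>n. trace_norm (\<E> n (tpow cbit_state (m n)) - tpow \<rho> n)) \<longlonglongrightarrow> 0"
    by (rule tendsto_sandwich[OF _ _ tendsto_const lim]) (use \<E> in auto)
  thus ?thesis using \<E> unfolding achievable_def Let_def m_def by blast
qed

section \<open>Positivity of the Fisher information and attainment of the period\<close>

text \<open>If the Fisher information vanished, every member of the optimal ensemble would have zero
  energy variance and be supported on a single energy, so \<rho> would be stationary. Positivity is
  what turns the bound by \<open>max R 0\<close> into a bound by the rate itself.\<close>

lemma qfi_pos:
  assumes H: "hermitian d H" and \<rho>: "density d \<rho>" and sd: "spectral_decomp d \<rho> U p"
    and \<tau>: "\<tau> > 0" and per: "evol H \<tau> \<rho> = \<rho>" and nst: "evol H t \<rho> \<noteq> \<rho>"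
  shows "qfi_of_decomp d H U p > 0"
proof (rule ccontr)
  assume "\<not> qfi_of_decomp d H U p > 0"
  moreover have "psd d \<rho>" using \<rho> by (simp add: density_def)
  moreover have "qfi_of_decomp d H U p \<ge> 0" unfolding qfi_of_decomp_def by (intro mult_nonneg_nonneg sum_nonneg) auto
  ultimately have F0: "qfi_of_decomp d H U p = 0" by simp
  from hermitian_spectral[OF H] obtain W E where W: "unitary d W" and Hd: "H = W * rdiag d E * adj W"
    by blast
  have rc: "\<rho> \<in> carrier_mat d d" using \<rho> by (simp add: density_def psd_def hermitian_def)
  from yu_ensemble[OF W Hd \<rho> sd \<tau> per] obtain I :: "(nat \<times> complex) set" and q \<psi> g e where fI: "finite I"
    and q: "\<forall>i\<in>I. q i > 0" and \<psi>1: "\<forall>i\<in>I. (\<Sum>a<d. (cmod (\<psi> i a))\<^sup>2) = 1"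
    and dec: "\<forall>a<d. \<forall>b<d. (adj W * \<rho> * W) $$ (a,b) = (\<Sum>i\<in>I. complex_of_real (q i) * (\<psi> i a * cnj (\<psi> i b)))"
    and lat: "\<forall>i\<in>I. \<forall>a<d. \<psi> i a \<noteq> 0 \<longrightarrow> E a = e i + 2 * pi / \<tau> * real (g i a)"
    and var: "4 * (\<Sum>i\<in>I. q i * variance (\<Sum>a<d. monom ((cmod (\<psi> i a))\<^sup>2) (g i a))) = (\<tau> / (2 * pi))\<^sup>2 * qfi_of_decomp d H U p"
    by blast
  define pp where "pp = (\<lambda>i. \<Sum>a<d. monom ((cmod (\<psi> i a))\<^sup>2) (g i a))"
  have ppr: "prob_poly (pp i)" if "i \<in> I" for i
    unfolding pp_def using \<psi>1 that by (intro prob_poly_sum_monom) auto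
  have "(\<Sum>i\<in>I. q i * variance (pp i)) = 0" using var F0 by (simp add: pp_def)
  hence "\<forall>i\<in>I. q i * variance (pp i) = 0"
    using fI q ppr variance_nonneg by (subst (asm) sum_nonneg_eq_0_iff) (auto simp: less_imp_le)
  hence v0: "variance (pp i) = 0" if "i \<in> I" for i using q that by fastforce
  have gm: "real (g i a) = mean (pp i)" if i: "i \<in> I" and a: "a < d" and nz: "\<psi> i a \<noteq> 0" for i a
  proof -
    let ?n = "max (degree (pp i)) (g i a)"
    have c0: "\<And>x. coeff (pp i) x \<ge> 0" using ppr[OF i] by (simp add: prob_poly_def)
    have "\<forall>x\<in>{..?n}. (real x - mean (pp i))\<^sup>2 * coeff (pp i) x = 0"
      using v0[OF i] c0 unfolding variance_eq_sum[OF ppr[OF i], of ?n, simplified]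
      by (subst (asm) sum_nonneg_eq_0_iff) auto
    hence "(real (g i a) - mean (pp i))\<^sup>2 * coeff (pp i) (g i a) = 0" by simp
    moreover have "coeff (pp i) (g i a) > 0"
    proof -
      have "0 < (cmod (\<psi> i a))\<^sup>2" using nz by simp
      also have "\<dots> = (if g i a = g i a then (cmod (\<psi> i a))\<^sup>2 else 0)" by simp
      also have "\<dots> \<le> (\<Sum>b<d. if g i b = g i a then (cmod (\<psi> i b))\<^sup>2 else 0)"
        using a by (intro member_le_sum[where f = "\<lambda>b. if g i b = g i a then (cmod (\<psi> i b))\<^sup>2 else 0"]) auto
      finally show ?thesis unfolding pp_def coeff_sum_monom .
    qed
    ultimately show ?thesis by simp
  qed
  have "evol H t \<rho> = \<rho>"
  proof (rule conj_inject[OF W evol_carrier[OF W Hd rc] rc])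
    have c: "adj W * \<rho> * W \<in> carrier_mat d d" using unitaryD(1)[OF W] rc by simp
    show "adj W * evol H t \<rho> * W = adj W * \<rho> * W"
    proof (rule eq_matI)
      fix a b assume "a < dim_row (adj W * \<rho> * W)" "b < dim_col (adj W * \<rho> * W)"
      hence ab: "a < d" "b < d" using unitaryD(1)[OF W] by auto
      show "(adj W * evol H t \<rho> * W) $$ (a,b) = (adj W * \<rho> * W) $$ (a,b)"
      proof (cases "E a = E b")
        case True
        thus ?thesis using evol_entry[OF W Hd rc ab, of t] by simp
      next
        case False
        have "\<psi> i a * cnj (\<psi> i b) = 0" if i: "i \<in> I" for i
          using lat gm[OF i ab(1)] gm[OF i ab(2)] ab i False by force
        hence "(adj W * \<rho> * W) $$ (a,b) = 0" using dec ab by (simp del: index_mult_mat)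
        thus ?thesis using evol_entry[OF W Hd rc ab, of t] by simp
      qed
    qed (use unitaryD(1)[OF W] evol_carrier[OF W Hd rc, of t] rc in auto)
  qed
  thus False using nst by simp
qed

text \<open>Return times are closed under positive differences. If the infimum T were not attained,
  there would be return times s < t below 2 T, although both s and t - s are at least T.\<close>

lemma period_attained:
  assumes H: "hermitian d H" and rc: "\<rho> \<in> carrier_mat d d"
    and ne: "{t. t > 0 \<and> evol H t \<rho> = \<rho>} \<noteq> {}" and pos: "period H \<rho> > 0"
  shows "evol H (period H \<rho>) \<rho> = \<rho>"
proof (rule ccontr)
  assume no: "evol H (period H \<rho>) \<rho> \<noteq> \<rho>"
  let ?S = "{t. t > 0 \<and> evol H t \<rho> = \<rho>}" and ?T = "period H \<rho>"
  from hermitian_spectral[OF H] obtain W E where W: "unitary d W" and Hd: "H = W * rdiag d E * adj W"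
    by blast
  have bdd: "bdd_below ?S" by (rule bdd_belowI[of _ 0]) auto
  have low: "?T \<le> t" if "t \<in> ?S" for t unfolding period_def using that bdd by (rule cInf_lower)
  have diff: "t - s \<in> ?S" if ts: "t \<in> ?S" "s \<in> ?S" "s < t" for t s
  proof -
    have "evol H (t - s) \<rho> = \<rho>"
    proof (rule conj_inject[OF W evol_carrier[OF W Hd rc] rc])
      show "adj W * evol H (t - s) \<rho> * W = adj W * \<rho> * W"
      proof (rule eq_matI)
        fix a b assume "a < dim_row (adj W * \<rho> * W)" "b < dim_col (adj W * \<rho> * W)"
        hence ab: "a < d" "b < d" using unitaryD(1)[OF W] by auto
        let ?R = "(adj W * \<rho> * W) $$ (a,b)" and ?w = "- (E a - E b)"
        have 1: "?R = cis (?w * t) * ?R" "?R = cis (?w * s) * ?R"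
          using evol_entry[OF W Hd rc ab, of t] evol_entry[OF W Hd rc ab, of s] ts by auto
        have "cis (?w * t) = cis (?w * (t - s)) * cis (?w * s)" by (simp add: cis_mult algebra_simps)
        hence "?R = cis (?w * (t - s)) * ?R" using 1 by (metis mult.assoc)
        thus "(adj W * evol H (t - s) \<rho> * W) $$ (a,b) = ?R"
          using evol_entry[OF W Hd rc ab, of "t - s"] by simp
      qed (use unitaryD(1)[OF W] evol_carrier[OF W Hd rc, of "t - s"] rc in auto)
    qed
    thus ?thesis using ts by simp
  qed
  have Tn: "?T \<notin> ?S" using no by simp
  have "?T < 2 * ?T" using pos by simp
  then obtain t where t: "t \<in> ?S" "t < 2 * ?T" using cInf_lessD[OF ne] unfolding period_def by blast
  hence "?T < t" using low[OF t(1)] Tn by (cases "?T = t") auto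
  then obtain s where s: "s \<in> ?S" "s < t" using cInf_lessD[OF ne] unfolding period_def by blast
  have "?T \<le> t - s" by (rule low[OF diff[OF t(1) s]])
  moreover have "?T \<le> s" by (rule low[OF s(1)])
  ultimately show False using t(2) by simp
qed

theorem theorem4:
  fixes d :: nat and H \<rho> :: "complex mat" and \<tau> :: real
  assumes "d \<ge> 1"
    and "hermitian d H"
    and "density d \<rho>"
    and "{t. t > 0 \<and> evol H t \<rho> = \<rho>} \<noteq> {}"
    and "\<tau> = period H \<rho>"
    and "\<tau> > 0"
  shows "coherence_cost d H \<rho> \<tau> = (\<tau> / (2 * pi))^2 * qfi d H \<rho>
    \<and> (\<forall>R. R > (\<tau> / (2 * pi))^2 * qfi d H \<rho> \<longrightarrow> achievable d H \<rho> \<tau> R)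
    \<and> (\<forall>R. R < (\<tau> / (2 * pi))^2 * qfi d H \<rho> \<longrightarrow> \<not> achievable d H \<rho> \<tau> R)"
proof -
  have rh: "hermitian d \<rho>" using assms(3) by (simp add: density_def psd_def)
  note rc = hermitian_carrier[OF rh]
  have per: "evol H \<tau> \<rho> = \<rho>"
    using period_attained[OF assms(2) rc assms(4)] assms(5,6) by simp
  from hermitian_spectral[OF rh] obtain V a where "unitary d V" "\<rho> = V * rdiag d a * adj V" by blast
  hence ex: "\<exists>X. spectral_decomp d \<rho> (fst X) (snd X)"
    by (intro exI[of _ "(V, a)"]) (simp add: spectral_decomp_def)
  \<comment> \<open>The bounds hold for every eigendecomposition, in particular for the one that
    \<open>qfi\<close> chooses.\<close>
  define X where "X = (SOME X. spectral_decomp d \<rho> (fst X) (snd X))"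
  have sd: "spectral_decomp d \<rho> (fst X) (snd X)" unfolding X_def by (rule someI_ex[OF ex])
  have qfi: "qfi d H \<rho> = qfi_of_decomp d H (fst X) (snd X)" unfolding qfi_def X_def Let_def ..
  \<comment> \<open>Half the infimum is too short to be a return time, which shows that \<rho> is
    not stationary.\<close>
  have nst: "evol H (\<tau> / 2) \<rho> \<noteq> \<rho>"
  proof
    assume "evol H (\<tau> / 2) \<rho> = \<rho>"
    hence "\<tau> / 2 \<in> {t. t > 0 \<and> evol H t \<rho> = \<rho>}" using assms(6) by simp
    moreover have "bdd_below {t. t > 0 \<and> evol H t \<rho> = \<rho>}" by (rule bdd_belowI[of _ 0]) auto
    ultimately have "\<tau> \<le> \<tau> / 2" unfolding assms(5) period_def by (rule cInf_lower)
    thus False using assms(6) by simp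
  qed
  let ?F = "(\<tau> / (2 * pi))^2 * qfi d H \<rho>"
  have Fpos: "?F > 0"
    using qfi_pos[OF assms(2,3) sd assms(6) per nst] assms(6) unfolding qfi by simp
  have ach: "achievable d H \<rho> \<tau> R" if "R > ?F" for R
    using qfi_achievable[OF assms(2,3) sd assms(6) per] that unfolding qfi by simp
  \<comment> \<open>Positivity of the bound removes the maximum with 0 and so excludes nonpositive
    rates as well.\<close>
  have nach: "?F \<le> R" if "achievable d H \<rho> \<tau> R" for R
    using achievable_imp_qfi_le[OF assms(2,3) sd assms(6) that] Fpos unfolding qfi by (simp add: max_def split: if_splits)
  have "coherence_cost d H \<rho> \<tau> = ?F"
    unfolding coherence_cost_def
  proof (rule cInf_eq_non_empty)
    show "{R. achievable d H \<rho> \<tau> R} \<noteq> {}" using ach[of "?F + 1"] by auto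
    show "?F \<le> x" if "x \<in> {R. achievable d H \<rho> \<tau> R}" for x using nach that by simp
    show "y \<le> ?F" if y: "\<And>x. x \<in> {R. achievable d H \<rho> \<tau> R} \<Longrightarrow> y \<le> x" for y
      by (rule dense_ge) (use ach y in simp)
  qed
  moreover have "\<forall>R. R < ?F \<longrightarrow> \<not> achievable d H \<rho> \<tau> R" using nach by force
  ultimately show ?thesis using ach by blast
qed

end
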